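(* Let $(W,\lambda)$ be any two-dimensional Liouville domain and let $H\in\mathcal H(W,\lambda)$ be an autonomous Hamiltonian. Then $h_{\rm top}(\varphi^1_{(\alpha_H)_n})=0$ for every $n\in\mathbb N$.
   Context: A Liouville domain $(W,\lambda)$ is a compact exact symplectic manifold with boundary (symplectic form $d\lambda$) whose Liouville vector field $Y_\lambda$, defined by $\iota_{Y_\lambda}d\lambda=\lambda$, is outward transverse to $\partial W$. For $H:W\to\mathbb R$ smooth and autonomous, $X_H$ is defined by $\iota_{X_H}d\lambda=dH$, $\tau_{\lambda,H}=\lambda(X_H)+H$, and $H\in\mathcal H(W,\lambda)$ means $H|_{\partial W}\equiv0$ and $\tau_{\lambda,H}>0$ on $W$. Iterated tubes: for $n\ge1$, $$(W_H)_n=\Big\{(w,z_1,\dots,z_n)\in W\times\mathbb C^n\ \Big|\ \pi\sum_{i=1}^n|z_i|^2\le H(w)\Big\},\qquad\lambda_n=\lambda+\frac12\sum_{i=1}^nr_i^2\,d\theta_i,$$ where $z_i=r_ie^{\sqrt{-1}\theta_i}$; this is a Liouville domain, and $(\alpha_H)_n:=\lambda_n|_{\partial(W_H)_n}$ is the induced contact form on its boundary. $\varphi^1_{(\alpha_H)_n}$ is the time-1 map of its Reeb flow, and $h_{\rm top}$ is topological entropy. *)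

theory Defs
  imports "HOL-Analysis.Analysis"
begin

section \<open>Smooth maps on arbitrary subsets of Euclidean spaces\<close>

text \<open>For open \<open>S\<close> this is the usual notion of a \<open>C\<^sup>k\<close> map: all iterated directional
  derivatives up to order \<open>k\<close> exist (as Frechet derivatives) and are continuous.\<close>

primrec Ck_on :: "nat \<Rightarrow> 'a::euclidean_space set \<Rightarrow> ('a \<Rightarrow> 'b::real_normed_vector) \<Rightarrow> bool" where
  "Ck_on 0 S f \<longleftrightarrow> continuous_on S f"
| "Ck_on (Suc k) S f \<longleftrightarrow> (\<forall>x\<in>S. f differentiable (at x)) \<and>
     (\<forall>v. Ck_on k S (\<lambda>x. frechet_derivative f (at x) v))"

text \<open>On a set that need not be open (such as a relatively open subset of a half-space),
  smooth means: locally the restriction of a smooth map on an open set.\<close>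

definition smooth_on :: "'a::euclidean_space set \<Rightarrow> ('a \<Rightarrow> 'b::real_normed_vector) \<Rightarrow> bool" where
  "smooth_on S f \<longleftrightarrow> (\<forall>x\<in>S. \<exists>T g. open T \<and> x \<in> T \<and> (\<forall>k. Ck_on k T g) \<and> (\<forall>y\<in>S \<inter> T. f y = g y))"


section \<open>Compact smooth manifolds with boundary\<close>

text \<open>The model of a manifold of dimension \<open>1 + DIM('f)\<close> is the closed half-space of
  \<open>\<real> \<times> 'f\<close>. A chart is a domain together with a coordinate map; the values of the map outside
  the domain are irrelevant.\<close>

definition half_space :: "(real \<times> 'f::euclidean_space) set" where
  "half_space = {x. 0 \<le> fst x}"

type_synonym ('a, 'f) chart = "'a set \<times> ('a \<Rightarrow> real \<times> 'f)"

abbreviation chart_dom :: "('a, 'f) chart \<Rightarrow> 'a set" where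
  "chart_dom c \<equiv> fst c"

abbreviation coord :: "('a, 'f) chart \<Rightarrow> 'a \<Rightarrow> real \<times> 'f" where
  "coord c \<equiv> snd c"

definition chart_inv :: "('a, 'f) chart \<Rightarrow> real \<times> 'f \<Rightarrow> 'a" where
  "chart_inv c = inv_into (chart_dom c) (coord c)"

definition chart_img :: "('a, 'f) chart \<Rightarrow> (real \<times> 'f) set" where
  "chart_img c = coord c ` chart_dom c"

definition topological_chart :: "'a topology \<Rightarrow> ('a, 'f::euclidean_space) chart \<Rightarrow> bool" where
  "topological_chart M c \<longleftrightarrow>
     openin M (chart_dom c) \<and>
     openin (top_of_set half_space) (chart_img c) \<and>
     homeomorphic_map (subtopology M (chart_dom c)) (top_of_set (chart_img c)) (coord c)"

text \<open>Coordinate change from \<open>c\<close> to \<open>d\<close>, and the part of the image of \<open>c\<close> on which it is defined.\<close>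

definition overlap :: "('a, 'f) chart \<Rightarrow> ('a, 'f) chart \<Rightarrow> (real \<times> 'f) set" where
  "overlap c d = coord c ` (chart_dom c \<inter> chart_dom d)"

definition transition :: "('a, 'f) chart \<Rightarrow> ('a, 'f) chart \<Rightarrow> real \<times> 'f \<Rightarrow> real \<times> 'f" where
  "transition c d = coord d \<circ> chart_inv c"

text \<open>Second countability is automatic by compactness. The boundary may be empty and the manifold
  need not be connected.\<close>

definition compact_manifold :: "'a topology \<Rightarrow> ('a, 'f::euclidean_space) chart set \<Rightarrow> bool" where
  "compact_manifold M A \<longleftrightarrow>
     Hausdorff_space M \<and> compact_space M \<and>
     (\<forall>c\<in>A. topological_chart M c) \<and>
     (\<Union>c\<in>A. chart_dom c) = topspace M \<and>
     (\<forall>c\<in>A. \<forall>d\<in>A. smooth_on (overlap c d) (transition c d))"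

definition manifold_boundary :: "'a topology \<Rightarrow> ('a, 'f::euclidean_space) chart set \<Rightarrow> 'a set" where
  "manifold_boundary M A = {p \<in> topspace M. \<exists>c\<in>A. p \<in> chart_dom c \<and> fst (coord c p) = 0}"


section \<open>Functions and one-forms\<close>

text \<open>Tangent vectors at \<open>p\<close> are given by their components in a chart around \<open>p\<close>. Derivatives in a
  chart are taken within the chart image; they are unique also at boundary points, because the
  image is relatively open in a half-space.\<close>

definition smooth_function :: "('a, 'f::euclidean_space) chart set \<Rightarrow> ('a \<Rightarrow> real) \<Rightarrow> bool" where
  "smooth_function A H \<longleftrightarrow> (\<forall>c\<in>A. smooth_on (chart_img c) (H \<circ> chart_inv c))"

definition differential ::
    "('a \<Rightarrow> real) \<Rightarrow> ('a, 'f::euclidean_space) chart \<Rightarrow> 'a \<Rightarrow> real \<times> 'f \<Rightarrow> real" where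
  "differential H c p v = frechet_derivative (H \<circ> chart_inv c) (at (coord c p) within chart_img c) v"

text \<open>A one-form assigns to a chart \<open>c\<close>, a point \<open>p\<close> and the components \<open>v\<close> in \<open>c\<close> of a tangent
  vector at \<open>p\<close> a real number, subject to the usual transformation law.\<close>

type_synonym ('a, 'f) one_form = "('a, 'f) chart \<Rightarrow> 'a \<Rightarrow> real \<times> 'f \<Rightarrow> real"

definition smooth_one_form ::
    "('a, 'f::euclidean_space) chart set \<Rightarrow> ('a, 'f) one_form \<Rightarrow> bool" where
  "smooth_one_form A lam \<longleftrightarrow>
     (\<forall>c\<in>A. \<forall>p\<in>chart_dom c. linear (lam c p)) \<and>
     (\<forall>c\<in>A. \<forall>v. smooth_on (chart_img c) (\<lambda>x. lam c (chart_inv c x) v)) \<and>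
     (\<forall>c\<in>A. \<forall>d\<in>A. \<forall>p\<in>chart_dom c \<inter> chart_dom d. \<forall>v.
        lam c p v =
        lam d p (frechet_derivative (transition c d) (at (coord c p) within overlap c d) v))"

text \<open>In coordinates, \<open>d\<lambda>(u,v) = D\<^sub>u(\<lambda>(v)) - D\<^sub>v(\<lambda>(u))\<close> for constant \<open>u\<close>, \<open>v\<close>.\<close>

definition ext_deriv ::
    "('a, 'f::euclidean_space) one_form \<Rightarrow> ('a, 'f) chart \<Rightarrow> 'a \<Rightarrow> real \<times> 'f \<Rightarrow> real \<times> 'f \<Rightarrow> real" where
  "ext_deriv lam c p u v =
     frechet_derivative (\<lambda>x. lam c (chart_inv c x) v) (at (coord c p) within chart_img c) u -
     frechet_derivative (\<lambda>x. lam c (chart_inv c x) u) (at (coord c p) within chart_img c) v"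


section \<open>Liouville domains\<close>

definition liouville_vf ::
    "('a, 'f::euclidean_space) one_form \<Rightarrow> ('a, 'f) chart \<Rightarrow> 'a \<Rightarrow> real \<times> 'f" where
  "liouville_vf lam c p = (THE Y. \<forall>v. ext_deriv lam c p Y v = lam c p v)"

text \<open>In the half-space model, outward vectors are those with negative first component. The
  dimension of the domain is \<open>1 + DIM('f)\<close>.\<close>

definition liouville_domain ::
    "'a topology \<Rightarrow> ('a, 'f::euclidean_space) chart set \<Rightarrow> ('a, 'f) one_form \<Rightarrow> bool" where
  "liouville_domain M A lam \<longleftrightarrow>
     compact_manifold M A \<and> smooth_one_form A lam \<and>
     (\<forall>c\<in>A. \<forall>p\<in>chart_dom c. \<forall>u. u \<noteq> 0 \<longrightarrow> (\<exists>v. ext_deriv lam c p u v \<noteq> 0)) \<and>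
     (\<forall>c\<in>A. \<forall>p\<in>chart_dom c \<inter> manifold_boundary M A. fst (liouville_vf lam c p) < 0)"


section \<open>Admissible Hamiltonians\<close>

definition hamiltonian_vf ::
    "('a, 'f::euclidean_space) one_form \<Rightarrow> ('a \<Rightarrow> real) \<Rightarrow> ('a, 'f) chart \<Rightarrow> 'a \<Rightarrow> real \<times> 'f" where
  "hamiltonian_vf lam H c p = (THE X. \<forall>v. ext_deriv lam c p X v = differential H c p v)"

definition tau ::
    "('a, 'f::euclidean_space) one_form \<Rightarrow> ('a \<Rightarrow> real) \<Rightarrow> ('a, 'f) chart \<Rightarrow> 'a \<Rightarrow> real" where
  "tau lam H c p = lam c p (hamiltonian_vf lam H c p) + H p"

definition admissible_hamiltonians ::
    "'a topology \<Rightarrow> ('a, 'f::euclidean_space) chart set \<Rightarrow> ('a, 'f) one_form \<Rightarrow> ('a \<Rightarrow> real) set" where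
  "admissible_hamiltonians M A lam =
     {H. smooth_function A H \<and>
         (\<forall>p\<in>manifold_boundary M A. H p = 0) \<and>
         (\<forall>c\<in>A. \<forall>p\<in>chart_dom c. tau lam H c p > 0)}"


section \<open>Iterated tubes\<close>

text \<open>The number \<open>n \<ge> 1\<close> of complex coordinates is \<open>CARD('n)\<close>.\<close>

definition tube :: "'a topology \<Rightarrow> ('a \<Rightarrow> real) \<Rightarrow> ('a \<times> (complex ^ ('n::finite))) topology" where
  "tube M H = subtopology (prod_topology M euclidean)
     {(w, z). w \<in> topspace M \<and> pi * (\<Sum>i\<in>UNIV. (cmod (z $ i))\<^sup>2) \<le> H w}"

text \<open>Coordinates on \<open>W \<times> \<complex>\<^sup>n\<close> induced by a chart of \<open>W\<close>, and their inverse.\<close>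

definition prod_coord ::
    "('a, 'f) chart \<Rightarrow> 'a \<times> (complex ^ 'n) \<Rightarrow> (real \<times> 'f) \<times> (complex ^ 'n)" where
  "prod_coord c = map_prod (coord c) id"

definition prod_inv ::
    "('a, 'f) chart \<Rightarrow> (real \<times> 'f) \<times> (complex ^ 'n) \<Rightarrow> 'a \<times> (complex ^ 'n)" where
  "prod_inv c = map_prod (chart_inv c) id"

text \<open>The smooth structure of the tube as a codimension-zero submanifold of \<open>W \<times> \<complex>\<^sup>n\<close>: its charts are
  all topological charts that are diffeomorphisms with respect to the coordinates of \<open>W \<times> \<complex>\<^sup>n\<close>.\<close>

definition tube_atlas ::
    "'a topology \<Rightarrow> ('a, 'f::euclidean_space) chart set \<Rightarrow> ('a \<Rightarrow> real) \<Rightarrow>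
     ('a \<times> (complex ^ ('n::finite)), 'f \<times> (complex ^ 'n)) chart set" where
  "tube_atlas M A H =
     {e. topological_chart (tube M H) e \<and>
         (\<forall>c\<in>A. let V = chart_dom e \<inter> (chart_dom c \<times> UNIV) in
            smooth_on (prod_coord c ` V) (coord e \<circ> prod_inv c) \<and>
            smooth_on (coord e ` V) (prod_coord c \<circ> chart_inv e))}"

text \<open>\<open>1/2 \<Sum> r\<^sub>i\<^sup>2 d\<theta>\<^sub>i = 1/2 \<Sum> (x\<^sub>i dy\<^sub>i - y\<^sub>i dx\<^sub>i)\<close>, which is smooth on all of \<open>\<complex>\<^sup>n\<close>, evaluated at
  the tangent vector \<open>\<zeta>\<close> in \<open>z\<close>.\<close>

definition std_form :: "(complex ^ ('n::finite)) \<Rightarrow> (complex ^ 'n) \<Rightarrow> real" where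
  "std_form z \<zeta> = 1/2 * (\<Sum>i\<in>UNIV. Re (z $ i) * Im (\<zeta> $ i) - Im (z $ i) * Re (\<zeta> $ i))"

text \<open>The restriction of \<open>\<lambda> + std_form\<close> to the tube. The components of a tangent vector are
  transformed from the chart \<open>e\<close> of the tube to the coordinates of \<open>W \<times> \<complex>\<^sup>n\<close> given by some
  chart of \<open>W\<close>; by the transformation law for \<open>\<lambda>\<close> the value does not depend on that chart.\<close>

definition tube_form ::
    "('a, 'f::euclidean_space) chart set \<Rightarrow> ('a, 'f) one_form \<Rightarrow>
     ('a \<times> (complex ^ ('n::finite)), 'f \<times> (complex ^ 'n)) one_form" where
  "tube_form A lam e p v =
     (let c = (SOME c. c \<in> A \<and> fst p \<in> chart_dom c);
          u = frechet_derivative (prod_coord c \<circ> chart_inv e)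
                (at (coord e p) within coord e ` (chart_dom e \<inter> (chart_dom c \<times> UNIV))) v
      in lam c (fst p) (fst u) + std_form (snd p) (snd u))"


section \<open>The Reeb flow on the boundary of a Liouville domain\<close>

text \<open>In a chart, the tangent vectors of the boundary are those with vanishing first component.
  So this is the Reeb vector field of the restriction of \<open>\<lambda>\<close> to the boundary.\<close>

definition reeb_vf ::
    "('a, 'f::euclidean_space) one_form \<Rightarrow> ('a, 'f) chart \<Rightarrow> 'a \<Rightarrow> real \<times> 'f" where
  "reeb_vf lam c p =
     (THE R. fst R = 0 \<and> lam c p R = 1 \<and> (\<forall>v. fst v = 0 \<longrightarrow> ext_deriv lam c p R v = 0))"

definition reeb_trajectory ::
    "'a topology \<Rightarrow> ('a, 'f::euclidean_space) chart set \<Rightarrow> ('a, 'f) one_form \<Rightarrow> (real \<Rightarrow> 'a) \<Rightarrow> bool" where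
  "reeb_trajectory M A lam \<gamma> \<longleftrightarrow>
     continuous_map euclideanreal M \<gamma> \<and>
     (\<forall>t. \<gamma> t \<in> manifold_boundary M A) \<and>
     (\<forall>t. \<forall>c\<in>A. \<gamma> t \<in> chart_dom c \<longrightarrow>
        ((coord c \<circ> \<gamma>) has_vector_derivative reeb_vf lam c (\<gamma> t)) (at t))"

definition reeb_flow ::
    "'a topology \<Rightarrow> ('a, 'f::euclidean_space) chart set \<Rightarrow> ('a, 'f) one_form \<Rightarrow> real \<Rightarrow> 'a \<Rightarrow> 'a" where
  "reeb_flow M A lam t p = (THE \<gamma>. reeb_trajectory M A lam \<gamma> \<and> \<gamma> 0 = p) t"


section \<open>Topological entropy\<close>

text \<open>The definition of Adler, Konheim and McAndrew for a continuous self-map of a compact space.\<close>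

definition open_cover :: "'a topology \<Rightarrow> 'a set set \<Rightarrow> bool" where
  "open_cover X \<U> \<longleftrightarrow> (\<forall>U\<in>\<U>. openin X U) \<and> \<Union>\<U> = topspace X"

definition cover_number :: "'a topology \<Rightarrow> 'a set set \<Rightarrow> nat" where
  "cover_number X \<U> = (LEAST k. \<exists>\<V>\<subseteq>\<U>. finite \<V> \<and> card \<V> = k \<and> \<Union>\<V> = topspace X)"

text \<open>The join of the covers \<open>f\<^sup>-\<^sup>i \<U>\<close> for \<open>i < n\<close>.\<close>

primrec iterated_join ::
    "'a topology \<Rightarrow> ('a \<Rightarrow> 'a) \<Rightarrow> 'a set set \<Rightarrow> nat \<Rightarrow> 'a set set" where
  "iterated_join X f \<U> 0 = {topspace X}"
| "iterated_join X f \<U> (Suc n) =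
     {U \<inter> {x \<in> topspace X. f x \<in> V} | U V. U \<in> \<U> \<and> V \<in> iterated_join X f \<U> n}"

text \<open>The limit superior is a limit, by subadditivity.\<close>

definition cover_entropy :: "'a topology \<Rightarrow> ('a \<Rightarrow> 'a) \<Rightarrow> 'a set set \<Rightarrow> ereal" where
  "cover_entropy X f \<U> =
     limsup (\<lambda>n. ereal (ln (real (cover_number X (iterated_join X f \<U> n))) / real n))"

definition topological_entropy :: "'a topology \<Rightarrow> ('a \<Rightarrow> 'a) \<Rightarrow> ereal" where
  "topological_entropy X f = (SUP \<U>\<in>{\<U>. open_cover X \<U>}. cover_entropy X f \<U>)"

end

(* The Reeb flow on the boundary of the tube is a skew product: on W it is the flow of X_H
   rescaled by 1 / tau, which preserves H, and on C^n it is the rotation by 2 pi times the integral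
   of 1 / tau along the base orbit, on the sphere pi |z|^2 = H(w).  By Bowen's inequality for the
   invariant function H, only the dynamics over single level sets of H matters.  A level set in a
   surface is, away from the rest points, a union of orbit arcs, and the part of it that leaves a
   neighbourhood of the rest points is covered by finitely many of them; near the rest points the
   base hardly moves while the fibre rotates almost rigidly.  In both regimes the number of
   distinguishable orbit segments of length m grows only linearly in m, so the entropy is zero. *)
theory Submission
  imports Defs "HOL-Real_Asymp.Real_Asymp"
begin

section \<open>Smooth maps\<close>

text \<open>The boundary of \<open>W\<close> is the obstacle to building the base flow: charts take
  values in a half-space, and a solution of the extended equation could leave it. Positivity of
  \<open>tau\<close> prevents this. At an interior minimum of \<open>H\<close> the field
  \<open>X_H\<close> vanishes, so \<open>H = tau > 0\<close> there; hence \<open>H\<close> is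
  positive off the boundary, and the outward Liouville field makes its inward slope at the boundary
  positive. A smooth extension of \<open>H\<close> is therefore negative just outside
  \<open>W\<close>, and conservation of \<open>H\<close> keeps solutions inside. The same facts make
  \<open>H - pi |z|^2\<close> a regular defining function of the tube. In the count, the
  neighbourhood of the rest points depends on the block length \<open>m\<close>, and the number of
  names of orbits leaving it depends on that neighbourhood. So \<open>m\<close> is fixed first, with
  its linear count below \<open>exp (a m / 2)\<close>, and then a much longer block
  \<open>T\<close>, a multiple of \<open>m\<close>: orbits that stay are counted block by block, the
  others once for the whole of \<open>T\<close>.\<close>

lemma Ck_on_mono: "Ck_on (Suc k) S f \<Longrightarrow> Ck_on k S f"
proof (induction k arbitrary: f)
  case 0
  then show ?case
    by (auto intro!: continuous_at_imp_continuous_on differentiable_imp_continuous_within)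
next
  case (Suc k)
  from Suc.prems have d: "\<forall>x\<in>S. f differentiable (at x)"
    and "\<forall>v. Ck_on (Suc k) S (\<lambda>x. frechet_derivative f (at x) v)"
    by auto
  then have "\<forall>v. Ck_on k S (\<lambda>x. frechet_derivative f (at x) v)"
    using Suc.IH by blast
  with d show ?case by simp
qed

lemma Ck_on_subset: "Ck_on k S f \<Longrightarrow> T \<subseteq> S \<Longrightarrow> Ck_on k T f"
  by (induction k arbitrary: f) (auto intro: continuous_on_subset)

lemma Ck_on_cong:
  assumes "open S" "\<And>x. x \<in> S \<Longrightarrow> f x = g x" "Ck_on k S f"
  shows "Ck_on k S g"
  using assms(2,3)
proof (induction k arbitrary: f g)
  case 0
  then show ?case by (metis Ck_on.simps(1) continuous_on_cong)
next
  case (Suc k)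
  have D: "(g has_derivative frechet_derivative f (at x)) (at x)" if "x \<in> S" for x
    using Suc.prems that assms(1)
    by (intro has_derivative_transform_within_open[of f _ x UNIV S g])
       (auto simp: frechet_derivative_works[symmetric])
  have e: "frechet_derivative g (at x) = frechet_derivative f (at x)" if "x \<in> S" for x
    using frechet_derivative_at[OF D[OF that]] by simp
  have "Ck_on k S (\<lambda>x. frechet_derivative g (at x) v)" for v
    by (rule Suc.IH[of "\<lambda>x. frechet_derivative f (at x) v"]) (use Suc.prems e in auto)
  then show ?case
    using D by (auto simp: differentiable_def)
qed

lemma Ck_on_Suc_has_derivative:
  "Ck_on (Suc k) S f \<Longrightarrow> x \<in> S \<Longrightarrow> (f has_derivative frechet_derivative f (at x)) (at x)"
  by (simp add: frechet_derivative_works[symmetric])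

text \<open>Lets an induction on the order work with an explicit formula \<open>f'\<close> instead
  of \<open>frechet_derivative\<close>. Openness of \<open>S\<close> is what transfers the formula,
  through \<open>Ck_on_cong\<close>.\<close>

lemma Ck_on_SucI:
  assumes "open S" "\<And>x. x \<in> S \<Longrightarrow> (f has_derivative f' x) (at x)"
    "\<And>v. Ck_on k S (\<lambda>x. f' x v)"
  shows "Ck_on (Suc k) S f"
proof -
  have "Ck_on k S (\<lambda>x. frechet_derivative f (at x) v)" for v
    by (rule Ck_on_cong[OF assms(1) _ assms(3)[of v]])
       (metis assms(2) frechet_derivative_at)
  then show ?thesis using assms(2) by (auto simp: differentiable_def)
qed

lemma Ck_on_const: "open S \<Longrightarrow> Ck_on k S (\<lambda>x. c)"
proof (induction k arbitrary: c)
  case (Suc k)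
  then show ?case by (intro Ck_on_SucI[where f' = "\<lambda>x v. 0"]) auto
qed auto

lemma Ck_on_add:
  assumes "open S" "Ck_on k S f" "Ck_on k S g"
  shows "Ck_on k S (\<lambda>x. f x + g x)"
  using assms(2,3)
proof (induction k arbitrary: f g)
  case 0
  then show ?case by (auto intro: continuous_intros)
next
  case (Suc k)
  show ?case
    by (rule Ck_on_SucI[OF assms(1) has_derivative_add[OF Suc.prems[THEN Ck_on_Suc_has_derivative]]])
       (use Suc in auto)
qed

lemma (in bounded_bilinear) Ck_on_bilinear:
  assumes "open S" "Ck_on k S f" "Ck_on k S g"
  shows "Ck_on k S (\<lambda>x. prod (f x) (g x))"
  using assms(2,3)
proof (induction k arbitrary: f g)
  case 0
  then show ?case by (auto intro: continuous_on)
next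
  case (Suc k)
  have *: "Ck_on k S f" "Ck_on k S g" using Suc.prems Ck_on_mono by auto
  show ?case
    by (rule Ck_on_SucI[OF assms(1) FDERIV[OF Suc.prems[THEN Ck_on_Suc_has_derivative]]])
       (use Suc * assms(1) in \<open>auto intro!: Ck_on_add\<close>)
qed

lemma (in bounded_linear) Ck_on_linear:
  assumes "open S" "Ck_on k S g"
  shows "Ck_on k S (\<lambda>x. f (g x))"
  using assms(2)
proof (induction k arbitrary: g)
  case 0
  then show ?case by (auto intro: continuous_on)
next
  case (Suc k)
  show ?case
    by (rule Ck_on_SucI[OF assms(1) has_derivative[OF Ck_on_Suc_has_derivative[OF Suc.prems]]])
       (use Suc in auto)
qed

lemma Ck_on_id: "open S \<Longrightarrow> Ck_on k S (\<lambda>x. x)"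
proof (cases k)
  case (Suc m)
  assume "open S"
  then show ?thesis unfolding Suc
    by (intro Ck_on_SucI[where f' = "\<lambda>x v. v"]) (auto intro: Ck_on_const)
qed auto

lemma Ck_on_sum:
  assumes "open S" "\<And>i. i \<in> I \<Longrightarrow> Ck_on k S (f i)"
  shows "Ck_on k S (\<lambda>x. \<Sum>i\<in>I. f i x)"
  using assms(2)
  by (induction I rule: infinite_finite_induct) (auto intro!: Ck_on_const Ck_on_add assms(1))

lemma frechet_expand:
  fixes D :: "'b::euclidean_space \<Rightarrow> 'c::real_normed_vector"
  assumes "linear D"
  shows "D v = (\<Sum>b\<in>Basis. (v \<bullet> b) *\<^sub>R D b)"
  by (metis (no_types, lifting) assms euclidean_representation linear_scale linear_sum sum.cong)

text \<open>\<open>Ck_on\<close> differentiates in fixed directions, but in the chain rule the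
  direction fed to the derivative of \<open>g\<close> depends on \<open>x\<close>. Expanding it in
  \<open>Basis\<close> makes the derivative a sum of products of a component of the derivative of
  \<open>f\<close> with a fixed directional derivative of \<open>g\<close>, and the induction
  hypothesis, general in \<open>g\<close>, applies to the latter.\<close>

lemma Ck_on_compose:
  fixes f :: "'a::euclidean_space \<Rightarrow> 'b::euclidean_space" and g :: "'b \<Rightarrow> 'c::real_normed_vector"
  assumes "open S" "open T" "\<And>x. x \<in> S \<Longrightarrow> f x \<in> T" "Ck_on k S f" "Ck_on k T g"
  shows "Ck_on k S (\<lambda>x. g (f x))"
  using assms(4,5)
proof (induction k arbitrary: g)
  case 0
  then show ?case using assms(3) by (auto intro!: continuous_on_compose2[of T g])
next
  case (Suc k)
  have df: "(f has_derivative frechet_derivative f (at x)) (at x)" if "x \<in> S" for x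
    using Suc.prems(1) that by (auto simp: frechet_derivative_works[symmetric])
  have dg: "(g has_derivative frechet_derivative g (at y)) (at y)" if "y \<in> T" for y
    using Suc.prems(2) that by (auto simp: frechet_derivative_works[symmetric])
  have d: "((\<lambda>x. g (f x)) has_derivative
        (\<lambda>v. \<Sum>b\<in>Basis. (frechet_derivative f (at x) v \<bullet> b) *\<^sub>R frechet_derivative g (at (f x)) b)) (at x)"
    if "x \<in> S" for x
    using has_derivative_compose[OF df[OF that] dg[OF assms(3)[OF that]]]
    by (subst frechet_expand[symmetric])
      (use dg[OF assms(3)[OF that]] in \<open>auto intro: has_derivative_linear\<close>)
  have "Ck_on k S (\<lambda>x. \<Sum>b\<in>Basis. (frechet_derivative f (at x) v \<bullet> b) *\<^sub>R frechet_derivative g (at (f x)) b)" for v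
    using Suc.prems Ck_on_mono[OF Suc.prems(1)]
    by (intro Ck_on_sum assms(1) bounded_bilinear.Ck_on_bilinear[OF bounded_bilinear_scaleR]
        bounded_linear.Ck_on_linear[OF bounded_linear_inner_left] Suc.IH) auto
  then show ?case
    by (rule Ck_on_SucI[OF assms(1) d, rotated])
qed

text \<open>The derivative formula contains the inverse itself only at the lower order, so the
  induction reproduces its own hypothesis. The same bootstrap later gives smoothness of a local
  inverse map.\<close>

lemma Ck_on_inverse:
  fixes f :: "'a::euclidean_space \<Rightarrow> real"
  assumes "open S" "\<And>x. x \<in> S \<Longrightarrow> f x \<noteq> 0" "Ck_on k S f"
  shows "Ck_on k S (\<lambda>x. inverse (f x))"
  using assms(3)
proof (induction k)
  case 0
  then show ?case using assms(2) by (auto intro!: continuous_intros)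
next
  case (Suc k)
  have df: "(f has_derivative frechet_derivative f (at x)) (at x)" if "x \<in> S" for x
    using Suc.prems that by (auto simp: frechet_derivative_works[symmetric])
  note m = bounded_bilinear.Ck_on_bilinear[OF bounded_bilinear_mult assms(1)]
  have i: "Ck_on k S (\<lambda>x. inverse (f x))" using Suc Ck_on_mono by blast
  have "Ck_on k S (\<lambda>x. - (inverse (f x) * frechet_derivative f (at x) v * inverse (f x)))" for v
    using Suc.prems by (intro bounded_linear.Ck_on_linear[OF bounded_linear_minus[OF bounded_linear_ident]] m i assms(1)) auto
  then show ?case
    by (rule Ck_on_SucI[OF assms(1) Deriv.has_derivative_inverse[OF assms(2) df], rotated 2])
qed

text \<open>Openness is part of the predicate, so the rules below can differentiate on full
  neighbourhoods without a separate side condition.\<close>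

definition smooth_open :: "'a::euclidean_space set \<Rightarrow> ('a \<Rightarrow> 'b::real_normed_vector) \<Rightarrow> bool" where
  "smooth_open T f \<longleftrightarrow> open T \<and> (\<forall>k. Ck_on k T f)"

lemma smooth_openD: "smooth_open T f \<Longrightarrow> open T" "smooth_open T f \<Longrightarrow> Ck_on k T f"
  by (auto simp: smooth_open_def)

lemma smooth_open_has_derivative:
  "smooth_open T f \<Longrightarrow> x \<in> T \<Longrightarrow> (f has_derivative frechet_derivative f (at x)) (at x)"
  using smooth_openD(2)[of T f "Suc 0"] by (auto simp: frechet_derivative_works[symmetric])

lemma smooth_open_continuous: "smooth_open T f \<Longrightarrow> continuous_on T f"
  using smooth_openD(2)[of T f 0] by simp

lemma smooth_open_deriv:
  "smooth_open T f \<Longrightarrow> smooth_open T (\<lambda>x. frechet_derivative f (at x) v)"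
  unfolding smooth_open_def by (metis Ck_on.simps(2))

lemma smooth_open_cong:
  "smooth_open T f \<Longrightarrow> (\<And>x. x \<in> T \<Longrightarrow> f x = g x) \<Longrightarrow> smooth_open T g"
  unfolding smooth_open_def by (meson Ck_on_cong)

lemma smooth_open_subset: "smooth_open T f \<Longrightarrow> open S \<Longrightarrow> S \<subseteq> T \<Longrightarrow> smooth_open S f"
  unfolding smooth_open_def by (meson Ck_on_subset)

lemma smooth_open_id: "open T \<Longrightarrow> smooth_open T (\<lambda>x. x)"
  by (simp add: smooth_open_def Ck_on_id)

lemma smooth_open_add: "smooth_open T f \<Longrightarrow> smooth_open T g \<Longrightarrow> smooth_open T (\<lambda>x. f x + g x)"
  by (simp add: smooth_open_def Ck_on_add)

lemma smooth_open_bilinear: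
  "bounded_bilinear h \<Longrightarrow> smooth_open T f \<Longrightarrow> smooth_open T g \<Longrightarrow> smooth_open T (\<lambda>x. h (f x) (g x))"
  by (simp add: smooth_open_def bounded_bilinear.Ck_on_bilinear)

lemmas smooth_open_mult = smooth_open_bilinear[OF bounded_bilinear_mult]

lemma smooth_open_linear:
  "bounded_linear h \<Longrightarrow> smooth_open T f \<Longrightarrow> smooth_open T (\<lambda>x. h (f x))"
  by (simp add: smooth_open_def bounded_linear.Ck_on_linear)

lemmas smooth_open_fst = smooth_open_linear[OF bounded_linear_fst]
lemmas smooth_open_snd = smooth_open_linear[OF bounded_linear_snd]

lemma smooth_open_minus: "smooth_open T f \<Longrightarrow> smooth_open T (\<lambda>x. - f x)"
  by (rule smooth_open_linear[OF bounded_linear_minus[OF bounded_linear_ident]])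

lemma smooth_open_diff: "smooth_open T f \<Longrightarrow> smooth_open T g \<Longrightarrow> smooth_open T (\<lambda>x. f x - g x)"
  using smooth_open_add[OF _ smooth_open_minus, of T f g] by simp

lemma smooth_open_divide:
  fixes f g :: "'a::euclidean_space \<Rightarrow> real"
  shows "smooth_open T f \<Longrightarrow> smooth_open T g \<Longrightarrow> (\<And>x. x \<in> T \<Longrightarrow> g x \<noteq> 0) \<Longrightarrow> smooth_open T (\<lambda>x. f x / g x)"
  unfolding divide_inverse
  by (rule smooth_open_mult) (auto simp: smooth_open_def Ck_on_inverse)

lemma smooth_open_Pair:
  fixes f :: "'a::euclidean_space \<Rightarrow> 'b::real_normed_vector" and g :: "'a \<Rightarrow> 'c::real_normed_vector"
  assumes "smooth_open T f" "smooth_open T g"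
  shows "smooth_open T (\<lambda>x. (f x, g x))"
proof -
  have "smooth_open T (\<lambda>x. (f x, 0) + (0, g x))"
    by (intro smooth_open_add smooth_open_linear[OF _ assms(1), of "\<lambda>y. (y, 0)"]
        smooth_open_linear[OF _ assms(2), of "\<lambda>y. (0, y)"])
      (auto intro!: bounded_linear_intros)
  then show ?thesis by simp
qed

lemma smooth_open_compose:
  fixes f :: "'a::euclidean_space \<Rightarrow> 'b::euclidean_space" and g :: "'b \<Rightarrow> 'c::real_normed_vector"
  assumes "smooth_open S f" "smooth_open T g" "\<And>x. x \<in> S \<Longrightarrow> f x \<in> T"
  shows "smooth_open S (\<lambda>x. g (f x))"
  unfolding smooth_open_def
proof (intro conjI allI)
  show "open S" by (rule smooth_openD(1)[OF assms(1)])
  show "Ck_on k S (\<lambda>x. g (f x))" for k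
    by (rule Ck_on_compose[OF smooth_openD(1)[OF assms(1)] smooth_openD(1)[OF assms(2)] assms(3)
          smooth_openD(2)[OF assms(1)] smooth_openD(2)[OF assms(2)]])
qed

section \<open>Smoothness on arbitrary sets through local extensions\<close>

lemma smooth_on_def':
  "smooth_on S f \<longleftrightarrow> (\<forall>x\<in>S. \<exists>T g. x \<in> T \<and> smooth_open T g \<and> (\<forall>y\<in>S \<inter> T. f y = g y))"
  unfolding smooth_on_def smooth_open_def by (simp add: conj_ac)

lemma smooth_onE:
  assumes "smooth_on S f" "x \<in> S"
  obtains T g where "x \<in> T" "smooth_open T g" "\<forall>y\<in>S \<inter> T. f y = g y"
  using assms unfolding smooth_on_def' by blast

lemma smooth_open_Int_preimage:
  assumes "smooth_open S f" "open T"
  shows "open (S \<inter> f -` T)"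
  using continuous_open_preimage[OF smooth_open_continuous[OF assms(1)] smooth_openD(1)[OF assms(1)] assms(2)] .

lemma smooth_on_compose:
  fixes f :: "'a::euclidean_space \<Rightarrow> 'b::euclidean_space" and g :: "'b \<Rightarrow> 'c::real_normed_vector"
  assumes "smooth_on S f" "smooth_on S' g" "f ` S \<subseteq> S'"
  shows "smooth_on S (\<lambda>x. g (f x))"
  unfolding smooth_on_def'
proof
  fix x assume x: "x \<in> S"
  obtain T F where T: "x \<in> T" "smooth_open T F" "\<forall>y\<in>S \<inter> T. f y = F y"
    by (rule smooth_onE[OF assms(1) x])
  have fx: "f x \<in> S'" using assms(3) x by blast
  obtain T' G where T': "f x \<in> T'" "smooth_open T' G" "\<forall>y\<in>S' \<inter> T'. g y = G y"
    by (rule smooth_onE[OF assms(2) fx])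
  let ?U = "T \<inter> F -` T'"
  have o: "open ?U" by (rule smooth_open_Int_preimage[OF T(2) smooth_openD(1)[OF T'(2)]])
  have "smooth_open ?U (\<lambda>y. G (F y))"
    by (rule smooth_open_compose[OF smooth_open_subset[OF T(2) o] T'(2)]) auto
  moreover have "x \<in> ?U" using T T' x by auto
  moreover have "\<forall>y\<in>S \<inter> ?U. g (f y) = G (F y)" using T(3) T'(3) assms(3) by auto
  ultimately show "\<exists>T h. x \<in> T \<and> smooth_open T h \<and> (\<forall>y\<in>S \<inter> T. g (f y) = h y)"
    by (intro exI conjI)
qed

lemma smooth_open_imp_smooth_on: "smooth_open T f \<Longrightarrow> S \<subseteq> T \<Longrightarrow> smooth_on S f"
  unfolding smooth_on_def' by blast

lemma smooth_on_cong:
  assumes "smooth_on S f" "\<And>x. x \<in> S \<Longrightarrow> f x = g x"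
  shows "smooth_on S g"
proof -
  have "(\<forall>y\<in>S \<inter> T. g y = h y) \<longleftrightarrow> (\<forall>y\<in>S \<inter> T. f y = h y)" for T and h :: "'a \<Rightarrow> 'b"
    using assms(2) by auto
  then show ?thesis using assms(1) unfolding smooth_on_def' by simp
qed

lemma smooth_on_Pair:
  fixes f :: "'a::euclidean_space \<Rightarrow> 'b::real_normed_vector" and g :: "'a \<Rightarrow> 'c::real_normed_vector"
  assumes "smooth_on S f" "smooth_on S g"
  shows "smooth_on S (\<lambda>x. (f x, g x))"
  unfolding smooth_on_def'
proof
  fix x assume x: "x \<in> S"
  obtain T F where T: "x \<in> T" "smooth_open T F" "\<forall>y\<in>S \<inter> T. f y = F y"
    by (rule smooth_onE[OF assms(1) x])
  obtain T' G where T': "x \<in> T'" "smooth_open T' G" "\<forall>y\<in>S \<inter> T'. g y = G y"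
    by (rule smooth_onE[OF assms(2) x])
  have o: "open (T \<inter> T')" by (intro open_Int smooth_openD(1)[OF T(2)] smooth_openD(1)[OF T'(2)])
  have "smooth_open (T \<inter> T') (\<lambda>y. (F y, G y))"
    by (intro smooth_open_Pair smooth_open_subset[OF T(2) o] smooth_open_subset[OF T'(2) o]) auto
  then show "\<exists>T h. x \<in> T \<and> smooth_open T h \<and> (\<forall>y\<in>S \<inter> T. (f y, g y) = h y)"
    using T T' by (intro exI[of _ "T \<inter> T'"] exI[of _ "\<lambda>y. (F y, G y)"]) auto
qed

lemma smooth_open_directional:
  fixes f :: "'a::euclidean_space \<Rightarrow> real"
  assumes "smooth_open T f" "x + s *\<^sub>R v \<in> T"
  shows "((\<lambda>s. f (x + s *\<^sub>R v)) has_real_derivative frechet_derivative f (at (x + s *\<^sub>R v)) v) (at s within A)"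
proof -
  note d = smooth_open_has_derivative[OF assms]
  have "((\<lambda>s. x + s *\<^sub>R v) has_derivative (\<lambda>r. r *\<^sub>R v)) (at s within A)"
    by (auto intro!: derivative_eq_intros)
  from has_derivative_compose[OF this d]
  show ?thesis
    unfolding has_field_derivative_def
    by (rule has_derivative_eq_rhs)
      (simp add: linear_scale[OF has_derivative_linear[OF d]] fun_eq_iff)
qed

section \<open>Symmetry of second derivatives\<close>

lemma second_difference_limit:
  fixes f :: "'a::euclidean_space \<Rightarrow> real"
  assumes f: "smooth_open T f" and x: "x \<in> T" and e: "e > 0"
  shows "\<exists>d>0. \<forall>s. 0 < s \<and> s < d \<longrightarrow>
     \<bar>(f (x + s *\<^sub>R u + s *\<^sub>R v) - f (x + s *\<^sub>R u) - f (x + s *\<^sub>R v) + f x) / s\<^sup>2 -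
       frechet_derivative (\<lambda>y. frechet_derivative f (at y) u) (at x) v\<bar> < e"
proof -
  let ?g = "\<lambda>y. frechet_derivative f (at y) u"
  let ?h = "\<lambda>y. frechet_derivative ?g (at y) v"
  have g: "smooth_open T ?g" by (rule smooth_open_deriv[OF f])
  have h: "smooth_open T ?h" by (rule smooth_open_deriv[OF g])
  have "isCont ?h x"
    using smooth_open_continuous[OF h] smooth_openD(1)[OF h] x by (simp add: continuous_on_eq_continuous_at)
  then obtain d1 where d1: "d1 > 0" "\<And>y. dist y x < d1 \<Longrightarrow> \<bar>?h y - ?h x\<bar> < e"
    using e unfolding continuous_at_eps_delta dist_real_def by metis
  obtain d2 where d2: "d2 > 0" "ball x d2 \<subseteq> T"
    using smooth_openD(1)[OF f] x openE by blast
  \<comment> \<open>Shrinks the parallelogram spanned by \<open>s u\<close> and \<open>s v\<close>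
    into both balls; the \<open>+ 1\<close> keeps the quotient meaningful when both vectors
    vanish.\<close>
  define d where "d = min d1 d2 / (norm u + norm v + 1)"
  have pos: "norm u + norm v + 1 > 0" by (smt (verit) norm_ge_zero)
  have d: "d > 0" unfolding d_def using d1(1) d2(1) pos by auto
  have near: "dist (x + a *\<^sub>R u + b *\<^sub>R v) x < min d1 d2" if "0 \<le> a" "a \<le> s" "0 \<le> b" "b \<le> s" "0 < s" "s < d" for a b s
  proof -
    have "dist (x + a *\<^sub>R u + b *\<^sub>R v) x \<le> norm (a *\<^sub>R u) + norm (b *\<^sub>R v)"
      by (simp only: dist_norm add.assoc add_diff_cancel_left' norm_triangle_ineq)
    also have "\<dots> \<le> s * norm u + s * norm v"
      using that by (auto intro!: add_mono mult_right_mono)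
    also have "\<dots> \<le> s * (norm u + norm v + 1)"
      using that by (simp add: algebra_simps)
    also have "\<dots> < d * (norm u + norm v + 1)"
      using that pos by (intro mult_strict_right_mono) auto
    finally show ?thesis unfolding d_def using pos by simp
  qed
  have inT: "x + a *\<^sub>R u + b *\<^sub>R v \<in> T" if "0 \<le> a" "a \<le> s" "0 \<le> b" "b \<le> s" "0 < s" "s < d" for a b s
    using near[OF that] d2(2) by (auto simp: dist_commute)
  have "\<bar>(f (x + s *\<^sub>R u + s *\<^sub>R v) - f (x + s *\<^sub>R u) - f (x + s *\<^sub>R v) + f x) / s\<^sup>2 - ?h x\<bar> < e"
    if s: "0 < s" "s < d" for s
  proof -
    \<comment> \<open>Mean value theorem twice: along \<open>u\<close> for the difference of
      \<open>f\<close> across \<open>s v\<close>, then along \<open>v\<close> for the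
      \<open>u\<close>-derivative of \<open>f\<close>. The second difference becomes
      \<open>s^2\<close> times the mixed derivative at one point of the parallelogram, to which
      continuity applies.\<close>
    let ?a = "\<lambda>r. f (x + s *\<^sub>R v + r *\<^sub>R u) - f (x + r *\<^sub>R u)"
    have "\<exists>z. 0 < z \<and> z < s \<and> ?a s - ?a 0 = (s - 0) * (?g (x + s *\<^sub>R v + z *\<^sub>R u) - ?g (x + z *\<^sub>R u))"
      using s
    proof (intro MVT2[of 0 s ?a])
      fix r assume r: "0 \<le> r" "r \<le> s"
      have 1: "x + s *\<^sub>R v + r *\<^sub>R u \<in> T" using inT[of r s s] r s by (simp add: algebra_simps)
      have 2: "x + r *\<^sub>R u \<in> T" using inT[of r s 0] r s by simp
      show "(?a has_real_derivative ?g (x + s *\<^sub>R v + r *\<^sub>R u) - ?g (x + r *\<^sub>R u)) (at r)"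
        by (rule DERIV_diff[OF smooth_open_directional[OF f 1] smooth_open_directional[OF f 2]])
    qed
    then obtain z where z: "0 < z" "z < s" and az: "?a s - ?a 0 = s * (?g (x + s *\<^sub>R v + z *\<^sub>R u) - ?g (x + z *\<^sub>R u))"
      by auto
    let ?b = "\<lambda>r. ?g (x + z *\<^sub>R u + r *\<^sub>R v)"
    have "\<exists>y. 0 < y \<and> y < s \<and> ?b s - ?b 0 = (s - 0) * ?h (x + z *\<^sub>R u + y *\<^sub>R v)"
      using s
    proof (intro MVT2[of 0 s ?b])
      fix r assume r: "0 \<le> r" "r \<le> s"
      have "x + z *\<^sub>R u + r *\<^sub>R v \<in> T" using inT[of z s r] r s z by simp
      then show "(?b has_real_derivative ?h (x + z *\<^sub>R u + r *\<^sub>R v)) (at r)"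
        by (rule smooth_open_directional[OF g])
    qed
    then obtain y where y: "0 < y" "y < s" "?b s - ?b 0 = s * ?h (x + z *\<^sub>R u + y *\<^sub>R v)"
      by auto
    have "(f (x + s *\<^sub>R u + s *\<^sub>R v) - f (x + s *\<^sub>R u) - f (x + s *\<^sub>R v) + f x) = ?a s - ?a 0"
      by (simp add: algebra_simps)
    also have "\<dots> = s * (?b s - ?b 0)" using az by (simp add: algebra_simps)
    also have "\<dots> = s\<^sup>2 * ?h (x + z *\<^sub>R u + y *\<^sub>R v)" using y(3) by (simp add: power2_eq_square)
    finally have "(f (x + s *\<^sub>R u + s *\<^sub>R v) - f (x + s *\<^sub>R u) - f (x + s *\<^sub>R v) + f x) / s\<^sup>2 = ?h (x + z *\<^sub>R u + y *\<^sub>R v)"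
      using s by simp
    moreover have "dist (x + z *\<^sub>R u + y *\<^sub>R v) x < d1"
      using near[of z s y] z y s by simp
    ultimately show ?thesis using d1(2) by simp
  qed
  then show ?thesis using d by blast
qed

text \<open>The second difference does not change when \<open>u\<close> and \<open>v\<close> are
  exchanged, so both mixed derivatives are limits of the same quotient; \<open>?e\<close> is half
  the supposed gap.\<close>

lemma frechet_derivative_symmetric:
  fixes f :: "'a::euclidean_space \<Rightarrow> real"
  assumes f: "smooth_open T f" and x: "x \<in> T"
  shows "frechet_derivative (\<lambda>y. frechet_derivative f (at y) u) (at x) v =
         frechet_derivative (\<lambda>y. frechet_derivative f (at y) v) (at x) u" (is "?A = ?B")
proof (rule ccontr)
  assume ne: "?A \<noteq> ?B"
  let ?e = "\<bar>?A - ?B\<bar> / 2"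
  have e: "?e > 0" using ne by simp
  obtain d1 where d1: "d1 > 0" "\<And>s. 0 < s \<Longrightarrow> s < d1 \<Longrightarrow>
     \<bar>(f (x + s *\<^sub>R u + s *\<^sub>R v) - f (x + s *\<^sub>R u) - f (x + s *\<^sub>R v) + f x) / s\<^sup>2 - ?A\<bar> < ?e"
    using second_difference_limit[OF f x e, of u v] by blast
  obtain d2 where d2: "d2 > 0" "\<And>s. 0 < s \<Longrightarrow> s < d2 \<Longrightarrow>
     \<bar>(f (x + s *\<^sub>R v + s *\<^sub>R u) - f (x + s *\<^sub>R v) - f (x + s *\<^sub>R u) + f x) / s\<^sup>2 - ?B\<bar> < ?e"
    using second_difference_limit[OF f x e, of v u] by blast
  define s where "s = min d1 d2 / 2"
  have s: "0 < s" "s < d1" "s < d2" using d1(1) d2(1) by (auto simp: s_def)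
  have "f (x + s *\<^sub>R v + s *\<^sub>R u) - f (x + s *\<^sub>R v) - f (x + s *\<^sub>R u) + f x =
    f (x + s *\<^sub>R u + s *\<^sub>R v) - f (x + s *\<^sub>R u) - f (x + s *\<^sub>R v) + f x"
    by (simp add: algebra_simps)
  with d2(2)[OF s(1,3)] have
    "\<bar>(f (x + s *\<^sub>R u + s *\<^sub>R v) - f (x + s *\<^sub>R u) - f (x + s *\<^sub>R v) + f x) / s\<^sup>2 - ?B\<bar> < ?e" by simp
  then have "\<bar>?A - ?B\<bar> < ?e + ?e"
    using d1(2)[OF s(1,2)] by linarith
  then show False by simp
qed

section \<open>Counting names of orbit blocks\<close>

text \<open>Counts itineraries through the cover rather than members of
  \<open>iterated_join\<close>: itineraries can be cut, glued and collected over unions without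
  mentioning the topology. A name is a function on all of \<open>nat\<close>, of which only the
  first \<open>n\<close> values matter.\<close>

definition name_cover :: "('a \<Rightarrow> 'a) \<Rightarrow> 'a set set \<Rightarrow> nat \<Rightarrow> nat \<Rightarrow> 'a set \<Rightarrow> bool" where
  "name_cover f \<U> n N S \<longleftrightarrow> (\<exists>Q. finite Q \<and> card Q \<le> N \<and> (\<forall>q\<in>Q. \<forall>i<n. q i \<in> \<U>) \<and>
     (\<forall>x\<in>S. \<exists>q\<in>Q. \<forall>i<n. (f ^^ i) x \<in> q i))"

lemma iterated_join_name:
  assumes "f ` topspace X \<subseteq> topspace X" "\<And>i. i < n \<Longrightarrow> q i \<in> \<U>"
  shows "{x \<in> topspace X. \<forall>i<n. (f ^^ i) x \<in> q i} \<in> iterated_join X f \<U> n"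
  using assms(2)
proof (induction n arbitrary: q)
  case 0
  then show ?case by simp
next
  case (Suc n)
  let ?V = "{x \<in> topspace X. \<forall>i<n. (f ^^ i) x \<in> q (Suc i)}"
  have "?V \<in> iterated_join X f \<U> n" using Suc by simp
  moreover have "{x \<in> topspace X. \<forall>i<Suc n. (f ^^ i) x \<in> q i} = q 0 \<inter> {x \<in> topspace X. f x \<in> ?V}"
    using assms(1) by (auto simp: All_less_Suc2 funpow_swap1)
  moreover have "q 0 \<in> \<U>" using Suc.prems by simp
  ultimately show ?case unfolding iterated_join.simps by blast
qed

text \<open>Each name yields one member of the iterated join, namely the set of points that follow
  it, and these members cover the space.\<close>

lemma cover_number_le:
  assumes "f ` topspace X \<subseteq> topspace X" "name_cover f \<U> n N (topspace X)"
  shows "cover_number X (iterated_join X f \<U> n) \<le> N"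
proof -
  obtain Q where Q: "finite Q" "card Q \<le> N" "\<forall>q\<in>Q. \<forall>i<n. q i \<in> \<U>"
    "\<forall>x\<in>topspace X. \<exists>q\<in>Q. \<forall>i<n. (f ^^ i) x \<in> q i"
    using assms(2) unfolding name_cover_def by blast
  let ?F = "\<lambda>q. {x \<in> topspace X. \<forall>i<n. (f ^^ i) x \<in> q i}"
  have "?F ` Q \<subseteq> iterated_join X f \<U> n"
    using iterated_join_name[OF assms(1)] Q(3) by blast
  moreover have "\<Union>(?F ` Q) = topspace X" using Q(4) by blast
  ultimately have "cover_number X (iterated_join X f \<U> n) \<le> card (?F ` Q)"
    unfolding cover_number_def using Q(1) by (intro Least_le) blast
  also have "\<dots> \<le> N" using card_image_le[OF Q(1), of ?F] Q(2) by linarith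
  finally show ?thesis .
qed

lemma name_cover_mono:
  assumes "name_cover f \<U> n N S" "n' \<le> n" "N \<le> N'" "S' \<subseteq> S"
  shows "name_cover f \<U> n' N' S'"
proof -
  obtain Q where Q: "finite Q" "card Q \<le> N" "\<forall>q\<in>Q. \<forall>i<n. q i \<in> \<U>"
    "\<forall>x\<in>S. \<exists>q\<in>Q. \<forall>i<n. (f ^^ i) x \<in> q i"
    using assms(1) unfolding name_cover_def by blast
  have *: "i < n" if "i < n'" for i using that assms(2) by simp
  show ?thesis unfolding name_cover_def
    using Q assms(3,4) * by (intro exI[of _ Q]) (meson le_trans subsetD)
qed

lemma name_cover_Un:
  assumes "name_cover f \<U> n N S" "name_cover f \<U> n N' S'"
  shows "name_cover f \<U> n (N + N') (S \<union> S')"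
proof -
  obtain Q where Q: "finite Q" "card Q \<le> N" "\<forall>q\<in>Q. \<forall>i<n. q i \<in> \<U>"
    "\<forall>x\<in>S. \<exists>q\<in>Q. \<forall>i<n. (f ^^ i) x \<in> q i"
    using assms(1) unfolding name_cover_def by blast
  obtain Q' where Q': "finite Q'" "card Q' \<le> N'" "\<forall>q\<in>Q'. \<forall>i<n. q i \<in> \<U>"
    "\<forall>x\<in>S'. \<exists>q\<in>Q'. \<forall>i<n. (f ^^ i) x \<in> q i"
    using assms(2) unfolding name_cover_def by blast
  show ?thesis unfolding name_cover_def
  proof (intro exI[of _ "Q \<union> Q'"] conjI)
    show "card (Q \<union> Q') \<le> N + N'" using card_Un_le[of Q Q'] Q(2) Q'(2) by linarith
    show "finite (Q \<union> Q')" using Q(1) Q'(1) by simp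
    show "\<forall>q\<in>Q \<union> Q'. \<forall>i<n. q i \<in> \<U>" using Q(3) Q'(3) by auto
    show "\<forall>x\<in>S \<union> S'. \<exists>q\<in>Q \<union> Q'. \<forall>i<n. (f ^^ i) x \<in> q i"
      using Q(4) Q'(4) by (auto simp: Ball_def Bex_def)
  qed
qed

lemma name_cover_UN:
  assumes "finite J" "\<And>j. j \<in> J \<Longrightarrow> name_cover f \<U> n (N j) (S j)"
  shows "name_cover f \<U> n (\<Sum>j\<in>J. N j) (\<Union>j\<in>J. S j)"
  using assms
proof (induction J rule: finite_induct)
  case empty
  then show ?case by (auto simp: name_cover_def)
next
  case (insert j J)
  then show ?case using name_cover_Un[of f \<U> n "N j" "S j"] by simp
qed

text \<open>A point that is in \<open>S\<close> at the start of every block is named by gluing one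
  name per block, chosen independently, whence the power. This is how a count for blocks of length
  \<open>m\<close> becomes an exponential rate.\<close>

lemma name_cover_concat:
  assumes "name_cover f \<U> m N S"
  shows "name_cover f \<U> (q * m) (N ^ q) {x. \<forall>j<q. (f ^^ (j * m)) x \<in> S}"
proof (induction q)
  case 0
  \<comment> \<open>For no blocks one name of length zero is needed, with arbitrary values, in
    agreement with \<open>N ^ 0 = 1\<close>.\<close>
  show ?case unfolding name_cover_def by (intro exI[of _ "{\<lambda>i. {}}"]) auto
next
  case (Suc q)
  obtain Q where Q: "finite Q" "card Q \<le> N" "\<forall>q\<in>Q. \<forall>i<m. q i \<in> \<U>"
    "\<forall>x\<in>S. \<exists>q\<in>Q. \<forall>i<m. (f ^^ i) x \<in> q i"
    using assms(1) unfolding name_cover_def by blast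
  obtain Q' where Q': "finite Q'" "card Q' \<le> N ^ q" "\<forall>r\<in>Q'. \<forall>i<q * m. r i \<in> \<U>"
    "\<forall>x\<in>{x. \<forall>j<q. (f ^^ (j * m)) x \<in> S}. \<exists>r\<in>Q'. \<forall>i<q * m. (f ^^ i) x \<in> r i"
    using Suc unfolding name_cover_def by blast
  let ?g = "\<lambda>(a, b) i. if i < m then a i else b (i - m)"
  show ?case unfolding name_cover_def
  proof (intro exI[of _ "?g ` (Q \<times> Q')"] conjI ballI)
    have "card (?g ` (Q \<times> Q')) \<le> card Q * card Q'"
      using card_image_le[of "Q \<times> Q'" ?g] Q(1) Q'(1) by (simp add: card_cartesian_product)
    also have "\<dots> \<le> N ^ Suc q" using Q(2) Q'(2) by (simp add: mult_le_mono)
    finally show "card (?g ` (Q \<times> Q')) \<le> N ^ Suc q" .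
    show "finite (?g ` (Q \<times> Q'))" using Q(1) Q'(1) by simp
    fix r assume "r \<in> ?g ` (Q \<times> Q')"
    then show "\<forall>i<Suc q * m. r i \<in> \<U>" using Q(3) Q'(3) by auto
  next
    fix x assume "x \<in> {x. \<forall>j<Suc q. (f ^^ (j * m)) x \<in> S}"
    then have x: "(f ^^ (j * m)) x \<in> S" if "j < Suc q" for j using that by blast
    obtain a where a: "a \<in> Q" "\<forall>i<m. (f ^^ i) x \<in> a i" using Q(4) x[of 0] by auto
    have "(f ^^ (j * m)) ((f ^^ m) x) \<in> S" if "j < q" for j
      using x[of "Suc j"] that by (simp add: funpow_add add.commute[of m])
    then have "(f ^^ m) x \<in> {x. \<forall>j<q. (f ^^ (j * m)) x \<in> S}" by simp
    then obtain b where b: "b \<in> Q'" "\<forall>i<q * m. (f ^^ i) ((f ^^ m) x) \<in> b i"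
      using bspec[OF Q'(4)] by blast
    have "(f ^^ i) x \<in> ?g (a, b) i" if "i < Suc q * m" for i
    proof (cases "i < m")
      case False
      then have "(f ^^ i) x = (f ^^ (i - m)) ((f ^^ m) x)"
        by (metis add.commute comp_apply funpow_add le_add_diff_inverse not_less)
      with False b(2) that show ?thesis by auto
    qed (use a in auto)
    then show "\<exists>r\<in>?g ` (Q \<times> Q'). \<forall>i<Suc q * m. (f ^^ i) x \<in> r i"
      using a(1) b(1) by (intro bexI[of _ "?g (a, b)"]) auto
  qed
qed

text \<open>The form in which orbit segments are counted later: label each point from a finite set
  and show that points with the same label visit a common cover member at each time. One name per
  label is then read off from a representative.\<close>

lemma name_cover_code:
  assumes C: "finite C" "card C \<le> N" "\<And>x. x \<in> S \<Longrightarrow> code x \<in> C"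
    and U: "\<And>x i. x \<in> S \<Longrightarrow> i < n \<Longrightarrow> \<exists>U\<in>\<U>. \<forall>y\<in>S. code y = code x \<longrightarrow> (f ^^ i) y \<in> U"
  shows "name_cover f \<U> n N S"
proof -
  obtain u where u: "\<And>x i. x \<in> S \<Longrightarrow> i < n \<Longrightarrow> u x i \<in> \<U> \<and> (\<forall>y\<in>S. code y = code x \<longrightarrow> (f ^^ i) y \<in> u x i)"
    using U by metis
  define rep where "rep c = (SOME x. x \<in> S \<and> code x = c)" for c
  have rep: "rep c \<in> S \<and> code (rep c) = c" if "c \<in> code ` S" for c
    unfolding rep_def by (rule someI_ex) (use that in auto)
  have sub: "code ` S \<subseteq> C" using C(3) by blast
  have fin: "finite (code ` S)" using sub C(1) finite_subset by blast
  show ?thesis unfolding name_cover_def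
  proof (intro exI[of _ "(\<lambda>c. u (rep c)) ` code ` S"] conjI ballI allI impI)
    show "card ((\<lambda>c. u (rep c)) ` code ` S) \<le> N"
      using card_image_le[OF fin] card_mono[OF C(1) sub] C(2) by (meson le_trans)
    show "finite ((\<lambda>c. u (rep c)) ` code ` S)" using fin by simp
    show "q i \<in> \<U>" if "q \<in> (\<lambda>c. u (rep c)) ` code ` S" "i < n" for q i
      using that rep u by auto
    show "\<exists>q\<in>(\<lambda>c. u (rep c)) ` code ` S. \<forall>i<n. (f ^^ i) x \<in> q i" if "x \<in> S" for x
      using that rep[of "code x"] u[of "rep (code x)"]
      by (intro bexI[of _ "u (rep (code x))"]) auto
  qed
qed

section \<open>From the level sets of an invariant function to the whole space\<close>

lemma continuous_map_funpow:
  "continuous_map X X f \<Longrightarrow> continuous_map X X (f ^^ n)"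
  by (induction n) (auto intro: continuous_map_compose)

lemma openin_name:
  assumes f: "continuous_map X X f" and q: "\<And>i. i < n \<Longrightarrow> openin X (q i)"
  shows "openin X {x \<in> topspace X. \<forall>i<n. (f ^^ i) x \<in> q i}"
  using q
proof (induction n)
  case (Suc n)
  have "{x \<in> topspace X. \<forall>i<Suc n. (f ^^ i) x \<in> q i} =
    {x \<in> topspace X. \<forall>i<n. (f ^^ i) x \<in> q i} \<inter> {x \<in> topspace X. (f ^^ n) x \<in> q n}"
    by (auto simp: less_Suc_eq)
  moreover have "openin X {x \<in> topspace X. (f ^^ n) x \<in> q n}"
    using openin_continuous_map_preimage[OF continuous_map_funpow[OF f]] Suc.prems by blast
  ultimately show ?case using Suc by auto
qed auto

lemma compactin_finite_index:
  assumes "compactin X K" "\<And>i. i \<in> I \<Longrightarrow> openin X (S i)" "\<And>x. x \<in> K \<Longrightarrow> \<exists>i\<in>I. x \<in> S i"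
  obtains D where "finite D" "D \<subseteq> I" "K \<subseteq> (\<Union>i\<in>D. S i)"
proof -
  have "\<forall>U\<in>S ` I. openin X U" "K \<subseteq> \<Union>(S ` I)" using assms(2,3) by auto
  then obtain F where F: "finite F" "F \<subseteq> S ` I" "K \<subseteq> \<Union>F"
    using assms(1) unfolding compactin_def by (elim conjE allE[of _ "S ` I"]) blast
  obtain D where D: "D \<subseteq> I" "finite D" "F = S ` D"
    using finite_subset_image[OF F(1,2)] by blast
  show thesis by (rule that[OF D(2,1)]) (use F(3) D(3) in simp)
qed

text \<open>Following a given name for \<open>n\<close> steps is an open condition on the starting
  point, so a count for a set persists on a neighbourhood of it.\<close>

lemma name_cover_nhd:
  assumes f: "continuous_map X X f" and U: "\<And>U. U \<in> \<U> \<Longrightarrow> openin X U"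
    and n: "name_cover f \<U> n N S" and S: "S \<subseteq> topspace X"
  obtains G where "openin X G" "S \<subseteq> G" "name_cover f \<U> n N G"
proof -
  obtain Q where Q: "finite Q" "card Q \<le> N" "\<forall>q\<in>Q. \<forall>i<n. q i \<in> \<U>"
    "\<forall>x\<in>S. \<exists>q\<in>Q. \<forall>i<n. (f ^^ i) x \<in> q i"
    using n unfolding name_cover_def by blast
  let ?G = "\<Union>q\<in>Q. {x \<in> topspace X. \<forall>i<n. (f ^^ i) x \<in> q i}"
  show thesis
  proof
    show "openin X ?G" using openin_name[OF f] Q(3) U by blast
    show "S \<subseteq> ?G" using Q(4) S by blast
    show "name_cover f \<U> n N ?G"
      unfolding name_cover_def using Q by (intro exI[of _ Q]) blast
  qed
qed

text \<open>Bowen's inequality for a factor on which the dynamics is trivial: entropy is carried by the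
  level sets of an invariant function.\<close>

lemma name_cover_from_levels:
  fixes h :: "'a \<Rightarrow> real"
  assumes X: "compact_space X" and f: "continuous_map X X f"
    and h: "continuous_map X euclideanreal h" and hf: "\<And>x. x \<in> topspace X \<Longrightarrow> h (f x) = h x"
    and U: "\<And>U. U \<in> \<U> \<Longrightarrow> openin X U"
    and a: "a \<ge> 0"
    and lev: "\<And>c. \<exists>m\<ge>1. \<exists>N. name_cover f \<U> m N {x \<in> topspace X. h x = c} \<and> real N \<le> exp (a * real m)"
  shows "\<exists>C\<ge>0. \<forall>n. \<exists>N. name_cover f \<U> n N (topspace X) \<and> real N \<le> C * exp (a * real n)"
proof -
  obtain m N where m: "\<And>c. m c \<ge> 1" and mN: "\<And>c. name_cover f \<U> (m c) (N c) {x \<in> topspace X. h x = c}"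
    and N: "\<And>c. real (N c) \<le> exp (a * real (m c))"
    using lev by metis
  have "\<exists>d>0. name_cover f \<U> (m c) (N c) {x \<in> topspace X. \<bar>h x - c\<bar> < d}" for c
  proof -
    obtain G where G: "openin X G" "{x \<in> topspace X. h x = c} \<subseteq> G" "name_cover f \<U> (m c) (N c) G"
      using name_cover_nhd[OF f U mN[of c]] by auto
    \<comment> \<open>The complement of \<open>G\<close> is compact, so its \<open>h\<close>-values
      form a closed set that misses \<open>c\<close>. Hence \<open>G\<close> contains all points
      whose value is close enough to \<open>c\<close>.\<close>
    have "compactin X (topspace X - G)"
      by (rule closedin_compact_space[OF X]) (use G(1) in blast)
    then have "compact (h ` (topspace X - G))"
      using image_compactin[OF _ h] by simp
    then have "open (- (h ` (topspace X - G)))" by (intro open_Compl compact_imp_closed)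
    moreover have "c \<in> - (h ` (topspace X - G))" using G(2) by auto
    ultimately obtain d where d: "d > 0" "ball c d \<subseteq> - (h ` (topspace X - G))"
      by (meson openE)
    have "{x \<in> topspace X. \<bar>h x - c\<bar> < d} \<subseteq> G"
    proof
      fix x assume x: "x \<in> {x \<in> topspace X. \<bar>h x - c\<bar> < d}"
      then have "h x \<in> ball c d" by (simp add: dist_real_def abs_minus_commute)
      with x d(2) show "x \<in> G" by blast
    qed
    with d(1) name_cover_mono[OF G(3)] show ?thesis by blast
  qed
  then obtain d where d: "\<And>c. d c > 0"
    and nd: "\<And>c. name_cover f \<U> (m c) (N c) {x \<in> topspace X. \<bar>h x - c\<bar> < d c}"
    by metis
  let ?S = "\<lambda>c. {x \<in> topspace X. \<bar>h x - c\<bar> < d c}"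
  have op: "openin X (?S c)" for c
  proof -
    have "openin X {x \<in> topspace X. h x \<in> ball c (d c)}"
      by (rule openin_continuous_map_preimage[OF h]) simp
    then show ?thesis by (simp add: dist_real_def abs_minus_commute)
  qed
  have "x \<in> ?S (h x)" if "x \<in> topspace X" for x using d[of "h x"] that by simp
  then have mem: "\<exists>c\<in>UNIV. x \<in> ?S c" if "x \<in> topspace X" for x using that by blast
  obtain D where D: "finite D" "D \<subseteq> UNIV" "topspace X \<subseteq> (\<Union>c\<in>D. ?S c)"
    by (rule compactin_finite_index[OF X[unfolded compact_space_def] op mem])
  have hn: "h ((f ^^ j) x) = h x \<and> (f ^^ j) x \<in> topspace X" if "x \<in> topspace X" for x j
    using that hf continuous_map_image_subset_topspace[OF f] by (induction j) auto
  have one: "\<exists>M. name_cover f \<U> n M (?S c) \<and> real M \<le> exp (a * real (m c)) * exp (a * real n)" for c n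
  proof -
    \<comment> \<open>Rounds \<open>n\<close> up to a multiple of \<open>m c\<close>. The overshoot
      is at most \<open>m c\<close> and costs only the constant factor
      \<open>exp (a * real (m c))\<close>.\<close>
    let ?q = "n div m c + 1"
    have "n mod m c < m c" "n div m c * m c + n mod m c = n" using m[of c] by auto
    moreover have "?q * m c = n div m c * m c + m c" by (simp only: distrib_right mult_1)
    ultimately have q: "n \<le> ?q * m c" "?q * m c \<le> n + m c" by linarith+
    have "name_cover f \<U> n (N c ^ ?q) (?S c)"
      by (rule name_cover_mono[OF name_cover_concat[OF nd[of c], of ?q] q(1) order_refl]) (use hn in auto)
    moreover have "real (N c ^ ?q) \<le> exp (a * real (m c)) * exp (a * real n)"
    proof -
      have "real (N c ^ ?q) \<le> exp (a * real (m c)) ^ ?q"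
        using N[of c] by (simp only: of_nat_power) (intro power_mono, auto)
      also have "\<dots> = exp (a * real (?q * m c))" by (simp only: exp_of_nat_mult[symmetric] of_nat_mult mult_ac)
      also have "\<dots> \<le> exp (a * real (n + m c))"
        using q(2) a by (simp only: exp_le_cancel_iff) (intro mult_left_mono, simp only: of_nat_le_iff, auto)
      finally show ?thesis by (simp add: exp_add[symmetric] algebra_simps)
    qed
    ultimately show ?thesis by blast
  qed
  then obtain M where M: "\<And>n c. name_cover f \<U> n (M n c) (?S c)"
    "\<And>n c. real (M n c) \<le> exp (a * real (m c)) * exp (a * real n)"
    by metis
  show ?thesis
  proof (intro exI[of _ "\<Sum>c\<in>D. exp (a * real (m c))"] conjI allI)
    fix n
    have "name_cover f \<U> n (\<Sum>c\<in>D. M n c) (topspace X)"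
      by (rule name_cover_mono[OF name_cover_UN[OF D(1) M(1)]]) (use D(3) in auto)
    moreover have "real (\<Sum>c\<in>D. M n c) \<le> (\<Sum>c\<in>D. exp (a * real (m c))) * exp (a * real n)"
      unfolding of_nat_sum sum_distrib_right by (intro sum_mono M(2))
    ultimately show "\<exists>N. name_cover f \<U> n N (topspace X) \<and> real N \<le> (\<Sum>c\<in>D. exp (a * real (m c))) * exp (a * real n)"
      by blast
  qed (auto intro: sum_nonneg)
qed

text \<open>The bound \<open>C * exp (a * real n)\<close> gives a rate of at most \<open>a\<close>
  plus \<open>ln (C + 1) / n\<close>. The second term is absorbed by passing to
  \<open>2 * a\<close>, and \<open>a\<close> is arbitrary.\<close>

lemma topological_entropy_eq_0:
  assumes f: "f ` topspace X \<subseteq> topspace X"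
    and U: "\<And>\<U> a. open_cover X \<U> \<Longrightarrow> a > 0 \<Longrightarrow>
      \<exists>C\<ge>0. \<forall>n. \<exists>N. name_cover f \<U> n N (topspace X) \<and> real N \<le> C * exp (a * real n)"
  shows "topological_entropy X f = 0"
proof -
  have nonneg: "0 \<le> cover_entropy X f \<U>" for \<U>
    unfolding cover_entropy_def
  proof (rule le_Limsup)
    \<comment> \<open>Holds also for \<open>k = 0\<close> because \<open>ln 0 = 0\<close>, so an
      empty space needs no separate treatment.\<close>
    have "0 \<le> ln (real k)" for k by (cases k) auto
    then show "\<forall>\<^sub>F n in sequentially. 0 \<le> ereal (ln (real (cover_number X (iterated_join X f \<U> n))) / real n)"
      by (intro always_eventually) (auto simp: zero_ereal_def)
  qed simp
  have small: "cover_entropy X f \<U> \<le> ereal (2 * a)" if cov: "open_cover X \<U>" and a: "a > 0" for \<U> a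
  proof -
    obtain C where C: "C \<ge> 0" "\<And>n. \<exists>N. name_cover f \<U> n N (topspace X) \<and> real N \<le> C * exp (a * real n)"
      using U[OF cov a] by blast
    let ?N = "\<lambda>n. cover_number X (iterated_join X f \<U> n)"
    have N: "ln (real (?N n)) \<le> ln (C + 1) + a * real n" for n
    proof (cases "?N n = 0")
      case False
      obtain N where N: "name_cover f \<U> n N (topspace X)" "real N \<le> C * exp (a * real n)"
        using C(2) by blast
      have "real (?N n) \<le> real N" using cover_number_le[OF f N(1)] by simp
      also have "\<dots> \<le> (C + 1) * exp (a * real n)"
        using N(2) by (simp add: distrib_right add_increasing2)
      finally have "real (?N n) \<le> (C + 1) * exp (a * real n)" .
      then have "ln (real (?N n)) \<le> ln ((C + 1) * exp (a * real n))"
        using False by (intro ln_mono) auto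
      also have "\<dots> = ln (C + 1) + a * real n" using C(1) by (simp add: ln_mult)
      finally show ?thesis .
    qed (use C(1) a in auto)
    have "\<forall>\<^sub>F n in sequentially. ln (C + 1) / a \<le> real n"
      by (rule eventually_compose_filterlim[OF eventually_ge_at_top filterlim_real_sequentially])
    then have "\<forall>\<^sub>F n in sequentially. ereal (ln (real (?N n)) / real n) \<le> ereal (2 * a)"
      using eventually_gt_at_top[of 0]
    proof eventually_elim
      case (elim n)
      have "ln (C + 1) \<le> a * real n" using elim a by (simp add: field_simps)
      then have "ln (real (?N n)) \<le> 2 * a * real n" using N[of n] by simp
      then show ?case using elim by (simp add: field_simps)
    qed
    then show ?thesis unfolding cover_entropy_def by (rule Limsup_bounded)
  qed
  have "cover_entropy X f \<U> \<le> 0" if "open_cover X \<U>" for \<U>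
  proof (rule ereal_le_epsilon2)
    show "cover_entropy X f \<U> \<le> 0 + ereal e" if "0 < e" for e
      using small[OF \<open>open_cover X \<U>\<close>, of "e / 2"] that by simp
  qed
  then have 1: "topological_entropy X f \<le> 0"
    unfolding topological_entropy_def by (intro SUP_least) simp
  have "open_cover X {topspace X}" by (simp add: open_cover_def)
  then have "0 \<le> topological_entropy X f"
    unfolding topological_entropy_def by (intro SUP_upper2[of "{topspace X}"] nonneg) simp
  with 1 show ?thesis by simp
qed

section \<open>Entropy of rotation extensions\<close>

definition rot :: "real \<Rightarrow> complex ^ 'n \<Rightarrow> complex ^ ('n::finite)" where
  "rot a z = (\<chi> i. cis a * z $ i)"

lemma rot_0 [simp]: "rot 0 z = z"
  by (simp add: rot_def)

lemma rot_rot: "rot a (rot b z) = rot (a + b) z"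
  by (simp add: rot_def vec_eq_iff cis_mult[symmetric])

lemma norm_cmult_vec: "norm (\<chi> i. c * z $ i) = cmod c * norm (z :: complex ^ ('n::finite))"
  by (simp add: norm_vec_def norm_mult L2_set_right_distrib)

lemma norm_rot [simp]: "norm (rot a z) = norm z"
  by (simp add: rot_def norm_cmult_vec)

text \<open>A chord of the unit circle is no longer than its arc; its length is twice the sine of
  half the angle.\<close>

lemma cmod_cis_diff: "cmod (cis a - cis b) \<le> \<bar>a - b\<bar>"
proof -
  have "cis a - cis b = cis b * (cis (a - b) - 1)" by (simp add: right_diff_distrib cis_mult)
  then have "cmod (cis a - cis b) = cmod (cis (a - b) - 1)" by (simp add: norm_mult)
  also have "\<dots> = 2 * \<bar>sin ((a - b) / 2)\<bar>" using dist_exp_i_1[of "a - b"] by (simp add: cis_conv_exp)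
  also have "\<dots> \<le> \<bar>a - b\<bar>" using abs_sin_x_le_abs_x[of "(a - b) / 2"] by simp
  finally show ?thesis .
qed

lemma norm_rot_diff: "norm (rot a z - rot b y) \<le> norm (z - y) + \<bar>a - b\<bar> * norm (y :: complex ^ ('n::finite))"
proof -
  have "rot a z - rot b y = rot a (z - y) + (\<chi> i. (cis a - cis b) * y $ i)"
    by (simp add: rot_def vec_eq_iff algebra_simps)
  then have "norm (rot a z - rot b y) \<le> norm (rot a (z - y)) + norm (\<chi> i. (cis a - cis b) * y $ i)"
    by (simp only: norm_triangle_ineq)
  also have "\<dots> = norm (z - y) + cmod (cis a - cis b) * norm y" by (simp only: norm_rot norm_cmult_vec)
  also have "\<dots> \<le> norm (z - y) + \<bar>a - b\<bar> * norm y"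
    by (intro add_left_mono mult_right_mono cmod_cis_diff) auto
  finally show ?thesis .
qed

lemma DERIV_bound_dist:
  fixes D :: "real \<Rightarrow> real"
  assumes "0 \<le> t" "\<And>s. (D has_real_derivative D' s) (at s)" "\<And>s. 0 \<le> s \<Longrightarrow> s \<le> t \<Longrightarrow> \<bar>D' s\<bar> \<le> e"
  shows "\<bar>D t - D 0\<bar> \<le> e * t"
proof (cases "t = 0")
  case False
  then obtain z where z: "0 < z" "z < t" "D t - D 0 = (t - 0) * D' z"
    using MVT2[of 0 t D D'] assms(1,2) by auto
  then have "\<bar>D t - D 0\<bar> = t * \<bar>D' z\<bar>" using assms(1) by (simp add: abs_mult)
  also have "\<dots> \<le> t * e" using z assms by (intro mult_left_mono) auto
  finally show ?thesis by (simp add: mult.commute)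
qed simp

text \<open>The data on which the entropy argument rests: a flow \<open>phi\<close> on a compact
  base with an invariant function \<open>H\<close>, and a phase \<open>sig\<close> accumulating at
  the rate \<open>rho\<close>. Two-dimensionality of the base enters only through
  \<open>flow_box\<close>: near a point that is not at rest, its level set is one short orbit
  arc.\<close>

locale rotation_extension =
  fixes W :: "'a topology" and phi :: "real \<Rightarrow> 'a \<Rightarrow> 'a" and H :: "'a \<Rightarrow> real" and rho :: "'a \<Rightarrow> real"
    and sig :: "real \<Rightarrow> 'a \<Rightarrow> real"
  assumes compact: "compact_space W"
    and phi_in: "w \<in> topspace W \<Longrightarrow> phi t w \<in> topspace W"
    and phi_0: "w \<in> topspace W \<Longrightarrow> phi 0 w = w"
    and phi_add: "w \<in> topspace W \<Longrightarrow> phi (s + t) w = phi s (phi t w)"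
    and phi_cont: "continuous_map (prod_topology euclideanreal W) W (\<lambda>(t, w). phi t w)"
    and H_cont: "continuous_map W euclideanreal H"
    and rho_cont: "continuous_map W euclideanreal rho"
    and H_phi: "w \<in> topspace W \<Longrightarrow> H (phi t w) = H w"
    and flow_box: "p \<in> topspace W \<Longrightarrow> (\<forall>t. phi t p = p) \<or>
       (\<exists>V. openin W V \<and> p \<in> V \<and> (\<forall>w\<in>V. H w = H p \<longrightarrow> (\<exists>t. \<bar>t\<bar> \<le> 1 \<and> w = phi t p)))"
    and sig_0: "w \<in> topspace W \<Longrightarrow> sig 0 w = 0"
    and sig_deriv: "w \<in> topspace W \<Longrightarrow> ((\<lambda>t. sig t w) has_real_derivative rho (phi t w)) (at t)"
begin

text \<open>The phase is measured in full turns, hence the factor \<open>2 * pi\<close>.\<close>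

definition skew :: "'a \<times> (complex ^ ('n::finite)) \<Rightarrow> 'a \<times> (complex ^ 'n)" where
  "skew = (\<lambda>(w, z). (phi 1 w, rot (2 * pi * sig 1 w) z))"

text \<open>Cocycle identity: as functions of \<open>t\<close>, both sides have derivative
  \<open>rho (phi (s + t) w)\<close>, and they agree at \<open>t = 0\<close>.\<close>

lemma sig_add:
  assumes w: "w \<in> topspace W"
  shows "sig (s + t) w = sig s w + sig t (phi s w)"
proof -
  have "((\<lambda>t. sig (s + t) w - sig t (phi s w)) has_real_derivative 0) (at t)" for t
  proof -
    have "((\<lambda>t. sig (s + t) w) has_real_derivative rho (phi (s + t) w)) (at t)"
    proof -
      have "((\<lambda>t. s + t) has_real_derivative 1) (at t)" by (auto intro!: derivative_eq_intros)
      from DERIV_chain2[OF sig_deriv[OF w] this] show ?thesis by simp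
    qed
    from DERIV_diff[OF this sig_deriv[OF phi_in[OF w, of s], of t]]
    show ?thesis using phi_add[OF w, of t s] by (simp add: add.commute[of t s])
  qed
  then have "sig (s + t) w - sig t (phi s w) = sig (s + 0) w - sig 0 (phi s w)"
    using DERIV_isconst_all[of "\<lambda>t. sig (s + t) w - sig t (phi s w)"] by blast
  then show ?thesis using sig_0[OF phi_in[OF w]] by simp
qed

lemma skew_funpow:
  "w \<in> topspace W \<Longrightarrow> (skew ^^ n) (w, z) = (phi (real n) w, rot (2 * pi * sig (real n) w) z)"
proof (induction n)
  case (Suc n)
  then show ?case
    using sig_add[OF Suc.prems, of "real n" 1] phi_add[OF Suc.prems, of 1 "real n"]
    by (simp add: skew_def rot_rot algebra_simps)
qed (simp add: phi_0 sig_0)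

lemma openin_flow_preimage:
  "openin W G \<Longrightarrow> openin (prod_topology euclideanreal W) {p \<in> topspace (prod_topology euclideanreal W). phi (fst p) (snd p) \<in> G}"
  using openin_continuous_map_preimage[OF phi_cont, of G] by (simp add: case_prod_beta)

text \<open>Tube lemma for a compact time interval: an open condition along an orbit segment
  survives a small change of the initial point, uniformly in time.\<close>

lemma flow_tube:
  assumes w: "w \<in> topspace W" and G: "openin W G" and t: "\<And>t. t \<in> {a..b} \<Longrightarrow> phi t w \<in> G"
  obtains V where "openin W V" "w \<in> V" "\<And>t v. t \<in> {a..b} \<Longrightarrow> v \<in> V \<Longrightarrow> phi t v \<in> G"
proof -
  have "\<exists>U V. openin euclideanreal U \<and> openin W V \<and> {a..b} \<subseteq> U \<and> w \<in> V \<and> U \<times> V \<subseteq>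
     {p \<in> topspace (prod_topology euclideanreal W). phi (fst p) (snd p) \<in> G}"
    by (rule tube_lemma_left[OF openin_flow_preimage[OF G] _ w]) (use w t in auto)
  then obtain U V where V: "openin W V" "w \<in> V" "{a..b} \<subseteq> U"
    "U \<times> V \<subseteq> {p \<in> topspace (prod_topology euclideanreal W). phi (fst p) (snd p) \<in> G}"
    by blast
  have "phi t v \<in> G" if "t \<in> {a..b}" "v \<in> V" for t v
  proof -
    have "(t, v) \<in> U \<times> V" using that V(3) by auto
    with V(4) show ?thesis by auto
  qed
  then show thesis by (rule that[OF V(1,2)])
qed

text \<open>The tube argument again, for the open condition that the rates along the orbits of
  \<open>v\<close> and \<open>w\<close> are \<open>e\<close>-close. Integrated over time, it
  controls the difference of the phases.\<close>

lemma rho_flow_near: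
  assumes w: "w \<in> topspace W" and e: "e > 0"
  obtains V where "openin W V" "w \<in> V" "\<And>t v. t \<in> {0..b} \<Longrightarrow> v \<in> V \<Longrightarrow> \<bar>rho (phi t v) - rho (phi t w)\<bar> < e"
proof -
  let ?T = "prod_topology euclideanreal W"
  have c1: "continuous_map ?T euclideanreal (\<lambda>p. rho (phi (fst p) (snd p)))"
    using continuous_map_compose[OF phi_cont rho_cont] by (simp add: o_def case_prod_beta)
  have c2: "continuous_map ?T euclideanreal (\<lambda>p. rho (phi (fst p) w))"
  proof -
    have "continuous_map ?T ?T (\<lambda>p. (fst p, w))"
      using w by (intro continuous_map_pairedI continuous_map_fst) auto
    from continuous_map_compose[OF this c1] show ?thesis by (simp add: o_def)
  qed
  have c3: "continuous_map ?T euclideanreal (\<lambda>p. rho (phi (fst p) (snd p)) - rho (phi (fst p) w))"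
    by (rule continuous_map_diff[OF c1 c2])
  have op: "openin ?T {p \<in> topspace ?T. rho (phi (fst p) (snd p)) - rho (phi (fst p) w) \<in> ball 0 e}"
    by (rule openin_continuous_map_preimage[OF c3]) simp
  have "\<exists>U V. openin euclideanreal U \<and> openin W V \<and> {0..b} \<subseteq> U \<and> w \<in> V \<and> U \<times> V \<subseteq>
     {p \<in> topspace ?T. rho (phi (fst p) (snd p)) - rho (phi (fst p) w) \<in> ball 0 e}"
    by (rule tube_lemma_left[OF op _ w]) (use w e in auto)
  then obtain U V where "openin W V" "{0..b} \<subseteq> U" "w \<in> V" and UV: "U \<times> V \<subseteq>
     {p \<in> topspace ?T. rho (phi (fst p) (snd p)) - rho (phi (fst p) w) \<in> ball 0 e}"
    by blast
  show thesis
  proof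
    show "\<bar>rho (phi t v) - rho (phi t w)\<bar> < e" if "t \<in> {0..b}" "v \<in> V" for t v
    proof -
      have "(t, v) \<in> U \<times> V" using that \<open>{0..b} \<subseteq> U\<close> by auto
      with UV show ?thesis by auto
    qed
  qed fact+
qed

lemma sig_diff_bound:
  assumes "v \<in> topspace W" "w \<in> topspace W" "0 \<le> t"
    "\<And>s. 0 \<le> s \<Longrightarrow> s \<le> t \<Longrightarrow> \<bar>rho (phi s v) - rho (phi s w)\<bar> \<le> e"
  shows "\<bar>sig t v - sig t w\<bar> \<le> e * t"
  using DERIV_bound_dist[OF assms(3) DERIV_diff[OF sig_deriv[OF assms(1)] sig_deriv[OF assms(2)]] assms(4)]
    sig_0[OF assms(1)] sig_0[OF assms(2)] by simp

lemma sig_cont: "continuous_map W euclideanreal (sig 1)"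
  unfolding continuous_map_atin
proof
  fix w assume w: "w \<in> topspace W"
  show "limitin euclideanreal (sig 1) (sig 1 w) (atin W w)"
    unfolding limitin_canonical_iff
  proof (rule tendstoI)
    fix e :: real assume e: "e > 0"
    then have e2: "e / 2 > 0" by simp
    obtain V where V: "openin W V" "w \<in> V" "\<And>t v. t \<in> {0..1} \<Longrightarrow> v \<in> V \<Longrightarrow> \<bar>rho (phi t v) - rho (phi t w)\<bar> < e / 2"
      using rho_flow_near[OF w e2, of 1] by blast
    have "dist (sig 1 v) (sig 1 w) < e" if "v \<in> V" for v
    proof -
      have v: "v \<in> topspace W" using that V(1) openin_subset by blast
      have "\<bar>sig 1 v - sig 1 w\<bar> \<le> e / 2 * 1"
        by (rule sig_diff_bound[OF v w]) (use V(3)[OF _ that] in \<open>auto intro: less_imp_le\<close>)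
      then show ?thesis using e by (simp add: dist_real_def)
    qed
    then show "\<forall>\<^sub>F v in atin W w. dist (sig 1 v) (sig 1 w) < e"
      using V(1,2) w unfolding eventually_atin by (intro disjI2 exI[of _ V]) auto
  qed
qed

abbreviation space :: "('a \<times> (complex ^ ('n::finite))) topology" where
  "space \<equiv> subtopology (prod_topology W euclidean) {(w, z). w \<in> topspace W \<and> pi * (norm z)\<^sup>2 = H w}"

text \<open>\<open>H\<close> is bounded on the compact base, so all fibres lie in one ball, and the
  equation of the fibres is a closed condition.\<close>

lemma compact_space_space: "compact_space (space :: ('a \<times> (complex ^ ('n::finite))) topology)"
proof -
  let ?P = "prod_topology W (euclidean :: (complex ^ 'n) topology)"
  have "compact (H ` topspace W)" using image_compactin[OF compact[unfolded compact_space_def] H_cont] by simp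
  then obtain B where "\<forall>x\<in>H ` topspace W. \<bar>x\<bar> \<le> B"
    using compact_imp_bounded bounded_real by metis
  then have B: "H w \<le> B" if "w \<in> topspace W" for w using that by (auto simp: abs_le_iff)
  let ?K = "topspace W \<times> cball (0 :: complex ^ 'n) (sqrt (\<bar>B\<bar> / pi))"
  have K: "compactin ?P ?K"
    using compact unfolding compactin_Times compact_space_def by simp
  have c: "continuous_map ?P euclideanreal (\<lambda>p. pi * (norm (snd p))\<^sup>2 - H (fst p))"
    by (intro continuous_intros continuous_map_compose[OF continuous_map_fst H_cont, unfolded o_def]
        continuous_map_compose[OF continuous_map_snd, unfolded o_def, where g="\<lambda>z. pi * (norm z)\<^sup>2"])
      (auto intro!: continuous_intros)
  have "closedin ?P {p \<in> topspace ?P. pi * (norm (snd p))\<^sup>2 - H (fst p) \<in> {0}}"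
    by (rule closedin_continuous_map_preimage[OF c]) simp
  moreover have "{p \<in> topspace ?P. pi * (norm (snd p))\<^sup>2 - H (fst p) \<in> {0}} =
      {(w, z). w \<in> topspace W \<and> pi * (norm z)\<^sup>2 = H w}" by auto
  ultimately have cl: "closedin ?P {(w, z). w \<in> topspace W \<and> pi * (norm z)\<^sup>2 = H w}" by simp
  have sub: "{(w, z :: complex ^ 'n). w \<in> topspace W \<and> pi * (norm z)\<^sup>2 = H w} \<subseteq> ?K"
  proof -
    have "(w, z) \<in> ?K" if w: "w \<in> topspace W" "pi * (norm z)\<^sup>2 = H w" for w and z :: "complex ^ 'n"
    proof -
    have "pi * (norm z)\<^sup>2 \<le> \<bar>B\<bar>" using B[OF w(1)] w(2) by linarith
    then have "(norm z)\<^sup>2 \<le> \<bar>B\<bar> / pi" by (simp add: field_simps)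
    then have "norm z \<le> sqrt (\<bar>B\<bar> / pi)" by (rule real_le_rsqrt)
    then show "(w, z) \<in> ?K" using w by simp
    qed
    then show ?thesis by auto
  qed
  show ?thesis
    by (rule compact_space_subtopology[OF closed_compactin[OF K sub cl]])
qed

lemma skew_cont: "continuous_map space space (skew :: 'a \<times> (complex ^ ('n::finite)) \<Rightarrow> _)"
proof -
  let ?P = "prod_topology W (euclidean :: (complex ^ 'n) topology)"
  have 1: "continuous_map ?P W (\<lambda>p. phi 1 (fst p))"
  proof -
    have "continuous_map ?P (prod_topology euclideanreal W) (\<lambda>p. (1, fst p))"
      by (intro continuous_map_pairedI continuous_map_fst) auto
    from continuous_map_compose[OF this phi_cont] show ?thesis by (simp add: o_def)
  qed
  have rc: "continuous_on UNIV (\<lambda>q. rot (2 * pi * fst q) (snd q) :: complex ^ 'n)"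
    unfolding rot_def by (intro continuous_intros)
  have 2: "continuous_map ?P euclidean (\<lambda>p. rot (2 * pi * sig 1 (fst p)) (snd p))"
  proof -
    have "continuous_map ?P (prod_topology euclideanreal euclidean) (\<lambda>p. (sig 1 (fst p), snd p))"
      by (intro continuous_map_pairedI continuous_map_snd
          continuous_map_compose[OF continuous_map_fst sig_cont, unfolded o_def])
    moreover have "continuous_map (prod_topology euclideanreal euclidean) euclidean (\<lambda>q. rot (2 * pi * fst q) (snd q) :: complex ^ 'n)"
      using rc by (simp add: euclidean_product_topology)
    ultimately show ?thesis
      by (rule continuous_map_compose[unfolded o_def, THEN continuous_map_eq]) simp
  qed
  have "continuous_map ?P ?P skew"
  proof -
    have "skew = (\<lambda>p :: 'a \<times> (complex ^ 'n). (phi 1 (fst p), rot (2 * pi * sig 1 (fst p)) (snd p)))"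
      by (auto simp: skew_def fun_eq_iff)
    then show ?thesis using continuous_map_pairedI[OF 1 2] by simp
  qed
  then show ?thesis
    by (intro continuous_map_into_subtopology continuous_map_from_subtopology)
      (auto simp: skew_def phi_in H_phi)
qed


section \<open>Covers split into base and fibre over one level\<close>

abbreviation level :: "real \<Rightarrow> 'a set" where
  "level c \<equiv> {w \<in> topspace W. H w = c}"

abbreviation fibre :: "real \<Rightarrow> (complex ^ ('n::finite)) set" where
  "fibre c \<equiv> {z. pi * (norm z)\<^sup>2 = c}"

lemma compactin_level: "compactin W (level c)"
proof -
  have "closedin W {w \<in> topspace W. H w \<in> {c}}"
    by (rule closedin_continuous_map_preimage[OF H_cont]) simp
  then show ?thesis using closedin_compact_space[OF compact] by simp
qed

lemma compact_fibre: "compact (fibre c :: (complex ^ ('n::finite)) set)"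
proof -
  have "closed (fibre c :: (complex ^ 'n) set)"
    by (intro closed_Collect_eq continuous_intros)
  moreover have "fibre c \<subseteq> cball (0 :: complex ^ 'n) (sqrt (c / pi))"
  proof clarify
    fix z :: "complex ^ 'n" 
    have "(norm z)\<^sup>2 = (pi * (norm z)\<^sup>2) / pi" by simp
    then show "z \<in> cball 0 (sqrt (pi * (norm z)\<^sup>2 / pi))" by simp
  qed
  ultimately show ?thesis
    using closed_subset compact_eq_bounded_closed bounded_cball bounded_subset by metis
qed

text \<open>A Lebesgue number for the fibre, uniform over the base points of \<open>V\<close>: the
  cover member depends on \<open>V\<close> and the centre \<open>z\<close> alone. This lets base and
  fibre be coded separately.\<close>

definition adapted :: "('a \<times> (complex ^ ('n::finite))) set set \<Rightarrow> real \<Rightarrow> 'a set \<Rightarrow> real \<Rightarrow> bool" where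
  "adapted \<U> c V e \<longleftrightarrow> (\<forall>z\<in>fibre c. \<exists>U\<in>\<U>. \<forall>w\<in>V \<inter> level c. \<forall>z'\<in>fibre c. dist z' z < e \<longrightarrow> (w, z') \<in> U)"

lemma adapted_mono:
  fixes \<U> :: "('a \<times> (complex ^ ('n::finite))) set set"
  assumes "adapted \<U> c V e" "d \<le> e"
  shows "adapted \<U> c V d"
  unfolding adapted_def
proof
  fix z :: "complex ^ 'n" assume "z \<in> fibre c"
  from bspec[OF assms(1)[unfolded adapted_def] this]
  obtain U where "U \<in> \<U>" and U: "\<forall>w\<in>V \<inter> level c. \<forall>z'\<in>fibre c. dist z' z < e \<longrightarrow> (w, z') \<in> U"
    by (elim bexE)
  then show "\<exists>U\<in>\<U>. \<forall>w\<in>V \<inter> level c. \<forall>z'\<in>fibre c. dist z' z < d \<longrightarrow> (w, z') \<in> U"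
    using assms(2) by (intro bexI[of _ U]) auto
qed

lemma adapted_nhd:
  fixes \<U> :: "('a \<times> (complex ^ ('n::finite))) set set"
  assumes cov: "open_cover space \<U>" and w: "w \<in> level c"
  shows "\<exists>V e. openin W V \<and> w \<in> V \<and> e > 0 \<and> adapted \<U> c V e"
proof -
  \<comment> \<open>The factor 2 leaves room: a fibre point within \<open>e\<close> of a point that
    is itself within \<open>e\<close> of the centre still belongs to the member attached to the
    centre.\<close>
  define P where "P z U V e \<longleftrightarrow> U \<in> \<U> \<and> openin W V \<and> w \<in> V \<and> e > 0 \<and>
      (\<forall>v\<in>V \<inter> level c. \<forall>z'\<in>fibre c. dist z' z < 2 * e \<longrightarrow> (v, z') \<in> U)"
    for z :: "complex ^ 'n" and U V and e :: real
  have "\<exists>U V e. P z U V e" if z: "z \<in> fibre c" for z :: "complex ^ 'n"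
  proof -
    have "(w, z) \<in> topspace space" using w z by simp
    then obtain U where U: "U \<in> \<U>" "(w, z) \<in> U" "openin space U"
      using cov unfolding open_cover_def by blast
    then obtain G where G: "openin (prod_topology W euclidean) G" "U = G \<inter> {(w, z). w \<in> topspace W \<and> pi * (norm z)\<^sup>2 = H w}"
      unfolding openin_subtopology by blast
    have "(w, z) \<in> G" using U(2) G(2) by simp
    then obtain V D where VD: "openin W V" "openin euclidean D" "w \<in> V" "z \<in> D" "V \<times> D \<subseteq> G"
      using G(1)[unfolded openin_prod_topology_alt, THEN spec, THEN spec, THEN mp, OF \<open>(w, z) \<in> G\<close>]
      by (elim exE conjE)
    then obtain e where e: "e > 0" "ball z e \<subseteq> D" by (meson open_openin openE)
    have "(v, z') \<in> U" if "v \<in> V \<inter> level c" "z' \<in> fibre c" "dist z' z < 2 * (e / 2)" for v z'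
    proof -
      have "z' \<in> D" using that(3) e(2) by (auto simp: dist_commute)
      then have "(v, z') \<in> G" using that(1) VD(5) by blast
      then show ?thesis using that G(2) by auto
    qed
    with U(1) VD e(1) have "P z U V (e / 2)" unfolding P_def by auto
    then show ?thesis by blast
  qed
  then obtain U V e where P: "\<And>z. z \<in> fibre c \<Longrightarrow> P z (U z) (V z) (e z)"
    by metis
  have U: "U z \<in> \<U>" and V: "openin W (V z) \<and> w \<in> V z \<and> e z > 0" if "z \<in> fibre c" for z
    using P[OF that] unfolding P_def by auto
  have UV: "(v, z') \<in> U z" if "z \<in> fibre c" "v \<in> V z \<inter> level c" "z' \<in> fibre c" "dist z' z < 2 * e z" for z v z'
    using P[OF that(1)] that(2-4) unfolding P_def by blast
  obtain F where F: "finite F" "F \<subseteq> fibre c" "fibre c \<subseteq> (\<Union>z\<in>F. ball z (e z))"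
  proof (rule compactin_finite_index[of euclidean "fibre c :: (complex ^ 'n) set" "fibre c" "\<lambda>z. ball z (e z)"])
    show "compactin euclidean (fibre c :: (complex ^ 'n) set)" using compact_fibre by simp
    show "\<exists>i\<in>fibre c. x \<in> ball i (e i)" if "x \<in> fibre c" for x using that V[OF that] by (intro bexI[of _ x]) auto
  qed auto
  define d where "d = Min (insert 1 (e ` F))"
  have d: "d > 0" "\<And>z. z \<in> F \<Longrightarrow> d \<le> e z" using F(1,2) V by (auto simp: d_def subset_iff)
  have "openin W (topspace W \<inter> \<Inter>(V ` F))"
    using F(1,2) V by (intro openin_Int_Inter) auto
  moreover have "w \<in> topspace W \<inter> \<Inter>(V ` F)" using w V F(2) by auto
  moreover have "adapted \<U> c (topspace W \<inter> \<Inter>(V ` F)) d"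
    unfolding adapted_def
  proof
    fix z :: "complex ^ 'n" assume z: "z \<in> fibre c"
    then obtain y where y: "y \<in> F" "dist y z < e y" using F(3) by auto
    have yf: "y \<in> fibre c" using y(1) F(2) by blast
    have "(v, z') \<in> U y" if "v \<in> (topspace W \<inter> \<Inter>(V ` F)) \<inter> level c" "z' \<in> fibre c" "dist z' z < d" for v z'
    proof (rule UV[OF yf _ that(2)])
      show "v \<in> V y \<inter> level c" using that(1) y(1) by auto
      have "dist z' y \<le> dist z' z + dist y z" by (metis dist_commute dist_triangle)
      then show "dist z' y < 2 * e y" using that(3) d(2)[OF y(1)] y(2) by linarith
    qed
    then show "\<exists>U\<in>\<U>. \<forall>v\<in>(topspace W \<inter> \<Inter>(V ` F)) \<inter> level c. \<forall>z'\<in>fibre c. dist z' z < d \<longrightarrow> (v, z') \<in> U"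
      using U[OF yf] by blast
  qed
  ultimately show ?thesis using d(1) by blast
qed

lemma adapted_cover:
  fixes \<U> :: "('a \<times> (complex ^ ('n::finite))) set set"
  assumes cov: "open_cover space \<U>"
  obtains \<V> e where "finite \<V>" "e > 0" "\<forall>V\<in>\<V>. openin W V" "\<forall>V\<in>\<V>. adapted \<U> c V e"
    "level c \<subseteq> \<Union>\<V>"
proof -
  define P where "P w V e \<longleftrightarrow> openin W V \<and> w \<in> V \<and> e > 0 \<and> adapted \<U> c V e" for w V and e :: real
  have "\<exists>V e. P w V e" if "w \<in> level c" for w
    unfolding P_def by (rule adapted_nhd[OF cov that])
  then obtain V e where P: "\<And>w. w \<in> level c \<Longrightarrow> P w (V w) (e w)"
    by metis
  have V: "openin W (V w)" "w \<in> V w" and e: "e w > 0" and a: "adapted \<U> c (V w) (e w)" if "w \<in> level c" for w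
    using P[OF that] unfolding P_def by auto
  have mem: "\<exists>v\<in>level c. w \<in> V v" if "w \<in> level c" for w using V(2) that by blast
  obtain D where D: "finite D" "D \<subseteq> level c" "level c \<subseteq> (\<Union>w\<in>D. V w)"
    by (rule compactin_finite_index[OF compactin_level[of c] V(1) mem])
  define d where "d = Min (insert 1 (e ` D))"
  have d: "d > 0" "\<And>w. w \<in> D \<Longrightarrow> d \<le> e w" using D(1,2) e by (auto simp: d_def subset_iff)
  show thesis
  proof (rule that[of "V ` D" d])
    show "\<forall>U\<in>V ` D. adapted \<U> c U d"
    proof
      fix U assume "U \<in> V ` D"
      obtain w where w: "w \<in> D" "U = V w" using \<open>U \<in> V ` D\<close> by blast
      have "adapted \<U> c U (e w)" using a w D(2) by blast
      then show "adapted \<U> c U d" using d(2)[OF w(1)] by (rule adapted_mono)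
    qed
    show "\<forall>U\<in>V ` D. openin W U" using V(1) D(2) by blast
  qed (use D(1,3) d(1) in simp_all)
qed


text \<open>By compactness finitely many balls of radius \<open>e / 2\<close> cover the fibre; two
  points assigned to the same centre are then \<open>e\<close>-close.\<close>

lemma fibre_cells:
  assumes e: "e > 0"
  obtains Z :: "(complex ^ ('n::finite)) set" and cell :: "complex ^ 'n \<Rightarrow> complex ^ 'n" where "finite Z" "\<forall>z\<in>fibre c. cell z \<in> Z"
    "\<forall>z\<in>fibre c. \<forall>y\<in>fibre c. cell z = cell y \<longrightarrow> dist z y < e"
proof -
  let ?F = "fibre c :: (complex ^ 'n) set"
  have K: "compactin euclidean ?F" using compact_fibre by simp
  have mem: "\<exists>y\<in>?F. z \<in> ball y (e / 2)" if "z \<in> ?F" for z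
    using that e by (intro bexI[of _ z]) auto
  obtain Z where Z: "finite Z" "Z \<subseteq> ?F" "?F \<subseteq> (\<Union>y\<in>Z. ball y (e / 2))"
    by (rule compactin_finite_index[OF K _ mem]) simp_all
  define cell :: "complex ^ 'n \<Rightarrow> complex ^ 'n" where "cell z = (SOME y. y \<in> Z \<and> dist y z < e / 2)" for z
  have cell: "cell z \<in> Z \<and> dist (cell z) z < e / 2" if "z \<in> ?F" for z
  proof -
    obtain y where "y \<in> Z" "z \<in> ball y (e / 2)" using Z(3) \<open>z \<in> ?F\<close> by blast
    then have "y \<in> Z \<and> dist y z < e / 2" by simp
    then show ?thesis unfolding cell_def by (rule someI)
  qed
  show thesis
  proof (rule that[of Z cell])
    show "\<forall>z\<in>?F. \<forall>y\<in>?F. cell z = cell y \<longrightarrow> dist z y < e"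
    proof (intro ballI impI)
      fix z y assume that: "z \<in> ?F" "y \<in> ?F" "cell z = cell y"
      show "dist z y < e"
        using cell[OF that(1)] cell[OF that(2)] that(3) dist_triangle_half_r by metis
    qed
    show "\<forall>z\<in>?F. cell z \<in> Z" using cell by blast
  qed (rule Z(1))
qed

lemma rho_bounded:
  obtains B where "B > 0" "\<forall>w\<in>topspace W. \<bar>rho w\<bar> \<le> B"
proof -
  have "compact (rho ` topspace W)"
    using image_compactin[OF compact[unfolded compact_space_def] rho_cont] by simp
  then obtain B where "B > 0" "\<forall>x\<in>rho ` topspace W. norm x \<le> B"
    using compact_imp_bounded bounded_pos by metis
  then show thesis using that[of B] by auto
qed

lemma sig_bound:
  assumes "w \<in> topspace W" "0 \<le> t" "\<And>w. w \<in> topspace W \<Longrightarrow> \<bar>rho w\<bar> \<le> B"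
  shows "\<bar>sig t w\<bar> \<le> B * t"
  using DERIV_bound_dist[OF assms(2) sig_deriv[OF assms(1)] assms(3)[OF phi_in[OF assms(1)]]] sig_0[OF assms(1)]
  by simp

text \<open>Error budget for one time: the fibre points start within \<open>e / 2\<close> of
  \<open>z\<close>, and a phase error of \<open>4 * eta\<close> moves a vector of length at most
  \<open>R\<close> by at most \<open>2 * pi * 4 * eta * R\<close>, which
  \<open>16 * pi * eta * R \<le> e\<close> bounds by \<open>e / 2\<close>. The common cover member
  is the one around \<open>rot (2 * pi * s) z\<close> over \<open>V\<close>.\<close>

lemma adapted_step:
  fixes \<U> :: "('a \<times> (complex ^ ('n::finite))) set set"
  assumes V: "adapted \<U> c V e" and z: "z \<in> fibre c"
    and S: "\<And>w' z'. (w', z') \<in> S \<Longrightarrow> w' \<in> level c \<and> z' \<in> fibre c \<and> phi (real i) w' \<in> V \<and>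
      \<bar>sig (real i) w' - s\<bar> \<le> 4 * eta \<and> dist z' z < e / 2"
    and R: "norm z \<le> R" "16 * pi * eta * R \<le> e" and eta: "eta > 0"
  shows "\<exists>U\<in>\<U>. \<forall>y\<in>S. (skew ^^ i) y \<in> U"
proof -
  have rf: "rot (2 * pi * s) z \<in> fibre c" using z by simp
  from bspec[OF V[unfolded adapted_def] rf]
  obtain U where U: "U \<in> \<U>" "\<forall>w\<in>V \<inter> level c. \<forall>z'\<in>fibre c. dist z' (rot (2 * pi * s) z) < e \<longrightarrow> (w, z') \<in> U"
    by (elim bexE)
  have "(skew ^^ i) y \<in> U" if y: "y \<in> S" for y
  proof -
    obtain w' z' where yy: "y = (w', z')" by (cases y)
    note h = S[OF y[unfolded yy]]
    let ?z = "rot (2 * pi * sig (real i) w') z'"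
    have "dist ?z (rot (2 * pi * s) z) \<le> norm (z' - z) + \<bar>2 * pi * sig (real i) w' - 2 * pi * s\<bar> * norm z"
      unfolding dist_norm by (rule norm_rot_diff)
    also have "\<bar>2 * pi * sig (real i) w' - 2 * pi * s\<bar> = 2 * pi * \<bar>sig (real i) w' - s\<bar>"
      by (simp add: right_diff_distrib[symmetric] abs_mult)
    also have "2 * pi * \<bar>sig (real i) w' - s\<bar> * norm z \<le> 2 * pi * (4 * eta) * R"
      using h R(1) eta by (intro mult_mono mult_left_mono) auto
    also have "\<dots> \<le> e / 2" using R(2) by simp
    also have "norm (z' - z) < e / 2" using h by (simp add: dist_norm)
    finally have d: "dist ?z (rot (2 * pi * s) z) < e" by simp
    have "phi (real i) w' \<in> V \<inter> level c" using h phi_in H_phi by auto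
    moreover have "?z \<in> fibre c" using h by simp
    ultimately have "(phi (real i) w', ?z) \<in> U" using U(2) d by blast
    then show ?thesis using skew_funpow[of w' i z'] h yy by simp
  qed
  with U(1) show ?thesis by blast
qed

lemma card_floor_interval:
  assumes "a \<le> b"
  shows "real (card {\<lfloor>a\<rfloor>..\<lfloor>b\<rfloor>}) \<le> b - a + 2"
proof -
  have "\<lfloor>a\<rfloor> \<le> \<lfloor>b\<rfloor>" using assms by (rule floor_mono)
  then have "real (card {\<lfloor>a\<rfloor>..\<lfloor>b\<rfloor>}) = of_int \<lfloor>b\<rfloor> - of_int \<lfloor>a\<rfloor> + 1" by simp
  then show ?thesis by linarith
qed

context
  fixes \<U> :: "('a \<times> (complex ^ ('n::finite))) set set" and c e R B eta :: real and \<V> :: "'a set set"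
    and Z :: "(complex ^ 'n) set" and cell :: "complex ^ 'n \<Rightarrow> complex ^ 'n"
  assumes finV: "finite \<V>" and opV: "\<forall>V\<in>\<V>. openin W V" and adV: "\<forall>V\<in>\<V>. adapted \<U> c V e"
    and covV: "level c \<subseteq> \<Union>\<V>"
    and eta: "eta > 0" and R: "\<forall>z :: complex ^ 'n\<in>fibre c. norm z \<le> R" "16 * pi * eta * R \<le> e"
    and B: "B > 0" "\<forall>w\<in>topspace W. \<bar>rho w\<bar> \<le> B"
    and finZ: "finite Z" and cell: "\<forall>z\<in>fibre c. cell z \<in> Z"
      "\<forall>z\<in>fibre c. \<forall>y\<in>fibre c. cell z = cell y \<longrightarrow> dist z y < e / 2"
begin

text \<open>Near the rest points the base point hardly moves during a block of length \<open>m\<close> and the fibre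
  rotates at an almost constant rate, so the number of names of a block is only linear in \<open>m\<close>.\<close>

lemma name_cover_near_rest_points:
  assumes m: "m \<ge> (1::nat)"
  shows "\<exists>N. openin W N \<and> {w \<in> level c. \<forall>t. phi t w = w} \<subseteq> N \<and>
    name_cover skew \<U> m (nat \<lfloor>real (card \<V>) * (2 * B / eta + 2) * real (card Z) * real m\<rfloor>)
      {(w, z :: complex ^ 'n). w \<in> level c \<inter> N \<and> z \<in> fibre c}"
proof -
  let ?F = "{w \<in> level c. \<forall>t. phi t w = w}"
  \<comment> \<open>A rate error of \<open>eta / m\<close> accumulates to at most \<open>eta\<close>
    of phase during \<open>m\<close> steps. The rest point \<open>w\<close> stays in
    \<open>V\<close> for all time, so by the tube lemma a neighbourhood of it does so up to time
    \<open>m\<close>.\<close>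
  define P where "P w V G \<longleftrightarrow> V \<in> \<V> \<and> openin W G \<and> w \<in> G \<and>
     (\<forall>t\<in>{0..real m}. \<forall>v\<in>G. phi t v \<in> V \<and> \<bar>rho (phi t v) - rho w\<bar> < eta / real m)" for w V G
  have "\<exists>V G. P w V G" if w: "w \<in> ?F" for w
  proof -
    have wW: "w \<in> topspace W" and fix_w: "phi t w = w" for t using w by auto
    obtain V where V: "V \<in> \<V>" "w \<in> V" using covV w by blast
    obtain G1 where G1: "openin W G1" "w \<in> G1" "\<And>t v. t \<in> {0..real m} \<Longrightarrow> v \<in> G1 \<Longrightarrow> phi t v \<in> V"
      by (rule flow_tube[OF wW opV[rule_format, OF V(1)], of 0 "real m"]) (use fix_w V(2) in auto)
    have em: "eta / real m > 0" using eta m by simp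
    obtain G2 where G2: "openin W G2" "w \<in> G2"
      "\<And>t v. t \<in> {0..real m} \<Longrightarrow> v \<in> G2 \<Longrightarrow> \<bar>rho (phi t v) - rho (phi t w)\<bar> < eta / real m"
      by (rule rho_flow_near[OF wW em, of "real m"]) auto
    have "P w V (G1 \<inter> G2)"
      unfolding P_def using V G1 G2 fix_w by auto
    then show ?thesis by blast
  qed
  then have "\<forall>w\<in>?F. \<exists>V G. P w V G" by blast
  from bchoice[OF this] obtain V where "\<forall>w\<in>?F. \<exists>G. P w (V w) G" by blast
  from bchoice[OF this] obtain G where "\<forall>w\<in>?F. P w (V w) (G w)" by blast
  then have P: "P w (V w) (G w)" if "w \<in> ?F" for w using that by blast
  have V: "V w \<in> \<V>" and G: "openin W (G w)" "w \<in> G w" 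
    and VG: "\<And>t v. t \<in> {0..real m} \<Longrightarrow> v \<in> G w \<Longrightarrow> phi t v \<in> V w \<and> \<bar>rho (phi t v) - rho w\<bar> < eta / real m"
    if "w \<in> ?F" for w using P[OF that] unfolding P_def by auto
  define N where "N = (\<Union>w\<in>?F. G w)"
  define base where "base v = (SOME w. w \<in> ?F \<and> v \<in> G w)" for v
  have base: "base v \<in> ?F \<and> v \<in> G (base v)" if "v \<in> N" for v
    unfolding base_def by (rule someI_ex) (use that in \<open>auto simp: N_def\<close>)
  define I where "I = {\<lfloor>- B * real m / eta\<rfloor>..\<lfloor>B * real m / eta\<rfloor>}"
  \<comment> \<open>The rest point itself is not recorded, since there may be infinitely many. Its
    member of \<open>\<V>\<close> and its rate up to \<open>eta / m\<close> suffice; the rate takes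
    about \<open>2 * B * m / eta\<close> values, which is the linear growth.\<close>
  define code where "code = (\<lambda>(v, z). (V (base v), \<lfloor>rho (base v) * real m / eta\<rfloor>, cell z))"
  let ?S = "{(w, z :: complex ^ 'n). w \<in> level c \<inter> N \<and> z \<in> fibre c}"
  have "name_cover skew \<U> m (nat \<lfloor>real (card \<V>) * (2 * B / eta + 2) * real (card Z) * real m\<rfloor>) ?S"
  proof (rule name_cover_code[where C = "\<V> \<times> I \<times> Z" and code = code])
    show "finite (\<V> \<times> I \<times> Z)" using finV finZ by (simp add: I_def)
    have "real (card I) \<le> B * real m / eta - (- B * real m / eta) + 2"
      unfolding I_def using B(1) eta m by (intro card_floor_interval) (simp add: divide_right_mono)
    also have "\<dots> \<le> (2 * B / eta + 2) * real m" using m by (simp add: field_simps)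
    finally have I: "real (card I) \<le> (2 * B / eta + 2) * real m" .
    have "real (card (\<V> \<times> I \<times> Z)) = real (card \<V>) * real (card I) * real (card Z)"
      by (simp add: card_cartesian_product)
    also have "\<dots> \<le> real (card \<V>) * ((2 * B / eta + 2) * real m) * real (card Z)"
      by (intro mult_right_mono mult_left_mono I) auto
    finally show "card (\<V> \<times> I \<times> Z) \<le> nat \<lfloor>real (card \<V>) * (2 * B / eta + 2) * real (card Z) * real m\<rfloor>"
      by (intro le_nat_floor) (simp add: mult_ac)
    show "code x \<in> \<V> \<times> I \<times> Z" if x: "x \<in> ?S" for x
    proof -
      obtain v z where xx: "x = (v, z)" "v \<in> N" "z \<in> fibre c" using x by auto
      have b: "base v \<in> ?F" using base[OF xx(2)] by simp
      have "- B \<le> rho (base v)" "rho (base v) \<le> B" using B(2)[rule_format, of "base v"] b by auto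
      then have "\<lfloor>rho (base v) * real m / eta\<rfloor> \<in> I"
        unfolding I_def atLeastAtMost_iff using eta
        by (intro conjI floor_mono divide_right_mono mult_right_mono) auto
      then show ?thesis using V[OF b] cell(1)[rule_format, OF xx(3)] by (simp add: code_def xx(1))
    qed
  next
    fix x i assume x: "x \<in> ?S" and i: "i < m"
    obtain v z where xx: "x = (v, z)" "v \<in> N" "z \<in> fibre c" using x by auto
    let ?b = "base v"
    have b: "?b \<in> ?F" using base[OF xx(2)] by simp
    have "\<exists>U\<in>\<U>. \<forall>y\<in>{y \<in> ?S. code y = code x}. (skew ^^ i) y \<in> U"
    proof (rule adapted_step[OF adV[rule_format, OF V[OF b]] xx(3) _ R(1)[rule_format, OF xx(3)] R(2) eta, where s = "sig (real i) ?b"])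
      fix v' z' assume y: "(v', z') \<in> {y \<in> ?S. code y = code x}"
      have vW: "v' \<in> topspace W" using y by auto
      have v'N: "v' \<in> N" using y by auto
      let ?b' = "base v'"
      have b': "?b' \<in> ?F" "v' \<in> G ?b'" using base[OF v'N] by auto
      have VV: "V ?b' = V ?b" and fl: "\<lfloor>rho ?b' * real m / eta\<rfloor> = \<lfloor>rho ?b * real m / eta\<rfloor>"
        and cl: "cell z' = cell z" using y by (auto simp: code_def xx(1))
      have z': "z' \<in> fibre c" using y by auto
      have "\<bar>rho ?b' * real m / eta - rho ?b * real m / eta\<bar> \<le> 1" using fl by linarith
      moreover have "rho ?b' * real m / eta - rho ?b * real m / eta = (rho ?b' - rho ?b) * (real m / eta)"
        by (simp add: left_diff_distrib diff_divide_distrib)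
      ultimately have "\<bar>rho ?b' - rho ?b\<bar> * (real m / eta) \<le> 1"
        using eta by (simp add: abs_mult)
      then have rb: "\<bar>rho ?b' - rho ?b\<bar> \<le> eta / real m"
        using eta m by (simp add: field_simps)
      have em: "eta / real m * real i \<le> eta"
        using i eta m by (simp add: field_simps)
      \<comment> \<open>The phase of \<open>v'\<close> is compared first with that of its own rest
        point, then the two rest points with each other. Each comparison costs at most
        \<open>eta\<close>.\<close>
      have "\<bar>sig (real i) v' - sig (real i) ?b'\<bar> \<le> eta / real m * real i"
      proof (rule sig_diff_bound[OF vW])
        show "\<bar>rho (phi s v') - rho (phi s ?b')\<bar> \<le> eta / real m" if "0 \<le> s" "s \<le> real i" for s
          using VG[OF b'(1) _ b'(2), of s] b'(1) that i by simp
      qed (use b' in auto)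
      moreover have "\<bar>sig (real i) ?b' - sig (real i) ?b\<bar> \<le> eta / real m * real i"
        by (rule sig_diff_bound) (use b b' rb in auto)
      ultimately have "\<bar>sig (real i) v' - sig (real i) ?b\<bar> \<le> 4 * eta" using em eta by linarith
      moreover have "phi (real i) v' \<in> V ?b" using VG[OF b'(1) _ b'(2), of "real i"] i VV by simp
      ultimately show "v' \<in> level c \<and> z' \<in> fibre c \<and> phi (real i) v' \<in> V ?b \<and>
          \<bar>sig (real i) v' - sig (real i) ?b\<bar> \<le> 4 * eta \<and> dist z' z < e / 2"
        using y cell(2)[rule_format, OF z' xx(3) cl] by simp
    qed
    then show "\<exists>U\<in>\<U>. \<forall>y\<in>?S. code y = code x \<longrightarrow> (skew ^^ i) y \<in> U" by blast
  qed
  moreover have "openin W N" unfolding N_def by (rule openin_Union) (use G(1) in auto)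
  moreover have "?F \<subseteq> N" unfolding N_def using G(2) by (intro subsetI UN_I)
  ultimately show ?thesis by (intro exI[of _ N] conjI)
qed


text \<open>A Lebesgue number in the time direction, from compactness of the level. Orbit parameters
  are later rounded with this step size: within one step the base stays in one member of
  \<open>\<V>\<close> and the phase moves by at most \<open>eta\<close>.\<close>

lemma uniform_short_time:
  obtains b where "b > 0" "B * b \<le> eta" "\<And>w. w \<in> level c \<Longrightarrow> \<exists>V\<in>\<V>. \<forall>r\<in>{0..b}. phi r w \<in> V"
proof -
  define P where "P w G b \<longleftrightarrow> openin W G \<and> w \<in> G \<and> b > 0 \<and> (\<exists>V\<in>\<V>. \<forall>r\<in>{0..b}. \<forall>v\<in>G. phi r v \<in> V)"
    for w G and b :: real
  have "\<exists>G b. P w G b" if w: "w \<in> level c" for w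
  proof -
    obtain V where V: "V \<in> \<V>" "w \<in> V" using covV w by blast
    let ?O = "{p \<in> topspace (prod_topology euclideanreal W). phi (fst p) (snd p) \<in> V}"
    have "(0, w) \<in> ?O" using w V(2) phi_0 by simp
    from openin_flow_preimage[OF opV[rule_format, OF V(1)], unfolded openin_prod_topology_alt, THEN spec, THEN spec, THEN mp, OF this]
    obtain U G where UG: "openin euclideanreal U" "openin W G" "0 \<in> U" "w \<in> G" "U \<times> G \<subseteq> ?O"
      by (elim exE conjE)
    obtain d where d: "d > 0" "ball 0 d \<subseteq> U" using UG(1,3) by (meson open_openin openE)
    have "phi r v \<in> V" if "r \<in> {0..d / 2}" "v \<in> G" for r v
    proof -
      have "r \<in> U" using that(1) d by (intro subsetD[OF d(2)]) auto
      then have "(r, v) \<in> ?O" using that(2) UG(5) by blast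
      then show ?thesis by simp
    qed
    then have "\<exists>V\<in>\<V>. \<forall>r\<in>{0..d / 2}. \<forall>v\<in>G. phi r v \<in> V" using V(1) by blast
    then have "P w G (d / 2)" unfolding P_def using UG(2,4) d(1) by simp
    then show ?thesis by blast
  qed
  then have "\<forall>w\<in>level c. \<exists>G b. P w G b" by blast
  from bchoice[OF this] obtain G where "\<forall>w\<in>level c. \<exists>b. P w (G w) b" by blast
  from bchoice[OF this] obtain b where "\<forall>w\<in>level c. P w (G w) (b w)" by blast
  then have P: "P w (G w) (b w)" if "w \<in> level c" for w using that by blast
  have op: "openin W (G w)" if "w \<in> level c" for w using P[OF that] unfolding P_def by simp
  have mem: "\<exists>v\<in>level c. w \<in> G v" if "w \<in> level c" for w
    by (rule bexI[OF _ that]) (use P[OF that] in \<open>simp add: P_def\<close>)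
  obtain D where D: "finite D" "D \<subseteq> level c" "level c \<subseteq> (\<Union>w\<in>D. G w)"
    by (rule compactin_finite_index[OF compactin_level[of c] op mem])
  define d where "d = Min (insert (eta / B) (b ` D))"
  have "b w > 0" if "w \<in> D" for w using P that D(2) unfolding P_def by blast
  then have d: "d > 0" "d \<le> eta / B" "\<And>w. w \<in> D \<Longrightarrow> d \<le> b w" using D(1) eta B(1) by (auto simp: d_def)
  show thesis
  proof (rule that[OF d(1)])
    show "B * d \<le> eta" using d(2) B(1) by (simp add: field_simps)
    show "\<exists>V\<in>\<V>. \<forall>r\<in>{0..d}. phi r w \<in> V" if w: "w \<in> level c" for w
    proof -
      obtain v where v: "v \<in> D" "w \<in> G v" using D(3) w by blast
      have "v \<in> level c" using v(1) D(2) by blast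
      from P[OF this] obtain V where "V \<in> \<V>" "\<forall>r\<in>{0..b v}. \<forall>v'\<in>G v. phi r v' \<in> V"
        unfolding P_def by blast
      with d(3)[OF v(1)] v(2) show ?thesis by (intro bexI[of _ V]) auto
    qed
  qed
qed

text \<open>Away from the rest points a level set is locally a single orbit arc, so all orbits leaving a
  neighbourhood of the rest points lie on finitely many orbits.\<close>

lemma name_cover_leaving:
  assumes N: "openin W N" "{w \<in> level c. \<forall>t. phi t w = w} \<subseteq> N"
  shows "\<exists>K\<ge>0. \<forall>T. name_cover skew \<U> T (nat \<lfloor>K * (real T + 1)\<rfloor>)
      {(w, z :: complex ^ 'n). w \<in> level c \<and> z \<in> fibre c \<and> (\<exists>j\<le>T. phi (real j) w \<notin> N)}"
proof -
  have "closedin W (topspace W - N)" using N(1) by blast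
  then have K: "compactin W (level c \<inter> (topspace W - N))" by (rule compact_Int_closedin[OF compactin_level])
  define P where "P p V \<longleftrightarrow> openin W V \<and> p \<in> V \<and> (\<forall>w\<in>V. H w = H p \<longrightarrow> (\<exists>t. \<bar>t\<bar> \<le> 1 \<and> w = phi t p))" for p V
  have "\<exists>V. P p V" if p: "p \<in> level c \<inter> (topspace W - N)" for p
  proof -
    have "\<not> (\<forall>t. phi t p = p)" using p N(2) by blast
    then show ?thesis using flow_box[of p] p unfolding P_def by blast
  qed
  then obtain V where P: "\<And>p. p \<in> level c \<inter> (topspace W - N) \<Longrightarrow> P p (V p)"
    by metis
  have V: "openin W (V p)" "p \<in> V p" "\<forall>w\<in>V p. H w = H p \<longrightarrow> (\<exists>t. \<bar>t\<bar> \<le> 1 \<and> w = phi t p)"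
    if "p \<in> level c \<inter> (topspace W - N)" for p using P[OF that] unfolding P_def by blast+
  obtain D where D: "finite D" "D \<subseteq> level c \<inter> (topspace W - N)" "level c \<inter> (topspace W - N) \<subseteq> (\<Union>p\<in>D. V p)"
  proof (rule compactin_finite_index[OF K, of "level c \<inter> (topspace W - N)" V])
    show "\<exists>i\<in>level c \<inter> (topspace W - N). x \<in> V i" if "x \<in> level c \<inter> (topspace W - N)" for x
      using V(2)[OF that] that by blast
    show "openin W (V i)" if "i \<in> level c \<inter> (topspace W - N)" for i using V(1)[OF that] .
  qed
  obtain b where b: "b > 0" "B * b \<le> eta" "\<And>w. w \<in> level c \<Longrightarrow> \<exists>V\<in>\<V>. \<forall>r\<in>{0..b}. phi r w \<in> V"
    using uniform_short_time by blast
  define K where "K = real (card D) * (2 / b + 2) * real (card Z)"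
  have "name_cover skew \<U> T (nat \<lfloor>K * (real T + 1)\<rfloor>)
      {(w, z :: complex ^ 'n). w \<in> level c \<and> z \<in> fibre c \<and> (\<exists>j\<le>T. phi (real j) w \<notin> N)}" (is "name_cover _ _ _ _ ?S")
    for T
  proof -
    \<comment> \<open>The orbit meets the flow box of \<open>p\<close> at a time
      \<open>j \<le> T\<close>, with a parameter \<open>t\<close> between -1 and 1 there; running
      back by \<open>j\<close> gives the parameter \<open>t - j\<close>, hence this range.\<close>
    define ok where "ok w p s \<longleftrightarrow> p \<in> D \<and> s \<in> {- real T - 1..1} \<and> w = phi s p" for w p s
    have "\<exists>p s. ok w p s" if w: "w \<in> level c" and j: "j \<le> T" "phi (real j) w \<notin> N" for w j
    proof -
      have wW: "w \<in> topspace W" using w by simp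
      have "phi (real j) w \<in> level c \<inter> (topspace W - N)" using w j(2) phi_in H_phi by auto
      then obtain p where p: "p \<in> D" "phi (real j) w \<in> V p" using D(3) by blast
      have pl: "p \<in> level c \<inter> (topspace W - N)" using p(1) D(2) by blast
      have "H (phi (real j) w) = H p" using pl w H_phi by auto
      then obtain t where t: "\<bar>t\<bar> \<le> 1" "phi (real j) w = phi t p" using V(3)[OF pl] p(2) by blast
      have "w = phi (- real j + real j) w" using phi_0[OF wW] by simp
      also have "\<dots> = phi (- real j) (phi (real j) w)" by (rule phi_add[OF wW])
      also have "\<dots> = phi (- real j + t) p" using t(2) phi_add[of p "- real j" t] pl by simp
      finally have "ok w p (- real j + t)" unfolding ok_def using p(1) t(1) j(1) by auto
      then show ?thesis by blast
    qed
    then have ex: "\<exists>p s. ok w p s" if "(w, z) \<in> ?S" for w z using that by blast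
    define pp where "pp w = (SOME p. \<exists>s. ok w p s)" for w
    define ss where "ss w = (SOME s. ok w (pp w) s)" for w
    have ok: "ok w (pp w) (ss w)" if "(w, z) \<in> ?S" for w z
    proof -
      have "\<exists>s. ok w (pp w) s" unfolding pp_def by (rule someI_ex[OF ex[OF that]])
      then show ?thesis unfolding ss_def by (rule someI_ex)
    qed
    define I where "I = {\<lfloor>(- real T - 1) / b\<rfloor>..\<lfloor>1 / b\<rfloor>}"
    define code where "code = (\<lambda>(w, z). (pp w, \<lfloor>ss w / b\<rfloor>, cell z))"
    show ?thesis
    proof (rule name_cover_code[where C = "D \<times> I \<times> Z" and code = code])
      show "finite (D \<times> I \<times> Z)" using D(1) finZ by (simp add: I_def)
      have "real (card I) \<le> 1 / b - (- real T - 1) / b + 2"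
        unfolding I_def using b(1) by (intro card_floor_interval divide_right_mono) auto
      also have "\<dots> \<le> (2 / b + 2) * (real T + 1)" using b(1) by (simp add: field_simps)
      finally have I: "real (card I) \<le> (2 / b + 2) * (real T + 1)" .
      have "real (card (D \<times> I \<times> Z)) = real (card D) * real (card I) * real (card Z)"
        by (simp add: card_cartesian_product)
      also have "\<dots> \<le> real (card D) * ((2 / b + 2) * (real T + 1)) * real (card Z)"
        by (intro mult_right_mono mult_left_mono I) auto
      also have "\<dots> = K * (real T + 1)" unfolding K_def by (simp only: mult_ac)
      finally show "card (D \<times> I \<times> Z) \<le> nat \<lfloor>K * (real T + 1)\<rfloor>" by (rule le_nat_floor)
      show "code x \<in> D \<times> I \<times> Z" if x: "x \<in> ?S" for x
      proof -
        obtain w z where xx: "x = (w, z)" by (cases x)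
        note o = ok[OF x[unfolded xx]]
        have "z \<in> fibre c" using x xx by simp
        moreover have "\<lfloor>ss w / b\<rfloor> \<in> I"
          unfolding I_def atLeastAtMost_iff using o b(1) unfolding ok_def
          by (intro conjI floor_mono divide_right_mono) auto
        ultimately show ?thesis using o cell(1)[rule_format] by (simp add: code_def xx ok_def)
      qed
    next
      fix x i assume x: "x \<in> ?S" and i: "i < T"
      obtain w z where xx: "x = (w, z)" by (cases x)
      have z: "z \<in> fibre c" and wl: "w \<in> level c" using x xx by simp_all
      have pD: "pp w \<in> D" using ok[OF x[unfolded xx]] unfolding ok_def by simp
      then have pl: "pp w \<in> level c" using D(2) by blast
      then have pW: "pp w \<in> topspace W" by simp
      \<comment> \<open>The orbit parameter rounded down to a multiple of \<open>b\<close>. All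
        points with the same label share the reference point \<open>w0\<close> and lie at most the
        time \<open>b\<close> ahead of it on its orbit.\<close>
      define k where "k = of_int \<lfloor>ss w / b\<rfloor> * b"
      define w0 where "w0 = phi k (pp w)"
      have w0: "w0 \<in> topspace W" "w0 \<in> level c" unfolding w0_def using pl phi_in H_phi by auto
      have "phi (real i) w0 \<in> level c" using w0 phi_in H_phi by auto
      from b(3)[OF this] obtain V0 where V0: "V0 \<in> \<V>" "\<And>r. 0 \<le> r \<Longrightarrow> r \<le> b \<Longrightarrow> phi r (phi (real i) w0) \<in> V0"
        by auto
      have "\<exists>U\<in>\<U>. \<forall>y\<in>{y \<in> ?S. code y = code x}. (skew ^^ i) y \<in> U"
      proof (rule adapted_step[OF adV[rule_format, OF V0(1)] z _ R(1)[rule_format, OF z] R(2) eta, where s = "sig (real i) w0"])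
        fix w' z' assume y: "(w', z') \<in> {y \<in> ?S. code y = code x}"
        then have yS: "(w', z') \<in> ?S" by blast
        note o = ok[OF yS]
        have pe: "pp w' = pp w" and fl: "\<lfloor>ss w' / b\<rfloor> = \<lfloor>ss w / b\<rfloor>" and cl: "cell z' = cell z"
          using y by (auto simp: code_def xx)
        have w'l: "w' \<in> level c" and z': "z' \<in> fibre c" using yS by simp_all
        define r where "r = ss w' - k"
        have "of_int \<lfloor>ss w' / b\<rfloor> * b \<le> ss w' / b * b" "ss w' / b * b \<le> (of_int \<lfloor>ss w' / b\<rfloor> + 1) * b"
          using b(1) by (intro mult_right_mono; linarith)+
        then have r: "0 \<le> r" "r \<le> b"
          unfolding r_def k_def fl[symmetric] using b(1) by (simp_all add: distrib_right)
        have "w' = phi (r + k) (pp w)" using o pe unfolding ok_def r_def by simp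
        also have "\<dots> = phi r w0" unfolding w0_def by (rule phi_add[OF pW])
        finally have w': "w' = phi r w0" .
        have "phi (real i) w' = phi (real i + r) w0" unfolding w' by (rule phi_add[OF w0(1), symmetric])
        also have "\<dots> = phi r (phi (real i) w0)" using phi_add[OF w0(1), of r "real i"] by (simp add: add.commute)
        finally have in_V0: "phi (real i) w' \<in> V0" using V0(2)[OF r] by simp
        \<comment> \<open>The cocycle identity for \<open>i + r\<close> in both orders: the phases
          of \<open>w'\<close> and \<open>w0\<close> at time \<open>i\<close> differ by two phases
          over the short time \<open>r\<close>, each at most \<open>eta\<close>, however large
          \<open>i\<close> is. This is why one rounding serves the entire segment.\<close>
        have "sig r w0 + sig (real i) w' = sig (real i) w0 + sig r (phi (real i) w0)"
          using sig_add[OF w0(1), of r "real i"] sig_add[OF w0(1), of "real i" r] unfolding w' by (simp add: add.commute)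
        moreover have "\<bar>sig r w0\<bar> \<le> eta" "\<bar>sig r (phi (real i) w0)\<bar> \<le> eta"
        proof -
          have "B * r \<le> eta" using r B(1) b(2) by (meson less_imp_le mult_left_mono order_trans)
          then show "\<bar>sig r w0\<bar> \<le> eta" "\<bar>sig r (phi (real i) w0)\<bar> \<le> eta"
            using sig_bound[OF w0(1) r(1) B(2)[rule_format]] sig_bound[OF phi_in[OF w0(1)] r(1) B(2)[rule_format]] by (meson order_trans)+
        qed
        ultimately have "\<bar>sig (real i) w' - sig (real i) w0\<bar> \<le> 4 * eta" using eta by linarith
        then show "w' \<in> level c \<and> z' \<in> fibre c \<and> phi (real i) w' \<in> V0 \<and>
          \<bar>sig (real i) w' - sig (real i) w0\<bar> \<le> 4 * eta \<and> dist z' z < e / 2"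
          using in_V0 w'l z' cell(2)[rule_format, OF z' z cl] by blast
      qed
      then show "\<exists>U\<in>\<U>. \<forall>y\<in>?S. code y = code x \<longrightarrow> (skew ^^ i) y \<in> U" by blast
    qed
  qed
  moreover have "K \<ge> 0" unfolding K_def using b(1) by simp
  ultimately show ?thesis by blast
qed

end


text \<open>An orbit either stays in \<open>N\<close> at all integer times up to \<open>T\<close>,
  and is named block by block, or leaves \<open>N\<close>, and is named once for the whole of
  \<open>T\<close>. The first count is held to \<open>exp (a / 2 * real T)\<close>; the gap to
  \<open>exp (a * real T)\<close> absorbs the second one, which is linear in
  \<open>T\<close>.\<close>

lemma name_cover_level:
  fixes \<U> :: "('a \<times> (complex ^ ('n::finite))) set set"
  assumes cov: "open_cover space \<U>" and a: "a > 0"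
  shows "\<exists>m\<ge>1. \<exists>N. name_cover skew \<U> m N {x \<in> topspace space. H (fst x) = c} \<and> real N \<le> exp (a * real m)"
proof -
  obtain \<V> e where V: "finite \<V>" "e > 0" "\<forall>V\<in>\<V>. openin W V" "\<forall>V\<in>\<V>. adapted \<U> c V e"
    "level c \<subseteq> \<Union>\<V>"
    using adapted_cover[OF cov, of c] .
  obtain B where B: "B > 0" "\<forall>w\<in>topspace W. \<bar>rho w\<bar> \<le> B"
    using rho_bounded .
  obtain R where R: "R > 0" "\<forall>z :: complex ^ 'n\<in>fibre c. norm z \<le> R"
    using compact_imp_bounded[OF compact_fibre[of c, where 'n='n], unfolded bounded_pos] by (elim exE conjE)
  define eta where "eta = e / (16 * pi * R)"
  have eta: "eta > 0" "16 * pi * eta * R \<le> e" unfolding eta_def using V(2) R(1) by simp_all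
  have e2: "e / 2 > 0" using V(2) by simp
  obtain Z :: "(complex ^ 'n) set" and cell :: "complex ^ 'n \<Rightarrow> complex ^ 'n" where Z: "finite Z"
    "\<forall>z\<in>fibre c. cell z \<in> Z"
    "\<forall>z\<in>fibre c. \<forall>y\<in>fibre c. cell z = cell y \<longrightarrow> dist z y < e / 2"
    using fibre_cells[OF e2, where 'n='n and c=c] .
  note near = name_cover_near_rest_points[OF V(1,3-5) eta(1) R(2) eta(2) B Z]
  note leave = name_cover_leaving[OF V(1,3-5) eta(1) R(2) eta(2) B Z]
  define K1 where "K1 = real (card \<V>) * (2 * B / eta + 2) * real (card Z)"
  have "eventually (\<lambda>m. K1 * real m \<le> exp (a / 2 * real m)) sequentially"
    using a by real_asymp
  then obtain m0 where "\<And>m. m \<ge> m0 \<Longrightarrow> K1 * real m \<le> exp (a / 2 * real m)"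
    unfolding eventually_sequentially by blast
  then obtain m where m: "m \<ge> 1" "K1 * real m \<le> exp (a / 2 * real m)"
    by (meson max.cobounded1 max.cobounded2)
  obtain N where N: "openin W N" "{w \<in> level c. \<forall>t. phi t w = w} \<subseteq> N"
    "name_cover skew \<U> m (nat \<lfloor>K1 * real m\<rfloor>) {(w, z :: complex ^ 'n). w \<in> level c \<inter> N \<and> z \<in> fibre c}"
    using near[OF m(1)] unfolding K1_def by (elim exE conjE)
  obtain K2 where K2: "K2 \<ge> 0" "\<forall>T. name_cover skew \<U> T (nat \<lfloor>K2 * (real T + 1)\<rfloor>)
      {(w, z :: complex ^ 'n). w \<in> level c \<and> z \<in> fibre c \<and> (\<exists>j\<le>T. phi (real j) w \<notin> N)}"
    using leave[OF N(1,2)] by (elim exE conjE)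
  have "eventually (\<lambda>T. exp (a / 2 * real T) + K2 * (real T + 1) \<le> exp (a * real T)) sequentially"
    using a by real_asymp
  then obtain T0 where T0: "\<And>T. T \<ge> T0 \<Longrightarrow> exp (a / 2 * real T) + K2 * (real T + 1) \<le> exp (a * real T)"
    unfolding eventually_sequentially by blast
  \<comment> \<open>Makes \<open>T\<close> a multiple of \<open>m\<close> that is at least 1 and at
    least \<open>T0\<close>, because \<open>m \<ge> 1\<close>.\<close>
  define q where "q = max 1 T0"
  define T where "T = q * m"
  have "q * 1 \<le> T" unfolding T_def by (rule mult_le_mono2[OF m(1)])
  then have T: "T \<ge> 1" "T \<ge> T0" unfolding q_def by simp_all
  let ?N = "nat \<lfloor>K1 * real m\<rfloor> ^ q + nat \<lfloor>K2 * (real T + 1)\<rfloor>"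
  have "name_cover skew \<U> T ?N {x \<in> topspace space. H (fst x) = c}"
  proof (rule name_cover_mono[OF name_cover_Un[OF name_cover_concat[OF N(3), of q, folded T_def] K2(2)[rule_format, of T]]])
    show "{x \<in> topspace space. H (fst x) = c} \<subseteq>
      {x. \<forall>j<q. (skew ^^ (j * m)) x \<in> {(w, z :: complex ^ 'n). w \<in> level c \<inter> N \<and> z \<in> fibre c}} \<union>
      {(w, z). w \<in> level c \<and> z \<in> fibre c \<and> (\<exists>j\<le>T. phi (real j) w \<notin> N)}"
    proof
      fix x :: "'a \<times> (complex ^ 'n)" assume x: "x \<in> {x \<in> topspace space. H (fst x) = c}"
      obtain w z where xx: "x = (w, z)" by (cases x)
      have w: "w \<in> level c" and z: "z \<in> fibre c" using x xx by auto
      show "x \<in> {x. \<forall>j<q. (skew ^^ (j * m)) x \<in> {(w, z :: complex ^ 'n). w \<in> level c \<inter> N \<and> z \<in> fibre c}} \<union>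
        {(w, z). w \<in> level c \<and> z \<in> fibre c \<and> (\<exists>j\<le>T. phi (real j) w \<notin> N)}"
      proof (cases "\<exists>j\<le>T. phi (real j) w \<notin> N")
        case False
        have "(skew ^^ (j * m)) x \<in> {(w, z :: complex ^ 'n). w \<in> level c \<inter> N \<and> z \<in> fibre c}" if "j < q" for j
        proof -
          have "j * m \<le> T" unfolding T_def using that by simp
          then have "phi (real (j * m)) w \<in> N" using False by blast
          moreover have "(skew ^^ (j * m)) x = (phi (real (j * m)) w, rot (2 * pi * sig (real (j * m)) w) z)"
            using w unfolding xx by (intro skew_funpow) simp
          ultimately show ?thesis using w z phi_in H_phi by simp
        qed
        then show ?thesis by simp
      qed (use w z xx in simp)
    qed
  qed auto
  moreover have "real ?N \<le> exp (a * real T)"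
  proof -
    have "0 \<le> K1 * real m" unfolding K1_def using B(1) eta(1) by simp
    then have "real (nat \<lfloor>K1 * real m\<rfloor>) \<le> exp (a / 2 * real m)" using m(2) by linarith
    then have "real (nat \<lfloor>K1 * real m\<rfloor>) ^ q \<le> exp (a / 2 * real m) ^ q" by (intro power_mono) auto
    also have "\<dots> = exp (a / 2 * real T)"
      unfolding T_def by (simp only: exp_of_nat_mult[symmetric] of_nat_mult mult_ac)
    finally have 1: "real (nat \<lfloor>K1 * real m\<rfloor>) ^ q \<le> exp (a / 2 * real T)" .
    have "0 \<le> K2 * (real T + 1)" using K2(1) by simp
    then have "real (nat \<lfloor>K2 * (real T + 1)\<rfloor>) \<le> K2 * (real T + 1)" by linarith
    with 1 T0[OF T(2)] show ?thesis by simp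
  qed
  ultimately show ?thesis using T(1) by (intro exI conjI)
qed

theorem topological_entropy_skew:
  "topological_entropy (space :: ('a \<times> (complex ^ ('n::finite))) topology) skew = 0"
proof (rule topological_entropy_eq_0)
  show "skew ` topspace space \<subseteq> (topspace space :: ('a \<times> (complex ^ 'n)) set)"
    using skew_cont by (rule continuous_map_image_subset_topspace)
  fix \<U> :: "('a \<times> (complex ^ 'n)) set set" and a :: real
  assume cov: "open_cover space \<U>" and a: "a > 0"
  have h: "continuous_map space euclideanreal (\<lambda>x :: 'a \<times> (complex ^ 'n). H (fst x))"
    using continuous_map_compose[OF continuous_map_fst H_cont]
    by (intro continuous_map_from_subtopology) (simp add: o_def)
  have op: "\<And>U. U \<in> \<U> \<Longrightarrow> openin space U" using cov unfolding open_cover_def by blast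
  show "\<exists>C\<ge>0. \<forall>n. \<exists>N. name_cover skew \<U> n N (topspace space) \<and> real N \<le> C * exp (a * real n)"
    by (rule name_cover_from_levels[OF compact_space_space skew_cont h _ op _ name_cover_level[OF cov a]])
      (use a H_phi in \<open>auto simp: skew_def\<close>)
qed

end

section \<open>Flows on compact manifolds\<close>

lemma gronwall_forward:
  fixes u v :: "real \<Rightarrow> 'a::real_inner"
  assumes t: "0 \<le> t"
    and u: "\<And>s. 0 \<le> s \<Longrightarrow> s \<le> t \<Longrightarrow> (u has_vector_derivative U s) (at s)"
    and v: "\<And>s. 0 \<le> s \<Longrightarrow> s \<le> t \<Longrightarrow> (v has_vector_derivative V s) (at s)"
    and L: "\<And>s. 0 \<le> s \<Longrightarrow> s \<le> t \<Longrightarrow> norm (U s - V s) \<le> L * norm (u s - v s)"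
  shows "norm (u t - v t) \<le> exp (L * t) * norm (u 0 - v 0)"
proof -
  let ?w = "\<lambda>s. u s - v s"
  \<comment> \<open>The squared distance is differentiable where the distance need not be. Damped by
    \<open>exp (- 2 * L * s)\<close> it has a derivative of at most zero, by Cauchy-Schwarz and the
    Lipschitz bound.\<close>
  let ?phi = "\<lambda>s. exp (- 2 * L * s) * (?w s \<bullet> ?w s)"
  have "?phi t \<le> ?phi 0"
  proof (rule DERIV_nonpos_imp_nonincreasing[OF t])
    fix s assume s: "0 \<le> s" "s \<le> t"
    have w: "(?w has_vector_derivative U s - V s) (at s)"
      by (rule has_vector_derivative_diff[OF u[OF s] v[OF s]])
    have "((\<lambda>s. ?w s \<bullet> ?w s) has_derivative (\<lambda>h. ?w s \<bullet> (h *\<^sub>R (U s - V s)) + (h *\<^sub>R (U s - V s)) \<bullet> ?w s)) (at s)"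
      using w unfolding has_vector_derivative_def by (rule has_derivative_inner[OF _ w[unfolded has_vector_derivative_def]])
    then have "((\<lambda>s. ?w s \<bullet> ?w s) has_real_derivative 2 * (?w s \<bullet> (U s - V s))) (at s)"
      unfolding has_field_derivative_def
      by (rule has_derivative_eq_rhs) (simp add: fun_eq_iff inner_commute algebra_simps)
    then have d: "(?phi has_real_derivative exp (- 2 * L * s) * (2 * (?w s \<bullet> (U s - V s))) + (exp (- 2 * L * s) * (- 2 * L)) * (?w s \<bullet> ?w s)) (at s)"
      by (auto intro!: derivative_eq_intros)
    have "?w s \<bullet> (U s - V s) \<le> norm (?w s) * norm (U s - V s)" by (rule norm_cauchy_schwarz)
    also have "\<dots> \<le> norm (?w s) * (L * norm (?w s))" by (intro mult_left_mono L[OF s]) auto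
    also have "\<dots> = L * (?w s \<bullet> ?w s)" by (simp add: power2_norm_eq_inner[symmetric] power2_eq_square)
    finally have "2 * (?w s \<bullet> (U s - V s)) - 2 * L * (?w s \<bullet> ?w s) \<le> 0" by simp
    then have "exp (- 2 * L * s) * (2 * (?w s \<bullet> (U s - V s)) - 2 * L * (?w s \<bullet> ?w s)) \<le> 0"
      by (intro mult_nonneg_nonpos) auto
    then have "exp (- 2 * L * s) * (2 * (?w s \<bullet> (U s - V s))) + (exp (- 2 * L * s) * (- 2 * L)) * (?w s \<bullet> ?w s) \<le> 0"
      by (simp only: algebra_simps)
    with d show "\<exists>y. (?phi has_real_derivative y) (at s) \<and> y \<le> 0" by blast
  qed
  then have "exp (- 2 * L * t) * (norm (?w t))\<^sup>2 \<le> (norm (?w 0))\<^sup>2"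
    by (simp add: power2_norm_eq_inner)
  then have "exp (2 * L * t) * (exp (- 2 * L * t) * (norm (?w t))\<^sup>2) \<le> exp (2 * L * t) * (norm (?w 0))\<^sup>2"
    by (intro mult_left_mono) auto
  moreover have "exp (2 * L * t) * (exp (- 2 * L * t) * (norm (?w t))\<^sup>2) = (norm (?w t))\<^sup>2"
    by (simp add: mult.assoc[symmetric] exp_add[symmetric])
  moreover have "exp (2 * L * t) = (exp (L * t))\<^sup>2" by (simp add: exp_double[symmetric] mult.assoc)
  ultimately have "(norm (?w t))\<^sup>2 \<le> (exp (L * t) * norm (?w 0))\<^sup>2"
    by (simp only: power_mult_distrib)
  then show ?thesis by (rule power2_le_imp_le) simp
qed

text \<open>Negative times are reduced to positive ones by reversing both curves; the Lipschitz
  bound does not see the sign of the velocities.\<close>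

lemma gronwall:
  fixes u v :: "real \<Rightarrow> 'a::real_inner"
  assumes t: "\<bar>t\<bar> < h"
    and u: "\<And>s. \<bar>s\<bar> < h \<Longrightarrow> (u has_vector_derivative U s) (at s)"
    and v: "\<And>s. \<bar>s\<bar> < h \<Longrightarrow> (v has_vector_derivative V s) (at s)"
    and L: "\<And>s. \<bar>s\<bar> < h \<Longrightarrow> norm (U s - V s) \<le> L * norm (u s - v s)"
  shows "norm (u t - v t) \<le> exp (L * \<bar>t\<bar>) * norm (u 0 - v 0)"
proof (cases "t \<ge> 0")
  case True
  then show ?thesis using gronwall_forward[of t u U v V L] t u v L by auto
next
  case False
  have refl: "((\<lambda>s. w (- s)) has_vector_derivative - D) (at s)"
    if "(w has_vector_derivative D) (at (- s))" for w :: "real \<Rightarrow> 'a" and D s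
  proof -
    have "((\<lambda>s. - s) has_vector_derivative - 1) (at s)" by (auto intro!: derivative_eq_intros)
    from vector_diff_chain_at[OF this, of w D] that show ?thesis by (simp add: o_def)
  qed
  have "norm (u (- (- t)) - v (- (- t))) \<le> exp (L * (- t)) * norm (u (- 0) - v (- 0))"
  proof (rule gronwall_forward[where u = "\<lambda>s. u (- s)" and v = "\<lambda>s. v (- s)" and U = "\<lambda>s. - U (- s)" and V = "\<lambda>s. - V (- s)"])
    fix s assume s: "0 \<le> s" "s \<le> - t"
    then have s': "\<bar>- s\<bar> < h" using t by simp
    show "((\<lambda>s. u (- s)) has_vector_derivative - U (- s)) (at s)" by (rule refl[OF u[OF s']])
    show "((\<lambda>s. v (- s)) has_vector_derivative - V (- s)) (at s)" by (rule refl[OF v[OF s']])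
    show "norm (- U (- s) - - V (- s)) \<le> L * norm (u (- s) - v (- s))"
      using L[OF s'] by (simp add: norm_minus_commute)
  qed (use False in simp)
  then show ?thesis using False by simp
qed

text \<open>Banach's fixed point theorem in the complete space of bounded continuous curves on the
  whole real line. Freezing time outside \<open>[-h, h]\<close> by \<open>cl\<close> keeps the
  Picard iterates bounded, and \<open>L * h\<close> is the contraction constant.\<close>

lemma picard:
  fixes F :: "'a::euclidean_space \<Rightarrow> 'a"
  assumes L: "\<And>x y. norm (F x - F y) \<le> L * norm (x - y)" and L0: "L \<ge> 0"
    and M: "\<And>x. norm (F x) \<le> M" and h: "h > 0" "L * h < 1"
  obtains u where "u 0 = x0" "\<And>t. \<bar>t\<bar> < h \<Longrightarrow> (u has_vector_derivative F (u t)) (at t)"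
proof -
  have Fc: "continuous_on UNIV F"
    unfolding continuous_on_iff
  proof (intro ballI allI impI)
    fix x e :: real and y :: 'a assume e: "0 < (e::real)"
    show "\<exists>d>0. \<forall>x'\<in>UNIV. dist x' y < d \<longrightarrow> dist (F x') (F y) < e"
    proof (intro exI[of _ "e / (L + 1)"] conjI ballI impI)
      show "0 < e / (L + 1)" using e L0 by simp
      fix x' assume "dist x' y < e / (L + 1)"
      then have "(L + 1) * norm (x' - y) < e" using L0 by (simp add: field_simps dist_norm)
      moreover have "L * norm (x' - y) \<le> (L + 1) * norm (x' - y)" by (intro mult_right_mono) auto
      ultimately show "dist (F x') (F y) < e" using L[of x' y] by (simp add: dist_norm)
    qed
  qed
  define cl where "cl t = max (- h) (min h t)" for t
  have cl: "cl t \<in> {- h..h}" "\<bar>t\<bar> \<le> h \<Longrightarrow> cl t = t" for t using h by (auto simp: cl_def)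
  have clc: "continuous_on UNIV cl" unfolding cl_def by (intro continuous_intros)
  \<comment> \<open>The signed integral from 0 to \<open>t\<close>. It is written as a difference
    because \<open>integral {0..t}\<close> vanishes for negative \<open>t\<close>.\<close>
  define G where "G g t = integral {- h..t} g - integral {- h..0} g" for g :: "real \<Rightarrow> 'a" and t
  have Gb: "norm (G g t) \<le> b * h" if g: "continuous_on {- h..h} g" and b: "\<And>s. s \<in> {- h..h} \<Longrightarrow> norm (g s) \<le> b" and t: "t \<in> {- h..h}" for g t b
  proof -
    have b0: "b \<ge> 0" using order_trans[OF norm_ge_zero b[of 0]] h by simp
    have int: "g integrable_on {a..c}" if "{a..c} \<subseteq> {- h..h}" for a c
      by (intro integrable_continuous_interval continuous_on_subset[OF g that])
    show ?thesis
    proof (cases "t \<ge> 0")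
      case True
      have "integral {- h..0} g + integral {0..t} g = integral {- h..t} g"
        using True t h by (intro Henstock_Kurzweil_Integration.integral_combine int) auto
      then have "G g t = integral {0..t} g" unfolding G_def by (simp add: algebra_simps)
      moreover have "norm (integral {0..t} g) \<le> b * (t - 0)"
        using True t b by (intro integral_bound continuous_on_subset[OF g]) auto
      moreover have "b * (t - 0) \<le> b * h" using t b0 by (intro mult_left_mono) auto
      ultimately show ?thesis by simp
    next
      case False
      have "integral {- h..t} g + integral {t..0} g = integral {- h..0} g"
        using False t h by (intro Henstock_Kurzweil_Integration.integral_combine int) auto
      then have "G g t = - integral {t..0} g" unfolding G_def by (simp add: algebra_simps)
      moreover have "norm (integral {t..0} g) \<le> b * (0 - t)"
        using False t h b by (intro integral_bound continuous_on_subset[OF g]) auto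
      moreover have "b * (0 - t) \<le> b * h" using t b0 by (intro mult_left_mono) auto
      ultimately show ?thesis by simp
    qed
  qed
  have Gd: "(G g has_vector_derivative g t) (at t within {- h..h})" if "continuous_on {- h..h} g" "t \<in> {- h..h}" for g t
    using has_vector_derivative_diff[OF integral_has_vector_derivative[OF that] has_vector_derivative_const]
    unfolding G_def by simp
  have Gc: "continuous_on {- h..h} (G g)" if "continuous_on {- h..h} g" for g
    using Gd[OF that] by (meson continuous_on_eq_continuous_within has_vector_derivative_continuous)
  have Fu: "continuous_on S (\<lambda>t. F (apply_bcontfun u t))" for u :: "real \<Rightarrow>\<^sub>C 'a" and S
  proof -
    have "continuous_on UNIV (apply_bcontfun u)" by (rule continuous_on_apply_bcontfun)
    from continuous_on_compose2[OF Fc this] have "continuous_on UNIV (\<lambda>t. F (apply_bcontfun u t))" by simp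
    then show ?thesis by (rule continuous_on_subset) simp
  qed
  define P where "P u = Bcontfun (\<lambda>t. x0 + G (\<lambda>s. F (apply_bcontfun u s)) (cl t))" for u :: "real \<Rightarrow>\<^sub>C 'a"
  have P: "apply_bcontfun (P u) t = x0 + G (\<lambda>s. F (apply_bcontfun u s)) (cl t)" for u t
  proof -
    have "(\<lambda>t. x0 + G (\<lambda>s. F (apply_bcontfun u s)) (cl t)) \<in> bcontfun"
    proof (rule bcontfun_normI)
      show "continuous_on UNIV (\<lambda>t. x0 + G (\<lambda>s. F (apply_bcontfun u s)) (cl t))"
        by (intro continuous_intros continuous_on_compose2[OF Gc[OF Fu] clc]) (use cl(1) in auto)
      show "norm (x0 + G (\<lambda>s. F (apply_bcontfun u s)) (cl t)) \<le> norm x0 + M * h" for t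
        using norm_triangle_ineq[of x0] Gb[OF Fu M cl(1)] by (meson add_left_mono order_trans)
    qed
    then show ?thesis unfolding P_def by (simp add: Bcontfun_inverse)
  qed
  have "\<exists>!u. P u = u"
  proof (rule banach_fix_type)
    show "0 \<le> L * h" "L * h < 1" using L0 h by auto
    show "\<forall>u v. dist (P u) (P v) \<le> L * h * dist u v"
    proof (intro allI dist_bound)
      fix u v :: "real \<Rightarrow>\<^sub>C 'a" and t
      let ?g = "\<lambda>s. F (apply_bcontfun u s) - F (apply_bcontfun v s)"
      have i: "(\<lambda>s. F (apply_bcontfun u s)) integrable_on {a..c}" for u :: "real \<Rightarrow>\<^sub>C 'a" and a c
        by (intro integrable_continuous_interval Fu)
      have "dist (apply_bcontfun (P u) t) (apply_bcontfun (P v) t) = norm (G ?g (cl t))"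
        unfolding P dist_norm G_def using i by (simp add: Henstock_Kurzweil_Integration.integral_diff algebra_simps)
      also have "\<dots> \<le> (L * dist u v) * h"
      proof (rule Gb[OF _ _ cl(1)])
        show "continuous_on {- h..h} ?g" by (intro continuous_intros Fu)
        fix s
        have "norm (?g s) \<le> L * dist (apply_bcontfun u s) (apply_bcontfun v s)"
          using L by (simp add: dist_norm)
        also have "\<dots> \<le> L * dist u v" by (intro mult_left_mono dist_bounded L0)
        finally show "norm (?g s) \<le> L * dist u v" .
      qed
      finally show "dist (apply_bcontfun (P u) t) (apply_bcontfun (P v) t) \<le> L * h * dist u v"
        by (simp add: mult_ac)
    qed
  qed
  then obtain u where u: "P u = u" by blast
  show thesis
  proof (rule that[of "apply_bcontfun u"])
    show "apply_bcontfun u 0 = x0"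
      using P[of u 0] u h cl(2)[of 0] by (simp add: G_def)
    fix t assume t: "\<bar>t\<bar> < h"
    have "((\<lambda>t. x0 + G (\<lambda>s. F (apply_bcontfun u s)) t) has_vector_derivative F (apply_bcontfun u t)) (at t within {- h..h})"
      using has_vector_derivative_add[OF has_vector_derivative_const[of x0] Gd[OF Fu[where u = u], of t]] t by (simp add: abs_less_iff)
    moreover have "at t within {- h..h} = at t" using t by (intro at_within_interior) auto
    ultimately have "((\<lambda>t. x0 + G (\<lambda>s. F (apply_bcontfun u s)) t) has_vector_derivative F (apply_bcontfun u t)) (at t)" by simp
    then show "(apply_bcontfun u has_vector_derivative F (apply_bcontfun u t)) (at t)"
    proof (rule has_vector_derivative_transform_within_open[where S = "{- h<..<h}"])
      fix s assume s: "s \<in> {- h<..<h}"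
      have "apply_bcontfun u s = apply_bcontfun (P u) s" using u by simp
      also have "\<dots> = x0 + G (\<lambda>s. F (apply_bcontfun u s)) s" unfolding P using cl(2)[of s] s by auto
      finally show "x0 + G (\<lambda>s. F (apply_bcontfun u s)) s = apply_bcontfun u s" by simp
    qed (use t in auto)
  qed
qed

text \<open>The nearest-point projection onto the ball is 1-Lipschitz, so composing with it extends
  \<open>F\<close> to the whole space with the same bounds. Curves that start in the half ball stay
  where the extension equals \<open>F\<close>.\<close>

lemma local_flow:
  fixes F :: "'a::euclidean_space \<Rightarrow> 'a"
  assumes r: "r > 0" and L: "\<And>x y. x \<in> cball x0 r \<Longrightarrow> y \<in> cball x0 r \<Longrightarrow> norm (F x - F y) \<le> L * norm (x - y)"
    and L0: "L \<ge> 0" and M: "\<And>x. x \<in> cball x0 r \<Longrightarrow> norm (F x) \<le> M"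
  obtains h u where "h > 0" "\<forall>x\<in>ball x0 (r / 2). u x 0 = x"
    "\<forall>x\<in>ball x0 (r / 2). \<forall>t. \<bar>t\<bar> < h \<longrightarrow> u x t \<in> ball x0 r \<and> (u x has_vector_derivative F (u x t)) (at t)"
    "continuous_on ({- h<..<h} \<times> ball x0 (r / 2)) (\<lambda>(t, x). u x t)"
proof -
  define F' where "F' x = F (closest_point (cball x0 r) x)" for x
  have ne: "cball x0 r \<noteq> {}" using r by auto
  have cp: "closest_point (cball x0 r) x \<in> cball x0 r" for x
    by (rule closest_point_in_set[OF closed_cball ne])
  have M0: "M \<ge> 0" using order_trans[OF norm_ge_zero M[of x0]] r by simp
  have L': "norm (F' x - F' y) \<le> L * norm (x - y)" for x y
  proof -
    have "norm (F' x - F' y) \<le> L * norm (closest_point (cball x0 r) x - closest_point (cball x0 r) y)"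
      unfolding F'_def by (rule L[OF cp cp])
    also have "\<dots> \<le> L * norm (x - y)"
      using closest_point_lipschitz[OF convex_cball closed_cball ne, of x y]
      by (intro mult_left_mono L0) (simp add: dist_norm)
    finally show ?thesis .
  qed
  have M': "norm (F' x) \<le> M" for x unfolding F'_def by (rule M[OF cp])
  \<comment> \<open>The first bound gives \<open>L * h < 1\<close> for \<open>picard\<close>, the
    second \<open>M * h < r / 2\<close>, so that curves from the half ball stay in the ball. The
    \<open>+ 1\<close> excludes zero denominators.\<close>
  define h where "h = min (1 / (2 * (L + 1))) (r / (2 * (M + 1)))"
  have h: "h > 0" using L0 M0 r by (simp add: h_def)
  have hL: "L * h < 1"
  proof -
    have "(L + 1) * h \<le> (L + 1) * (1 / (2 * (L + 1)))" using L0 by (intro mult_left_mono) (auto simp: h_def)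
    also have "\<dots> = 1 / 2" using L0 by (simp add: field_simps)
    finally have "(L + 1) * h \<le> 1 / 2" .
    then show ?thesis using h by (simp add: distrib_right)
  qed
  have hM: "M * h < r / 2"
  proof -
    have "(M + 1) * h \<le> (M + 1) * (r / (2 * (M + 1)))" using M0 by (intro mult_left_mono) (auto simp: h_def)
    also have "\<dots> = r / 2" using M0 by (simp add: field_simps)
    finally show ?thesis using h by (simp add: distrib_right)
  qed
  have "\<exists>u. u 0 = x \<and> (\<forall>t. \<bar>t\<bar> < h \<longrightarrow> (u has_vector_derivative F' (u t)) (at t))" for x
    by (rule picard[OF L' L0 M' h hL, of x]) blast
  then obtain u where u: "\<And>x. u x 0 = x"
    "\<And>x t. \<bar>t\<bar> < h \<Longrightarrow> (u x has_vector_derivative F' (u x t)) (at t)" by metis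
  have ut: "norm (u x t - u x s) \<le> M * norm (t - s)" if "\<bar>t\<bar> < h" "\<bar>s\<bar> < h" for x t s
  proof (rule differentiable_bound[where S = "{- h<..<h}" and f' = "\<lambda>t a. a *\<^sub>R F' (u x t)"])
    show "(u x has_derivative (\<lambda>a. a *\<^sub>R F' (u x t))) (at t within {- h<..<h})" if "t \<in> {- h<..<h}" for t
    proof -
      have "\<bar>t\<bar> < h" using that by auto
      from u(2)[OF this, of x] show ?thesis
        unfolding has_vector_derivative_def by (rule has_derivative_at_withinI)
    qed
    show "onorm (\<lambda>a. a *\<^sub>R F' (u x t)) \<le> M" for t
    proof (rule onorm_le)
      fix a
      have "\<bar>a\<bar> * norm (F' (u x t)) \<le> \<bar>a\<bar> * M" by (intro mult_left_mono M') auto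
      then show "norm (a *\<^sub>R F' (u x t)) \<le> M * norm a" by (simp add: mult.commute)
    qed
  qed (use that in auto)
  have in_ball: "u x t \<in> ball x0 r" if "x \<in> ball x0 (r / 2)" "\<bar>t\<bar> < h" for x t
  proof -
    have "norm (u x t - u x 0) \<le> M * \<bar>t\<bar>" using ut[OF that(2), of 0] h by simp
    also have "\<dots> \<le> M * h" using that(2) M0 by (intro mult_left_mono) auto
    finally have "norm (u x t - x) < r / 2" using hM u(1) by simp
    moreover have "norm (x - x0) < r / 2" using that(1) by (simp add: dist_norm norm_minus_commute)
    ultimately have "norm ((u x t - x) + (x - x0)) < r" using norm_triangle_ineq[of "u x t - x" "x - x0"] by linarith
    then show ?thesis by (simp add: dist_norm norm_minus_commute)
  qed
  have ux: "norm (u x t - u y t) \<le> exp (L * h) * norm (x - y)" if "\<bar>t\<bar> < h" for x y t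
  proof -
    have "norm (u x t - u y t) \<le> exp (L * \<bar>t\<bar>) * norm (u x 0 - u y 0)"
      by (rule gronwall[OF that u(2) u(2) L'])
    also have "\<dots> \<le> exp (L * h) * norm (x - y)"
      unfolding u(1) using that L0 by (intro mult_right_mono) (auto intro!: mult_left_mono)
    finally show ?thesis .
  qed
  show thesis
  proof (rule that[of h u])
    show "\<forall>x\<in>ball x0 (r / 2). \<forall>t. \<bar>t\<bar> < h \<longrightarrow> u x t \<in> ball x0 r \<and> (u x has_vector_derivative F (u x t)) (at t)"
    proof (intro ballI allI impI conjI)
      fix x t assume *: "x \<in> ball x0 (r / 2)" "\<bar>t\<bar> < h"
      show b: "u x t \<in> ball x0 r" by (rule in_ball[OF *])
      then have "F' (u x t) = F (u x t)" unfolding F'_def by (subst closest_point_self) auto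
      then show "(u x has_vector_derivative F (u x t)) (at t)" using u(2)[OF *(2), of x] by simp
    qed
    show "continuous_on ({- h<..<h} \<times> ball x0 (r / 2)) (\<lambda>(t, x). u x t)"
      unfolding continuous_on_iff
    proof (intro ballI allI impI)
      fix y and e :: real assume y: "y \<in> {- h<..<h} \<times> ball x0 (r / 2)" and e: "0 < e"
      obtain t x where yy: "y = (t, x)" by (cases y)
      have tx: "t \<in> {- h<..<h}" "x \<in> ball x0 (r / 2)" using y yy by auto
      let ?K = "M + exp (L * h) + 1"
      have K: "?K > 0" using M0 by (simp add: add_nonneg_pos)
      show "\<exists>d>0. \<forall>x'\<in>{- h<..<h} \<times> ball x0 (r / 2). dist x' y < d \<longrightarrow>
        dist (case x' of (t, x) \<Rightarrow> u x t) (case y of (t, x) \<Rightarrow> u x t) < e"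
        unfolding yy
      proof (intro exI[of _ "e / ?K"] conjI ballI impI)
        show "0 < e / ?K" using e K by simp
        fix p assume p: "p \<in> {- h<..<h} \<times> ball x0 (r / 2)" "dist p (t, x) < e / ?K"
        obtain t' x' where pp: "p = (t', x')" by (cases p)
        have d1: "norm (t' - t) \<le> dist p (t, x)" and d2: "norm (x' - x) \<le> dist p (t, x)"
          using dist_fst_le[of p "(t, x)"] dist_snd_le[of p "(t, x)"] by (simp_all add: pp dist_norm)
        have th: "\<bar>t'\<bar> < h" "\<bar>t\<bar> < h" using p(1) tx pp by auto
        have "norm (u x' t' - u x t) \<le> norm (u x' t' - u x t') + norm (u x t' - u x t)"
          using norm_triangle_ineq[of "u x' t' - u x t'" "u x t' - u x t"] by simp
        also have "\<dots> \<le> exp (L * h) * norm (x' - x) + M * norm (t' - t)"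
          by (intro add_mono ux ut th)
        also have "\<dots> \<le> exp (L * h) * dist p (t, x) + M * dist p (t, x)"
          using d1 d2 M0 by (intro add_mono mult_left_mono) auto
        also have "\<dots> \<le> ?K * dist p (t, x)" by (simp add: algebra_simps)
        also have "\<dots> < e" using p(2) K by (simp add: field_simps)
        finally show "dist (case p of (t, x) \<Rightarrow> u x t) (case (t, x) of (t, x) \<Rightarrow> u x t) < e"
          by (simp add: pp dist_norm)
      qed
    qed
  qed (use h u(1) in auto)
qed


section \<open>Charts and trajectories\<close>

lemma topological_chart_facts:
  assumes c: "topological_chart W c"
  shows "openin W (chart_dom c)" "inj_on (coord c) (chart_dom c)"
    "\<And>p. p \<in> chart_dom c \<Longrightarrow> chart_inv c (coord c p) = p"
    "\<And>x. x \<in> chart_img c \<Longrightarrow> chart_inv c x \<in> chart_dom c \<and> coord c (chart_inv c x) = x"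
    "\<And>p. p \<in> chart_dom c \<Longrightarrow> coord c p \<in> chart_img c"
    "\<And>U. openin W U \<Longrightarrow> U \<subseteq> chart_dom c \<Longrightarrow> \<exists>T. open T \<and> coord c ` U = chart_img c \<inter> T"
    "\<And>T. open T \<Longrightarrow> openin W {p \<in> chart_dom c. coord c p \<in> T}"
proof -
  have o: "openin W (chart_dom c)" and h: "homeomorphic_map (subtopology W (chart_dom c)) (top_of_set (chart_img c)) (coord c)"
    using c unfolding topological_chart_def by auto
  have ts: "topspace (subtopology W (chart_dom c)) = chart_dom c"
    using openin_subset[OF o] by auto
  show "openin W (chart_dom c)" by (rule o)
  show inj: "inj_on (coord c) (chart_dom c)"
    using homeomorphic_imp_injective_map[OF h] ts by simp
  show "chart_inv c (coord c p) = p" if "p \<in> chart_dom c" for p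
    unfolding chart_inv_def by (rule inv_into_f_f[OF inj that])
  show "chart_inv c x \<in> chart_dom c \<and> coord c (chart_inv c x) = x" if "x \<in> chart_img c" for x
    using that unfolding chart_inv_def chart_img_def by (simp add: inv_into_into f_inv_into_f)
  show "coord c p \<in> chart_img c" if "p \<in> chart_dom c" for p
    using that unfolding chart_img_def by simp
  show "\<exists>T. open T \<and> coord c ` U = chart_img c \<inter> T" if U: "openin W U" "U \<subseteq> chart_dom c" for U
  proof -
    have "openin (subtopology W (chart_dom c)) U"
      using U o by (simp add: openin_open_subtopology)
    then have "openin (top_of_set (chart_img c)) (coord c ` U)"
      using homeomorphic_imp_open_map[OF h] unfolding open_map_def by blast
    then show ?thesis unfolding openin_open by blast
  qed
  show "openin W {p \<in> chart_dom c. coord c p \<in> T}" if T: "open T" for T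
  proof -
    have cm: "continuous_map (subtopology W (chart_dom c)) (top_of_set (chart_img c)) (coord c)"
      using homeomorphic_imp_continuous_map[OF h] .
    have "openin (top_of_set (chart_img c)) (chart_img c \<inter> T)" using T by (rule openin_open_Int)
    from openin_continuous_map_preimage[OF cm this]
    have "openin (subtopology W (chart_dom c)) {p \<in> chart_dom c. coord c p \<in> chart_img c \<inter> T}"
      unfolding ts .
    moreover have "{p \<in> chart_dom c. coord c p \<in> chart_img c \<inter> T} = {p \<in> chart_dom c. coord c p \<in> T}"
      by (auto simp: chart_img_def)
    ultimately show ?thesis using o by (simp add: openin_open_subtopology)
  qed
qed

text \<open>\<open>Y\<close> is only a family of coordinate expressions on half-space images.
  \<open>transition\<close> relates them under coordinate changes, and \<open>field\<close> supplies
  a Lipschitz extension to a full ball. The last clause of \<open>field\<close> deals with the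
  boundary: a solution of the extended equation that starts in the chart image does not leave
  it.\<close>

locale manifold_flow =
  fixes W :: "'a topology" and A :: "('a, 'f::euclidean_space) chart set"
    and Y :: "('a, 'f) chart \<Rightarrow> 'a \<Rightarrow> real \<times> 'f"
  assumes Hausdorff: "Hausdorff_space W" and compact: "compact_space W"
    and charts: "c \<in> A \<Longrightarrow> topological_chart W c"
    and covers: "(\<Union>c\<in>A. chart_dom c) = topspace W"
    and transition: "c \<in> A \<Longrightarrow> d \<in> A \<Longrightarrow> p \<in> chart_dom c \<Longrightarrow> p \<in> chart_dom d \<Longrightarrow>
      \<exists>T g g'. open T \<and> coord c p \<in> T \<and> (g has_derivative g') (at (coord c p)) \<and> g' (Y c p) = Y d p \<and>
        (\<forall>q\<in>chart_dom c \<inter> chart_dom d. coord c q \<in> T \<longrightarrow> coord d q = g (coord c q))"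
    and field: "c \<in> A \<Longrightarrow> p \<in> chart_dom c \<Longrightarrow>
      \<exists>r L M F. r > 0 \<and> L \<ge> 0 \<and>
        (\<forall>x\<in>cball (coord c p) r. \<forall>y\<in>cball (coord c p) r. norm (F x - F y) \<le> L * norm (x - y)) \<and>
        (\<forall>x\<in>cball (coord c p) r. norm (F x) \<le> M) \<and>
        (\<forall>q\<in>chart_dom c. coord c q \<in> cball (coord c p) r \<longrightarrow> F (coord c q) = Y c q) \<and>
        (\<forall>u h. u (0::real) \<in> chart_img c \<longrightarrow>
           (\<forall>t. \<bar>t\<bar> < h \<longrightarrow> u t \<in> ball (coord c p) r \<and> (u has_vector_derivative F (u t)) (at t)) \<longrightarrow>
           (\<forall>t. \<bar>t\<bar> < h \<longrightarrow> u t \<in> chart_img c))"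
begin

lemmas chart_facts = topological_chart_facts[OF charts]

text \<open>One chart is enough, by \<open>trajectory_derivative\<close>. Staying in its domain near
  \<open>t\<close> is demanded explicitly, because continuity of \<open>\<gamma>\<close> is not
  assumed and \<open>coord c\<close> has meaningless values outside the domain.\<close>

definition trajectory_at :: "(real \<Rightarrow> 'a) \<Rightarrow> real \<Rightarrow> bool" where
  "trajectory_at \<gamma> t \<longleftrightarrow> (\<exists>c\<in>A. \<gamma> t \<in> chart_dom c \<and> eventually (\<lambda>s. \<gamma> s \<in> chart_dom c) (nhds t) \<and>
     ((coord c \<circ> \<gamma>) has_vector_derivative Y c (\<gamma> t)) (at t))"

lemma eventually_nhds_isCont:
  assumes "isCont f t" "open T" "f t \<in> T"
  shows "eventually (\<lambda>s. f s \<in> T) (nhds t)"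
proof -
  obtain S where "open S" "t \<in> S" "\<forall>s\<in>S. f s \<in> T"
    using assms(1)[unfolded continuous_at_open, rule_format, of T] assms(2,3) by auto
  then show ?thesis unfolding eventually_nhds by (intro exI[of _ S]) simp
qed

text \<open>Continuity at \<open>t\<close>, recovered from the differentiable coordinate curve: open
  subsets of the domain correspond to relatively open subsets of the chart image, and
  \<open>coord c\<close> is injective.\<close>

lemma trajectory_eventually:
  assumes tr: "trajectory_at \<gamma> t" and U: "openin W U" "\<gamma> t \<in> U"
  shows "eventually (\<lambda>s. \<gamma> s \<in> U) (nhds t)"
proof -
  obtain c where c: "c \<in> A" "\<gamma> t \<in> chart_dom c" "eventually (\<lambda>s. \<gamma> s \<in> chart_dom c) (nhds t)"
    "((coord c \<circ> \<gamma>) has_vector_derivative Y c (\<gamma> t)) (at t)"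
    using tr unfolding trajectory_at_def by blast
  obtain T where T: "open T" "coord c ` (chart_dom c \<inter> U) = chart_img c \<inter> T"
    using chart_facts(6)[OF c(1) openin_Int[OF chart_facts(1)[OF c(1)] U(1)]] by blast
  have "isCont (coord c \<circ> \<gamma>) t" using c(4) by (rule has_vector_derivative_continuous)
  moreover have "(coord c \<circ> \<gamma>) t \<in> T" using T(2) c(2) U(2) by auto
  ultimately have "eventually (\<lambda>s. (coord c \<circ> \<gamma>) s \<in> T) (nhds t)"
    using eventually_nhds_isCont T(1) by blast
  with c(3) show ?thesis
  proof eventually_elim
    case (elim s)
    then have "coord c (\<gamma> s) \<in> coord c ` (chart_dom c \<inter> U)"
      unfolding T(2) using chart_facts(5)[OF c(1)] by simp
    then obtain q where "q \<in> chart_dom c" "q \<in> U" "coord c (\<gamma> s) = coord c q" by blast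
    then show ?case using inj_onD[OF chart_facts(2)[OF c(1)], of "\<gamma> s" q] elim(1) by simp
  qed
qed

lemma trajectory_in: "trajectory_at \<gamma> t \<Longrightarrow> \<gamma> t \<in> topspace W"
  unfolding trajectory_at_def using covers by blast

lemma trajectory_derivative:
  assumes tr: "trajectory_at \<gamma> t" and d: "d \<in> A" "\<gamma> t \<in> chart_dom d"
  shows "((coord d \<circ> \<gamma>) has_vector_derivative Y d (\<gamma> t)) (at t)"
proof -
  obtain c where c: "c \<in> A" "\<gamma> t \<in> chart_dom c" "eventually (\<lambda>s. \<gamma> s \<in> chart_dom c) (nhds t)"
    "((coord c \<circ> \<gamma>) has_vector_derivative Y c (\<gamma> t)) (at t)"
    using tr unfolding trajectory_at_def by blast
  obtain T g g' where T: "open T" "coord c (\<gamma> t) \<in> T" and g: "(g has_derivative g') (at (coord c (\<gamma> t)))"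
    "g' (Y c (\<gamma> t)) = Y d (\<gamma> t)" and eq: "\<forall>q\<in>chart_dom c \<inter> chart_dom d. coord c q \<in> T \<longrightarrow> coord d q = g (coord c q)"
    using transition[OF c(1) d(1) c(2) d(2)] by blast
  have "(coord c \<circ> \<gamma> has_derivative (\<lambda>h. h *\<^sub>R Y c (\<gamma> t))) (at t)"
    using c(4) unfolding has_vector_derivative_def .
  from diff_chain_at[OF this, of g g'] g(1)
  have "(g \<circ> (coord c \<circ> \<gamma>) has_derivative g' \<circ> (\<lambda>h. h *\<^sub>R Y c (\<gamma> t))) (at t)" by simp
  then have gd: "((g \<circ> (coord c \<circ> \<gamma>)) has_vector_derivative Y d (\<gamma> t)) (at t)"
    unfolding has_vector_derivative_def
    by (rule has_derivative_eq_rhs)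
      (use g(2) linear_scale[OF has_derivative_linear[OF g(1)]] in \<open>auto simp: fun_eq_iff\<close>)
  have "isCont (coord c \<circ> \<gamma>) t" using c(4) by (rule has_vector_derivative_continuous)
  then have "eventually (\<lambda>s. (coord c \<circ> \<gamma>) s \<in> T) (nhds t)"
    using eventually_nhds_isCont T by (metis comp_apply)
  moreover have "eventually (\<lambda>s. \<gamma> s \<in> chart_dom d) (nhds t)"
    by (rule trajectory_eventually[OF tr chart_facts(1)[OF d(1)] d(2)])
  ultimately have "eventually (\<lambda>s. (g \<circ> (coord c \<circ> \<gamma>)) s = (coord d \<circ> \<gamma>) s) (nhds t)"
    using c(3) by eventually_elim (use eq in auto)
  then obtain S where "open S" "t \<in> S" "\<forall>s\<in>S. (g \<circ> (coord c \<circ> \<gamma>)) s = (coord d \<circ> \<gamma>) s"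
    unfolding eventually_nhds by blast
  then show ?thesis using has_vector_derivative_transform_within_open[OF gd, of S] by blast
qed

lemma trajectory_cong:
  assumes "eventually (\<lambda>s. \<gamma> s = \<gamma>' s) (nhds t)" "trajectory_at \<gamma> t"
  shows "trajectory_at \<gamma>' t"
proof -
  obtain S where S: "open S" "t \<in> S" "\<And>s. s \<in> S \<Longrightarrow> \<gamma> s = \<gamma>' s"
    using assms(1) unfolding eventually_nhds by blast
  obtain c where c: "c \<in> A" "\<gamma> t \<in> chart_dom c" "eventually (\<lambda>s. \<gamma> s \<in> chart_dom c) (nhds t)"
    "((coord c \<circ> \<gamma>) has_vector_derivative Y c (\<gamma> t)) (at t)"
    using assms(2) unfolding trajectory_at_def by blast
  have "((coord c \<circ> \<gamma>') has_vector_derivative Y c (\<gamma> t)) (at t)"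
    by (rule has_vector_derivative_transform_within_open[OF c(4) S(1,2)]) (use S(3) in auto)
  moreover have "eventually (\<lambda>s. \<gamma>' s \<in> chart_dom c) (nhds t)"
    using c(3) assms(1) by eventually_elim auto
  ultimately show ?thesis unfolding trajectory_at_def using c(1,2) S(2,3) by auto
qed

lemma trajectory_shift:
  assumes "trajectory_at \<gamma> (t + a)"
  shows "trajectory_at (\<lambda>s. \<gamma> (s + a)) t"
proof -
  obtain c where c: "c \<in> A" "\<gamma> (t + a) \<in> chart_dom c" "eventually (\<lambda>s. \<gamma> s \<in> chart_dom c) (nhds (t + a))"
    "((coord c \<circ> \<gamma>) has_vector_derivative Y c (\<gamma> (t + a))) (at (t + a))"
    using assms unfolding trajectory_at_def by blast
  have "((\<lambda>s. s + a) has_vector_derivative 1) (at t)" by (auto intro!: derivative_eq_intros)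
  from vector_diff_chain_at[OF this c(4)]
  have "((coord c \<circ> (\<lambda>s. \<gamma> (s + a))) has_vector_derivative Y c (\<gamma> (t + a))) (at t)"
    by (simp add: o_def)
  moreover have "eventually (\<lambda>s. \<gamma> (s + a) \<in> chart_dom c) (nhds t)"
  proof -
    have "filterlim (\<lambda>s. s + a) (nhds (t + a)) (nhds t)" by (intro tendsto_intros filterlim_ident)
    from eventually_compose_filterlim[OF c(3) this] show ?thesis .
  qed
  ultimately show ?thesis unfolding trajectory_at_def using c(1,2) by auto
qed


text \<open>Joint continuity in time and point at \<open>(t, q)\<close>, spelled out by
  neighbourhoods because it is also applied to local flows, which are meaningful only near
  \<open>q\<close>.\<close>

definition continuous_near :: "(real \<Rightarrow> 'a \<Rightarrow> 'a) \<Rightarrow> real \<Rightarrow> 'a \<Rightarrow> bool" where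
  "continuous_near P t q \<longleftrightarrow> (\<forall>U. openin W U \<longrightarrow> P t q \<in> U \<longrightarrow>
     (\<exists>e>0. \<exists>V. openin W V \<and> q \<in> V \<and> (\<forall>t' q'. \<bar>t' - t\<bar> < e \<longrightarrow> q' \<in> V \<longrightarrow> P t' q' \<in> U)))"

text \<open>The local flow of the extended field in one chart, carried back by
  \<open>chart_inv\<close>; that its curves stay in the chart image is the last clause of
  \<open>field\<close>.\<close>

lemma local_trajectories:
  assumes p: "p \<in> topspace W"
  shows "\<exists>V h P. openin W V \<and> p \<in> V \<and> h > 0 \<and> (\<forall>q\<in>V. P 0 q = q \<and>
    (\<forall>t. \<bar>t\<bar> < h \<longrightarrow> trajectory_at (\<lambda>t. P t q) t \<and> continuous_near P t q))"
proof -
  obtain c where c: "c \<in> A" "p \<in> chart_dom c" using p covers by blast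
  let ?x0 = "coord c p"
  obtain r L M F where r: "r > 0" "L \<ge> 0"
    and L: "\<forall>x\<in>cball ?x0 r. \<forall>y\<in>cball ?x0 r. norm (F x - F y) \<le> L * norm (x - y)"
    and M: "\<forall>x\<in>cball ?x0 r. norm (F x) \<le> M"
    and F: "\<forall>q\<in>chart_dom c. coord c q \<in> cball ?x0 r \<longrightarrow> F (coord c q) = Y c q"
    and inv: "\<forall>u h. u (0::real) \<in> chart_img c \<longrightarrow>
           (\<forall>t. \<bar>t\<bar> < h \<longrightarrow> u t \<in> ball ?x0 r \<and> (u has_vector_derivative F (u t)) (at t)) \<longrightarrow>
           (\<forall>t. \<bar>t\<bar> < h \<longrightarrow> u t \<in> chart_img c)"
    using field[OF c] by (elim exE conjE)
  obtain h u where h: "h > 0" and u0: "\<forall>x\<in>ball ?x0 (r / 2). u x 0 = x"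
    and u: "\<forall>x\<in>ball ?x0 (r / 2). \<forall>t. \<bar>t\<bar> < h \<longrightarrow> u x t \<in> ball ?x0 r \<and> (u x has_vector_derivative F (u x t)) (at t)"
    and uc: "continuous_on ({- h<..<h} \<times> ball ?x0 (r / 2)) (\<lambda>(t, x). u x t)"
    using local_flow[OF r(1) L[rule_format] r(2) M[rule_format]] .
  define V where "V = {q \<in> chart_dom c. coord c q \<in> ball ?x0 (r / 2)}"
  define P where "P t q = chart_inv c (u (coord c q) t)" for t q
  have V: "openin W V" unfolding V_def by (rule chart_facts(7)[OF c(1) open_ball])
  have pV: "p \<in> V" unfolding V_def using c(2) r(1) by simp
  have img: "u (coord c q) t \<in> chart_img c" if "q \<in> V" "\<bar>t\<bar> < h" for q t
  proof -
    have q: "q \<in> chart_dom c" "coord c q \<in> ball ?x0 (r / 2)" using that(1) by (auto simp: V_def)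
    have "u (coord c q) 0 \<in> chart_img c" using u0 q chart_facts(5)[OF c(1)] by simp
    then show ?thesis using inv[rule_format, of "u (coord c q)" h t] u q(2) that(2) by blast
  qed
  have P: "P t q \<in> chart_dom c" "coord c (P t q) = u (coord c q) t" if "q \<in> V" "\<bar>t\<bar> < h" for q t
    using chart_facts(4)[OF c(1) img[OF that]] unfolding P_def by auto
  have tr: "trajectory_at (\<lambda>t. P t q) t" if q: "q \<in> V" and t: "\<bar>t\<bar> < h" for q t
  proof -
    have qb: "coord c q \<in> ball ?x0 (r / 2)" using q by (auto simp: V_def)
    have *: "\<bar>s\<bar> < h" if "s \<in> {- h<..<h}" for s using that by auto
    have tI: "t \<in> {- h<..<h}" using t by auto
    have d: "(u (coord c q) has_vector_derivative F (u (coord c q) t)) (at t)" using u qb t by blast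
    have "((coord c \<circ> (\<lambda>t. P t q)) has_vector_derivative F (u (coord c q) t)) (at t)"
      by (rule has_vector_derivative_transform_within_open[OF d open_greaterThanLessThan tI])
        (use P(2)[OF q *] in auto)
    moreover have "F (u (coord c q) t) = Y c (P t q)"
    proof -
      have "u (coord c q) t \<in> ball ?x0 r" using u qb t by blast
      then show ?thesis using F[rule_format, OF P(1)[OF q t]] P(2)[OF q t] by simp
    qed
    moreover have "eventually (\<lambda>s. P s q \<in> chart_dom c) (nhds t)"
      unfolding eventually_nhds using tI P(1)[OF q *] by (intro exI[of _ "{- h<..<h}"]) auto
    ultimately show ?thesis unfolding trajectory_at_def using c(1) P(1)[OF q t] by auto
  qed
  have cn: "continuous_near P t q" if q: "q \<in> V" and t: "\<bar>t\<bar> < h" for q t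
    unfolding continuous_near_def
  proof (intro allI impI)
    fix U assume U: "openin W U" "P t q \<in> U"
    obtain T where T: "open T" "coord c ` (chart_dom c \<inter> U) = chart_img c \<inter> T"
      using chart_facts(6)[OF c(1) openin_Int[OF chart_facts(1)[OF c(1)] U(1)]] by blast
    let ?O = "({- h<..<h} \<times> ball ?x0 (r / 2)) \<inter> (\<lambda>(t, x). u x t) -` T"
    have "open ?O" by (rule continuous_open_preimage[OF uc _ T(1)]) (simp add: open_Times)
    moreover have "(t, coord c q) \<in> ?O"
    proof -
      have "coord c (P t q) \<in> T" using T(2) P(1)[OF q t] U(2) by blast
      then show ?thesis using P(2)[OF q t] q t by (auto simp: V_def)
    qed
    ultimately obtain B1 B2 where B: "open B1" "open B2" "t \<in> B1" "coord c q \<in> B2" "B1 \<times> B2 \<subseteq> ?O"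
      by (rule open_prod_elim) auto
    obtain e where e: "e > 0" "ball t e \<subseteq> B1" using B(1,3) by (meson openE)
    let ?V = "{q' \<in> chart_dom c. coord c q' \<in> B2}"
    have "P t' q' \<in> U" if t': "\<bar>t' - t\<bar> < e" and q': "q' \<in> ?V" for t' q'
    proof -
      have "t' \<in> B1" using t' e(2) by (auto simp: dist_real_def abs_minus_commute subset_iff)
      then have O: "(t', coord c q') \<in> ?O" using q' B(5) by blast
      then have V': "q' \<in> V" "\<bar>t'\<bar> < h" using q' by (auto simp: V_def)
      have "coord c (P t' q') \<in> chart_img c \<inter> T" using O P(2)[OF V'] img[OF V'] by auto
      then obtain q'' where "q'' \<in> chart_dom c" "q'' \<in> U" "coord c (P t' q') = coord c q''"
        unfolding T(2)[symmetric] by blast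
      then show ?thesis using inj_onD[OF chart_facts(2)[OF c(1)], of "P t' q'" q''] P(1)[OF V'] by simp
    qed
    moreover have "openin W ?V" by (rule chart_facts(7)[OF c(1) B(2)])
    moreover have "q \<in> ?V" using q B(4) by (auto simp: V_def)
    ultimately show "\<exists>e>0. \<exists>V. openin W V \<and> q \<in> V \<and> (\<forall>t' q'. \<bar>t' - t\<bar> < e \<longrightarrow> q' \<in> V \<longrightarrow> P t' q' \<in> U)"
      using e(1) by (intro exI[of _ e] exI[of _ ?V] conjI) blast+
  qed
  have "P 0 q = q" if "q \<in> V" for q
    using that u0 chart_facts(3)[OF c(1)] unfolding P_def V_def by auto
  with V pV h tr cn show ?thesis by (intro exI[of _ V] exI[of _ h] exI[of _ P]) auto
qed

text \<open>Near \<open>t\<close> both curves run in one chart and solve the same Lipschitz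
  equation, so the Gronwall estimate applies with initial distance zero.\<close>

lemma trajectory_unique_near:
  assumes e: "e > 0" and tr: "\<And>s. \<bar>s - t\<bar> < e \<Longrightarrow> trajectory_at \<gamma> s" "\<And>s. \<bar>s - t\<bar> < e \<Longrightarrow> trajectory_at \<gamma>' s"
    and eq: "\<gamma> t = \<gamma>' t"
  shows "\<exists>d>0. \<forall>s. \<bar>s - t\<bar> < d \<longrightarrow> \<gamma> s = \<gamma>' s"
proof -
  have t0: "trajectory_at \<gamma> t" "trajectory_at \<gamma>' t" using tr e by auto
  obtain c where c: "c \<in> A" "\<gamma> t \<in> chart_dom c" using trajectory_in[OF t0(1)] covers by blast
  let ?x0 = "coord c (\<gamma> t)"
  obtain r L M F where r: "r > 0" "L \<ge> 0"
    and L: "\<forall>x\<in>cball ?x0 r. \<forall>y\<in>cball ?x0 r. norm (F x - F y) \<le> L * norm (x - y)"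
    and M: "\<forall>x\<in>cball ?x0 r. norm (F x) \<le> M"
    and F: "\<forall>q\<in>chart_dom c. coord c q \<in> cball ?x0 r \<longrightarrow> F (coord c q) = Y c q"
    using field[OF c] by (elim exE conjE)
  let ?N = "{q \<in> chart_dom c. coord c q \<in> ball ?x0 r}"
  have N: "openin W ?N" by (rule chart_facts(7)[OF c(1) open_ball])
  have "eventually (\<lambda>s. \<gamma> s \<in> ?N) (nhds t)"
    by (rule trajectory_eventually[OF t0(1) N]) (use c(2) r(1) in simp)
  moreover have "eventually (\<lambda>s. \<gamma>' s \<in> ?N) (nhds t)"
    by (rule trajectory_eventually[OF t0(2) N]) (use c(2) r(1) eq in simp)
  ultimately have "eventually (\<lambda>s. \<gamma> s \<in> ?N \<and> \<gamma>' s \<in> ?N) (nhds t)" by (rule eventually_conj)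
  then obtain d0 where d0: "d0 > 0" "\<And>s. dist s t < d0 \<Longrightarrow> \<gamma> s \<in> ?N \<and> \<gamma>' s \<in> ?N"
    unfolding eventually_nhds_metric by blast
  define d where "d = min d0 e"
  have d: "d > 0" using d0(1) e by (simp add: d_def)
  have dN: "\<gamma> (s + t) \<in> ?N" "\<gamma>' (s + t) \<in> ?N" "trajectory_at \<gamma> (s + t)" "trajectory_at \<gamma>' (s + t)" if "\<bar>s\<bar> < d" for s
    using d0(2)[of "s + t"] tr[of "s + t"] that by (auto simp: d_def dist_real_def)
  have der: "((\<lambda>s. coord c (\<beta> (s + t))) has_vector_derivative F (coord c (\<beta> (s + t)))) (at s)"
    if "\<beta> (s + t) \<in> ?N" "trajectory_at \<beta> (s + t)" for \<beta> :: "real \<Rightarrow> 'a" and s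
  proof -
    have in_dom: "\<beta> (s + t) \<in> chart_dom c" using that(1) by simp
    from trajectory_derivative[OF trajectory_shift[OF that(2)] c(1)] in_dom
    have "((coord c \<circ> (\<lambda>s. \<beta> (s + t))) has_vector_derivative Y c (\<beta> (s + t))) (at s)" by simp
    moreover have "F (coord c (\<beta> (s + t))) = Y c (\<beta> (s + t))" using F that(1) by auto
    ultimately show ?thesis by (simp add: o_def)
  qed
  have "\<gamma> s = \<gamma>' s" if s: "\<bar>s - t\<bar> < d" for s
  proof -
    have "norm (coord c (\<gamma> (s - t + t)) - coord c (\<gamma>' (s - t + t))) \<le> exp (L * \<bar>s - t\<bar>) * norm (coord c (\<gamma> (0 + t)) - coord c (\<gamma>' (0 + t)))"
    proof (rule gronwall[OF s, where u = "\<lambda>s. coord c (\<gamma> (s + t))" and v = "\<lambda>s. coord c (\<gamma>' (s + t))"])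
      fix s assume s: "\<bar>s\<bar> < d"
      show "((\<lambda>s. coord c (\<gamma> (s + t))) has_vector_derivative F (coord c (\<gamma> (s + t)))) (at s)"
        by (rule der[OF dN(1,3)[OF s]])
      show "((\<lambda>s. coord c (\<gamma>' (s + t))) has_vector_derivative F (coord c (\<gamma>' (s + t)))) (at s)"
        by (rule der[OF dN(2,4)[OF s]])
      show "norm (F (coord c (\<gamma> (s + t))) - F (coord c (\<gamma>' (s + t)))) \<le> L * norm (coord c (\<gamma> (s + t)) - coord c (\<gamma>' (s + t)))"
        using dN(1,2)[OF s] L by simp
    qed
    then have "coord c (\<gamma> s) = coord c (\<gamma>' s)" using eq by simp
    moreover have "\<gamma> s \<in> chart_dom c" "\<gamma>' s \<in> chart_dom c" using dN(1,2)[of "s - t"] s by auto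
    ultimately show ?thesis using inj_onD[OF chart_facts(2)[OF c(1)]] by blast
  qed
  with d show ?thesis by blast
qed

text \<open>Connectedness of the interval: agreement is an open condition by local uniqueness, and
  disagreement is open because \<open>W\<close> is Hausdorff.\<close>

lemma trajectory_unique:
  assumes tr: "\<And>s. s \<in> {a<..<b} \<Longrightarrow> trajectory_at \<gamma> s" "\<And>s. s \<in> {a<..<b} \<Longrightarrow> trajectory_at \<gamma>' s"
    and t0: "t0 \<in> {a<..<b}" "\<gamma> t0 = \<gamma>' t0" and t: "t \<in> {a<..<b}"
  shows "\<gamma> t = \<gamma>' t"
proof (rule ccontr)
  assume ne: "\<gamma> t \<noteq> \<gamma>' t"
  let ?S = "{s \<in> {a<..<b}. \<gamma> s = \<gamma>' s}" and ?R = "{s \<in> {a<..<b}. \<gamma> s \<noteq> \<gamma>' s}"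
  have "open ?S"
    unfolding open_dist
  proof
    fix s assume s: "s \<in> ?S"
    define e where "e = min (s - a) (b - s)"
    have e: "e > 0" "\<And>x. \<bar>x - s\<bar> < e \<Longrightarrow> x \<in> {a<..<b}" using s by (auto simp: e_def)
    obtain d where d: "d > 0" "\<forall>x. \<bar>x - s\<bar> < d \<longrightarrow> \<gamma> x = \<gamma>' x"
      using trajectory_unique_near[OF e(1) tr(1)[OF e(2)] tr(2)[OF e(2)]] s by blast
    show "\<exists>e>0. \<forall>y. dist y s < e \<longrightarrow> y \<in> ?S"
      using d e by (intro exI[of _ "min d e"]) (auto simp: dist_real_def)
  qed
  moreover have "open ?R"
    unfolding open_dist
  proof
    fix s assume s: "s \<in> ?R"
    have ts: "trajectory_at \<gamma> s" "trajectory_at \<gamma>' s" using tr s by auto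
    obtain U V where UV: "openin W U" "openin W V" "\<gamma> s \<in> U" "\<gamma>' s \<in> V" "disjnt U V"
      using Hausdorff trajectory_in[OF ts(1)] trajectory_in[OF ts(2)] s unfolding Hausdorff_space_def by blast
    have "eventually (\<lambda>x. \<gamma> x \<in> U) (nhds s)" "eventually (\<lambda>x. \<gamma>' x \<in> V) (nhds s)"
      using trajectory_eventually[OF ts(1) UV(1,3)] trajectory_eventually[OF ts(2) UV(2,4)] by auto
    then have "eventually (\<lambda>x. \<gamma> x \<in> U \<and> \<gamma>' x \<in> V) (nhds s)" by (rule eventually_conj)
    then obtain d where d: "d > 0" "\<And>x. dist x s < d \<Longrightarrow> \<gamma> x \<in> U \<and> \<gamma>' x \<in> V"
      unfolding eventually_nhds_metric by blast
    have "\<gamma> x \<noteq> \<gamma>' x" if "dist x s < d" for x using d(2)[OF that] UV(5) unfolding disjnt_def by auto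
    moreover have "\<exists>e>0. \<forall>x. dist x s < e \<longrightarrow> x \<in> {a<..<b}"
      using s by (intro exI[of _ "min (s - a) (b - s)"]) (auto simp: dist_real_def)
    ultimately show "\<exists>e>0. \<forall>y. dist y s < e \<longrightarrow> y \<in> ?R"
      using d(1) by (metis (mono_tags, lifting) mem_Collect_eq min_less_iff_conj)
  qed
  moreover have "?S \<inter> ?R \<inter> {a<..<b} = {}" "{a<..<b} \<subseteq> ?S \<union> ?R" by auto
  ultimately have "?S \<inter> {a<..<b} = {} \<or> ?R \<inter> {a<..<b} = {}"
    using connectedD[OF connected_Ioo, of ?S ?R a b] by blast
  then show False using t0 t ne by blast
qed


section \<open>Completeness and continuity of the flow\<close>

lemma uniform_trajectories:
  "\<exists>h>0. \<forall>p\<in>topspace W. \<exists>\<gamma>. \<gamma> 0 = p \<and> (\<forall>t. \<bar>t\<bar> < h \<longrightarrow> trajectory_at \<gamma> t)"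
proof -
  define Q where "Q p V h \<longleftrightarrow> openin W V \<and> p \<in> V \<and> h > 0 \<and>
      (\<forall>q\<in>V. \<exists>\<gamma>. \<gamma> 0 = q \<and> (\<forall>t. \<bar>t\<bar> < h \<longrightarrow> trajectory_at \<gamma> t))" for p V and h :: real
  have "\<exists>V h. Q p V h" if p: "p \<in> topspace W" for p
  proof -
    obtain V h P where V: "openin W V" "p \<in> V" "h > 0" "\<forall>q\<in>V. P 0 q = q \<and>
      (\<forall>t. \<bar>t\<bar> < h \<longrightarrow> trajectory_at (\<lambda>t. P t q) t \<and> continuous_near P t q)"
      using local_trajectories[OF p] by (elim exE conjE)
    have "\<exists>\<gamma>. \<gamma> 0 = q \<and> (\<forall>t. \<bar>t\<bar> < h \<longrightarrow> trajectory_at \<gamma> t)" if "q \<in> V" for q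
      using V(4) that by (intro exI[of _ "\<lambda>t. P t q"]) simp
    with V(1-3) have "Q p V h" unfolding Q_def by simp
    then show ?thesis by blast
  qed
  then obtain V h where Q: "\<And>p. p \<in> topspace W \<Longrightarrow> Q p (V p) (h p)" by metis
  have op: "openin W (V p)" if "p \<in> topspace W" for p using Q[OF that] unfolding Q_def by simp
  have mem: "\<exists>i\<in>topspace W. p \<in> V i" if "p \<in> topspace W" for p
    by (rule bexI[OF _ that]) (use Q[OF that] in \<open>simp add: Q_def\<close>)
  obtain D where D: "finite D" "D \<subseteq> topspace W" "topspace W \<subseteq> (\<Union>p\<in>D. V p)"
    by (rule compactin_finite_index[OF compact[unfolded compact_space_def] op mem])
  define d where "d = Min (insert 1 (h ` D))"
  have "h p > 0" if "p \<in> D" for p using Q[of p] that D(2) unfolding Q_def by blast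
  then have d: "d > 0" "\<And>p. p \<in> D \<Longrightarrow> d \<le> h p" using D(1) by (auto simp: d_def)
  have "\<exists>\<gamma>. \<gamma> 0 = q \<and> (\<forall>t. \<bar>t\<bar> < d \<longrightarrow> trajectory_at \<gamma> t)" if q: "q \<in> topspace W" for q
  proof -
    obtain p where p: "p \<in> D" "q \<in> V p" using D(3) q by blast
    then obtain \<gamma> where "\<gamma> 0 = q" "\<forall>t. \<bar>t\<bar> < h p \<longrightarrow> trajectory_at \<gamma> t"
      using Q[of p] D(2) unfolding Q_def by blast
    with d(2)[OF p(1)] show ?thesis by (intro exI[of _ \<gamma>]) auto
  qed
  with d(1) show ?thesis by blast
qed

text \<open>Restart at distance \<open>h / 2\<close> before either end: the new piece lives for the
  time \<open>h\<close>, so it reaches \<open>h / 2\<close> beyond the end, and uniqueness makes it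
  agree with \<open>\<gamma>\<close> on the overlap.\<close>

lemma trajectory_extend:
  assumes h: "h > 0" and loc: "\<forall>p\<in>topspace W. \<exists>\<gamma>. \<gamma> 0 = p \<and> (\<forall>t. \<bar>t\<bar> < h \<longrightarrow> trajectory_at \<gamma> t)"
    and T: "h \<le> T" and \<gamma>: "\<And>t. \<bar>t\<bar> < T \<Longrightarrow> trajectory_at \<gamma> t"
  shows "\<exists>\<gamma>'. \<gamma>' 0 = \<gamma> 0 \<and> (\<forall>t. \<bar>t\<bar> < T + h / 2 \<longrightarrow> trajectory_at \<gamma>' t)"
proof -
  have cont: "\<exists>\<beta>. (\<forall>t. \<bar>t - a\<bar> < h \<longrightarrow> trajectory_at \<beta> t) \<and> (\<forall>t. \<bar>t\<bar> < T \<longrightarrow> \<bar>t - a\<bar> < h \<longrightarrow> \<beta> t = \<gamma> t)"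
    if a: "\<bar>a\<bar> < T" for a
  proof -
    obtain \<beta> where \<beta>: "\<beta> 0 = \<gamma> a" "\<forall>t. \<bar>t\<bar> < h \<longrightarrow> trajectory_at \<beta> t"
      using loc trajectory_in[OF \<gamma>[OF a]] by blast
    have tr: "trajectory_at (\<lambda>s. \<beta> (s - a)) t" if "\<bar>t - a\<bar> < h" for t
      using trajectory_shift[of \<beta> t "- a"] \<beta>(2) that by simp
    have "\<beta> (t - a) = \<gamma> t" if t: "\<bar>t\<bar> < T" "\<bar>t - a\<bar> < h" for t
    proof (rule trajectory_unique[where \<gamma> = "\<lambda>s. \<beta> (s - a)" and \<gamma>' = \<gamma> and a = "max (- T) (a - h)" and b = "min T (a + h)" and ?t0.0 = a])
      show "a \<in> {max (- T) (a - h)<..<min T (a + h)}" using a h by auto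
      show "t \<in> {max (- T) (a - h)<..<min T (a + h)}" using t by auto
    qed (use tr \<gamma> \<beta>(1) in auto)
    with tr show ?thesis by (intro exI[of _ "\<lambda>s. \<beta> (s - a)"]) auto
  qed
  have a1: "\<bar>T - h / 2\<bar> < T" and a2: "\<bar>h / 2 - T\<bar> < T" using h T by auto
  obtain \<beta>1 where b1: "\<forall>t. \<bar>t - (T - h / 2)\<bar> < h \<longrightarrow> trajectory_at \<beta>1 t"
    "\<forall>t. \<bar>t\<bar> < T \<longrightarrow> \<bar>t - (T - h / 2)\<bar> < h \<longrightarrow> \<beta>1 t = \<gamma> t" using cont[OF a1] by blast
  obtain \<beta>2 where b2: "\<forall>t. \<bar>t - (h / 2 - T)\<bar> < h \<longrightarrow> trajectory_at \<beta>2 t"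
    "\<forall>t. \<bar>t\<bar> < T \<longrightarrow> \<bar>t - (h / 2 - T)\<bar> < h \<longrightarrow> \<beta>2 t = \<gamma> t" using cont[OF a2] by blast
  define \<gamma>' where "\<gamma>' t = (if \<bar>t\<bar> < T then \<gamma> t else if t > 0 then \<beta>1 t else \<beta>2 t)" for t
  have "trajectory_at \<gamma>' t" if t: "\<bar>t\<bar> < T + h / 2" for t
  proof -
    consider "\<bar>t\<bar> < T" | "T \<le> t" | "t \<le> - T" by linarith
    then show ?thesis
    proof cases
      case 1
      have "eventually (\<lambda>s. s \<in> {- T<..<T}) (nhds t)" using 1 by (intro eventually_nhds_in_open) auto
      then have "eventually (\<lambda>s. \<gamma> s = \<gamma>' s) (nhds t)" by eventually_elim (auto simp: \<gamma>'_def)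
      then show ?thesis by (rule trajectory_cong[OF _ \<gamma>[OF 1]])
    next
      case 2
      have "eventually (\<lambda>s. s \<in> {T - h / 2<..<T + h / 2}) (nhds t)"
        using 2 t h by (intro eventually_nhds_in_open) auto
      then have "eventually (\<lambda>s. \<beta>1 s = \<gamma>' s) (nhds t)"
      proof eventually_elim
        case (elim s)
        then have "s > 0" "\<bar>s - (T - h / 2)\<bar> < h" using T h by auto
        then show ?case using b1(2) unfolding \<gamma>'_def by auto
      qed
      moreover have "trajectory_at \<beta>1 t" using b1(1) 2 t h by auto
      ultimately show ?thesis by (rule trajectory_cong)
    next
      case 3
      have "eventually (\<lambda>s. s \<in> {- T - h / 2<..<h / 2 - T}) (nhds t)"
        using 3 t h by (intro eventually_nhds_in_open) auto
      then have "eventually (\<lambda>s. \<beta>2 s = \<gamma>' s) (nhds t)"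
      proof eventually_elim
        case (elim s)
        then have "\<not> s > 0" "\<bar>s - (h / 2 - T)\<bar> < h" using T h by auto
        then show ?case using b2(2) unfolding \<gamma>'_def by auto
      qed
      moreover have "trajectory_at \<beta>2 t" using b2(1) 3 t h by auto
      ultimately show ?thesis by (rule trajectory_cong)
    qed
  qed
  moreover have "\<gamma>' 0 = \<gamma> 0" using h T by (simp add: \<gamma>'_def)
  ultimately show ?thesis by blast
qed

text \<open>Each extension gains the same amount \<open>h / 2\<close>, so the lifetimes
  \<open>T n\<close> are unbounded; by uniqueness the curves agree wherever two of them are
  trajectories, and they glue.\<close>

lemma global_trajectory:
  assumes p: "p \<in> topspace W"
  shows "\<exists>\<gamma>. \<gamma> 0 = p \<and> (\<forall>t. trajectory_at \<gamma> t)"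
proof -
  obtain h where h: "h > 0" "\<forall>p\<in>topspace W. \<exists>\<gamma>. \<gamma> 0 = p \<and> (\<forall>t. \<bar>t\<bar> < h \<longrightarrow> trajectory_at \<gamma> t)"
    using uniform_trajectories by blast
  define T where "T n = h + real n * (h / 2)" for n
  have "\<exists>\<gamma>. \<gamma> 0 = p \<and> (\<forall>t. \<bar>t\<bar> < T n \<longrightarrow> trajectory_at \<gamma> t)" for n
  proof (induction n)
    case 0
    then show ?case using h(2) p by (simp add: T_def)
  next
    case (Suc n)
    then obtain \<gamma> where \<gamma>: "\<gamma> 0 = p" "\<And>t. \<bar>t\<bar> < T n \<Longrightarrow> trajectory_at \<gamma> t" by blast
    have "h \<le> T n" using h(1) by (simp add: T_def)
    from trajectory_extend[OF h this \<gamma>(2)] \<gamma>(1) show ?case by (simp add: T_def algebra_simps add_divide_distrib)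
  qed
  then obtain \<gamma> where \<gamma>: "\<And>n. \<gamma> n 0 = p" "\<And>n t. \<bar>t\<bar> < T n \<Longrightarrow> trajectory_at (\<gamma> n) t" by metis
  have ex: "\<exists>n. \<bar>t\<bar> < T n" for t
  proof -
    obtain n where "\<bar>t\<bar> / (h / 2) < real n" using reals_Archimedean2 by blast
    then have "\<bar>t\<bar> < real n * (h / 2)" using h(1) by (simp add: field_simps)
    then show ?thesis unfolding T_def using h(1) by (intro exI[of _ n]) linarith
  qed
  have agree: "\<gamma> n t = \<gamma> m t" if "\<bar>t\<bar> < T n" "\<bar>t\<bar> < T m" for n m t
  proof (rule trajectory_unique[where a = "- min (T n) (T m)" and b = "min (T n) (T m)" and ?t0.0 = 0])
    have "T n > 0" "T m > 0" using h(1) by (simp_all add: T_def add_pos_nonneg)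
    then show "0 \<in> {- min (T n) (T m)<..<min (T n) (T m)}" by auto
  qed (use that \<gamma> in auto)
  define N where "N t = (SOME n. \<bar>t\<bar> < T n)" for t
  have N: "\<bar>t\<bar> < T (N t)" for t unfolding N_def using ex by (rule someI_ex)
  have "trajectory_at (\<lambda>t. \<gamma> (N t) t) t" for t
  proof (rule trajectory_cong[OF _ \<gamma>(2)[OF N]])
    have "eventually (\<lambda>s. s \<in> {- T (N t)<..<T (N t)}) (nhds t)"
      using N[of t] by (intro eventually_nhds_in_open) (auto simp: abs_less_iff)
    then show "eventually (\<lambda>s. \<gamma> (N t) s = \<gamma> (N s) s) (nhds t)"
      by eventually_elim (rule agree[OF _ N], auto simp: abs_less_iff)
  qed
  then show ?thesis using \<gamma>(1) by (intro exI[of _ "\<lambda>t. \<gamma> (N t) t"]) simp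
qed

definition flow :: "real \<Rightarrow> 'a \<Rightarrow> 'a" where
  "flow t p = (SOME \<gamma>. \<gamma> 0 = p \<and> (\<forall>t. trajectory_at \<gamma> t)) t"

lemma flow_trajectory:
  assumes "p \<in> topspace W"
  shows "flow 0 p = p" "trajectory_at (\<lambda>t. flow t p) t"
  using someI_ex[OF global_trajectory[OF assms]] unfolding flow_def by auto

lemma flow_unique:
  assumes "\<And>s. \<bar>s\<bar> < h \<Longrightarrow> trajectory_at \<gamma> s" "\<bar>t\<bar> < h"
  shows "\<gamma> t = flow t (\<gamma> 0)"
proof -
  have "trajectory_at \<gamma> 0" using assms by auto
  then have g: "\<gamma> 0 \<in> topspace W" by (rule trajectory_in)
  show ?thesis
  proof (rule trajectory_unique[where \<gamma>' = "\<lambda>t. flow t (\<gamma> 0)" and a = "- h" and b = h and ?t0.0 = 0])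
    show "t \<in> {- h<..<h}" "0 \<in> {- h<..<h}" using assms(2) by auto
  qed (use assms(1) flow_trajectory[OF g] in auto)
qed

lemma flow_in: "p \<in> topspace W \<Longrightarrow> flow t p \<in> topspace W"
  using flow_trajectory(2) by (rule trajectory_in)

lemma flow_add:
  assumes p: "p \<in> topspace W"
  shows "flow (s + t) p = flow s (flow t p)"
proof -
  have "(\<lambda>s. flow (s + t) p) s = flow s ((\<lambda>s. flow (s + t) p) 0)"
    by (rule flow_unique[of "\<bar>s\<bar> + 1"])
      (use trajectory_shift[of "\<lambda>t. flow t p", OF flow_trajectory(2)[OF p]] in auto)
  then show ?thesis by simp
qed

text \<open>Time doubling: compactness gives continuity for all times below some \<open>d\<close>,
  uniformly in the point. Since \<open>flow t\<close> is \<open>flow (t / 2)\<close> applied twice,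
  the range of times with continuity can be doubled again and again.\<close>

lemma continuous_near_flow:
  assumes p: "p \<in> topspace W"
  shows "continuous_near flow t p"
proof -
  define R where "R p V h \<longleftrightarrow> openin W V \<and> p \<in> V \<and> h > 0 \<and> (\<forall>q\<in>V. \<forall>t. \<bar>t\<bar> < h \<longrightarrow> continuous_near flow t q)"
    for p V and h :: real
  have "\<exists>V h. R p V h" if p: "p \<in> topspace W" for p
  proof -
    obtain V h P where V: "openin W V" "p \<in> V" "h > 0" and P: "\<forall>q\<in>V. P 0 q = q \<and>
      (\<forall>t. \<bar>t\<bar> < h \<longrightarrow> trajectory_at (\<lambda>t. P t q) t \<and> continuous_near P t q)"
      using local_trajectories[OF p] by (elim exE conjE)
    have eq: "P t q = flow t q" if "q \<in> V" "\<bar>t\<bar> < h" for q t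
      using flow_unique[of h "\<lambda>t. P t q" t] P that by simp
    have "continuous_near flow t q" if q: "q \<in> V" and t: "\<bar>t\<bar> < h" for q t
      unfolding continuous_near_def
    proof (intro allI impI)
      fix U assume U: "openin W U" "flow t q \<in> U"
      have "continuous_near P t q" using P q t by blast
      moreover have "P t q \<in> U" using eq[OF q t] U(2) by simp
      ultimately obtain e V' where e: "e > 0" "openin W V'" "q \<in> V'"
        "\<forall>t' q'. \<bar>t' - t\<bar> < e \<longrightarrow> q' \<in> V' \<longrightarrow> P t' q' \<in> U"
        using U(1) unfolding continuous_near_def by blast
      have "flow t' q' \<in> U" if "\<bar>t' - t\<bar> < min e (h - \<bar>t\<bar>)" "q' \<in> V \<inter> V'" for t' q'
      proof -
        have "\<bar>t'\<bar> < h" using that(1) by linarith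
        moreover have "P t' q' \<in> U" using e(4) that by auto
        ultimately show ?thesis using eq[of q' t'] that(2) by simp
      qed
      moreover have "min e (h - \<bar>t\<bar>) > 0" using e(1) t by simp
      moreover have "openin W (V \<inter> V')" using V(1) e(2) by (rule openin_Int)
      ultimately show "\<exists>e>0. \<exists>V. openin W V \<and> q \<in> V \<and> (\<forall>t' q'. \<bar>t' - t\<bar> < e \<longrightarrow> q' \<in> V \<longrightarrow> flow t' q' \<in> U)"
        using q e(3) by (intro exI[of _ "min e (h - \<bar>t\<bar>)"] conjI exI[of _ "V \<inter> V'"]) auto
    qed
    with V have "R p V h" unfolding R_def by blast
    then show ?thesis by blast
  qed
  then obtain V h where R: "\<And>p. p \<in> topspace W \<Longrightarrow> R p (V p) (h p)" by metis
  have op: "openin W (V p)" if "p \<in> topspace W" for p using R[OF that] unfolding R_def by simp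
  have mem: "\<exists>i\<in>topspace W. p \<in> V i" if "p \<in> topspace W" for p
    by (rule bexI[OF _ that]) (use R[OF that] in \<open>simp add: R_def\<close>)
  obtain D where D: "finite D" "D \<subseteq> topspace W" "topspace W \<subseteq> (\<Union>p\<in>D. V p)"
    by (rule compactin_finite_index[OF compact[unfolded compact_space_def] op mem])
  define d where "d = Min (insert 1 (h ` D))"
  have "h p > 0" if "p \<in> D" for p using R[of p] that D(2) unfolding R_def by blast
  then have d: "d > 0" "\<And>p. p \<in> D \<Longrightarrow> d \<le> h p" using D(1) by (auto simp: d_def)
  have base: "continuous_near flow t q" if q: "q \<in> topspace W" and t: "\<bar>t\<bar> < d" for q t
  proof -
    obtain p where p: "p \<in> D" "q \<in> V p" using D(3) q by blast
    have "\<bar>t\<bar> < h p" using t d(2)[OF p(1)] by linarith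
    then show ?thesis using R[of p] p D(2) unfolding R_def by blast
  qed
  have "\<forall>q\<in>topspace W. \<forall>t. \<bar>t\<bar> < 2 ^ n * d \<longrightarrow> continuous_near flow t q" for n
  proof (induction n)
    case 0
    then show ?case using base by simp
  next
    case (Suc n)
    show ?case
    proof (intro ballI allI impI)
      fix q t assume q: "q \<in> topspace W" and t: "\<bar>t\<bar> < 2 ^ Suc n * d"
      have t2: "\<bar>t / 2\<bar> < 2 ^ n * d" using t by simp
      have half: "flow s q' = flow (s / 2) (flow (s / 2) q')" if "q' \<in> topspace W" for s q'
        using flow_add[OF that, of "s / 2" "s / 2"] by simp
      show "continuous_near flow t q"
        unfolding continuous_near_def
      proof (intro allI impI)
        fix U assume U: "openin W U" "flow t q \<in> U"
        have "continuous_near flow (t / 2) (flow (t / 2) q)" using Suc t2 flow_in[OF q] by blast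
        then obtain e1 V1 where 1: "e1 > 0" "openin W V1" "flow (t / 2) q \<in> V1"
          "\<forall>t' q'. \<bar>t' - t / 2\<bar> < e1 \<longrightarrow> q' \<in> V1 \<longrightarrow> flow t' q' \<in> U"
          using U half[OF q] unfolding continuous_near_def by metis
        have "continuous_near flow (t / 2) q" using Suc t2 q by blast
        then obtain e2 V2 where 2: "e2 > 0" "openin W V2" "q \<in> V2"
          "\<forall>t' q'. \<bar>t' - t / 2\<bar> < e2 \<longrightarrow> q' \<in> V2 \<longrightarrow> flow t' q' \<in> V1"
          using 1(2,3) unfolding continuous_near_def by blast
        have "flow t' q' \<in> U" if "\<bar>t' - t\<bar> < min e1 e2" "q' \<in> V2" for t' q'
        proof -
          have "q' \<in> topspace W" using openin_subset[OF 2(2)] that(2) by blast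
          moreover have "\<bar>t' / 2 - t / 2\<bar> < e1" "\<bar>t' / 2 - t / 2\<bar> < e2" using that(1) by auto
          ultimately show ?thesis using half[of q' t'] 1(4) 2(4) that(2) by simp
        qed
        then show "\<exists>e>0. \<exists>V. openin W V \<and> q \<in> V \<and> (\<forall>t' q'. \<bar>t' - t\<bar> < e \<longrightarrow> q' \<in> V \<longrightarrow> flow t' q' \<in> U)"
          using 1(1) 2(1-3) by (intro exI[of _ "min e1 e2"] conjI exI[of _ V2]) auto
      qed
    qed
  qed
  moreover obtain n where "\<bar>t\<bar> / d < 2 ^ n" using real_arch_pow[of 2 "\<bar>t\<bar> / d"] by auto
  moreover from this have "\<bar>t\<bar> < 2 ^ n * d" using d(1) by (simp add: field_simps)
  ultimately show ?thesis using p by blast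
qed

lemma continuous_map_flow: "continuous_map (prod_topology euclideanreal W) W (\<lambda>(t, p). flow t p)"
  unfolding continuous_map_def
proof (intro conjI allI impI)
  show "(\<lambda>(t, p). flow t p) \<in> topspace (prod_topology euclideanreal W) \<rightarrow> topspace W"
    using flow_in by auto
  fix U assume U: "openin W U"
  show "openin (prod_topology euclideanreal W) {x \<in> topspace (prod_topology euclideanreal W). (case x of (t, p) \<Rightarrow> flow t p) \<in> U}"
    (is "openin _ ?O")
    unfolding openin_prod_topology_alt
  proof (intro allI impI)
    fix t p assume tp: "(t, p) \<in> ?O"
    then have "p \<in> topspace W" "flow t p \<in> U" by auto
    with continuous_near_flow[of p t] U obtain e V where e: "e > 0" "openin W V" "p \<in> V"
      "\<forall>t' q'. \<bar>t' - t\<bar> < e \<longrightarrow> q' \<in> V \<longrightarrow> flow t' q' \<in> U"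
      unfolding continuous_near_def by blast
    have "ball t e \<times> V \<subseteq> ?O"
    proof (rule subsetI)
      fix x assume x: "x \<in> ball t e \<times> V"
      obtain t' q' where xx: "x = (t', q')" by (cases x)
      have "t' \<in> ball t e" "q' \<in> V" using x xx by auto
      then have "flow t' q' \<in> U" "q' \<in> topspace W"
        using e(4) openin_subset[OF e(2)] by (auto simp: dist_real_def abs_minus_commute)
      then show "x \<in> ?O" using xx by simp
    qed
    then show "\<exists>A B. openin euclideanreal A \<and> openin W B \<and> t \<in> A \<and> p \<in> B \<and> A \<times> B \<subseteq> ?O"
      using e(1-3) by (intro exI[of _ "ball t e"] exI[of _ V]) simp
  qed
qed

end

section \<open>Half-space derivatives and pullbacks\<close>

lemma half_space_openE:
  assumes S: "openin (top_of_set half_space) S" and x: "x \<in> S"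
  obtains r where "r > 0" "half_space \<inter> ball x r \<subseteq> S"
proof -
  obtain O' where "open O'" "S = half_space \<inter> O'" using S unfolding openin_open by blast
  moreover from this x obtain r where "r > 0" "ball x r \<subseteq> O'" by (meson IntD2 openE)
  ultimately show thesis using that[of r] by blast
qed

text \<open>Small positive steps along the basis vectors stay in the half-space, as these vectors
  have nonnegative first component. This suffices for uniqueness of the derivative, even at the
  edge.\<close>

lemma frechet_derivative_half_space:
  fixes f :: "real \<times> 'f::euclidean_space \<Rightarrow> 'b::real_normed_vector"
  assumes S: "openin (top_of_set half_space) S" and x: "x \<in> S"
    and f: "(f has_derivative f') (at x within S)"
  shows "frechet_derivative f (at x within S) = f'"
proof -
  obtain r where r: "r > 0" "half_space \<inter> ball x r \<subseteq> S" by (rule half_space_openE[OF S x])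
  have "\<exists>d. 0 < \<bar>d\<bar> \<and> \<bar>d\<bar> < e \<and> x + d *\<^sub>R i \<in> S" if i: "i \<in> Basis" and e: "0 < e" for i e
  proof -
    define d where "d = min e r / 2"
    have d: "0 < d" "d < e" "d < r" using e r(1) by (auto simp: d_def)
    have xS: "fst x \<ge> 0" using x S by (auto simp: openin_open half_space_def)
    have "fst i \<ge> 0" using i by (auto simp: Basis_prod_def)
    then have "x + d *\<^sub>R i \<in> half_space" using xS d(1) by (simp add: half_space_def)
    moreover have "x + d *\<^sub>R i \<in> ball x r" using d i by (simp add: dist_norm)
    ultimately show ?thesis using r(2) d by (intro exI[of _ d]) auto
  qed
  moreover have "(f has_derivative frechet_derivative f (at x within S)) (at x within S)"
    using f by (meson differentiable_def frechet_derivative_works)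
  ultimately show ?thesis using f by (rule_tac frechet_derivative_unique_within[of f _ x S]) auto
qed

text \<open>Reduces the derivatives within chart images, as they occur in the definitions, to
  ordinary derivatives of a smooth extension. The coordinate computations below pass through
  this.\<close>

lemma frechet_derivative_half_space_ext:
  fixes f :: "real \<times> 'f::euclidean_space \<Rightarrow> 'b::real_normed_vector"
  assumes S: "openin (top_of_set half_space) S" and x: "x \<in> S" and T: "open T" "x \<in> T"
    and g: "(g has_derivative g') (at x)" and eq: "\<And>y. y \<in> S \<Longrightarrow> y \<in> T \<Longrightarrow> f y = g y"
  shows "frechet_derivative f (at x within S) = g'"
proof (rule frechet_derivative_half_space[OF S x])
  obtain e where e: "e > 0" "ball x e \<subseteq> T" using T by (meson openE)
  show "(f has_derivative g') (at x within S)"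
  proof (rule has_derivative_transform_within[OF has_derivative_at_withinI[OF g] e(1) x])
    show "g y = f y" if "y \<in> S" "dist y x < e" for y
    proof -
      have "y \<in> ball x e" using that(2) by (simp add: dist_commute)
      then show ?thesis using eq[OF that(1)] e(2) by auto
    qed
  qed
qed

lemma derivative_eq_on_half_space:
  fixes f g :: "real \<times> 'f::euclidean_space \<Rightarrow> 'b::real_normed_vector"
  assumes "openin (top_of_set half_space) S" "x \<in> S" "open T" "x \<in> T"
    "(f has_derivative f') (at x)" "(g has_derivative g') (at x)" "\<And>y. y \<in> S \<Longrightarrow> y \<in> T \<Longrightarrow> f y = g y"
  shows "f' = g'"
  using frechet_derivative_half_space_ext[OF assms(1-4,6,7)]
    frechet_derivative_half_space[OF assms(1,2) has_derivative_at_withinI[OF assms(5)]] by simp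

text \<open>The exterior derivative of a one-form in coordinates on an open set, with the sign
  convention of \<open>ext_deriv\<close>.\<close>

definition curl :: "('a::euclidean_space \<Rightarrow> 'a \<Rightarrow> real) \<Rightarrow> 'a \<Rightarrow> 'a \<Rightarrow> 'a \<Rightarrow> real" where
  "curl m x u v = frechet_derivative (\<lambda>y. m y v) (at x) u - frechet_derivative (\<lambda>y. m y u) (at x) v"

lemma frechet_derivative_symmetric_vec:
  fixes G :: "'a::euclidean_space \<Rightarrow> 'b::euclidean_space"
  assumes G: "smooth_open T G" and x: "x \<in> T"
  shows "frechet_derivative (\<lambda>y. frechet_derivative G (at y) u) (at x) v =
         frechet_derivative (\<lambda>y. frechet_derivative G (at y) v) (at x) u"
proof (rule euclidean_eqI)
  fix b :: 'b assume "b \<in> Basis"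
  have Gb: "smooth_open T (\<lambda>y. G y \<bullet> b)" by (rule smooth_open_linear[OF bounded_linear_inner_left G])
  have 1: "frechet_derivative (\<lambda>y. G y \<bullet> b) (at y) w = frechet_derivative G (at y) w \<bullet> b" if "y \<in> T" for y w
    using frechet_derivative_at[OF bounded_linear.has_derivative[OF bounded_linear_inner_left smooth_open_has_derivative[OF G that]]]
    by metis
  have 2: "frechet_derivative (\<lambda>y. frechet_derivative (\<lambda>y. G y \<bullet> b) (at y) w) (at x) =
      (\<lambda>v. frechet_derivative (\<lambda>y. frechet_derivative G (at y) w) (at x) v \<bullet> b)" for w
  proof (rule frechet_derivative_at[symmetric])
    show "((\<lambda>y. frechet_derivative (\<lambda>y. G y \<bullet> b) (at y) w) has_derivative
      (\<lambda>v. frechet_derivative (\<lambda>y. frechet_derivative G (at y) w) (at x) v \<bullet> b)) (at x)"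
      by (rule has_derivative_transform_within_open[OF bounded_linear.has_derivative[OF bounded_linear_inner_left
            smooth_open_has_derivative[OF smooth_open_deriv[OF G] x]] smooth_openD(1)[OF G] x])
        (use 1 in simp)
  qed
  show "frechet_derivative (\<lambda>y. frechet_derivative G (at y) u) (at x) v \<bullet> b =
    frechet_derivative (\<lambda>y. frechet_derivative G (at y) v) (at x) u \<bullet> b"
    using frechet_derivative_symmetric[OF Gb x, of u v] unfolding 2 .
qed

text \<open>\<open>m\<close> depends on a base point and linearly on a vector, and both move with
  \<open>y\<close>. Expanding the vector in \<open>Basis\<close> reduces this to the ordinary
  product rule, after which the two sums are collected again.\<close>

lemma pullback_derivative:
  fixes G :: "'a::euclidean_space \<Rightarrow> 'b::euclidean_space" and m :: "'b \<Rightarrow> 'b \<Rightarrow> real"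
  assumes G: "smooth_open T G" and m: "\<And>v. smooth_open T' (\<lambda>y. m y v)" and lin: "\<And>y. y \<in> T' \<Longrightarrow> linear (m y)"
    and GT: "\<And>y. y \<in> T \<Longrightarrow> G y \<in> T'" and x: "x \<in> T"
  shows "((\<lambda>y. m (G y) (frechet_derivative G (at y) v)) has_derivative
     (\<lambda>u. m (G x) (frechet_derivative (\<lambda>y. frechet_derivative G (at y) v) (at x) u) +
        frechet_derivative (\<lambda>y. m y (frechet_derivative G (at x) v)) (at (G x)) (frechet_derivative G (at x) u))) (at x)"
proof -
  let ?D = "\<lambda>y w. frechet_derivative G (at y) w"
  let ?DD = "\<lambda>u. frechet_derivative (\<lambda>y. frechet_derivative G (at y) v) (at x) u"
  have dG: "(G has_derivative ?D x) (at x)" by (rule smooth_open_has_derivative[OF G x])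
  have dD: "((\<lambda>y. ?D y v) has_derivative ?DD) (at x)"
    by (rule smooth_open_has_derivative[OF smooth_open_deriv[OF G] x])
  have dm: "((\<lambda>y. m y w) has_derivative frechet_derivative (\<lambda>y. m y w) (at (G x))) (at (G x))" for w
    by (rule smooth_open_has_derivative[OF m GT[OF x]])
  have expand: "m y w = (\<Sum>b\<in>Basis. (w \<bullet> b) * m y b)" if "y \<in> T'" for y w
    using frechet_expand[OF lin[OF that], of w] by simp
  have "((\<lambda>y. \<Sum>b\<in>Basis. (?D y v \<bullet> b) * m (G y) b) has_derivative
    (\<lambda>u. \<Sum>b\<in>Basis. (?D x v \<bullet> b) * frechet_derivative (\<lambda>y. m y b) (at (G x)) (?D x u) + (?DD u \<bullet> b) * m (G x) b)) (at x)"
    by (intro has_derivative_sum has_derivative_mult bounded_linear.has_derivative[OF bounded_linear_inner_left dD]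
        has_derivative_compose[OF dG dm])
  then have d: "((\<lambda>y. m (G y) (?D y v)) has_derivative
    (\<lambda>u. \<Sum>b\<in>Basis. (?D x v \<bullet> b) * frechet_derivative (\<lambda>y. m y b) (at (G x)) (?D x u) + (?DD u \<bullet> b) * m (G x) b)) (at x)"
    by (rule has_derivative_transform_within_open[OF _ smooth_openD(1)[OF G] x]) (use expand[OF GT] in simp)
  have lin2: "frechet_derivative (\<lambda>y. m y (?D x v)) (at (G x)) = (\<lambda>w. \<Sum>b\<in>Basis. (?D x v \<bullet> b) * frechet_derivative (\<lambda>y. m y b) (at (G x)) w)"
  proof (rule frechet_derivative_at[symmetric])
    have "((\<lambda>y. \<Sum>b\<in>Basis. (?D x v \<bullet> b) * m y b) has_derivative (\<lambda>w. \<Sum>b\<in>Basis. (?D x v \<bullet> b) * frechet_derivative (\<lambda>y. m y b) (at (G x)) w)) (at (G x))"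
      by (intro has_derivative_sum has_derivative_mult_right dm)
    then show "((\<lambda>y. m y (?D x v)) has_derivative (\<lambda>w. \<Sum>b\<in>Basis. (?D x v \<bullet> b) * frechet_derivative (\<lambda>y. m y b) (at (G x)) w)) (at (G x))"
      by (rule has_derivative_transform_within_open[OF _ smooth_openD(1)[OF m] GT[OF x]]) (use expand in simp)
  qed
  show ?thesis
  proof (rule has_derivative_eq_rhs[OF d], rule ext)
    fix u
    show "(\<Sum>b\<in>Basis. (?D x v \<bullet> b) * frechet_derivative (\<lambda>y. m y b) (at (G x)) (?D x u) + (?DD u \<bullet> b) * m (G x) b) =
      m (G x) (?DD u) + frechet_derivative (\<lambda>y. m y (?D x v)) (at (G x)) (?D x u)"
      unfolding lin2 by (subst expand[OF GT[OF x], of "?DD u"]) (simp add: sum.distrib)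
  qed
qed

text \<open>Exterior derivative and pullback commute: the terms with second derivatives of
  \<open>G\<close> cancel by symmetry.\<close>

lemma pullback_curl:
  fixes G :: "'a::euclidean_space \<Rightarrow> 'b::euclidean_space" and m :: "'b \<Rightarrow> 'b \<Rightarrow> real"
  assumes G: "smooth_open T G" and m: "\<And>v. smooth_open T' (\<lambda>y. m y v)" and lin: "\<And>y. y \<in> T' \<Longrightarrow> linear (m y)"
    and GT: "\<And>y. y \<in> T \<Longrightarrow> G y \<in> T'" and x: "x \<in> T"
  shows "curl (\<lambda>y v. m (G y) (frechet_derivative G (at y) v)) x u v =
    curl m (G x) (frechet_derivative G (at x) u) (frechet_derivative G (at x) v)"
proof -
  have d: "frechet_derivative (\<lambda>y. m (G y) (frechet_derivative G (at y) v)) (at x) =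
    (\<lambda>u. m (G x) (frechet_derivative (\<lambda>y. frechet_derivative G (at y) v) (at x) u) +
        frechet_derivative (\<lambda>y. m y (frechet_derivative G (at x) v)) (at (G x)) (frechet_derivative G (at x) u))" for v
    by (rule frechet_derivative_at[OF pullback_derivative[OF assms], symmetric])
  show ?thesis
    unfolding curl_def d by (simp add: frechet_derivative_symmetric_vec[OF G x, of u v])
qed

text \<open>On a compact ball the partial derivatives are bounded, and the sum of the bounds
  dominates the operator norm; convexity of the ball turns this into a Lipschitz estimate.\<close>

lemma smooth_open_lipschitz:
  fixes F :: "'a::euclidean_space \<Rightarrow> 'b::real_normed_vector"
  assumes F: "smooth_open T F" and r: "cball x0 r \<subseteq> T"
  obtains L where "L \<ge> 0" "\<forall>x\<in>cball x0 r. \<forall>y\<in>cball x0 r. norm (F x - F y) \<le> L * norm (x - y)"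
proof -
  have "\<exists>B. \<forall>x\<in>cball x0 r. norm (frechet_derivative F (at x) b) \<le> B" for b
  proof -
    have "continuous_on (cball x0 r) (\<lambda>x. frechet_derivative F (at x) b)"
      using smooth_open_continuous[OF smooth_open_deriv[OF F]] r by (rule continuous_on_subset)
    then have "bounded ((\<lambda>x. frechet_derivative F (at x) b) ` cball x0 r)"
      by (intro compact_imp_bounded compact_continuous_image compact_cball)
    then show ?thesis unfolding bounded_iff by auto
  qed
  then obtain B where B: "\<And>b x. x \<in> cball x0 r \<Longrightarrow> norm (frechet_derivative F (at x) b) \<le> B b" by metis
  define L where "L = (\<Sum>b\<in>Basis. \<bar>B b\<bar>)"
  have "norm (F x - F y) \<le> L * norm (x - y)" if "x \<in> cball x0 r" "y \<in> cball x0 r" for x y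
  proof (rule differentiable_bound[OF convex_cball, where f' = "\<lambda>x. frechet_derivative F (at x)"])
    fix z assume z: "z \<in> cball x0 r"
    have d: "(F has_derivative frechet_derivative F (at z)) (at z)"
      using smooth_open_has_derivative[OF F] r z by blast
    then show "(F has_derivative frechet_derivative F (at z)) (at z within cball x0 r)"
      by (rule has_derivative_at_withinI)
    show "onorm (frechet_derivative F (at z)) \<le> L"
    proof (rule onorm_le)
      fix v
      have "norm (frechet_derivative F (at z) v) = norm (\<Sum>b\<in>Basis. (v \<bullet> b) *\<^sub>R frechet_derivative F (at z) b)"
        using frechet_expand[OF has_derivative_linear[OF d], of v] by simp
      also have "\<dots> \<le> (\<Sum>b\<in>Basis. norm ((v \<bullet> b) *\<^sub>R frechet_derivative F (at z) b))" by (rule norm_sum)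
      also have "\<dots> \<le> (\<Sum>b\<in>Basis. norm v * \<bar>B b\<bar>)"
      proof (intro sum_mono)
        fix b :: 'a assume "b \<in> Basis"
        then have "\<bar>v \<bullet> b\<bar> \<le> norm v" by (rule Basis_le_norm)
        moreover have "norm (frechet_derivative F (at z) b) \<le> \<bar>B b\<bar>" using B[OF z, of b] by linarith
        ultimately show "norm ((v \<bullet> b) *\<^sub>R frechet_derivative F (at z) b) \<le> norm v * \<bar>B b\<bar>"
          by (auto intro!: mult_mono)
      qed
      finally show "norm (frechet_derivative F (at z) v) \<le> L * norm v"
        unfolding L_def by (simp add: sum_distrib_left[symmetric] mult.commute)
    qed
  qed (use that in auto)
  then show thesis using that[of L] unfolding L_def by (simp add: sum_nonneg)
qed

section \<open>Hamiltonians on Liouville surfaces\<close>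

abbreviation d1 :: "(real \<times> real \<Rightarrow> 'b::real_normed_vector) \<Rightarrow> real \<times> real \<Rightarrow> 'b" where
  "d1 f x \<equiv> frechet_derivative f (at x) (1, 0)"

abbreviation d2 :: "(real \<times> real \<Rightarrow> 'b::real_normed_vector) \<Rightarrow> real \<times> real \<Rightarrow> 'b" where
  "d2 f x \<equiv> frechet_derivative f (at x) (0, 1)"

lemma frechet_derivative_plane:
  fixes f :: "real \<times> real \<Rightarrow> real"
  assumes "(f has_derivative frechet_derivative f (at x)) (at x)"
  shows "frechet_derivative f (at x) v = fst v * d1 f x + snd v * d2 f x"
proof -
  interpret linear "frechet_derivative f (at x)" by (rule has_derivative_linear[OF assms])
  have "v = fst v *\<^sub>R (1, 0) + snd v *\<^sub>R (0, 1)" by (cases v) simp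
  then have "frechet_derivative f (at x) v = frechet_derivative f (at x) (fst v *\<^sub>R (1, 0) + snd v *\<^sub>R (0, 1))" by simp
  then show ?thesis unfolding add scaleR by simp
qed

definition plane_form :: "(real \<times> real \<Rightarrow> real) \<Rightarrow> (real \<times> real \<Rightarrow> real) \<Rightarrow> real \<times> real \<Rightarrow> real \<times> real \<Rightarrow> real" where
  "plane_form l1 l2 x v = fst v * l1 x + snd v * l2 x"

text \<open>The density of the exterior derivative of \<open>l1 dx + l2 dy\<close> with respect to
  the area form \<open>dx dy\<close>.\<close>

definition plane_curl :: "(real \<times> real \<Rightarrow> real) \<Rightarrow> (real \<times> real \<Rightarrow> real) \<Rightarrow> real \<times> real \<Rightarrow> real" where
  "plane_curl l1 l2 x = d1 l2 x - d2 l1 x"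

text \<open>With \<open>w = plane_curl l1 l2 x\<close> nonzero, the Hamiltonian field is
  \<open>(d2 h, - d1 h) / w\<close>, so that \<open>tau\<close> equals \<open>kappa / w\<close>. The
  quotient \<open>X_H / tau\<close> therefore has \<open>kappa\<close> as its only
  denominator.\<close>

definition kappa :: "(real \<times> real \<Rightarrow> real) \<Rightarrow> (real \<times> real \<Rightarrow> real) \<Rightarrow> (real \<times> real \<Rightarrow> real) \<Rightarrow> real \<times> real \<Rightarrow> real" where
  "kappa l1 l2 h x = l1 x * d2 h x - l2 x * d1 h x + h x * plane_curl l1 l2 x"

lemma plane_form_smooth: "smooth_open T l1 \<Longrightarrow> smooth_open T l2 \<Longrightarrow> smooth_open T (\<lambda>x. plane_form l1 l2 x v)"
  unfolding plane_form_def
  by (intro smooth_open_add smooth_open_linear[OF bounded_linear_mult_right])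

lemma plane_form_linear: "linear (plane_form l1 l2 x)"
  unfolding plane_form_def by (auto intro!: linearI simp: algebra_simps)

lemma curl_plane_form:
  assumes l: "smooth_open T l1" "smooth_open T l2" and x: "x \<in> T"
  shows "curl (plane_form l1 l2) x u v = (fst u * snd v - snd u * fst v) * plane_curl l1 l2 x"
proof -
  have "frechet_derivative (\<lambda>y. plane_form l1 l2 y v) (at x) u =
     fst v * (fst u * d1 l1 x + snd u * d2 l1 x) + snd v * (fst u * d1 l2 x + snd u * d2 l2 x)" for u v
  proof -
    note e = smooth_open_has_derivative[OF l(1) x] smooth_open_has_derivative[OF l(2) x]
    have "((\<lambda>y. plane_form l1 l2 y v) has_derivative (\<lambda>u. fst v * frechet_derivative l1 (at x) u + snd v * frechet_derivative l2 (at x) u)) (at x)"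
      unfolding plane_form_def by (intro has_derivative_add has_derivative_mult_right e)
    from frechet_derivative_at[OF this, symmetric] show ?thesis
      using frechet_derivative_plane[OF e(1), of u] frechet_derivative_plane[OF e(2), of u] by simp
  qed
  then show ?thesis unfolding curl_def plane_curl_def by (simp add: algebra_simps)
qed

locale liouville_surface =
  fixes W :: "'a topology" and A :: "('a, real) chart set" and lam :: "('a, real) one_form" and H :: "'a \<Rightarrow> real"
  assumes liouville: "liouville_domain W A lam" and admissible: "H \<in> admissible_hamiltonians W A lam"
begin

lemma manifold: "compact_manifold W A" and one_form: "smooth_one_form A lam"
  using liouville unfolding liouville_domain_def by auto

lemma W_Hausdorff: "Hausdorff_space W" and W_compact: "compact_space W"
  and charts: "c \<in> A \<Longrightarrow> topological_chart W c" and covers: "(\<Union>c\<in>A. chart_dom c) = topspace W"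
  and transitions: "c \<in> A \<Longrightarrow> d \<in> A \<Longrightarrow> smooth_on (overlap c d) (Defs.transition c d)"
  using manifold unfolding compact_manifold_def by auto

lemmas chart_facts = topological_chart_facts[OF charts]

lemma chart_img_open: "c \<in> A \<Longrightarrow> openin (top_of_set half_space) (chart_img c)"
  using charts unfolding topological_chart_def by auto

lemma chart_img_half: "c \<in> A \<Longrightarrow> p \<in> chart_dom c \<Longrightarrow> fst (coord c p) \<ge> 0"
  using chart_img_open[of c] chart_facts(5)[of c p] openin_imp_subset unfolding half_space_def by blast

text \<open>\<open>T\<close> is open in the plane, so at the boundary the three functions are
  extensions across it and ordinary derivatives can be used. The inclusion of
  \<open>half_space \<inter> T\<close> in the chart image says that every half-space point of
  \<open>T\<close> comes from a point of \<open>W\<close>.\<close>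

definition local_rep :: "('a, real) chart \<Rightarrow> (real \<times> real) set \<Rightarrow> (real \<times> real \<Rightarrow> real) \<Rightarrow> (real \<times> real \<Rightarrow> real) \<Rightarrow> (real \<times> real \<Rightarrow> real) \<Rightarrow> bool" where
  "local_rep c T l1 l2 h \<longleftrightarrow> c \<in> A \<and> smooth_open T l1 \<and> smooth_open T l2 \<and> smooth_open T h \<and> half_space \<inter> T \<subseteq> chart_img c \<and>
     (\<forall>q\<in>chart_dom c. coord c q \<in> T \<longrightarrow> lam c q = plane_form l1 l2 (coord c q) \<and> H q = h (coord c q))"

lemma local_rep_subset: "local_rep c T l1 l2 h \<Longrightarrow> open S \<Longrightarrow> S \<subseteq> T \<Longrightarrow> local_rep c S l1 l2 h"
  unfolding local_rep_def by (auto intro: smooth_open_subset)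

lemma local_rep_exists:
  assumes c: "c \<in> A" "p \<in> chart_dom c"
  obtains T l1 l2 h where "coord c p \<in> T" "local_rep c T l1 l2 h"
proof -
  note cf = chart_facts[OF c(1)]
  have x: "coord c p \<in> chart_img c" by (rule cf(5)[OF c(2)])
  have s: "smooth_on (chart_img c) (\<lambda>x. lam c (chart_inv c x) v)" for v
    using one_form c(1) unfolding smooth_one_form_def by blast
  have lin: "linear (lam c q)" if "q \<in> chart_dom c" for q
    using one_form c(1) that unfolding smooth_one_form_def by blast
  have sh: "smooth_on (chart_img c) (H \<circ> chart_inv c)"
    using admissible c(1) unfolding admissible_hamiltonians_def smooth_function_def by blast
  obtain T1 l1 where 1: "coord c p \<in> T1" "smooth_open T1 l1" "\<forall>y\<in>chart_img c \<inter> T1. lam c (chart_inv c y) (1, 0) = l1 y"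
    by (rule smooth_onE[OF s x])
  obtain T2 l2 where 2: "coord c p \<in> T2" "smooth_open T2 l2" "\<forall>y\<in>chart_img c \<inter> T2. lam c (chart_inv c y) (0, 1) = l2 y"
    by (rule smooth_onE[OF s x])
  obtain T3 h where 3: "coord c p \<in> T3" "smooth_open T3 h" "\<forall>y\<in>chart_img c \<inter> T3. (H \<circ> chart_inv c) y = h y"
    by (rule smooth_onE[OF sh x])
  obtain r where r: "r > 0" "half_space \<inter> ball (coord c p) r \<subseteq> chart_img c"
    by (rule half_space_openE[OF chart_img_open[OF c(1)] x])
  let ?T = "T1 \<inter> T2 \<inter> T3 \<inter> ball (coord c p) r"
  have o: "open ?T" by (intro open_Int smooth_openD(1)[OF 1(2)] smooth_openD(1)[OF 2(2)] smooth_openD(1)[OF 3(2)] open_ball)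
  have "lam c q = plane_form l1 l2 (coord c q) \<and> H q = h (coord c q)" if q: "q \<in> chart_dom c" "coord c q \<in> ?T" for q
  proof -
    have xi: "coord c q \<in> chart_img c" by (rule cf(5)[OF q(1)])
    have "lam c q v = plane_form l1 l2 (coord c q) v" for v
    proof -
      interpret linear "lam c q" by (rule lin[OF q(1)])
      have "v = fst v *\<^sub>R (1, 0) + snd v *\<^sub>R (0, 1)" by (cases v) simp
      then have "lam c q v = lam c q (fst v *\<^sub>R (1, 0) + snd v *\<^sub>R (0, 1))" by simp
      also have "\<dots> = fst v * lam c q (1, 0) + snd v * lam c q (0, 1)" unfolding add scaleR by simp
      finally show ?thesis
        using bspec[OF 1(3), of "coord c q"] bspec[OF 2(3), of "coord c q"] xi q cf(3)[OF q(1)]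
        unfolding plane_form_def by simp
    qed
    moreover have "H q = h (coord c q)" using bspec[OF 3(3), of "coord c q"] xi q cf(3)[OF q(1)] by simp
    ultimately show ?thesis by blast
  qed
  then have "local_rep c ?T l1 l2 h" unfolding local_rep_def
    using c(1) smooth_open_subset[OF 1(2) o] smooth_open_subset[OF 2(2) o] smooth_open_subset[OF 3(2) o] r(2) by auto
  moreover have "coord c p \<in> ?T" using 1 2 3 r(1) by simp
  ultimately show thesis by (rule that[rotated])
qed

lemma rep_facts:
  assumes "local_rep c T l1 l2 h"
  shows "c \<in> A" "smooth_open T l1" "smooth_open T l2" "smooth_open T h" "half_space \<inter> T \<subseteq> chart_img c"
    "\<And>q. q \<in> chart_dom c \<Longrightarrow> coord c q \<in> T \<Longrightarrow> lam c q = plane_form l1 l2 (coord c q)"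
    "\<And>q. q \<in> chart_dom c \<Longrightarrow> coord c q \<in> T \<Longrightarrow> H q = h (coord c q)"
  using assms unfolding local_rep_def by auto

context
  fixes c T l1 l2 h q
  assumes rep: "local_rep c T l1 l2 h" and q: "q \<in> chart_dom c" "coord c q \<in> T"
begin

lemmas rf = rep_facts[OF rep]

lemma ext_deriv_rep: "ext_deriv lam c q u v = (fst u * snd v - snd u * fst v) * plane_curl l1 l2 (coord c q)"
proof -
  note cf = chart_facts[OF rf(1)]
  have "frechet_derivative (\<lambda>x. lam c (chart_inv c x) v) (at (coord c q) within chart_img c) =
    frechet_derivative (\<lambda>x. plane_form l1 l2 x v) (at (coord c q))" for v
  proof (rule frechet_derivative_half_space_ext[OF chart_img_open[OF rf(1)] cf(5)[OF q(1)] smooth_openD(1)[OF rf(2)] q(2)])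
    show "((\<lambda>x. plane_form l1 l2 x v) has_derivative frechet_derivative (\<lambda>x. plane_form l1 l2 x v) (at (coord c q))) (at (coord c q))"
      by (rule smooth_open_has_derivative[OF plane_form_smooth[OF rf(2,3)] q(2)])
    show "lam c (chart_inv c y) v = plane_form l1 l2 y v" if "y \<in> chart_img c" "y \<in> T" for y
      using rf(6)[of "chart_inv c y"] cf(4)[OF that(1)] that(2) by simp
  qed
  then have "ext_deriv lam c q u v = curl (plane_form l1 l2) (coord c q) u v"
    unfolding ext_deriv_def curl_def by simp
  then show ?thesis using curl_plane_form[OF rf(2,3) q(2)] by simp
qed

lemma differential_rep: "differential H c q v = fst v * d1 h (coord c q) + snd v * d2 h (coord c q)"
proof -
  note cf = chart_facts[OF rf(1)]
  have d: "(h has_derivative frechet_derivative h (at (coord c q))) (at (coord c q))"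
    by (rule smooth_open_has_derivative[OF rf(4) q(2)])
  have eq: "frechet_derivative (H \<circ> chart_inv c) (at (coord c q) within chart_img c) = frechet_derivative h (at (coord c q))"
  proof (rule frechet_derivative_half_space_ext[OF chart_img_open[OF rf(1)] cf(5)[OF q(1)] smooth_openD(1)[OF rf(2)] q(2) d])
    show "(H \<circ> chart_inv c) y = h y" if "y \<in> chart_img c" "y \<in> T" for y
      using rf(7)[of "chart_inv c y"] cf(4)[OF that(1)] that(2) by simp
  qed
  show ?thesis unfolding differential_def eq by (rule frechet_derivative_plane[OF d])
qed

lemma plane_curl_nonzero: "plane_curl l1 l2 (coord c q) \<noteq> 0"
proof -
  have "\<forall>u. u \<noteq> 0 \<longrightarrow> (\<exists>v. ext_deriv lam c q u v \<noteq> 0)"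
  proof -
    have "\<forall>c\<in>A. \<forall>p\<in>chart_dom c. \<forall>u. u \<noteq> 0 \<longrightarrow> (\<exists>v. ext_deriv lam c p u v \<noteq> 0)"
      using liouville unfolding liouville_domain_def by simp
    then show ?thesis using rf(1) q(1) by simp
  qed
  moreover have "(1 :: real, 0 :: real) \<noteq> 0" by (simp add: zero_prod_def)
  ultimately have "\<exists>v. ext_deriv lam c q (1, 0) v \<noteq> 0" by blast
  then obtain v where "ext_deriv lam c q (1, 0) v \<noteq> 0" by (elim exE)
  then show ?thesis unfolding ext_deriv_rep by (rule contrapos_nn) simp
qed

text \<open>Solves the defining equation of a Hamiltonian field for an arbitrary covector
  \<open>(a, b)\<close>. Being an equivalence, it evaluates the \<open>THE\<close> in both
  \<open>hamiltonian_vf\<close> and \<open>liouville_vf\<close>.\<close>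

lemma symplectic_dual:
  "(\<forall>v. ext_deriv lam c q X v = fst v * a + snd v * b) \<longleftrightarrow>
     X = (b / plane_curl l1 l2 (coord c q), - a / plane_curl l1 l2 (coord c q))" (is "?L \<longleftrightarrow> ?R")
proof
  assume L: ?L
  have "fst X * plane_curl l1 l2 (coord c q) = b" "- snd X * plane_curl l1 l2 (coord c q) = a"
    using L[rule_format, of "(0, 1)"] L[rule_format, of "(1, 0)"] unfolding ext_deriv_rep by simp_all
  then show ?R using plane_curl_nonzero by (auto simp: prod_eq_iff field_simps)
next
  assume ?R
  then show ?L unfolding ext_deriv_rep using plane_curl_nonzero by (auto simp: field_simps)
qed

lemma hamiltonian_vf_rep: "hamiltonian_vf lam H c q =
    (d2 h (coord c q) / plane_curl l1 l2 (coord c q), - d1 h (coord c q) / plane_curl l1 l2 (coord c q))"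
  unfolding hamiltonian_vf_def differential_rep by (rule the_equality) (use symplectic_dual in blast)+

lemma liouville_vf_rep: "liouville_vf lam c q =
    (l2 (coord c q) / plane_curl l1 l2 (coord c q), - l1 (coord c q) / plane_curl l1 l2 (coord c q))"
  unfolding liouville_vf_def rf(6)[OF q] plane_form_def
  by (rule the_equality) (use symplectic_dual in blast)+

lemma tau_rep: "tau lam H c q = kappa l1 l2 h (coord c q) / plane_curl l1 l2 (coord c q)"
  unfolding tau_def hamiltonian_vf_rep kappa_def rf(6)[OF q] rf(7)[OF q] plane_form_def
  using plane_curl_nonzero by (simp add: field_simps)

lemma tau_pos: "tau lam H c q > 0"
  using admissible rf(1) q(1) unfolding admissible_hamiltonians_def by blast

lemma kappa_nonzero: "kappa l1 l2 h (coord c q) \<noteq> 0"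
  using tau_pos tau_rep by auto

end

definition reeb_field :: "('a, real) chart \<Rightarrow> 'a \<Rightarrow> real \<times> real" where
  "reeb_field c q = hamiltonian_vf lam H c q /\<^sub>R tau lam H c q"

lemma reeb_field_rep:
  assumes rep: "local_rep c T l1 l2 h" and q: "q \<in> chart_dom c" "coord c q \<in> T"
  shows "reeb_field c q = (d2 h (coord c q) / kappa l1 l2 h (coord c q), - d1 h (coord c q) / kappa l1 l2 h (coord c q))"
  unfolding reeb_field_def hamiltonian_vf_rep[OF rep q] tau_rep[OF rep q]
  using plane_curl_nonzero[OF rep q] kappa_nonzero[OF rep q] by (simp add: field_simps)


section \<open>Invariance under coordinate changes\<close>

lemma transition_rep:
  assumes c: "local_rep c Tc l1 l2 h" and d: "local_rep d Td k1 k2 g" and p: "p \<in> chart_dom c" "p \<in> chart_dom d"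
    and x: "coord c p \<in> Tc" "coord d p \<in> Td"
  obtains T G where "coord c p \<in> T" "smooth_open T G" "T \<subseteq> Tc" "G ` T \<subseteq> Td"
    "\<forall>q\<in>chart_dom c \<inter> chart_dom d. coord c q \<in> T \<longrightarrow> coord d q = G (coord c q) \<and>
        (\<forall>v. lam c q v = lam d q (frechet_derivative G (at (coord c q)) v))"
proof -
  have cA: "c \<in> A" and dA: "d \<in> A" using c d unfolding local_rep_def by auto
  note cf = chart_facts[OF cA]
  have xo: "coord c p \<in> overlap c d" using p unfolding overlap_def by blast
  obtain T0 G where G: "coord c p \<in> T0" "smooth_open T0 G" "\<forall>y\<in>overlap c d \<inter> T0. Defs.transition c d y = G y"
    by (rule smooth_onE[OF transitions[OF cA dA] xo])
  have oc: "open Tc" and od: "open Td" using c d unfolding local_rep_def by (auto dest: smooth_openD(1))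
  have eqG: "coord d q = G (coord c q)" if "q \<in> chart_dom c" "q \<in> chart_dom d" "coord c q \<in> T0" for q
  proof -
    have "coord c q \<in> overlap c d" using that unfolding overlap_def by blast
    then have "Defs.transition c d (coord c q) = G (coord c q)" using G(3) that(3) by blast
    then show ?thesis unfolding Defs.transition_def using cf(3)[OF that(1)] by simp
  qed
  let ?T = "T0 \<inter> Tc \<inter> (T0 \<inter> G -` Td)"
  have o: "open ?T"
    by (intro open_Int oc smooth_openD(1)[OF G(2)] smooth_open_Int_preimage[OF G(2) od])
  have xT: "coord c p \<in> ?T" using G(1) x eqG[OF p G(1)] by simp
  have so: "smooth_open ?T G" by (rule smooth_open_subset[OF G(2) o]) auto
  have ov: "openin (top_of_set half_space) (overlap c d)"
  proof -
    obtain S where "open S" "coord c ` (chart_dom c \<inter> chart_dom d) = chart_img c \<inter> S"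
      using cf(6)[OF openin_Int[OF cf(1) chart_facts(1)[OF dA]]] by blast
    then show ?thesis unfolding overlap_def using chart_img_open[OF cA]
      by (simp add: openin_Int_open)
  qed
  have "lam c q v = lam d q (frechet_derivative G (at (coord c q)) v)"
    if q: "q \<in> chart_dom c" "q \<in> chart_dom d" "coord c q \<in> ?T" for q v
  proof -
    have qo: "coord c q \<in> overlap c d" using q unfolding overlap_def by blast
    have "frechet_derivative (Defs.transition c d) (at (coord c q) within overlap c d) = frechet_derivative G (at (coord c q))"
      by (rule frechet_derivative_half_space_ext[OF ov qo o q(3) smooth_open_has_derivative[OF so q(3)]])
        (use G(3) in auto)
    moreover have "lam c q v = lam d q (frechet_derivative (Defs.transition c d) (at (coord c q) within overlap c d) v)"
      using one_form cA dA q(1,2) unfolding smooth_one_form_def by blast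
    ultimately show ?thesis by simp
  qed
  then show thesis
    by (intro that[OF xT so]) (use eqG in auto)
qed

lemma ext_deriv_transition:
  assumes c: "local_rep c Tc l1 l2 h" and d: "local_rep d Td k1 k2 g" and p: "p \<in> chart_dom c" "p \<in> chart_dom d"
    and x: "coord c p \<in> Tc" "coord d p \<in> Td"
    and T: "coord c p \<in> T" "smooth_open T G" "T \<subseteq> Tc" "G ` T \<subseteq> Td"
    and G: "\<forall>q\<in>chart_dom c \<inter> chart_dom d. coord c q \<in> T \<longrightarrow> coord d q = G (coord c q) \<and>
        (\<forall>v. lam c q v = lam d q (frechet_derivative G (at (coord c q)) v))"
  shows "ext_deriv lam c p u v = ext_deriv lam d p (frechet_derivative G (at (coord c p)) u) (frechet_derivative G (at (coord c p)) v)"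
    and "differential H c p u = differential H d p (frechet_derivative G (at (coord c p)) u)"
proof -
  note rc = rep_facts[OF c] and rd = rep_facts[OF d]
  note cf = chart_facts[OF rc(1)]
  have Gp: "G (coord c p) = coord d p" using G p T(1) by auto
  obtain S where S: "open S" "coord c ` (chart_dom c \<inter> chart_dom d) = chart_img c \<inter> S"
    using cf(6)[OF openin_Int[OF cf(1) chart_facts(1)[OF rd(1)]]] by blast
  define Q where "Q = coord c ` (chart_dom c \<inter> chart_dom d)"
  have Q: "openin (top_of_set half_space) Q" "coord c p \<in> Q"
    unfolding Q_def using chart_img_open[OF rc(1)] S p by (auto simp: openin_Int_open)
  have Qe: "\<exists>q. q \<in> chart_dom c \<and> q \<in> chart_dom d \<and> y = coord c q" if "y \<in> Q" for y
    using that unfolding Q_def by blast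
  have k: "smooth_open Td (\<lambda>y. plane_form k1 k2 y w)" for w by (rule plane_form_smooth[OF rd(2,3)])
  have GT: "G y \<in> Td" if "y \<in> T" for y using T(4) that by blast
  let ?m = "\<lambda>y v. plane_form k1 k2 (G y) (frechet_derivative G (at y) v)"
  \<comment> \<open>The two one-forms agree only on the overlap inside the half-space, but agreement
    there already determines the derivatives in all directions.\<close>
  have same: "frechet_derivative (\<lambda>y. plane_form l1 l2 y w) (at (coord c p)) = frechet_derivative (\<lambda>y. ?m y w) (at (coord c p))" for w
  proof (rule derivative_eq_on_half_space[OF Q smooth_openD(1)[OF T(2)] T(1)])
    show "((\<lambda>y. plane_form l1 l2 y w) has_derivative frechet_derivative (\<lambda>y. plane_form l1 l2 y w) (at (coord c p))) (at (coord c p))"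
      by (rule smooth_open_has_derivative[OF plane_form_smooth[OF rc(2,3)] x(1)])
    show "((\<lambda>y. ?m y w) has_derivative frechet_derivative (\<lambda>y. ?m y w) (at (coord c p))) (at (coord c p))"
      by (rule frechet_derivative_works[THEN iffD1, OF differentiableI[OF pullback_derivative[OF T(2) k plane_form_linear GT T(1)]]])
    show "plane_form l1 l2 y w = ?m y w" if y: "y \<in> Q" "y \<in> T" for y
    proof -
      obtain q where q: "q \<in> chart_dom c" "q \<in> chart_dom d" "y = coord c q" using Qe[OF y(1)] by blast
      have yd: "coord d q = G y" "lam c q w = lam d q (frechet_derivative G (at y) w)"
        using bspec[OF G, of q] q y(2) by blast+
      have "lam c q = plane_form l1 l2 y" using rc(6)[OF q(1)] y(2) T(3) q(3) by blast
      moreover have "lam d q = plane_form k1 k2 (G y)" using rd(6)[OF q(2)] yd(1) GT[OF y(2)] by simp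
      ultimately show ?thesis using yd(2) by simp
    qed
  qed
  have "curl (plane_form l1 l2) (coord c p) u v = curl ?m (coord c p) u v"
    unfolding curl_def same ..
  also have "\<dots> = curl (plane_form k1 k2) (coord d p) (frechet_derivative G (at (coord c p)) u) (frechet_derivative G (at (coord c p)) v)"
    using pullback_curl[OF T(2) k plane_form_linear GT T(1)] Gp by simp
  finally show "ext_deriv lam c p u v = ext_deriv lam d p (frechet_derivative G (at (coord c p)) u) (frechet_derivative G (at (coord c p)) v)"
    unfolding ext_deriv_rep[OF c p(1) x(1)] ext_deriv_rep[OF d p(2) x(2)]
      curl_plane_form[OF rc(2,3) x(1)] curl_plane_form[OF rd(2,3) x(2)] .
  have dg: "(g has_derivative frechet_derivative g (at (coord d p))) (at (G (coord c p)))"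
    unfolding Gp by (rule smooth_open_has_derivative[OF rd(4) x(2)])
  have dh: "(h has_derivative frechet_derivative h (at (coord c p))) (at (coord c p))"
    by (rule smooth_open_has_derivative[OF rc(4) x(1)])
  have "frechet_derivative h (at (coord c p)) = (\<lambda>u. frechet_derivative g (at (coord d p)) (frechet_derivative G (at (coord c p)) u))"
  proof (rule derivative_eq_on_half_space[OF Q smooth_openD(1)[OF T(2)] T(1) dh has_derivative_compose[OF smooth_open_has_derivative[OF T(2,1)] dg]])
    show "h y = g (G y)" if y: "y \<in> Q" "y \<in> T" for y
    proof -
      obtain q where q: "q \<in> chart_dom c" "q \<in> chart_dom d" "y = coord c q" using Qe[OF y(1)] by blast
      have yd: "coord d q = G y" using G q y(2) by auto
      show ?thesis using rc(7)[OF q(1)] rd(7)[OF q(2)] yd q(3) y(2) T(3) GT[OF y(2)] by auto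
    qed
  qed
  then show "differential H c p u = differential H d p (frechet_derivative G (at (coord c p)) u)"
    unfolding differential_rep[OF c p(1) x(1)] differential_rep[OF d p(2) x(2)]
    using frechet_derivative_plane[OF dh, of u] frechet_derivative_plane[OF dg[unfolded Gp], of "frechet_derivative G (at (coord c p)) u"] by simp
qed

text \<open>Nondegeneracy in the chart \<open>c\<close> makes the derivative of the coordinate
  change injective, hence surjective. So the image of the Hamiltonian field of \<open>c\<close> is
  tested against every vector in the chart \<open>d\<close> and satisfies the equation that
  characterises the field there.\<close>

lemma invariance:
  assumes c: "local_rep c Tc l1 l2 h" and d: "local_rep d Td k1 k2 g" and p: "p \<in> chart_dom c" "p \<in> chart_dom d"
    and x: "coord c p \<in> Tc" "coord d p \<in> Td"
    and T: "coord c p \<in> T" "smooth_open T G" "T \<subseteq> Tc" "G ` T \<subseteq> Td"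
    and G: "\<forall>q\<in>chart_dom c \<inter> chart_dom d. coord c q \<in> T \<longrightarrow> coord d q = G (coord c q) \<and>
        (\<forall>v. lam c q v = lam d q (frechet_derivative G (at (coord c q)) v))"
  shows "tau lam H c p = tau lam H d p" "frechet_derivative G (at (coord c p)) (reeb_field c p) = reeb_field d p"
proof -
  let ?D = "frechet_derivative G (at (coord c p))"
  note e = ext_deriv_transition[OF assms]
  have lin: "linear ?D" by (rule has_derivative_linear[OF smooth_open_has_derivative[OF T(2,1)]])
  have "u = 0" if "?D u = 0" for u
  proof -
    have "ext_deriv lam c p u v = 0" for v unfolding e(1) that ext_deriv_rep[OF d p(2) x(2)] by simp
    then have "(fst u * snd v - snd u * fst v) = 0" for v
      unfolding ext_deriv_rep[OF c p(1) x(1)] using plane_curl_nonzero[OF c p(1) x(1)] by simp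
    from this[of "(1, 0)"] this[of "(0, 1)"] show ?thesis by (simp add: prod_eq_iff)
  qed
  then have "inj ?D" by (simp add: linear_injective_0[OF lin])
  then have "surj ?D" by (rule linear_inj_imp_surj[OF lin])
  then obtain D' where D': "\<And>w. ?D (D' w) = w" by (metis surj_def)
  have Xc: "\<forall>v. ext_deriv lam c p (hamiltonian_vf lam H c p) v = differential H c p v"
    unfolding hamiltonian_vf_rep[OF c p(1) x(1)] differential_rep[OF c p(1) x(1)]
    using symplectic_dual[OF c p(1) x(1)] by blast
  have "\<forall>v. ext_deriv lam d p (?D (hamiltonian_vf lam H c p)) v = fst v * d1 g (coord d p) + snd v * d2 g (coord d p)"
    unfolding differential_rep[OF d p(2) x(2), symmetric]
    using Xc e D' by metis
  then have X: "?D (hamiltonian_vf lam H c p) = hamiltonian_vf lam H d p"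
    unfolding symplectic_dual[OF d p(2) x(2)] hamiltonian_vf_rep[OF d p(2) x(2)] .
  have "lam c p v = lam d p (?D v)" for v using bspec[OF G, of p] p T(1) by blast
  then show t: "tau lam H c p = tau lam H d p" unfolding tau_def using X by simp
  show "?D (reeb_field c p) = reeb_field d p"
    unfolding reeb_field_def using X t linear_scale[OF lin] by simp
qed

end

section \<open>Straightening the time-changed Hamiltonian flow\<close>

text \<open>An integral from one fixed left end serves only the times to its right, so the left end
  \<open>- N\<close> moves with \<open>t\<close>; normalised to vanish at 0, the integrals agree for
  all large \<open>N\<close>.\<close>

lemma antiderivative_exists:
  fixes g :: "real \<Rightarrow> real"
  assumes g: "continuous_on UNIV g"
  shows "\<exists>F. F 0 = 0 \<and> (\<forall>t. (F has_real_derivative g t) (at t))"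
proof -
  define G where "G N t = integral {- N..t} g - integral {- N..0} g" for N t
  have int: "g integrable_on {a..b}" for a b
    by (intro integrable_continuous_interval continuous_on_subset[OF g]) auto
  have agree: "G N t = G M t" if "\<bar>t\<bar> \<le> N" "N \<le> M" for N M t
  proof -
    have "integral {- M..- N} g + integral {- N..t} g = integral {- M..t} g"
      "integral {- M..- N} g + integral {- N..0} g = integral {- M..0} g"
      using that by (intro Henstock_Kurzweil_Integration.integral_combine int; linarith)+
    then show ?thesis unfolding G_def by linarith
  qed
  define F where "F t = G (\<bar>t\<bar> + 1) t" for t
  have "(F has_real_derivative g t) (at t)" for t
  proof -
    let ?N = "\<bar>t\<bar> + 2"
    have t: "t \<in> {- ?N<..<?N}" by auto
    have "((\<lambda>t. integral {- ?N..t} g) has_real_derivative g t) (at t within {- ?N..?N})"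
      by (rule integral_has_real_derivative[OF continuous_on_subset[OF g]]) auto
    then have "((\<lambda>t. integral {- ?N..t} g) has_real_derivative g t) (at t)"
      using t by (simp add: at_within_Icc_at)
    from DERIV_diff[OF this DERIV_const[of "integral {- ?N..0} g"]]
    have "(G ?N has_real_derivative g t) (at t)" unfolding G_def by simp
    then show ?thesis
    proof (rule has_field_derivative_transform_within_open[where S = "{t - 1<..<t + 1}"])
      show "G ?N s = F s" if "s \<in> {t - 1<..<t + 1}" for s
        unfolding F_def by (rule agree[symmetric]) (use that in auto)
    qed auto
  qed
  moreover have "F 0 = 0" by (simp add: F_def G_def)
  ultimately show ?thesis by blast
qed

lemma smooth_open_onorm_continuous:
  fixes F :: "'a::euclidean_space \<Rightarrow> 'b::euclidean_space"
  assumes F: "smooth_open T F" and x: "x \<in> T" and e: "e > 0"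
  shows "\<exists>d>0. \<forall>y. dist x y < d \<longrightarrow> onorm (\<lambda>v. frechet_derivative F (at y) v - frechet_derivative F (at x) v) < e"
proof -
  let ?D = "\<lambda>y v. frechet_derivative F (at y) v"
  \<comment> \<open>The operator norm is bounded by a sum over \<open>Basis\<close>; the factor 2
    makes the final inequality strict.\<close>
  define k where "k = e / (2 * real (card (Basis :: 'a set)))"
  have k: "k > 0" using e by (simp add: k_def)
  have "\<exists>d>0. \<forall>y. dist x y < d \<longrightarrow> norm (?D y b - ?D x b) < k" for b
  proof -
    have "isCont (\<lambda>y. ?D y b) x"
      using smooth_open_continuous[OF smooth_open_deriv[OF F]] smooth_openD(1)[OF F] x
      by (simp add: continuous_on_eq_continuous_at)
    then show ?thesis using k unfolding continuous_at_eps_delta by (metis dist_commute dist_norm)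
  qed
  then obtain d where d: "\<And>b. d b > 0" "\<And>b y. dist x y < d b \<Longrightarrow> norm (?D y b - ?D x b) < k" by metis
  obtain r where r: "r > 0" "ball x r \<subseteq> T" using smooth_openD(1)[OF F] x by (meson openE)
  define m where "m = Min (insert r (d ` Basis))"
  have m: "m > 0" "m \<le> r" using r(1) d(1) by (auto simp: m_def)
  have m3: "m \<le> d b" if "b \<in> Basis" for b unfolding m_def by (rule Min_le) (use that in auto)
  have "onorm (\<lambda>v. ?D y v - ?D x v) < e" if y: "dist x y < m" for y
  proof -
    have yT: "y \<in> T" using y m(2) r(2) by (auto simp: subset_iff)
    have lin: "linear (\<lambda>v. ?D y v - ?D x v)"
      by (intro linear_compose_sub has_derivative_linear[OF smooth_open_has_derivative[OF F]] yT x)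
    have "onorm (\<lambda>v. ?D y v - ?D x v) \<le> real (card (Basis :: 'a set)) * k"
    proof (rule onorm_le)
      fix v
      have "norm (?D y v - ?D x v) = norm (\<Sum>b\<in>Basis. (v \<bullet> b) *\<^sub>R (?D y b - ?D x b))"
        using frechet_expand[OF lin, of v] by simp
      also have "\<dots> \<le> (\<Sum>b\<in>Basis. norm ((v \<bullet> b) *\<^sub>R (?D y b - ?D x b)))" by (rule norm_sum)
      also have "\<dots> \<le> (\<Sum>b\<in>(Basis :: 'a set). norm v * k)"
      proof (intro sum_mono)
        fix b :: 'a assume b: "b \<in> Basis"
        have "\<bar>v \<bullet> b\<bar> \<le> norm v" by (rule Basis_le_norm[OF b])
        moreover have "norm (?D y b - ?D x b) \<le> k" using d(2)[of y b] m3[OF b] y by simp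
        ultimately show "norm ((v \<bullet> b) *\<^sub>R (?D y b - ?D x b)) \<le> norm v * k"
          by (auto intro!: mult_mono)
      qed
      finally show "norm (?D y v - ?D x v) \<le> real (card (Basis :: 'a set)) * k * norm v"
        by (simp add: mult_ac)
    qed
    also have "\<dots> = e / 2" by (simp add: k_def)
    finally show ?thesis using e by simp
  qed
  with m(1) show ?thesis by blast
qed

lemma smooth_open_locally_injective:
  fixes F :: "'a::euclidean_space \<Rightarrow> 'b::euclidean_space"
  assumes F: "smooth_open T F" and x: "x \<in> T" and inj: "\<And>v. frechet_derivative F (at x) v = 0 \<Longrightarrow> v = 0"
  obtains r where "r > 0" "ball x r \<subseteq> T" "inj_on F (ball x r)"
proof -
  let ?D = "\<lambda>y. frechet_derivative F (at y)"
  have lin: "linear (?D x)" by (rule has_derivative_linear[OF smooth_open_has_derivative[OF F x]])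
  have "inj (?D x)" using inj by (simp add: linear_injective_0[OF lin])
  then obtain g where g: "linear g" "g \<circ> ?D x = id" using linear_injective_left_inverse[OF lin] by blast
  show thesis
  proof (rule has_derivative_locally_injective[where f' = ?D, OF x smooth_openD(1)[OF F] _ g(2)])
    show "bounded_linear g" using g(1) by (simp add: linear_conv_bounded_linear)
    show "(F has_derivative ?D y) (at y)" if "y \<in> T" for y by (rule smooth_open_has_derivative[OF F that])
    show "\<exists>d>0. \<forall>y. dist x y < d \<longrightarrow> onorm (\<lambda>v. ?D y v - ?D x v) < e" if "e > 0" for e
      by (rule smooth_open_onorm_continuous[OF F x that])
  qed (rule that)
qed

context liouville_surface
begin

section \<open>The sign of \<open>H\<close> and its slope at the boundary\<close>

lemma in_chart_of_half_space:
  assumes rep: "local_rep c T l1 l2 h" and x: "x \<in> T" "fst x \<ge> 0"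
  shows "chart_inv c x \<in> chart_dom c" "coord c (chart_inv c x) = x" "H (chart_inv c x) = h x"
proof -
  note r = rep_facts[OF rep]
  have "x \<in> chart_img c" using r(5) x by (auto simp: half_space_def)
  from chart_facts(4)[OF r(1) this]
  show "chart_inv c x \<in> chart_dom c" "coord c (chart_inv c x) = x" "H (chart_inv c x) = h x"
    using r(7)[of "chart_inv c x"] x(1) by auto
qed

lemma H_boundary:
  assumes "c \<in> A" "p \<in> chart_dom c" "fst (coord c p) = 0"
  shows "H p = 0" and "p \<in> manifold_boundary W A"
proof -
  have "p \<in> topspace W" using assms covers by blast
  then show "p \<in> manifold_boundary W A" unfolding manifold_boundary_def using assms by blast
  then show "H p = 0" using admissible unfolding admissible_hamiltonians_def by blast
qed

text \<open>At an interior minimum the differential vanishes and \<open>X_H\<close> with it, so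
  \<open>tau\<close> reduces to the value of \<open>H\<close>, and \<open>tau\<close> is positive by
  admissibility.\<close>

lemma H_interior_minimum:
  assumes c: "c \<in> A" "p \<in> chart_dom c" "fst (coord c p) > 0" and min: "\<And>q. q \<in> topspace W \<Longrightarrow> H p \<le> H q"
  shows "H p > 0"
proof -
  obtain T l1 l2 h where x: "coord c p \<in> T" and rep: "local_rep c T l1 l2 h"
    by (rule local_rep_exists[OF c(1,2)])
  note r = rep_facts[OF rep]
  let ?S = "T \<inter> {x. fst x > 0}"
  have o: "open ?S" by (intro open_Int smooth_openD(1)[OF r(4)] open_Collect_less continuous_intros)
  have d: "(h has_derivative frechet_derivative h (at (coord c p))) (at (coord c p))"
    by (rule smooth_open_has_derivative[OF r(4) x])
  have "frechet_derivative h (at (coord c p)) = (\<lambda>v. 0)"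
  proof (rule differential_zero_maxmin[OF _ o d])
    show "coord c p \<in> ?S" using x c(3) by simp
    have "h (coord c p) \<le> h y" if y: "y \<in> ?S" for y
    proof -
      have y': "y \<in> T" "fst y \<ge> 0" using y by auto
      have "chart_inv c y \<in> topspace W" using in_chart_of_half_space(1)[OF rep y'] covers c(1) by blast
      from min[OF this] show ?thesis using in_chart_of_half_space(3)[OF rep y'] r(7)[OF c(2) x] by simp
    qed
    then show "(\<forall>y\<in>?S. h y \<le> h (coord c p)) \<or> (\<forall>y\<in>?S. h (coord c p) \<le> h y)" by blast
  qed
  then have "tau lam H c p = h (coord c p)"
    unfolding tau_rep[OF rep c(2) x] kappa_def using plane_curl_nonzero[OF rep c(2) x] by simp
  then show ?thesis using tau_pos[OF rep c(2) x] r(7)[OF c(2) x] by simp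
qed

lemma continuous_map_local:
  assumes "\<And>c p. c \<in> A \<Longrightarrow> p \<in> chart_dom c \<Longrightarrow> \<exists>T f. open T \<and> coord c p \<in> T \<and> continuous_on T f \<and>
     (\<forall>q\<in>chart_dom c. coord c q \<in> T \<longrightarrow> F q = f (coord c q))"
  shows "continuous_map W euclideanreal F"
  unfolding continuous_map_def
proof (intro conjI allI impI)
  fix U :: "real set" assume U: "openin euclideanreal U"
  show "openin W {x \<in> topspace W. F x \<in> U}"
  proof (subst openin_subopen, intro ballI)
    fix p assume p: "p \<in> {x \<in> topspace W. F x \<in> U}"
    then obtain c where c: "c \<in> A" "p \<in> chart_dom c" using covers by blast
    obtain T f where T: "open T" "coord c p \<in> T" "continuous_on T f" "\<forall>q\<in>chart_dom c. coord c q \<in> T \<longrightarrow> F q = f (coord c q)"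
      using assms[OF c] by (elim exE conjE)
    have o: "open (T \<inter> f -` U)" using continuous_open_preimage[OF T(3,1)] U by simp
    let ?V = "{q \<in> chart_dom c. coord c q \<in> T \<inter> f -` U}"
    have "openin W ?V" by (rule chart_facts(7)[OF c(1) o])
    moreover have "p \<in> ?V" using c(2) T(2,4) p by auto
    moreover have "?V \<subseteq> {x \<in> topspace W. F x \<in> U}" using T(4) covers c(1) by auto
    ultimately show "\<exists>V. openin W V \<and> p \<in> V \<and> V \<subseteq> {x \<in> topspace W. F x \<in> U}" by blast
  qed
qed auto

lemma H_continuous: "continuous_map W euclideanreal H"
proof (rule continuous_map_local)
  fix c p assume c: "c \<in> A" "p \<in> chart_dom c"
  obtain T l1 l2 h where x: "coord c p \<in> T" and rep: "local_rep c T l1 l2 h"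
    by (rule local_rep_exists[OF c])
  note r = rep_facts[OF rep]
  show "\<exists>T f. open T \<and> coord c p \<in> T \<and> continuous_on T f \<and> (\<forall>q\<in>chart_dom c. coord c q \<in> T \<longrightarrow> H q = f (coord c q))"
    using x r(7) smooth_openD(1)[OF r(4)] smooth_open_continuous[OF r(4)] by (intro exI[of _ T] exI[of _ h]) auto
qed

text \<open>On the compact \<open>W\<close> a minimum is attained, either on the boundary, where
  \<open>H\<close> is zero, or in the interior, where the minimum is positive.\<close>

lemma H_nonneg: assumes p: "p \<in> topspace W" shows "H p \<ge> 0"
proof -
  have "compact (H ` topspace W)"
    using image_compactin[OF W_compact[unfolded compact_space_def] H_continuous] by simp
  moreover have "H ` topspace W \<noteq> {}" using p by blast
  ultimately obtain q where q: "q \<in> topspace W" "\<And>q'. q' \<in> topspace W \<Longrightarrow> H q \<le> H q'"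
    using compact_attains_inf[of "H ` topspace W"] by auto
  obtain c where c: "c \<in> A" "q \<in> chart_dom c" using q(1) covers by blast
  have "H q \<ge> 0"
  proof (cases "fst (coord c q) = 0")
    case True
    then show ?thesis using H_boundary(1)[OF c] by simp
  next
    case False
    then have "fst (coord c q) > 0" using chart_img_half[OF c] by simp
    from H_interior_minimum[OF c this q(2)] show ?thesis by simp
  qed
  then show ?thesis using q(2)[OF p] by simp
qed

text \<open>Since \<open>H\<close> is nonnegative, an interior zero would be a minimum.\<close>

lemma H_pos: assumes c: "c \<in> A" "p \<in> chart_dom c" "fst (coord c p) > 0" shows "H p > 0"
proof (rule ccontr)
  assume n: "\<not> H p > 0"
  have "H p \<le> H q" if "q \<in> topspace W" for q using n H_nonneg[OF that] by simp
  from H_interior_minimum[OF c this] n show False by simp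
qed

lemma kappa_smooth:
  assumes "local_rep c T l1 l2 h"
  shows "smooth_open T (kappa l1 l2 h)"
proof -
  note r = rep_facts[OF assms]
  have "smooth_open T (\<lambda>x. l1 x * d2 h x - l2 x * d1 h x + h x * plane_curl l1 l2 x)"
    unfolding plane_curl_def
    by (intro smooth_open_add smooth_open_diff smooth_open_mult smooth_open_deriv r)
  then show ?thesis by (rule smooth_open_cong) (simp add: kappa_def)
qed


text \<open>The sign condition on \<open>h\<close> lets its value detect the side of the boundary: a
  curve in the ball along which \<open>h\<close> is constant and nonnegative cannot leave the
  half-space. The condition on \<open>kappa\<close> keeps the extended field defined on the whole
  ball.\<close>

definition good_ball :: "('a, real) chart \<Rightarrow> real \<times> real \<Rightarrow> real \<Rightarrow> (real \<times> real \<Rightarrow> real) \<Rightarrow> (real \<times> real \<Rightarrow> real) \<Rightarrow> (real \<times> real \<Rightarrow> real) \<Rightarrow> bool" where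
  "good_ball c x0 r l1 l2 h \<longleftrightarrow> r > 0 \<and> local_rep c (ball x0 r) l1 l2 h \<and> (\<forall>x\<in>ball x0 r. kappa l1 l2 h x \<noteq> 0) \<and>
     (\<forall>x\<in>ball x0 r. fst x < 0 \<longrightarrow> h x < 0) \<and> (fst x0 = 0 \<longrightarrow> d1 h x0 > 0)"

text \<open>On the boundary \<open>h\<close> and its tangential derivative vanish, so
  \<open>tau\<close> is \<open>- (l2 / w)\<close> times \<open>d1 h\<close>, where \<open>w\<close>
  is \<open>plane_curl l1 l2\<close>. The first component of the Liouville field is
  \<open>l2 / w\<close>, negative because the field points outward; then \<open>tau > 0\<close>
  fixes the sign of \<open>d1 h\<close>.\<close>

lemma boundary_slope:
  assumes rep: "local_rep c T l1 l2 h" and p: "p \<in> chart_dom c" "coord c p \<in> T" and b: "fst (coord c p) = 0"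
  shows "d1 h (coord c p) > 0"
proof -
  note r = rep_facts[OF rep]
  let ?x = "coord c p"
  have d: "(h has_derivative frechet_derivative h (at ?x)) (at ?x)" by (rule smooth_open_has_derivative[OF r(4) p(2)])
  obtain e where e: "e > 0" "ball ?x e \<subseteq> T" using smooth_openD(1)[OF r(4)] p(2) by (meson openE)
  have zero: "h (?x + s *\<^sub>R (0, 1)) = 0" if "\<bar>s\<bar> < e" for s
  proof -
    have "?x + s *\<^sub>R (0, 1) \<in> ball ?x e" using that by (simp add: dist_norm norm_Pair)
    then have y: "?x + s *\<^sub>R (0, 1) \<in> T" using e(2) by blast
    have f: "fst (?x + s *\<^sub>R (0, 1)) = 0" using b by simp
    note i = in_chart_of_half_space[OF rep y, unfolded f, OF order_refl]
    show ?thesis using H_boundary(1)[OF r(1) i(1)] i(2,3) f by simp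
  qed
  have "((\<lambda>s. h (?x + s *\<^sub>R (0, 1))) has_real_derivative frechet_derivative h (at (?x + 0 *\<^sub>R (0, 1))) (0, 1)) (at 0)"
    by (rule smooth_open_directional[OF r(4)]) (use p(2) in \<open>simp add: zero_prod_def[symmetric]\<close>)
  moreover have "((\<lambda>s. h (?x + s *\<^sub>R (0, 1))) has_real_derivative 0) (at 0)"
    by (rule has_field_derivative_transform_within_open[OF DERIV_const[of 0], of "{- e<..<e}"]) (use e(1) zero in \<open>auto simp: abs_less_iff\<close>)
  ultimately have "d2 h (?x + 0 *\<^sub>R (0, 1)) = 0" by (rule DERIV_unique)
  then have d2: "d2 h ?x = 0" by (simp add: zero_prod_def[symmetric])
  have h0: "h ?x = 0" using zero[of 0] e(1) by (simp add: zero_prod_def[symmetric])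
  have "\<forall>c\<in>A. \<forall>p\<in>chart_dom c \<inter> manifold_boundary W A. fst (liouville_vf lam c p) < 0"
    using liouville unfolding liouville_domain_def by simp
  then have "fst (liouville_vf lam c p) < 0" using H_boundary(2)[OF r(1) p(1) b] r(1) p(1) by simp
  then have 1: "l2 ?x / plane_curl l1 l2 ?x < 0" unfolding liouville_vf_rep[OF rep p] by simp
  have "kappa l1 l2 h ?x / plane_curl l1 l2 ?x > 0" using tau_pos[OF rep p] tau_rep[OF rep p] by simp
  then have "- (l2 ?x / plane_curl l1 l2 ?x) * d1 h ?x > 0" unfolding kappa_def d2 h0 by simp
  moreover have "- (l2 ?x / plane_curl l1 l2 ?x) > 0" using 1 by linarith
  ultimately show ?thesis by (rule zero_less_mult_pos)
qed

lemma good_ball_exists: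
  assumes c: "c \<in> A" "p \<in> chart_dom c"
  obtains r l1 l2 h where "good_ball c (coord c p) r l1 l2 h"
proof -
  let ?x = "coord c p"
  obtain T l1 l2 h where x: "?x \<in> T" and rep: "local_rep c T l1 l2 h"
    by (rule local_rep_exists[OF c])
  note r = rep_facts[OF rep]
  define S where "S = T \<inter> kappa l1 l2 h -` (- {0})"
  have "open S" unfolding S_def by (rule smooth_open_Int_preimage[OF kappa_smooth[OF rep]]) auto
  moreover have "?x \<in> S" unfolding S_def using x kappa_nonzero[OF rep c(2) x] by simp
  ultimately obtain e where e: "e > 0" "ball ?x e \<subseteq> S" by (meson openE)
  have k: "kappa l1 l2 h y \<noteq> 0" "y \<in> T" if "y \<in> ball ?x e" for y using that e(2) unfolding S_def by auto
  show thesis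
  proof (cases "fst ?x = 0")
    case False
    then have pos: "fst ?x > 0" using chart_img_half[OF c] by simp
    \<comment> \<open>Around an interior point the ball is kept inside the half-space, so the sign
      condition is vacuous.\<close>
    let ?r = "min e (fst ?x)"
    have "fst y \<ge> 0" if "y \<in> ball ?x ?r" for y
    proof -
      have "\<bar>fst ?x - fst y\<bar> \<le> dist ?x y" using dist_fst_le[of ?x y] by (simp add: dist_real_def)
      moreover have "dist ?x y < fst ?x" using that by simp
      ultimately show ?thesis by linarith
    qed
    then have "good_ball c ?x ?r l1 l2 h" unfolding good_ball_def
      using e(1) pos k local_rep_subset[OF rep open_ball, of ?x ?r] by (fastforce simp: subset_iff)
    then show thesis by (rule that)
  next
    case True
    have "isCont (\<lambda>y. d1 h y) ?x"
      using smooth_open_continuous[OF smooth_open_deriv[OF r(4)]] smooth_openD(1)[OF r(4)] x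
      by (simp add: continuous_on_eq_continuous_at)
    then obtain d where d: "d > 0" "\<And>y. dist y ?x < d \<Longrightarrow> \<bar>d1 h y - d1 h ?x\<bar> < d1 h ?x"
      using boundary_slope[OF rep c(2) x True] unfolding continuous_at_eps_delta dist_real_def by meson
    let ?r = "min e d"
    have pos: "d1 h y > 0" if "y \<in> ball ?x ?r" for y
      using d(2)[of y] that by (simp add: dist_commute) 
    have "h y < 0" if y: "y \<in> ball ?x ?r" "fst y < 0" for y
    proof -
      \<comment> \<open>From \<open>y\<close> move horizontally to the boundary line, where
        \<open>h = 0\<close>. The centre has first coordinate 0, so the segment stays in the ball,
        and \<open>d1 h > 0\<close> along it.\<close>
      let ?y0 = "(0, snd y)"
      have seg: "?y0 + s *\<^sub>R (1, 0) \<in> ball ?x ?r" if s: "fst y \<le> s" "s \<le> 0" for s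
      proof -
        have "dist ?x (?y0 + s *\<^sub>R (1, 0)) \<le> dist ?x y"
          using s True by (cases y; cases ?x) (simp add: dist_prod_def dist_real_def power_mono abs_le_square_iff[symmetric])
        then show ?thesis using y(1) by simp
      qed
      have "\<exists>z. fst y < z \<and> z < 0 \<and> h (?y0 + 0 *\<^sub>R (1, 0)) - h (?y0 + fst y *\<^sub>R (1, 0)) = (0 - fst y) * d1 h (?y0 + z *\<^sub>R (1, 0))"
      proof (rule MVT2[OF y(2)])
        fix s assume "fst y \<le> s" "s \<le> 0"
        then have "?y0 + s *\<^sub>R (1, 0) \<in> T" using seg k(2) by simp
        then show "((\<lambda>s. h (?y0 + s *\<^sub>R (1, 0))) has_real_derivative d1 h (?y0 + s *\<^sub>R (1, 0))) (at s)"
          by (rule smooth_open_directional[OF r(4)])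
      qed
      then obtain z where z: "fst y < z" "z < 0" "h ?y0 - h y = (0 - fst y) * d1 h (?y0 + z *\<^sub>R (1, 0))"
        by (cases y) auto
      have "0 < (0 - fst y) * d1 h (?y0 + z *\<^sub>R (1, 0))"
        using y(2) pos[OF seg[of z]] z(1,2) by (intro mult_pos_pos) auto
      moreover have "h ?y0 = 0"
      proof -
        have "?y0 \<in> T" using seg[of 0] y(2) k(2) by simp
        note i = in_chart_of_half_space[OF rep this, simplified]
        show ?thesis using H_boundary(1)[OF r(1) i(1)] i(2,3) by simp
      qed
      ultimately show ?thesis using z(3) by simp
    qed
    moreover have "local_rep c (ball ?x ?r) l1 l2 h"
      by (rule local_rep_subset[OF rep open_ball]) (use k(2) in auto)
    ultimately have "good_ball c ?x ?r l1 l2 h" unfolding good_ball_def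
      using e(1) d(1) k(1) boundary_slope[OF rep c(2) x True] by simp
    then show thesis by (rule that)
  qed
qed

lemma good_ballD:
  assumes "good_ball c x0 r l1 l2 h"
  shows "r > 0" "local_rep c (ball x0 r) l1 l2 h" "\<And>x. x \<in> ball x0 r \<Longrightarrow> kappa l1 l2 h x \<noteq> 0"
    "\<And>x. x \<in> ball x0 r \<Longrightarrow> fst x < 0 \<Longrightarrow> h x < 0" "fst x0 = 0 \<Longrightarrow> d1 h x0 > 0"
  using assms unfolding good_ball_def by auto

section \<open>The time-changed Hamiltonian field generates a flow\<close>

definition plane_field :: "(real \<times> real \<Rightarrow> real) \<Rightarrow> (real \<times> real \<Rightarrow> real) \<Rightarrow> (real \<times> real \<Rightarrow> real) \<Rightarrow> real \<times> real \<Rightarrow> real \<times> real" where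
  "plane_field l1 l2 h x = (d2 h x / kappa l1 l2 h x, - d1 h x / kappa l1 l2 h x)"

lemma plane_field_smooth:
  assumes g: "good_ball c x0 r l1 l2 h"
  shows "smooth_open (ball x0 r) (plane_field l1 l2 h)"
proof -
  note g' = good_ballD[OF g]
  note rf = rep_facts[OF g'(2)]
  have "smooth_open (ball x0 r) (\<lambda>x. (d2 h x / kappa l1 l2 h x, - d1 h x / kappa l1 l2 h x))"
    by (intro smooth_open_Pair smooth_open_divide smooth_open_minus smooth_open_deriv rf kappa_smooth[OF g'(2)] g'(3))
  then show ?thesis by (rule smooth_open_cong) (simp add: plane_field_def)
qed

lemma plane_field_tangent:
  assumes "(h has_derivative frechet_derivative h (at x)) (at x)"
  shows "frechet_derivative h (at x) (plane_field l1 l2 h x) = 0"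
  unfolding plane_field_def by (subst frechet_derivative_plane[OF assms]) simp

lemma plane_field_rep:
  assumes "good_ball c x0 r l1 l2 h" "q \<in> chart_dom c" "coord c q \<in> ball x0 r"
  shows "plane_field l1 l2 h (coord c q) = reeb_field c q"
  unfolding plane_field_def using reeb_field_rep[OF good_ballD(2)[OF assms(1)] assms(2,3)] by simp

sublocale reeb: manifold_flow W A reeb_field
proof
  show "Hausdorff_space W" by (rule W_Hausdorff)
  show "compact_space W" by (rule W_compact)
  show "topological_chart W c" if "c \<in> A" for c by (rule charts[OF that])
  show "(\<Union>c\<in>A. chart_dom c) = topspace W" by (rule covers)
next
  fix c d p assume cd: "c \<in> A" "d \<in> A" and p: "p \<in> chart_dom c" "p \<in> chart_dom d"
  obtain Tc l1 l2 h where c: "coord c p \<in> Tc" "local_rep c Tc l1 l2 h" by (rule local_rep_exists[OF cd(1) p(1)])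
  obtain Td k1 k2 g where d: "coord d p \<in> Td" "local_rep d Td k1 k2 g" by (rule local_rep_exists[OF cd(2) p(2)])
  obtain T G where T: "coord c p \<in> T" "smooth_open T G" "T \<subseteq> Tc" "G ` T \<subseteq> Td" and
    G: "\<forall>q\<in>chart_dom c \<inter> chart_dom d. coord c q \<in> T \<longrightarrow> coord d q = G (coord c q) \<and>
        (\<forall>v. lam c q v = lam d q (frechet_derivative G (at (coord c q)) v))"
    by (rule transition_rep[OF c(2) d(2) p c(1) d(1)])
  note inv = invariance(2)[OF c(2) d(2) p c(1) d(1) T G]
  show "\<exists>T g g'. open T \<and> coord c p \<in> T \<and> (g has_derivative g') (at (coord c p)) \<and> g' (reeb_field c p) = reeb_field d p \<and>
        (\<forall>q\<in>chart_dom c \<inter> chart_dom d. coord c q \<in> T \<longrightarrow> coord d q = g (coord c q))"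
    by (rule exI[of _ T], rule exI[of _ G], rule exI[of _ "frechet_derivative G (at (coord c p))"])
      (use T(1) smooth_openD(1)[OF T(2)] smooth_open_has_derivative[OF T(2,1)] inv G in blast)
next
  fix c p assume c: "c \<in> A" "p \<in> chart_dom c"
  let ?x0 = "coord c p"
  obtain r l1 l2 h where g: "good_ball c ?x0 r l1 l2 h" by (rule good_ball_exists[OF c])
  note g' = good_ballD[OF g]
  note rf = rep_facts[OF g'(2)]
  \<comment> \<open>Half the radius, so that the closed ball needed for the bounds lies in the open
    ball of \<open>good_ball\<close>.\<close>
  let ?F = "plane_field l1 l2 h" and ?r = "r / 2"
  have sub: "cball ?x0 ?r \<subseteq> ball ?x0 r" using g'(1) by auto
  obtain L where L: "L \<ge> 0" "\<forall>x\<in>cball ?x0 ?r. \<forall>y\<in>cball ?x0 ?r. norm (?F x - ?F y) \<le> L * norm (x - y)"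
    by (rule smooth_open_lipschitz[OF plane_field_smooth[OF g] sub])
  have M: "norm (?F x) \<le> norm (?F ?x0) + L * ?r" if x: "x \<in> cball ?x0 ?r" for x
  proof -
    have "norm (?F x - ?F ?x0) \<le> L * norm (x - ?x0)" using L(2) x g'(1) by simp
    also have "\<dots> \<le> L * ?r" using x L(1) by (intro mult_left_mono) (auto simp: dist_norm norm_minus_commute)
    finally show ?thesis using norm_triangle_sub[of "?F x" "?F ?x0"] by linarith
  qed
  \<comment> \<open>The boundary clause: \<open>h\<close> is constant along a solution because the
    field is tangent to its levels, nonnegative at the start because that is a point of
    \<open>W\<close>, and negative beyond the boundary.\<close>
  have inv: "u t \<in> chart_img c" if u0: "u (0::real) \<in> chart_img c"
    and u: "\<forall>t. \<bar>t\<bar> < e \<longrightarrow> u t \<in> ball ?x0 ?r \<and> (u has_vector_derivative ?F (u t)) (at t)" and t: "\<bar>t\<bar> < e" for u e t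
  proof -
    have ub: "u s \<in> ball ?x0 r" if "\<bar>s\<bar> < e" for s
    proof -
      have "u s \<in> ball ?x0 ?r" using u that by blast
      then show ?thesis using g'(1) by auto
    qed
    have d: "((\<lambda>s. h (u s)) has_real_derivative 0) (at s)" if s: "\<bar>s\<bar> < e" for s
    proof -
      have hd: "(h has_derivative frechet_derivative h (at (u s))) (at (u s))"
        by (rule smooth_open_has_derivative[OF rf(4) ub[OF s]])
      have "(u has_derivative (\<lambda>a. a *\<^sub>R ?F (u s))) (at s)" using u s unfolding has_vector_derivative_def by blast
      from has_derivative_compose[OF this hd] show ?thesis
        unfolding has_field_derivative_def
        by (rule has_derivative_eq_rhs)
          (simp add: linear_scale[OF has_derivative_linear[OF hd]] plane_field_tangent[OF hd] fun_eq_iff)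
    qed
    have "norm (h (u t) - h (u 0)) \<le> 0 * norm (t - 0)"
    proof (rule field_differentiable_bound[where S = "{- e<..<e}" and f' = "\<lambda>_. 0"])
      show "((\<lambda>s. h (u s)) has_field_derivative 0) (at s within {- e<..<e})" if "s \<in> {- e<..<e}" for s
        by (rule has_field_derivative_at_within[OF d]) (use that in auto)
    qed (use t in auto)
    then have const: "h (u t) = h (u 0)" by simp
    have "\<bar>0\<bar> < e" using t by simp
    note u0b = ub[OF this]
    have "chart_inv c (u 0) \<in> topspace W" using chart_facts(4)[OF c(1) u0] covers c(1) by blast
    from H_nonneg[OF this] have "h (u 0) \<ge> 0"
      using rf(7)[of "chart_inv c (u 0)"] chart_facts(4)[OF c(1) u0] u0b by simp
    then have "\<not> fst (u t) < 0" using g'(4)[OF ub[OF t]] const by auto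
    then have "u t \<in> half_space \<inter> ball ?x0 r" using ub[OF t] by (simp add: half_space_def)
    then show ?thesis using rf(5) by blast
  qed
  show "\<exists>r L M F. r > 0 \<and> L \<ge> 0 \<and>
        (\<forall>x\<in>cball ?x0 r. \<forall>y\<in>cball ?x0 r. norm (F x - F y) \<le> L * norm (x - y)) \<and>
        (\<forall>x\<in>cball ?x0 r. norm (F x) \<le> M) \<and>
        (\<forall>q\<in>chart_dom c. coord c q \<in> cball ?x0 r \<longrightarrow> F (coord c q) = reeb_field c q) \<and>
        (\<forall>u h. u (0::real) \<in> chart_img c \<longrightarrow>
           (\<forall>t. \<bar>t\<bar> < h \<longrightarrow> u t \<in> ball ?x0 r \<and> (u has_vector_derivative F (u t)) (at t)) \<longrightarrow>
           (\<forall>t. \<bar>t\<bar> < h \<longrightarrow> u t \<in> chart_img c))"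
  proof (intro exI conjI)
    show "?r > 0" using g'(1) by simp
    show "L \<ge> 0" by (rule L(1))
    show "\<forall>x\<in>cball ?x0 ?r. \<forall>y\<in>cball ?x0 ?r. norm (?F x - ?F y) \<le> L * norm (x - y)" by (rule L(2))
    show "\<forall>x\<in>cball ?x0 ?r. norm (?F x) \<le> norm (?F ?x0) + L * ?r" using M by blast
    show "\<forall>q\<in>chart_dom c. coord c q \<in> cball ?x0 ?r \<longrightarrow> ?F (coord c q) = reeb_field c q"
      using plane_field_rep[OF g] sub by blast
    show "\<forall>u h. u (0::real) \<in> chart_img c \<longrightarrow>
           (\<forall>t. \<bar>t\<bar> < h \<longrightarrow> u t \<in> ball ?x0 ?r \<and> (u has_vector_derivative ?F (u t)) (at t)) \<longrightarrow>
           (\<forall>t. \<bar>t\<bar> < h \<longrightarrow> u t \<in> chart_img c)"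
      by (intro allI impI) (rule inv)
  qed
qed


section \<open>The rate of rotation, conservation of \<open>H\<close> and flow boxes\<close>

lemma tau_chart_independent:
  assumes "c \<in> A" "d \<in> A" "p \<in> chart_dom c" "p \<in> chart_dom d"
  shows "tau lam H c p = tau lam H d p"
proof -
  obtain Tc l1 l2 h where c: "coord c p \<in> Tc" "local_rep c Tc l1 l2 h" by (rule local_rep_exists[OF assms(1,3)])
  obtain Td k1 k2 g where d: "coord d p \<in> Td" "local_rep d Td k1 k2 g" by (rule local_rep_exists[OF assms(2,4)])
  obtain T G where T: "coord c p \<in> T" "smooth_open T G" "T \<subseteq> Tc" "G ` T \<subseteq> Td" and
    G: "\<forall>q\<in>chart_dom c \<inter> chart_dom d. coord c q \<in> T \<longrightarrow> coord d q = G (coord c q) \<and>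
        (\<forall>v. lam c q v = lam d q (frechet_derivative G (at (coord c q)) v))"
    by (rule transition_rep[OF c(2) d(2) assms(3,4) c(1) d(1)])
  show ?thesis by (rule invariance(1)[OF c(2) d(2) assms(3,4) c(1) d(1) T G])
qed

definition rho :: "'a \<Rightarrow> real" where
  "rho w = 1 / tau lam H (SOME c. c \<in> A \<and> w \<in> chart_dom c) w"

lemma rho_eq:
  assumes c: "c \<in> A" "w \<in> chart_dom c"
  shows "rho w = 1 / tau lam H c w"
proof -
  have "(SOME c. c \<in> A \<and> w \<in> chart_dom c) \<in> A \<and> w \<in> chart_dom (SOME c. c \<in> A \<and> w \<in> chart_dom c)"
    by (rule someI_ex) (use c in blast)
  then show ?thesis unfolding rho_def using tau_chart_independent[OF _ c(1) _ c(2)] by simp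
qed

lemma rho_continuous: "continuous_map W euclideanreal rho"
proof (rule continuous_map_local)
  fix c p assume c: "c \<in> A" "p \<in> chart_dom c"
  obtain r l1 l2 h where g: "good_ball c (coord c p) r l1 l2 h" by (rule good_ball_exists[OF c])
  note g' = good_ballD[OF g]
  note rf = rep_facts[OF g'(2)]
  let ?B = "ball (coord c p) r"
  have "smooth_open ?B (\<lambda>x. plane_curl l1 l2 x / kappa l1 l2 h x)"
    unfolding plane_curl_def by (intro smooth_open_divide smooth_open_diff smooth_open_deriv rf kappa_smooth[OF g'(2)] g'(3))
  moreover have "rho q = plane_curl l1 l2 (coord c q) / kappa l1 l2 h (coord c q)" if "q \<in> chart_dom c" "coord c q \<in> ?B" for q
    unfolding rho_eq[OF c(1) that(1)] tau_rep[OF g'(2) that] by simp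
  ultimately show "\<exists>T f. open T \<and> coord c p \<in> T \<and> continuous_on T f \<and> (\<forall>q\<in>chart_dom c. coord c q \<in> T \<longrightarrow> rho q = f (coord c q))"
    using g'(1) by (intro exI[of _ ?B] exI[of _ "\<lambda>x. plane_curl l1 l2 x / kappa l1 l2 h x"])
      (auto dest: smooth_open_continuous)
qed

lemma H_flow:
  assumes w: "w \<in> topspace W"
  shows "H (reeb.flow t w) = H w"
proof -
  have "((\<lambda>t. H (reeb.flow t w)) has_real_derivative 0) (at t)" for t
  proof -
    let ?q = "reeb.flow t w"
    have tr: "reeb.trajectory_at (\<lambda>t. reeb.flow t w) t" by (rule reeb.flow_trajectory(2)[OF w])
    obtain c where c: "c \<in> A" "?q \<in> chart_dom c" using reeb.flow_in[OF w] covers by blast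
    obtain r l1 l2 h where g: "good_ball c (coord c ?q) r l1 l2 h" by (rule good_ball_exists[OF c])
    note g' = good_ballD[OF g]
    note rf = rep_facts[OF g'(2)]
    let ?B = "ball (coord c ?q) r"
    have qB: "coord c ?q \<in> ?B" using g'(1) by simp
    have hd: "(h has_derivative frechet_derivative h (at (coord c ?q))) (at (coord c ?q))"
      by (rule smooth_open_has_derivative[OF rf(4) qB])
    have cd: "((\<lambda>s. coord c (reeb.flow s w)) has_derivative (\<lambda>a. a *\<^sub>R reeb_field c ?q)) (at t)"
      using reeb.trajectory_derivative[OF tr c] unfolding has_vector_derivative_def o_def .
    have "frechet_derivative h (at (coord c ?q)) (reeb_field c ?q) = 0"
      using plane_field_tangent[OF hd, of l1 l2] unfolding plane_field_rep[OF g c(2) qB] .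
    then have d: "((\<lambda>s. h (coord c (reeb.flow s w))) has_real_derivative 0) (at t)"
      using has_derivative_compose[OF cd hd] unfolding has_field_derivative_def
      by (elim has_derivative_eq_rhs) (simp add: linear_scale[OF has_derivative_linear[OF hd]] fun_eq_iff)
    have "openin W {q \<in> chart_dom c. coord c q \<in> ?B}" by (rule chart_facts(7)[OF c(1) open_ball])
    from reeb.trajectory_eventually[OF tr this] c(2) qB
    have "eventually (\<lambda>s. reeb.flow s w \<in> {q \<in> chart_dom c. coord c q \<in> ?B}) (nhds t)" by simp
    then obtain S where S: "open S" "t \<in> S" "\<forall>s\<in>S. reeb.flow s w \<in> {q \<in> chart_dom c. coord c q \<in> ?B}"
      unfolding eventually_nhds by blast
    show ?thesis
      by (rule has_field_derivative_transform_within_open[OF d S(1,2)]) (use S(3) rf(7) in auto)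
  qed
  then have "H (reeb.flow t w) = H (reeb.flow 0 w)"
    using DERIV_isconst_all[of "\<lambda>t. H (reeb.flow t w)"] by blast
  then show ?thesis using reeb.flow_trajectory(1)[OF w] by simp
qed

lemma rest_point:
  assumes c: "c \<in> A" "p \<in> chart_dom c" "reeb_field c p = 0"
  shows "reeb.flow t p = p"
proof -
  have "reeb.trajectory_at (\<lambda>_. p) s" for s
    unfolding reeb.trajectory_at_def using c by (intro bexI[of _ c]) (auto simp: o_def)
  then show ?thesis using reeb.flow_unique[of "\<bar>t\<bar> + 1" "\<lambda>_. p" t] by simp
qed

text \<open>Where the field \<open>Y\<close> is nonzero at \<open>p\<close>, so is the gradient of
  \<open>h\<close>, and the two are perpendicular; hence \<open>h\<close> and the component along
  \<open>Y\<close> separate points near \<open>p\<close>. A nearby point of the same level is then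
  on the orbit as soon as the orbit attains its component along \<open>Y\<close>, and the
  intermediate value theorem finds the time.\<close>

lemma flow_box:
  assumes p: "p \<in> topspace W"
  shows "(\<forall>t. reeb.flow t p = p) \<or>
    (\<exists>V. openin W V \<and> p \<in> V \<and> (\<forall>w\<in>V. H w = H p \<longrightarrow> (\<exists>t. \<bar>t\<bar> \<le> 1 \<and> w = reeb.flow t p)))"
proof -
  obtain c where c: "c \<in> A" "p \<in> chart_dom c" using p covers by blast
  show ?thesis
  proof (cases "reeb_field c p = 0")
    case True
    then show ?thesis using rest_point[OF c] by blast
  next
    case False
    let ?x = "coord c p" and ?Y = "reeb_field c p"
    obtain r l1 l2 h where g: "good_ball c ?x r l1 l2 h" by (rule good_ball_exists[OF c])
    note g' = good_ballD[OF g]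
    note rf = rep_facts[OF g'(2)]
    let ?B = "ball ?x r"
    have xB: "?x \<in> ?B" using g'(1) by simp
    have Y: "?Y = (d2 h ?x / kappa l1 l2 h ?x, - d1 h ?x / kappa l1 l2 h ?x)"
      using plane_field_rep[OF g c(2) xB] unfolding plane_field_def by simp
    let ?f = "\<lambda>x. (h x, x \<bullet> ?Y)"
    have f: "smooth_open ?B ?f"
      by (intro smooth_open_Pair rf smooth_open_linear[OF bounded_linear_inner_left] smooth_open_id open_ball)
    have hd: "(h has_derivative frechet_derivative h (at ?x)) (at ?x)"
      by (rule smooth_open_has_derivative[OF rf(4) xB])
    have fd: "frechet_derivative ?f (at ?x) = (\<lambda>v. (frechet_derivative h (at ?x) v, v \<bullet> ?Y))"
      by (rule frechet_derivative_at[symmetric]) (intro has_derivative_Pair hd has_derivative_inner_left has_derivative_ident)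
    have inj: "v = 0" if "frechet_derivative ?f (at ?x) v = 0" for v
    proof -
      let ?k = "kappa l1 l2 h ?x" and ?a = "d1 h ?x" and ?b = "d2 h ?x"
      have k: "?k \<noteq> 0" by (rule g'(3)[OF xB])
      have 1: "fst v * ?a + snd v * ?b = 0"
        using that frechet_derivative_plane[OF hd, of v] unfolding fd by (simp add: zero_prod_def)
      have "v \<bullet> ?Y = 0" using that unfolding fd by (simp add: zero_prod_def)
      then have "(fst v * ?b - snd v * ?a) / ?k = 0" unfolding Y by (cases v) (simp add: diff_divide_distrib)
      then have 2: "fst v * ?b - snd v * ?a = 0" using k by simp
      have ne: "?a\<^sup>2 + ?b\<^sup>2 \<noteq> 0" using False unfolding Y by (auto simp: sum_power2_eq_zero_iff zero_prod_def)
      \<comment> \<open>Cramer's rule for the two linear equations; up to sign the determinant is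
        the squared length of the gradient of \<open>h\<close>.\<close>
      have "fst v * (?a\<^sup>2 + ?b\<^sup>2) = ?a * (fst v * ?a + snd v * ?b) + ?b * (fst v * ?b - snd v * ?a)"
        by (simp add: algebra_simps power2_eq_square)
      moreover have "snd v * (?a\<^sup>2 + ?b\<^sup>2) = ?b * (fst v * ?a + snd v * ?b) - ?a * (fst v * ?b - snd v * ?a)"
        by (simp add: algebra_simps power2_eq_square)
      ultimately have "fst v * (?a\<^sup>2 + ?b\<^sup>2) = 0" "snd v * (?a\<^sup>2 + ?b\<^sup>2) = 0" unfolding 1 2 by simp_all
      then have "fst v = 0" "snd v = 0" using ne mult_eq_0_iff by blast+
      then show ?thesis by (simp add: prod_eq_iff)
    qed
    obtain r' where r': "r' > 0" "ball ?x r' \<subseteq> ?B" "inj_on ?f (ball ?x r')"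
      by (rule smooth_open_locally_injective[OF f xB inj])
    define \<gamma> where "\<gamma> t = reeb.flow t p" for t
    have \<gamma>0: "\<gamma> 0 = p" unfolding \<gamma>_def by (rule reeb.flow_trajectory(1)[OF p])
    have tr: "reeb.trajectory_at \<gamma> t" for t unfolding \<gamma>_def by (rule reeb.flow_trajectory(2)[OF p])
    have No: "openin W {q \<in> chart_dom c. coord c q \<in> ball ?x r'}" by (rule chart_facts(7)[OF c(1) open_ball])
    have "eventually (\<lambda>t. \<gamma> t \<in> {q \<in> chart_dom c. coord c q \<in> ball ?x r'}) (nhds 0)"
      by (rule reeb.trajectory_eventually[OF tr No]) (use \<gamma>0 c(2) r'(1) in simp)
    then obtain e where e: "e > 0" "\<And>t. \<bar>t\<bar> < e \<Longrightarrow> \<gamma> t \<in> chart_dom c \<and> coord c (\<gamma> t) \<in> ball ?x r'"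
      unfolding eventually_nhds_metric by (auto simp: dist_real_def)
    let ?u = "\<lambda>t. coord c (\<gamma> t) \<bullet> ?Y"
    have ud: "(?u has_real_derivative reeb_field c (\<gamma> t) \<bullet> ?Y) (at t)" if "\<bar>t\<bar> < e" for t
    proof -
      have "((\<lambda>t. coord c (\<gamma> t)) has_derivative (\<lambda>a. a *\<^sub>R reeb_field c (\<gamma> t))) (at t)"
        using reeb.trajectory_derivative[OF tr c(1)] e(2)[OF that] unfolding has_vector_derivative_def o_def by blast
      from has_derivative_inner_left[OF this, of ?Y] show ?thesis
        unfolding has_field_derivative_def by (rule has_derivative_eq_rhs) (simp add: fun_eq_iff)
    qed
    have pos: "?Y \<bullet> ?Y > 0" using False by simp
    have u0: "(?u has_real_derivative ?Y \<bullet> ?Y) (at 0)" using ud[of 0] e(1) \<gamma>0 by simp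
    obtain dr where dr: "dr > 0" "\<And>s. 0 < s \<Longrightarrow> s < dr \<Longrightarrow> ?u 0 < ?u (0 + s)"
      using DERIV_pos_inc_right[OF u0 pos] by blast
    obtain dl where dl: "dl > 0" "\<And>s. 0 < s \<Longrightarrow> s < dl \<Longrightarrow> ?u (0 - s) < ?u 0"
      using DERIV_pos_inc_left[OF u0 pos] by blast
    \<comment> \<open>Within the range where the orbit stays in the chart and \<open>?u\<close> is
      comparable with \<open>?u 0\<close> on either side; \<open>d \<le> 1\<close> gives the time
      bound of the claim.\<close>
    define d where "d = min (min dr dl) (min e 1) / 2"
    have d: "0 < d" "d < dr" "d < dl" "d < e" "d \<le> 1" using dr(1) dl(1) e(1) by (auto simp: d_def)
    have less: "?u (- d) < ?u 0" "?u 0 < ?u d" using dr(2)[of d] dl(2)[of d] d by simp_all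
    let ?T = "ball ?x r' \<inter> {x. ?u (- d) < x \<bullet> ?Y} \<inter> {x. x \<bullet> ?Y < ?u d}"
    let ?V = "{q \<in> chart_dom c. coord c q \<in> ?T}"
    have "open ?T" by (intro open_Int open_ball open_Collect_less continuous_intros)
    then have V: "openin W ?V" by (rule chart_facts(7)[OF c(1)])
    have pV: "p \<in> ?V" using c(2) r'(1) less \<gamma>0 by simp
    have "\<exists>t. \<bar>t\<bar> \<le> 1 \<and> w = reeb.flow t p" if w: "w \<in> ?V" "H w = H p" for w
    proof -
      have "continuous_on {- d..d} ?u"
      proof (rule DERIV_continuous_on)
        fix t assume "t \<in> {- d..d}"
        then have "\<bar>t\<bar> < e" using d(4) by auto
        from ud[OF this] show "(?u has_real_derivative reeb_field c (\<gamma> t) \<bullet> ?Y) (at t within {- d..d})"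
          by (rule has_field_derivative_at_within)
      qed
      moreover have "?u (- d) \<le> coord c w \<bullet> ?Y" "coord c w \<bullet> ?Y \<le> ?u d" "- d \<le> d" using w(1) d(1) by auto
      ultimately have "\<exists>t. - d \<le> t \<and> t \<le> d \<and> ?u t = coord c w \<bullet> ?Y" by (intro IVT')
      then obtain t where t: "- d \<le> t" "t \<le> d" "?u t = coord c w \<bullet> ?Y" by (elim exE conjE)
      have te: "\<bar>t\<bar> < e" using t(1,2) d(4) by linarith
      note gt = e(2)[OF te]
      have wd: "w \<in> chart_dom c" "coord c w \<in> ball ?x r'" using w(1) by auto
      have "h (coord c (\<gamma> t)) = H (\<gamma> t)" using rf(7)[of "\<gamma> t"] gt r'(2) by auto
      also have "\<dots> = H p" unfolding \<gamma>_def by (rule H_flow[OF p])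
      also have "\<dots> = h (coord c w)" using w(2) rf(7)[of w] wd r'(2) by auto
      finally have "?f (coord c (\<gamma> t)) = ?f (coord c w)" using t(3) by simp
      then have "coord c (\<gamma> t) = coord c w" using inj_onD[OF r'(3)] gt wd(2) by blast
      then have "\<gamma> t = w" using inj_onD[OF chart_facts(2)[OF c(1)]] gt wd(1) by blast
      then show ?thesis using t(1,2) d(5) unfolding \<gamma>_def by (intro exI[of _ t]) auto
    qed
    with V pV show ?thesis by blast
  qed
qed

text \<open>The integral of \<open>1 / tau\<close> along the orbit, taken as the antiderivative that
  vanishes at 0; it counts the turns of the fibre.\<close>

definition phase :: "real \<Rightarrow> 'a \<Rightarrow> real" where
  "phase t w = (SOME F. F 0 = 0 \<and> (\<forall>t. (F has_real_derivative rho (reeb.flow t w)) (at t))) t"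

lemma phase:
  assumes w: "w \<in> topspace W"
  shows "phase 0 w = 0" "((\<lambda>t. phase t w) has_real_derivative rho (reeb.flow t w)) (at t)"
proof -
  have "continuous_map euclideanreal (prod_topology euclideanreal W) (\<lambda>t. (t, w))"
    using w by (intro continuous_map_pairedI) auto
  from continuous_map_compose[OF continuous_map_compose[OF this reeb.continuous_map_flow] rho_continuous]
  have "continuous_on UNIV (\<lambda>t. rho (reeb.flow t w))" by (simp add: o_def)
  from someI_ex[OF antiderivative_exists[OF this]]
  show "phase 0 w = 0" "((\<lambda>t. phase t w) has_real_derivative rho (reeb.flow t w)) (at t)"
    unfolding phase_def by auto
qed

sublocale extension: rotation_extension W reeb.flow H rho phase
  by unfold_locales
    (simp_all add: W_compact reeb.flow_in reeb.flow_trajectory(1) reeb.flow_add reeb.continuous_map_flow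
      H_continuous rho_continuous H_flow flow_box phase)

end

section \<open>Boundary charts of iterated tubes\<close>

text \<open>The inverse function theorem gives a differentiable inverse \<open>N\<close>. Its
  smoothness is bootstrapped: the derivative of \<open>N\<close> is an explicit rational expression
  in derivatives of \<open>k\<close> at \<open>N\<close>, so each order of differentiability of
  \<open>N\<close> yields the next.\<close>

lemma smooth_straightening:
  fixes k :: "real \<times> 'f::euclidean_space \<Rightarrow> real"
  assumes k: "smooth_open T k" and y0: "y0 \<in> T" and nz: "frechet_derivative k (at y0) (1, 0) \<noteq> 0"
  obtains U V N where "open U" "U \<subseteq> T" "y0 \<in> U" "open V" "homeomorphism U V (\<lambda>y. (k y, snd y)) N" "smooth_open V N"
proof -
  let ?M = "\<lambda>y. (k y, snd y)"
  let ?D = "\<lambda>y v. (frechet_derivative k (at y) v, snd v)"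
  have kd: "(k has_derivative frechet_derivative k (at y)) (at y)" if "y \<in> T" for y
    by (rule smooth_open_has_derivative[OF k that])
  have Md: "(?M has_derivative ?D y) (at y)" if "y \<in> T" for y
    by (intro has_derivative_Pair kd that has_derivative_snd has_derivative_ident)
  define f' where "f' y = Blinfun (?D y)" for y
  have bl: "blinfun_apply (f' y) = ?D y" if "y \<in> T" for y
    unfolding f'_def by (rule bounded_linear_Blinfun_apply[OF has_derivative_bounded_linear[OF Md[OF that]]])
  have cont: "continuous_on T f'"
  proof (rule continuous_on_blinfun_componentwise)
    fix i :: "real \<times> 'f"
    have "continuous_on T (\<lambda>y. ?D y i)"
      by (intro continuous_intros smooth_open_continuous[OF smooth_open_deriv[OF k]])
    then show "continuous_on T (\<lambda>y. blinfun_apply (f' y) i)"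
      by (rule continuous_on_cong[THEN iffD1, rotated 2]) (simp_all add: bl)
  qed
  have lin0: "linear (?D y0)" by (rule has_derivative_linear[OF Md[OF y0]])
  have split: "frechet_derivative k (at y) (a, b) = a * frechet_derivative k (at y) (1, 0) + frechet_derivative k (at y) (0, b)"
    if "y \<in> T" for y a b
  proof -
    interpret linear "frechet_derivative k (at y)" by (rule has_derivative_linear[OF kd[OF that]])
    have "(a, b) = a *\<^sub>R (1, 0) + (0, b)" by simp
    then show ?thesis by (metis add scaleR real_scaleR_def)
  qed
  have "inj (?D y0)"
    unfolding linear_injective_0[OF lin0]
  proof (intro allI impI)
    fix v assume v: "?D y0 v = 0"
    then have "snd v = 0" "frechet_derivative k (at y0) v = 0" by (simp_all add: zero_prod_def)
    moreover have "frechet_derivative k (at y0) v = fst v * frechet_derivative k (at y0) (1, 0) + frechet_derivative k (at y0) (0, snd v)"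
      using split[OF y0, of "fst v" "snd v"] by simp
    ultimately show "v = 0"
      using nz linear_0[OF has_derivative_linear[OF kd[OF y0]]] by (simp add: zero_prod_def prod_eq_iff)
  qed
  then obtain g0 where g0: "linear g0" "g0 \<circ> ?D y0 = id" using linear_injective_left_inverse[OF lin0] by blast
  have "Blinfun g0 o\<^sub>L f' y0 = id_blinfun"
  proof (rule blinfun_eqI)
    fix i
    have eq: "blinfun_apply (Blinfun g0) = g0"
      using g0(1) by (intro bounded_linear_Blinfun_apply) (simp add: linear_conv_bounded_linear)
    have "g0 (?D y0 i) = i" using fun_cong[OF g0(2), of i] by simp
    then show "blinfun_apply (Blinfun g0 o\<^sub>L f' y0) i = blinfun_apply id_blinfun i"
      unfolding blinfun_apply_blinfun_compose eq bl[OF y0] by simp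
  qed
  moreover have "(?M has_derivative blinfun_apply (f' y)) (at y)" if "y \<in> T" for y
    using Md[OF that] bl[OF that] by simp
  ultimately have "\<exists>U V N g'. open U \<and> U \<subseteq> T \<and> y0 \<in> U \<and> open V \<and> homeomorphism U V ?M N \<and>
    (\<forall>y\<in>V. (N has_derivative (g' y)) (at y) \<and> g' y = inv (blinfun_apply (f' (N y))) \<and> bij (blinfun_apply (f' (N y))))"
  proof (rule_tac inverse_function_theorem[OF smooth_openD(1)[OF k] _ cont y0])
    fix U V N g'
    assume "open U" "U \<subseteq> T" "y0 \<in> U" "open V" "homeomorphism U V ?M N"
      "\<And>y. y \<in> V \<Longrightarrow> (N has_derivative (g' y)) (at y)" "\<And>y. y \<in> V \<Longrightarrow> g' y = inv (blinfun_apply (f' (N y)))"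
      "\<And>y. y \<in> V \<Longrightarrow> bij (blinfun_apply (f' (N y)))"
    then show ?thesis by (intro exI[of _ U] exI[of _ V] exI[of _ N] exI[of _ g'] conjI ballI)
  qed
  then obtain U V N g' where U: "open U" "U \<subseteq> T" "y0 \<in> U" "open V" "homeomorphism U V ?M N"
    and all: "\<forall>y\<in>V. (N has_derivative (g' y)) (at y) \<and> g' y = inv (blinfun_apply (f' (N y))) \<and> bij (blinfun_apply (f' (N y)))"
    by (elim exE conjE)
  have N: "(N has_derivative (g' y)) (at y)" and g': "g' y = inv (blinfun_apply (f' (N y)))"
    and bij: "bij (blinfun_apply (f' (N y)))" if "y \<in> V" for y
    using all that by blast+
  have NT: "N y \<in> T" "N y \<in> U" if "y \<in> V" for y
    using homeomorphism_image2[OF U(5)] U(2) that by blast+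
  have nz': "frechet_derivative k (at (N y)) (1, 0) \<noteq> 0" if y: "y \<in> V" for y
  proof
    assume "frechet_derivative k (at (N y)) (1, 0) = 0"
    then have "blinfun_apply (f' (N y)) (1, 0) = blinfun_apply (f' (N y)) 0"
      unfolding blinfun.zero_right bl[OF NT(1)[OF y]]
      using linear_0[OF has_derivative_linear[OF kd[OF NT(1)[OF y]]]] by (simp add: zero_prod_def)
    then show False using bij_is_inj[OF bij[OF y]] by (auto dest!: injD simp: zero_prod_def)
  qed
  \<comment> \<open>The inverse of the derivative of \<open>?M\<close>: the second component is kept
    and the first is solved for, with the derivative of \<open>k\<close> along \<open>(1, 0)\<close>
    as divisor.\<close>
  let ?N' = "\<lambda>y v. ((fst v - frechet_derivative k (at (N y)) (0, snd v)) * inverse (frechet_derivative k (at (N y)) (1, 0)), snd v)"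
  have Nd: "(N has_derivative ?N' y) (at y)" if y: "y \<in> V" for y
  proof (rule has_derivative_eq_rhs[OF N[OF y]], rule ext)
    fix v
    have "blinfun_apply (f' (N y)) (?N' y v) = v"
      unfolding bl[OF NT(1)[OF y]]
        split[OF NT(1)[OF y], of "(fst v - frechet_derivative k (at (N y)) (0, snd v)) * inverse (frechet_derivative k (at (N y)) (1, 0))" "snd v"]
      using nz'[OF y] by (simp add: prod_eq_iff mult.assoc)
    then show "g' y v = ?N' y v"
      unfolding g'[OF y] using inv_f_eq[OF bij_is_inj[OF bij[OF y]]] by blast
  qed
  have "Ck_on j V N" for j
  proof (induction j)
    case 0
    show ?case using homeomorphism_cont2[OF U(5)] by simp
  next
    case (Suc j)
    have kN: "Ck_on j V (\<lambda>y. frechet_derivative k (at (N y)) w)" for w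
      by (rule Ck_on_compose[OF U(4) smooth_openD(1)[OF k] NT(1) Suc smooth_openD(2)[OF smooth_open_deriv[OF k]]])
    have "Ck_on j V (\<lambda>y. ?N' y v)" for v
    proof -
      have 1: "Ck_on j V (\<lambda>y. (fst v - frechet_derivative k (at (N y)) (0, snd v)) * inverse (frechet_derivative k (at (N y)) (1, 0)))"
      proof (intro bounded_bilinear.Ck_on_bilinear[OF bounded_bilinear_mult U(4)] Ck_on_inverse[OF U(4) nz' kN])
        have "Ck_on j V (\<lambda>y. fst v + - frechet_derivative k (at (N y)) (0, snd v))"
          by (intro Ck_on_add[OF U(4)] Ck_on_const[OF U(4)]
              bounded_linear.Ck_on_linear[OF bounded_linear_minus[OF bounded_linear_ident] U(4)] kN)
        then show "Ck_on j V (\<lambda>y. fst v - frechet_derivative k (at (N y)) (0, snd v))" by simp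
      qed
      have "Ck_on j V (\<lambda>y. ((fst v - frechet_derivative k (at (N y)) (0, snd v)) * inverse (frechet_derivative k (at (N y)) (1, 0)), 0) + (0, snd v))"
        by (intro Ck_on_add[OF U(4)] Ck_on_const[OF U(4)]
            bounded_linear.Ck_on_linear[OF _ U(4) 1, of "\<lambda>y. (y, 0)"]) (auto intro!: bounded_linear_intros)
      then show ?thesis by simp
    qed
    then show ?case by (rule Ck_on_SucI[OF U(4) Nd, rotated])
  qed
  then have "smooth_open V N" unfolding smooth_open_def using U(4) by blast
  then show thesis by (rule that[OF U])
qed

text \<open>\<open>smooth_straightening\<close> needs a nonzero derivative along the first axis.
  Here the axes are chosen so that a given direction \<open>b\<close> becomes the first; the
  hyperplane orthogonal to \<open>b\<close> is identified with \<open>'f\<close> by its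
  dimension.\<close>

lemma linear_splitting:
  fixes b :: "'e::euclidean_space"
  assumes b: "b \<noteq> 0" and dim: "DIM('e) = Suc DIM('f::euclidean_space)"
  obtains \<Phi> :: "'e \<Rightarrow> real \<times> ('f::euclidean_space)" and \<Psi> where "bounded_linear \<Phi>" "bounded_linear \<Psi>" "\<forall>y. \<Psi> (\<Phi> y) = y" "\<forall>y. \<Phi> (\<Psi> y) = y" "\<Psi> (1, 0) = b"
proof -
  let ?S = "{y. b \<bullet> y = 0}"
  have S: "subspace ?S" by (rule subspace_hyperplane)
  have "dim ?S = dim (UNIV :: 'f set)" using dim_hyperplane[OF b] dim by simp
  then have "\<exists>f g. linear f \<and> linear g \<and> g ` (UNIV :: 'f set) = ?S \<and> (\<forall>x\<in>?S. g (f x) = x) \<and> (\<forall>x. f (g x) = x)"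
  proof (rule isometries_subspaces[OF S subspace_UNIV])
    fix f :: "'e \<Rightarrow> 'f" and g
    assume "linear f" "linear g" "g ` (UNIV :: 'f set) = ?S" "\<And>x. x \<in> ?S \<Longrightarrow> g (f x) = x" "\<And>x. x \<in> UNIV \<Longrightarrow> f (g x) = x"
    then show ?thesis by (intro exI[of _ f] exI[of _ g]) auto
  qed
  then obtain f g where f: "linear f" and g: "linear g" and gS: "g ` (UNIV :: 'f set) = ?S"
    and gf: "\<forall>x\<in>?S. g (f x) = x" and fg: "\<forall>x. f (g x) = x"
    by (elim exE conjE)
  have bb: "b \<bullet> b \<noteq> 0" using b by simp
  define \<Phi> where "\<Phi> y = ((b \<bullet> y) / (b \<bullet> b), f (y - ((b \<bullet> y) / (b \<bullet> b)) *\<^sub>R b))" for y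
  define \<Psi> where "\<Psi> p = fst p *\<^sub>R b + g (snd p)" for p
  have "linear \<Phi>" unfolding \<Phi>_def
    by (rule linearI)
      (simp_all add: linear_add[OF f] linear_diff[OF f] linear_scale[OF f] inner_add_right add_divide_distrib algebra_simps)
  moreover have "linear \<Psi>" unfolding \<Psi>_def
    by (rule linearI) (simp_all add: linear_add[OF g] linear_scale[OF g] algebra_simps)
  moreover have "\<Psi> (\<Phi> y) = y" for y
  proof -
    have "y - ((b \<bullet> y) / (b \<bullet> b)) *\<^sub>R b \<in> ?S" using bb by (simp add: inner_diff_right)
    from gf[rule_format, OF this] show ?thesis unfolding \<Phi>_def \<Psi>_def by simp
  qed
  moreover have "\<Phi> (\<Psi> p) = p" for p
  proof -
    have "b \<bullet> g (snd p) = 0" using gS by blast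
    then have "(b \<bullet> \<Psi> p) / (b \<bullet> b) = fst p" unfolding \<Psi>_def using bb by (simp add: inner_add_right)
    then show ?thesis unfolding \<Phi>_def by (simp add: \<Psi>_def fg)
  qed
  moreover have "\<Psi> (1, 0) = b" unfolding \<Psi>_def using linear_0[OF g] by simp
  ultimately show thesis by (intro that[of \<Phi> \<Psi>]) (simp_all add: linear_conv_bounded_linear)
qed

lemma sum_cmod_square: "(\<Sum>i\<in>UNIV. (cmod (z $ i))\<^sup>2) = (norm (z :: complex ^ ('n::finite)))\<^sup>2"
  by (simp add: norm_vec_def L2_set_def sum_nonneg)

lemma DIM_tube: "DIM((real \<times> real) \<times> (complex ^ ('n::finite))) = Suc DIM(real \<times> (complex ^ 'n))"
  by simp

context liouville_surface
begin

lemma topspace_tube: "topspace (tube W H :: ('a \<times> (complex ^ ('n::finite))) topology) = {(w, z). w \<in> topspace W \<and> pi * (norm z)\<^sup>2 \<le> H w}"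
  unfolding tube_def by (auto simp: sum_cmod_square)

text \<open>Used with an extension \<open>h\<close> of \<open>H\<close> across the boundary of
  \<open>W\<close>: the tube is where this function is nonnegative, and its boundary is where it
  vanishes.\<close>

definition defining :: "(real \<times> real \<Rightarrow> real) \<Rightarrow> (real \<times> real) \<times> (complex ^ ('n::finite)) \<Rightarrow> real" where
  "defining h y = h (fst y) - pi * (snd y \<bullet> snd y)"

lemma defining_smooth:
  assumes "smooth_open T h"
  shows "smooth_open (T \<times> UNIV) (defining h :: (real \<times> real) \<times> (complex ^ ('n::finite)) \<Rightarrow> real)"
proof -
  have o: "open (T \<times> (UNIV :: (complex ^ 'n) set))" by (intro open_Times smooth_openD(1)[OF assms] open_UNIV)
  have "smooth_open (T \<times> UNIV) (\<lambda>y :: (real \<times> real) \<times> (complex ^ 'n). h (fst y))"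
    by (rule smooth_open_compose[OF smooth_open_fst[OF smooth_open_id[OF o]] assms]) auto
  moreover have "smooth_open (T \<times> UNIV) (\<lambda>y :: (real \<times> real) \<times> (complex ^ 'n). pi * (snd y \<bullet> snd y))"
    by (intro smooth_open_linear[OF bounded_linear_mult_right] smooth_open_bilinear[OF bounded_bilinear_inner] smooth_open_snd smooth_open_id o)
  ultimately show ?thesis unfolding defining_def by (rule smooth_open_diff)
qed

lemma defining_derivative:
  assumes h: "smooth_open T h" and y: "fst y \<in> T"
  shows "frechet_derivative (defining h) (at y) v = frechet_derivative h (at (fst y)) (fst v) - 2 * pi * (snd y \<bullet> snd v)"
proof -
  have "(defining h has_derivative (\<lambda>v. frechet_derivative h (at (fst y)) (fst v) - pi * (snd y \<bullet> snd v + snd v \<bullet> snd y))) (at y)"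
    unfolding defining_def
    by (intro has_derivative_diff has_derivative_mult_right has_derivative_inner has_derivative_snd has_derivative_ident
        has_derivative_compose[OF has_derivative_fst[OF has_derivative_ident] smooth_open_has_derivative[OF h y]])
  from frechet_derivative_at[OF this, symmetric] show ?thesis by (simp add: inner_commute)
qed

lemma tube_open_chart:
  assumes U: "openin (tube W H :: ('a \<times> (complex ^ ('n::finite))) topology) U" and p: "p \<in> U" and c: "c \<in> A" "fst p \<in> chart_dom c"
  obtains N where "open N" "prod_coord c p \<in> N"
    "\<forall>q\<in>topspace (tube W H). fst q \<in> chart_dom c \<longrightarrow> prod_coord c q \<in> N \<longrightarrow> q \<in> U"
proof -
  obtain G where G: "openin (prod_topology W euclidean) G"
    "U = G \<inter> {(w, z). w \<in> topspace W \<and> pi * (\<Sum>i\<in>UNIV. (cmod (z $ i))\<^sup>2) \<le> H w}"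
    using U unfolding tube_def openin_subtopology by blast
  obtain w z where pp: "p = (w, z)" by (cases p)
  have "(w, z) \<in> G" using p pp G(2) by simp
  then obtain V D where VD: "openin W V" "openin euclidean D" "w \<in> V" "z \<in> D" "V \<times> D \<subseteq> G"
    using G(1)[unfolded openin_prod_topology_alt, THEN spec, THEN spec, THEN mp, OF \<open>(w, z) \<in> G\<close>]
    by (elim exE conjE)
  note cf = chart_facts[OF c(1)]
  obtain S where S: "open S" "coord c ` (chart_dom c \<inter> V) = chart_img c \<inter> S"
    using cf(6)[OF openin_Int[OF cf(1) VD(1)]] by blast
  show thesis
  proof (rule that[of "S \<times> D"])
    show "open (S \<times> D)" using S(1) VD(2) by (simp add: open_Times)
    have "coord c w \<in> S" using S(2) c(2) pp VD(3) by auto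
    then show "prod_coord c p \<in> S \<times> D" using VD(4) by (simp add: prod_coord_def pp)
    show "\<forall>q\<in>topspace (tube W H). fst q \<in> chart_dom c \<longrightarrow> prod_coord c q \<in> S \<times> D \<longrightarrow> q \<in> U"
    proof (intro ballI impI)
      fix q :: "'a \<times> (complex ^ 'n)"
      assume q: "q \<in> topspace (tube W H)" "fst q \<in> chart_dom c" "prod_coord c q \<in> S \<times> D"
      obtain w' z' where qq: "q = (w', z')" by (cases q)
      have w': "w' \<in> chart_dom c" "coord c w' \<in> S" "z' \<in> D" using q qq by (auto simp: prod_coord_def)
      then have "coord c w' \<in> coord c ` (chart_dom c \<inter> V)" unfolding S(2) using cf(5) by blast
      then obtain w'' where "w'' \<in> chart_dom c" "w'' \<in> V" "coord c w' = coord c w''" by blast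
      then have "w' \<in> V" using inj_onD[OF cf(2), of w' w''] w'(1) by simp
      then have "q \<in> G" using VD(5) w'(3) qq by blast
      then show "q \<in> U" unfolding G(2) using q(1) qq by (auto simp: topspace_tube sum_cmod_square)
    qed
  qed
qed

lemma tube_open_preimage:
  assumes c: "c \<in> A" and N: "open N"
  shows "openin (tube W H :: ('a \<times> (complex ^ ('n::finite))) topology)
    {q \<in> topspace (tube W H). fst q \<in> chart_dom c \<and> prod_coord c q \<in> N}"
proof -
  let ?G = "{q \<in> topspace (prod_topology W (euclidean :: (complex ^ 'n) topology)). fst q \<in> chart_dom c \<and> prod_coord c q \<in> N}"
  note cf = chart_facts[OF c]
  have "openin (prod_topology W euclidean) ?G"
    unfolding openin_prod_topology_alt
  proof (intro allI impI)
    fix w and z :: "complex ^ 'n" assume wz: "(w, z) \<in> ?G"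
    then have "(coord c w, z) \<in> N" by (simp add: prod_coord_def)
    then obtain S D where SD: "open S" "open D" "coord c w \<in> S" "z \<in> D" "S \<times> D \<subseteq> N"
      by (rule open_prod_elim[OF N]) auto
    have "openin W {w \<in> chart_dom c. coord c w \<in> S}" by (rule cf(7)[OF SD(1)])
    moreover have "{w \<in> chart_dom c. coord c w \<in> S} \<times> D \<subseteq> ?G"
      using SD(5) openin_subset[OF cf(1)] by (auto simp: prod_coord_def)
    ultimately show "\<exists>U V. openin W U \<and> openin euclidean V \<and> w \<in> U \<and> z \<in> V \<and> U \<times> V \<subseteq> ?G"
      using SD wz by (intro exI[of _ "{w \<in> chart_dom c. coord c w \<in> S}"] exI[of _ D]) auto
  qed
  moreover have "{q \<in> topspace (tube W H). fst q \<in> chart_dom c \<and> prod_coord c q \<in> N} =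
    ?G \<inter> {(w, z). w \<in> topspace W \<and> pi * (\<Sum>i\<in>UNIV. (cmod (z $ i))\<^sup>2) \<le> H w}"
    unfolding tube_def by auto
  ultimately show ?thesis unfolding tube_def openin_subtopology by blast
qed


text \<open>For \<open>z\<close> nonzero the radial derivative is nonzero. If \<open>z = 0\<close>
  then \<open>H w = 0\<close>, so \<open>w\<close> lies on the boundary of \<open>W\<close>, where
  the slope of \<open>h\<close> is positive. Hence the tube has no corner over the boundary of
  \<open>W\<close>.\<close>

lemma defining_derivative_nonzero:
  fixes z :: "complex ^ ('n::finite)"
  assumes g: "good_ball c (coord c w) r l1 l2 h" and c: "c \<in> A" "w \<in> chart_dom c" and bd: "pi * (norm z)\<^sup>2 = H w"
  shows "\<exists>v. frechet_derivative (defining h) (at (coord c w, z)) v \<noteq> 0"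
proof -
  note g' = good_ballD[OF g]
  note rf = rep_facts[OF g'(2)]
  have x: "coord c w \<in> ball (coord c w) r" using g'(1) by simp
  note dd = defining_derivative[OF rf(4), of "(coord c w, z)", unfolded fst_conv snd_conv, OF x]
  have lin0: "frechet_derivative h (at (coord c w)) 0 = 0"
    by (rule linear_0[OF has_derivative_linear[OF smooth_open_has_derivative[OF rf(4) x]]])
  show ?thesis
  proof (cases "z = 0")
    case False
    then have "frechet_derivative (defining h) (at (coord c w, z)) (0, z) \<noteq> 0"
      unfolding dd fst_conv snd_conv lin0 by simp
    then show ?thesis by blast
  next
    case True
    then have "H w = 0" using bd by simp
    then have "fst (coord c w) = 0" using H_pos[OF c] chart_img_half[OF c] by fastforce
    from g'(5)[OF this] have "frechet_derivative (defining h) (at (coord c w, z)) ((1, 0), 0) \<noteq> 0"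
      unfolding dd fst_conv snd_conv by simp
    then show ?thesis by blast
  qed
qed

text \<open>The inequality for \<open>defining h\<close> contains the half-space condition: it
  forces \<open>h x \<ge> 0\<close>, while \<open>h\<close> is negative beyond the boundary.\<close>

lemma tube_point:
  fixes z :: "complex ^ ('n::finite)"
  assumes g: "good_ball c x0 r l1 l2 h" and y: "x \<in> ball x0 r" "defining h (x, z) \<ge> 0"
  shows "(chart_inv c x, z) \<in> topspace (tube W H)" "chart_inv c x \<in> chart_dom c" "prod_coord c (chart_inv c x, z) = (x, z)"
proof -
  note g' = good_ballD[OF g]
  note rf = rep_facts[OF g'(2)]
  have h: "pi * (norm z)\<^sup>2 \<le> h x" using y(2) by (simp add: defining_def power2_norm_eq_inner)
  moreover have "0 \<le> pi * (norm z)\<^sup>2" by simp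
  ultimately have "fst x \<ge> 0" using g'(4)[OF y(1)] by linarith
  note i = in_chart_of_half_space[OF g'(2) y(1) this]
  show "chart_inv c x \<in> chart_dom c" by (rule i(1))
  show "(chart_inv c x, z) \<in> topspace (tube W H)"
    using i(1,3) h covers rf(1) by (auto simp: topspace_tube)
  show "prod_coord c (chart_inv c x, z) = (x, z)" using i(2) by (simp add: prod_coord_def)
qed

lemma tube_defining:
  fixes q :: "'a \<times> (complex ^ ('n::finite))"
  assumes rep: "local_rep c T l1 l2 h" and q: "fst q \<in> chart_dom c" "coord c (fst q) \<in> T"
  shows "defining h (prod_coord c q) = H (fst q) - pi * (norm (snd q))\<^sup>2"
  using rep_facts(7)[OF rep q] by (cases q) (simp add: defining_def prod_coord_def power2_norm_eq_inner)

lemma transition_coord: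
  assumes "c \<in> A" "q \<in> chart_dom c"
  shows "Defs.transition c d (coord c q) = coord d q"
  unfolding Defs.transition_def using chart_facts(3)[OF assms] by simp

lemma prod_inv_coord:
  assumes "c \<in> A" "fst q \<in> chart_dom c"
  shows "prod_inv c (prod_coord c q) = q"
  using chart_facts(3)[OF assms] by (cases q) (simp add: prod_inv_def prod_coord_def)

text \<open>The defining function is made the first coordinate, by a linear change of axes
  \<open>\<Phi>\<close> and a straightening with inverse \<open>N\<close>. As
  \<open>tube_atlas\<close> is the set of all compatible charts, nothing in its definition
  guarantees one around \<open>p\<close>; compatibility of the new chart is checked against each
  \<open>d\<close> in \<open>A\<close> through the chart \<open>c\<close> of the
  construction.\<close>

lemma tube_boundary_chart:
  fixes p :: "'a \<times> (complex ^ ('n::finite))"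
  assumes p: "fst p \<in> topspace W" "pi * (norm (snd p))\<^sup>2 = H (fst p)"
  shows "\<exists>e\<in>tube_atlas W A H. p \<in> chart_dom e \<and> fst (coord e p) = 0"
proof -
  let ?M = "tube W H :: ('a \<times> (complex ^ 'n)) topology"
  obtain c where c: "c \<in> A" "fst p \<in> chart_dom c" using p(1) covers by blast
  obtain r l1 l2 h where g: "good_ball c (coord c (fst p)) r l1 l2 h" by (rule good_ball_exists[OF c])
  note g' = good_ballD[OF g]
  note rf = rep_facts[OF g'(2)]
  let ?B = "ball (coord c (fst p)) r"
  let ?T0 = "?B \<times> (UNIV :: (complex ^ 'n) set)"
  let ?K = "defining h :: (real \<times> real) \<times> (complex ^ 'n) \<Rightarrow> real"
  let ?y0 = "prod_coord c p"
  have y0: "?y0 = (coord c (fst p), snd p)" by (cases p) (simp add: prod_coord_def)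
  have y0T: "?y0 \<in> ?T0" using y0 g'(1) by simp
  have K: "smooth_open ?T0 ?K" by (rule defining_smooth[OF rf(4)])
  have Kd: "(?K has_derivative frechet_derivative ?K (at ?y0)) (at ?y0)" by (rule smooth_open_has_derivative[OF K y0T])
  obtain b where b: "frechet_derivative ?K (at ?y0) b \<noteq> 0"
    using defining_derivative_nonzero[OF g c p(2)] y0 by auto
  have "b \<noteq> 0" using b linear_0[OF has_derivative_linear[OF Kd]] by auto
  from linear_splitting[OF this DIM_tube]
  obtain \<Phi> :: "(real \<times> real) \<times> (complex ^ 'n) \<Rightarrow> real \<times> (real \<times> (complex ^ 'n))" and \<Psi>
    where \<Phi>: "bounded_linear \<Phi>" and \<Psi>: "bounded_linear \<Psi>" and inv0: "\<forall>y. \<Psi> (\<Phi> y) = y" "\<forall>y. \<Phi> (\<Psi> y) = y"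
    and \<Psi>b: "\<Psi> (1, 0) = b" .
  have \<Psi>\<Phi>: "\<Psi> (\<Phi> y) = y" and \<Phi>\<Psi>: "\<Phi> (\<Psi> x) = x" for x y using inv0 by blast+
  have \<Psi>s: "smooth_open UNIV \<Psi>" by (rule smooth_open_linear[OF \<Psi> smooth_open_id[OF open_UNIV]])
  have \<Phi>s: "smooth_open UNIV \<Phi>" by (rule smooth_open_linear[OF \<Phi> smooth_open_id[OF open_UNIV]])
  \<comment> \<open>In the new axes the derivative along the first axis is that of \<open>?K\<close>
    along \<open>b\<close>, which is nonzero.\<close>
  define k where "k y = ?K (\<Psi> y)" for y
  define T where "T = \<Psi> -` ?T0"
  have oT: "open T" using smooth_open_Int_preimage[OF \<Psi>s smooth_openD(1)[OF K]] by (simp add: T_def)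
  have k: "smooth_open T k" unfolding k_def
    by (rule smooth_open_compose[OF smooth_open_subset[OF \<Psi>s oT] K]) (auto simp: T_def)
  have \<Phi>y0: "\<Phi> ?y0 \<in> T" unfolding T_def using y0T \<Psi>\<Phi> by simp
  have "((\<lambda>y. ?K (\<Psi> y)) has_derivative (\<lambda>v. frechet_derivative ?K (at ?y0) (\<Psi> v))) (at (\<Phi> ?y0))"
    by (rule has_derivative_compose[OF bounded_linear_imp_has_derivative[OF \<Psi>]]) (use Kd \<Psi>\<Phi> in simp)
  from frechet_derivative_at[OF this, symmetric]
  have nz: "frechet_derivative k (at (\<Phi> ?y0)) (1, 0) \<noteq> 0" unfolding k_def using b \<Psi>b by simp
  let ?M' = "\<lambda>y. (k y, snd y)"
  obtain U V N where U: "open U" "U \<subseteq> T" "\<Phi> ?y0 \<in> U" and V: "open V" and hom: "homeomorphism U V ?M' N" and N: "smooth_open V N"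
    by (rule smooth_straightening[OF k \<Phi>y0 nz])
  have NU: "N v \<in> U" "?M' (N v) = v" if "v \<in> V" for v
    using homeomorphism_image2[OF hom] homeomorphism_apply2[OF hom] that by blast+
  have MV: "?M' u \<in> V" "N (?M' u) = u" if "u \<in> U" for u
    using homeomorphism_image1[OF hom] homeomorphism_apply1[OF hom] that by blast+
  have M's: "smooth_open T ?M'" by (intro smooth_open_Pair k smooth_open_snd smooth_open_id oT)
  define D where "D = {q \<in> topspace ?M. fst q \<in> chart_dom c \<and> prod_coord c q \<in> \<Phi> -` U}"
  define f where "f q = ?M' (\<Phi> (prod_coord c q))" for q
  define e where "e = (D, f)"
  have pre: "open (\<Phi> -` S)" if "open S" for S
    using smooth_open_Int_preimage[OF \<Phi>s that] by simp
  have qD: "\<Phi> (prod_coord c q) \<in> U" "prod_coord c q \<in> ?T0" "f q \<in> V" "N (f q) = \<Phi> (prod_coord c q)"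
    "fst (f q) = H (fst q) - pi * (norm (snd q))\<^sup>2" if q: "q \<in> D" for q
  proof -
    show u: "\<Phi> (prod_coord c q) \<in> U" using q unfolding D_def by simp
    then have "\<Psi> (\<Phi> (prod_coord c q)) \<in> ?T0" using U(2) unfolding T_def by blast
    then show t: "prod_coord c q \<in> ?T0" using \<Psi>\<Phi> by simp
    show "f q \<in> V" "N (f q) = \<Phi> (prod_coord c q)" unfolding f_def using MV[OF u] by auto
    have "coord c (fst q) \<in> ?B" using t by (cases q) (simp add: prod_coord_def)
    then show "fst (f q) = H (fst q) - pi * (norm (snd q))\<^sup>2"
      unfolding f_def k_def using tube_defining[OF g'(2), of q] q \<Psi>\<Phi> unfolding D_def by simp
  qed
  \<comment> \<open>Half-space points of \<open>V\<close> come from the tube: a nonnegative first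
    coordinate is a nonnegative value of the defining function, so \<open>tube_point\<close>
    applies. This makes the image of the chart relatively open in the half-space.\<close>
  have lift: "\<exists>q\<in>D. f q = v \<and> prod_coord c q = \<Psi> (N v)" if v: "v \<in> V" "fst v \<ge> 0" for v
  proof -
    obtain x z where xz: "\<Psi> (N v) = (x, z)" by (cases "\<Psi> (N v)")
    have "\<Psi> (N v) \<in> ?T0" using NU(1)[OF v(1)] U(2) unfolding T_def by blast
    then have xB: "x \<in> ?B" using xz by simp
    have "?K (x, z) = fst (?M' (N v))" unfolding fst_conv k_def xz ..
    then have "?K (x, z) \<ge> 0" using NU(2)[OF v(1)] v(2) by simp
    note tp = tube_point[OF g xB this]
    let ?q = "(chart_inv c x, z)"
    have pc: "prod_coord c ?q = \<Psi> (N v)" using tp(3) xz by simp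
    have "?q \<in> D" unfolding D_def using tp(1,2) NU(1)[OF v(1)] \<Phi>\<Psi> pc by simp
    moreover have "f ?q = v" unfolding f_def pc using \<Phi>\<Psi> NU(2)[OF v(1)] by simp
    ultimately show ?thesis using pc by blast
  qed
  have img: "f ` D = half_space \<inter> V"
  proof
    show "f ` D \<subseteq> half_space \<inter> V"
      using qD(3,5) unfolding half_space_def D_def by (auto simp: topspace_tube)
    show "half_space \<inter> V \<subseteq> f ` D" using lift unfolding half_space_def by blast
  qed
  have Dop: "openin ?M D" unfolding D_def by (rule tube_open_preimage[OF c(1) pre[OF U(1)]])
  have Dsub: "D \<subseteq> topspace ?M" by (rule openin_subset[OF Dop])
  have pcinj: "q = q'" if "q \<in> D" "q' \<in> D" "prod_coord c q = prod_coord c q'" for q q'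
  proof -
    have d: "fst q \<in> chart_dom c" "fst q' \<in> chart_dom c" using that(1,2) unfolding D_def by auto
    have "q = prod_inv c (prod_coord c q')" using prod_inv_coord[OF c(1) d(1)] that(3) by simp
    then show ?thesis using prod_inv_coord[OF c(1) d(2)] by simp
  qed
  have finj: "inj_on f D"
  proof (rule inj_onI)
    fix q q' assume q: "q \<in> D" "q' \<in> D" "f q = f q'"
    then have "\<Phi> (prod_coord c q) = \<Phi> (prod_coord c q')" using qD(4)[OF q(1)] qD(4)[OF q(2)] by simp
    then have "prod_coord c q = prod_coord c q'" using \<Psi>\<Phi> by metis
    then show "q = q'" by (rule pcinj[OF q(1,2)])
  qed
  have tsD: "topspace (subtopology ?M D) = D" using Dsub by auto
  have hm: "homeomorphic_map (subtopology ?M D) (top_of_set (f ` D)) f"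
  proof (rule bijective_open_imp_homeomorphic_map)
    show "f ` topspace (subtopology ?M D) = topspace (top_of_set (f ` D))" using tsD by simp
    show "inj_on f (topspace (subtopology ?M D))" unfolding tsD by (rule finj)
    show "continuous_map (subtopology ?M D) (top_of_set (f ` D)) f"
      unfolding continuous_map_in_subtopology
    proof (intro conjI)
      show "continuous_map (subtopology ?M D) euclidean f"
        unfolding continuous_map_def
      proof (intro conjI allI impI)
        fix S :: "(real \<times> (real \<times> (complex ^ 'n))) set" assume S: "openin euclidean S"
        have o: "open (U \<inter> ?M' -` S)"
          using smooth_open_Int_preimage[OF smooth_open_subset[OF M's U(1,2)]] S by simp
        have "{q \<in> topspace (subtopology ?M D). f q \<in> S} =
          {q \<in> topspace ?M. fst q \<in> chart_dom c \<and> prod_coord c q \<in> \<Phi> -` (U \<inter> ?M' -` S)}"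
          unfolding tsD D_def f_def by auto
        then have "openin ?M {q \<in> topspace (subtopology ?M D). f q \<in> S}"
          using tube_open_preimage[OF c(1) pre[OF o]] by simp
        moreover have "{q \<in> topspace (subtopology ?M D). f q \<in> S} \<subseteq> D" by auto
        ultimately show "openin (subtopology ?M D) {q \<in> topspace (subtopology ?M D). f q \<in> S}"
          unfolding openin_open_subtopology[OF Dop] by blast
      qed simp
      show "f \<in> topspace (subtopology ?M D) \<rightarrow> f ` D" unfolding tsD by auto
    qed
    show "open_map (subtopology ?M D) (top_of_set (f ` D)) f"
      unfolding open_map_def
    proof (intro allI impI)
      fix S assume "openin (subtopology ?M D) S"
      then have S: "openin ?M S" "S \<subseteq> D" using Dop by (auto simp: openin_open_subtopology)
      show "openin (top_of_set (f ` D)) (f ` S)"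
      proof (subst openin_subopen, intro ballI)
        fix v assume "v \<in> f ` S"
        then obtain q where q: "q \<in> S" "v = f q" by blast
        have qD': "q \<in> D" "fst q \<in> chart_dom c" using q(1) S(2) unfolding D_def by auto
        obtain O' where O': "open O'" "prod_coord c q \<in> O'"
          "\<forall>q\<in>topspace ?M. fst q \<in> chart_dom c \<longrightarrow> prod_coord c q \<in> O' \<longrightarrow> q \<in> S"
          by (rule tube_open_chart[OF S(1) q(1) c(1) qD'(2)])
        let ?P = "V \<inter> N -` (\<Psi> -` O')"
        have "open (\<Psi> -` O')" using smooth_open_Int_preimage[OF \<Psi>s O'(1)] by simp
        then have oP: "open ?P" by (rule smooth_open_Int_preimage[OF N])
        have "v \<in> f ` D \<inter> ?P" using q qD'(1) qD(3,4)[OF qD'(1)] \<Psi>\<Phi> O'(2) by simp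
        moreover have "f ` D \<inter> ?P \<subseteq> f ` S"
        proof
          fix u assume u: "u \<in> f ` D \<inter> ?P"
          then obtain q' where q': "q' \<in> D" "u = f q'" by blast
          have "prod_coord c q' \<in> O'" using u q' qD(4)[OF q'(1)] \<Psi>\<Phi> by simp
          then have "q' \<in> S" using O'(3) q'(1) unfolding D_def by blast
          then show "u \<in> f ` S" using q'(2) by blast
        qed
        ultimately show "\<exists>P. openin (top_of_set (f ` D)) P \<and> v \<in> P \<and> P \<subseteq> f ` S"
          using oP by (intro exI[of _ "f ` D \<inter> ?P"] conjI openin_open_Int) auto
      qed
    qed
  qed
  have top_chart: "topological_chart ?M e"
    unfolding topological_chart_def e_def chart_img_def fst_conv snd_conv
    using Dop hm img V by (auto intro: openin_open_Int)
  have inv_e: "chart_inv e (f q) = q" if "q \<in> D" for q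
    unfolding chart_inv_def e_def fst_conv snd_conv by (rule inv_into_f_f[OF finj that])
  have smooth: "smooth_on (prod_coord d ` (D \<inter> (chart_dom d \<times> UNIV))) (f \<circ> prod_inv d) \<and>
     smooth_on (f ` (D \<inter> (chart_dom d \<times> UNIV))) (prod_coord d \<circ> chart_inv e)" if d: "d \<in> A" for d
  proof
    let ?V = "D \<inter> (chart_dom d \<times> UNIV)"
    have pc: "prod_coord a q = (coord a (fst q), snd q)" for a :: "('a, real) chart" and q :: "'a \<times> (complex ^ 'n)"
      by (cases q) (simp add: prod_coord_def)
    have trans: "prod_coord c q = (Defs.transition d c (fst (prod_coord d q)), snd (prod_coord d q))"
      "prod_coord d q = (Defs.transition c d (fst (prod_coord c q)), snd (prod_coord c q))" if "q \<in> ?V" for q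
      using transition_coord[OF d, of "fst q" c] transition_coord[OF c(1), of "fst q" d] that
      unfolding pc D_def by auto
    have fs: "smooth_on X fst" "smooth_on X snd" for X :: "((real \<times> real) \<times> (complex ^ 'n)) set"
      by (rule smooth_open_imp_smooth_on[OF smooth_open_fst[OF smooth_open_id[OF open_UNIV]]], simp)
        (rule smooth_open_imp_smooth_on[OF smooth_open_snd[OF smooth_open_id[OF open_UNIV]]], simp)
    show "smooth_on (prod_coord d ` ?V) (f \<circ> prod_inv d)"
    proof (rule smooth_on_cong)
      have 1: "smooth_on (prod_coord d ` ?V) (\<lambda>y. (Defs.transition d c (fst y), snd y))"
        by (intro smooth_on_Pair fs smooth_on_compose[OF fs(1) transitions[OF d c(1)]])
          (auto simp: overlap_def pc D_def)
      have 2: "smooth_on (\<Phi> -` U) (\<lambda>y. ?M' (\<Phi> y))"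
        by (rule smooth_open_imp_smooth_on[OF smooth_open_compose[OF smooth_open_subset[OF \<Phi>s pre[OF U(1)]] M's]])
          (use U(2) in auto)
      show "smooth_on (prod_coord d ` ?V) (\<lambda>y. ?M' (\<Phi> (Defs.transition d c (fst y), snd y)))"
      proof (rule smooth_on_compose[OF 1 2])
        show "(\<lambda>y. (Defs.transition d c (fst y), snd y)) ` prod_coord d ` ?V \<subseteq> \<Phi> -` U"
        proof clarsimp
          fix w z assume "(w, z) \<in> D" "w \<in> chart_dom d"
          then have q: "(w, z) \<in> ?V" by simp
          show "\<Phi> (Defs.transition d c (fst (prod_coord d (w, z))), snd (prod_coord d (w, z))) \<in> U"
            using trans(1)[OF q] qD(1)[of "(w, z)"] q by simp
        qed
      qed
      fix y assume "y \<in> prod_coord d ` ?V"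
      then obtain q where q: "q \<in> ?V" "y = prod_coord d q" by blast
      have "prod_inv d y = q" using prod_inv_coord[OF d] q by auto
      then show "?M' (\<Phi> (Defs.transition d c (fst y), snd y)) = (f \<circ> prod_inv d) y"
        unfolding f_def comp_apply using trans(1)[OF q(1)] q(2) by simp
    qed
    show "smooth_on (f ` ?V) (prod_coord d \<circ> chart_inv e)"
    proof (rule smooth_on_cong)
      have 1: "smooth_on (f ` ?V) (\<lambda>v. \<Psi> (N v))"
        by (rule smooth_open_imp_smooth_on[OF smooth_open_linear[OF \<Psi> N]]) (use qD(3) in auto)
      have \<Psi>N: "\<Psi> (N (f q)) = prod_coord c q" if "q \<in> ?V" for q using qD(4)[of q] \<Psi>\<Phi> that by simp
      have 2: "smooth_on (prod_coord c ` ?V) (\<lambda>y. (Defs.transition c d (fst y), snd y))"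
        by (intro smooth_on_Pair fs smooth_on_compose[OF fs(1) transitions[OF c(1) d]])
          (auto simp: overlap_def pc D_def)
      show "smooth_on (f ` ?V) (\<lambda>v. (Defs.transition c d (fst (\<Psi> (N v))), snd (\<Psi> (N v))))"
        by (rule smooth_on_compose[OF 1 2]) (use \<Psi>N in auto)
      fix v assume "v \<in> f ` ?V"
      then obtain q where q: "q \<in> ?V" "v = f q" by blast
      then have "chart_inv e v = q" using inv_e by simp
      then show "(Defs.transition c d (fst (\<Psi> (N v))), snd (\<Psi> (N v))) = (prod_coord d \<circ> chart_inv e) v"
        using trans(2)[OF q(1)] \<Psi>N[OF q(1)] q(2) by simp
    qed
  qed
  have "e \<in> tube_atlas W A H"
    unfolding tube_atlas_def Let_def using top_chart smooth by (simp add: e_def)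
  moreover have pD: "p \<in> D" unfolding D_def using p c(2) U(3) by (cases p) (simp add: topspace_tube)
  moreover have "fst (coord e p) = 0" using qD(5)[OF pD] p(2) by (simp add: e_def)
  ultimately show ?thesis by (intro bexI[of _ e]) (simp_all add: e_def)
qed

end

section \<open>The Reeb flow of an iterated tube\<close>

text \<open>The standard complex structure on the fibre; as a vector field it generates the rotation
  \<open>rot\<close>.\<close>

definition imul :: "complex ^ ('n::finite) \<Rightarrow> complex ^ 'n" where
  "imul z = (\<chi> i. \<i> * z $ i)"

lemma imul_linear: "bounded_linear imul"
  unfolding imul_def
  by (simp add: linear_conv_bounded_linear[symmetric] linear_iff vec_eq_iff algebra_simps)

lemma imul_add: "imul (x + y) = imul x + imul y" and imul_scaleR: "imul (a *\<^sub>R x) = a *\<^sub>R imul x"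
  by (simp_all add: imul_def vec_eq_iff algebra_simps)

lemma inner_imul: "imul z \<bullet> imul y = z \<bullet> (y :: complex ^ ('n::finite))"
  by (simp add: imul_def inner_vec_def inner_complex_def add.commute)

lemma imul_imul: "imul (imul z) = - z"
  by (simp add: imul_def vec_eq_iff mult.assoc[symmetric])

lemma inner_imul_self: "z \<bullet> imul (z :: complex ^ ('n::finite)) = 0"
  by (simp add: imul_def inner_vec_def inner_complex_def)

lemma std_form_eq: "std_form z \<zeta> = - (z \<bullet> imul \<zeta>) / 2"
  by (simp add: std_form_def imul_def inner_vec_def inner_complex_def sum_negf[symmetric] algebra_simps)

lemma imul_skew: "imul z \<bullet> y = - (z \<bullet> imul (y :: complex ^ ('n::finite)))"
proof -
  have "- (imul z \<bullet> y) = z \<bullet> imul y" using inner_imul[of z "imul y"] by (simp add: imul_imul)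
  then show ?thesis by linarith
qed

lemma std_form_bounded_linear: "bounded_linear (\<lambda>z. std_form z \<zeta>)"
proof -
  have "(\<lambda>z. std_form z \<zeta>) = (\<lambda>z. z \<bullet> ((- 1 / 2) *\<^sub>R imul \<zeta>))" by (simp add: std_form_eq fun_eq_iff)
  then show ?thesis by (simp only: bounded_linear_inner_left)
qed

definition tube_plane_form where
  "tube_plane_form l1 l2 y v = plane_form l1 l2 (fst y) (fst v) + std_form (snd y) (snd v :: complex ^ ('n::finite))"

lemma tube_plane_form_smooth:
  assumes "smooth_open T l1" "smooth_open T l2"
  shows "smooth_open (T \<times> (UNIV :: (complex ^ ('n::finite)) set)) (\<lambda>y. tube_plane_form l1 l2 y v)"
proof -
  have o: "open (T \<times> (UNIV :: (complex ^ 'n) set))" by (intro open_Times smooth_openD(1)[OF assms(1)] open_UNIV)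
  have "smooth_open (T \<times> UNIV) (\<lambda>y :: (real \<times> real) \<times> (complex ^ 'n). plane_form l1 l2 (fst y) (fst v))"
    by (rule smooth_open_compose[OF smooth_open_fst[OF smooth_open_id[OF o]] plane_form_smooth[OF assms]]) auto
  moreover have "smooth_open (T \<times> UNIV) (\<lambda>y :: (real \<times> real) \<times> (complex ^ 'n). std_form (snd y) (snd v))"
    by (rule smooth_open_linear[OF std_form_bounded_linear smooth_open_snd[OF smooth_open_id[OF o]]])
  ultimately show ?thesis unfolding tube_plane_form_def by (rule smooth_open_add)
qed

lemma tube_plane_form_linear: "linear (tube_plane_form l1 l2 y)"
proof -
  interpret p: linear "plane_form l1 l2 (fst y)" by (rule plane_form_linear)
  interpret i: bounded_linear imul by (rule imul_linear)
  show ?thesis unfolding tube_plane_form_def std_form_eq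
    by (rule linearI) (simp_all add: p.add p.scaleR i.add i.scaleR inner_add_right field_simps)
qed

text \<open>The fibre term occurs once for each order of the arguments, with equal contributions
  since \<open>imul\<close> is skew; this cancels the factor 1/2 of \<open>std_form\<close> and
  leaves the standard symplectic form.\<close>

lemma curl_tube_plane_form:
  fixes y :: "(real \<times> real) \<times> (complex ^ ('n::finite))"
  assumes l: "smooth_open T l1" "smooth_open T l2" and y: "fst y \<in> T"
  shows "curl (tube_plane_form l1 l2) y u v =
     (fst (fst u) * snd (fst v) - snd (fst u) * fst (fst v)) * plane_curl l1 l2 (fst y) - snd u \<bullet> imul (snd v)"
proof -
  have "frechet_derivative (\<lambda>y. tube_plane_form l1 l2 y v) (at y) u =
    frechet_derivative (\<lambda>x. plane_form l1 l2 x (fst v)) (at (fst y)) (fst u) - (snd u \<bullet> imul (snd v)) / 2" for u v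
  proof -
    have "((\<lambda>y. tube_plane_form l1 l2 y v) has_derivative
      (\<lambda>u. frechet_derivative (\<lambda>x. plane_form l1 l2 x (fst v)) (at (fst y)) (fst u) + - (snd u \<bullet> imul (snd v)) / 2)) (at y)"
      unfolding tube_plane_form_def std_form_eq[symmetric]
    proof (intro has_derivative_add)
      show "((\<lambda>y. plane_form l1 l2 (fst y) (fst v)) has_derivative
        (\<lambda>u. frechet_derivative (\<lambda>x. plane_form l1 l2 x (fst v)) (at (fst y)) (fst u))) (at y)"
        by (rule has_derivative_compose[OF has_derivative_fst[OF has_derivative_ident] smooth_open_has_derivative[OF plane_form_smooth[OF l] y]])
      show "((\<lambda>w. std_form (snd w) (snd v)) has_derivative (\<lambda>u. std_form (snd u) (snd v))) (at y)"
        by (rule bounded_linear_imp_has_derivative[OF bounded_linear_compose[OF std_form_bounded_linear bounded_linear_snd]])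
    qed
    from frechet_derivative_at[OF this, symmetric] show ?thesis by simp
  qed
  then have "curl (tube_plane_form l1 l2) y u v = curl (plane_form l1 l2) (fst y) (fst u) (fst v)
      - (snd u \<bullet> imul (snd v)) / 2 + (snd v \<bullet> imul (snd u)) / 2"
    unfolding curl_def by simp
  moreover have "snd v \<bullet> imul (snd u) = - (snd u \<bullet> imul (snd v))"
    using imul_skew[of "snd u" "snd v"] by (simp add: inner_commute)
  ultimately show ?thesis unfolding curl_plane_form[OF l y] by simp
qed

lemma left_inverse_imp_right_inverse:
  fixes f :: "'a::euclidean_space \<Rightarrow> 'b::euclidean_space"
  assumes f: "linear f" and gf: "\<And>x. g (f x) = x" and dim: "DIM('a) = DIM('b)"
  shows "f (g y) = y"
proof -
  have "inj f" by (rule inj_on_inverseI[of UNIV g f]) (rule gf)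
  then have "surj f" using linear_injective_imp_surjective[OF f] dim by simp
  then obtain x where "y = f x" by (auto simp: surj_def)
  then show ?thesis using gf by simp
qed

lemma has_vector_derivative_chain:
  assumes u: "(u has_vector_derivative v) (at t)" and F: "(F has_derivative F') (at (u t))"
  shows "((\<lambda>s. F (u s)) has_vector_derivative F' v) (at t)"
  unfolding has_vector_derivative_def
  by (rule has_derivative_eq_rhs[OF has_derivative_compose[OF u[unfolded has_vector_derivative_def] F]])
    (simp add: linear_scale[OF has_derivative_linear[OF F]])

lemma has_vector_derivative_transform_eventually:
  assumes "(f has_vector_derivative v) (at t)" "eventually (\<lambda>s. f s = g s) (nhds t)"
  shows "(g has_vector_derivative v) (at t)"
proof -
  obtain X where "open X" "t \<in> X" "\<forall>s\<in>X. f s = g s" using assms(2) unfolding eventually_nhds by blast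
  then show ?thesis using has_vector_derivative_transform_within_open[OF assms(1), of X] by blast
qed

lemma continuous_map_eventually:
  assumes "continuous_map euclideanreal X f" "openin X U" "f t \<in> U"
  shows "eventually (\<lambda>s. f s \<in> U) (nhds t)"
proof -
  have "open {s. f s \<in> U}" using openin_continuous_map_preimage[OF assms(1,2)] by simp
  then show ?thesis unfolding eventually_nhds using assms(3) by (intro exI[of _ "{s. f s \<in> U}"]) simp
qed

lemma topological_entropy_cong:
  assumes f: "f ` topspace X \<subseteq> topspace X" and eq: "\<And>x. x \<in> topspace X \<Longrightarrow> g x = f x"
  shows "topological_entropy X g = topological_entropy X f"
proof -
  have "iterated_join X g \<U> n = iterated_join X f \<U> n" for \<U> n
  proof (induction n)
    case (Suc n)
    have "{x \<in> topspace X. g x \<in> V} = {x \<in> topspace X. f x \<in> V}" for V using eq by auto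
    then show ?case using Suc by simp
  qed simp
  then show ?thesis unfolding topological_entropy_def cover_entropy_def by simp
qed

section \<open>Charts of the tube compared with product coordinates\<close>

context liouville_surface
begin

text \<open>\<open>G\<close> and \<open>g\<close> extend the coordinate changes between the tube
  chart \<open>e\<close> and the product coordinates of \<open>c\<close> to open sets. Beyond the
  boundary two such extensions need not be inverse to each other, so inverseness is stated for their
  derivatives at \<open>p\<close>.\<close>

definition tube_rep where
  "tube_rep e p c x0 r T G S g \<longleftrightarrow>
     coord e p \<in> T \<and> smooth_open T G \<and> (\<forall>y\<in>T. fst (G y) \<in> ball x0 r) \<and>
     (\<forall>q\<in>chart_dom e. coord e q \<in> T \<longrightarrow> fst q \<in> chart_dom c \<and> prod_coord c q = G (coord e q)) \<and>
     prod_coord c p \<in> S \<and> smooth_open S g \<and>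
     (\<forall>q\<in>chart_dom e. fst q \<in> chart_dom c \<longrightarrow> prod_coord c q \<in> S \<longrightarrow> coord e q = g (prod_coord c q)) \<and>
     (\<forall>v. frechet_derivative g (at (prod_coord c p)) (frechet_derivative G (at (coord e p)) v) = v) \<and>
     (\<forall>w. frechet_derivative G (at (coord e p)) (frechet_derivative g (at (prod_coord c p)) w) = w)"

lemma tube_chart:
  fixes e :: "('a \<times> (complex ^ ('n::finite)), real \<times> (complex ^ 'n)) chart"
  assumes "e \<in> tube_atlas W A H"
  shows "topological_chart (tube W H) e"
    "c \<in> A \<Longrightarrow> smooth_on (prod_coord c ` (chart_dom e \<inter> (chart_dom c \<times> UNIV))) (coord e \<circ> prod_inv c)"
    "c \<in> A \<Longrightarrow> smooth_on (coord e ` (chart_dom e \<inter> (chart_dom c \<times> UNIV))) (prod_coord c \<circ> chart_inv e)"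
    "openin (top_of_set half_space) (chart_img e)"
  using assms unfolding tube_atlas_def Let_def topological_chart_def by auto

lemma tube_rep_exists:
  fixes e :: "('a \<times> (complex ^ ('n::finite)), real \<times> (complex ^ 'n)) chart"
  assumes e: "e \<in> tube_atlas W A H" and p: "p \<in> chart_dom e" and c: "c \<in> A" "fst p \<in> chart_dom c" and r: "r > 0"
  obtains T G S g where "tube_rep e p c (coord c (fst p)) r T G S g"
proof -
  let ?B = "ball (coord c (fst p)) r"
  let ?V = "chart_dom e \<inter> (chart_dom c \<times> UNIV)"
  note tc = tube_chart[OF e]
  note ef = topological_chart_facts[OF tc(1)]
  have pV: "p \<in> ?V" using p c(2) by (cases p) simp
  have pV': "coord e p \<in> coord e ` ?V" "prod_coord c p \<in> prod_coord c ` ?V" using pV by (rule imageI)+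
  obtain T0 G where G: "coord e p \<in> T0" "smooth_open T0 G" "\<forall>y\<in>coord e ` ?V \<inter> T0. (prod_coord c \<circ> chart_inv e) y = G y"
    by (rule smooth_onE[OF tc(3)[OF c(1)] pV'(1)])
  obtain S g where g: "prod_coord c p \<in> S" "smooth_open S g" "\<forall>y\<in>prod_coord c ` ?V \<inter> S. (coord e \<circ> prod_inv c) y = g y"
    by (rule smooth_onE[OF tc(2)[OF c(1)] pV'(2)])
  have "openin (tube W H) (chart_dom e \<inter> {q \<in> topspace (tube W H). fst q \<in> chart_dom c \<and> prod_coord c q \<in> UNIV})"
    by (rule openin_Int[OF ef(1) tube_open_preimage[OF c(1) open_UNIV]])
  moreover have "chart_dom e \<inter> {q \<in> topspace (tube W H). fst q \<in> chart_dom c \<and> prod_coord c q \<in> UNIV} = ?V"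
    using openin_subset[OF ef(1)] by auto
  ultimately obtain Q where Q: "open Q" "coord e ` ?V = chart_img e \<inter> Q" using ef(6)[of ?V] by auto
  define T where "T = T0 \<inter> Q \<inter> (T0 \<inter> G -` (?B \<times> UNIV))"
  have oT: "open T" unfolding T_def
    by (intro open_Int smooth_openD(1)[OF G(2)] Q(1) smooth_open_Int_preimage[OF G(2)] open_Times open_ball open_UNIV)
  have Gs: "smooth_open T G" by (rule smooth_open_subset[OF G(2) oT]) (auto simp: T_def)
  have eqG: "q \<in> ?V \<and> prod_coord c q = G (coord e q)" if q: "q \<in> chart_dom e" "coord e q \<in> T0 \<inter> Q" for q
  proof -
    have "coord e q \<in> coord e ` ?V" unfolding Q(2) using q ef(5) by auto
    then obtain q' where q': "q' \<in> ?V" "coord e q = coord e q'" by blast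
    then have "q = q'" using inj_onD[OF ef(2)] q(1) by blast
    then have V: "q \<in> ?V" using q'(1) by simp
    then have "(prod_coord c \<circ> chart_inv e) (coord e q) = G (coord e q)" using G(3) q(2) by blast
    then show ?thesis using V ef(3)[OF q(1)] by simp
  qed
  have eqg: "coord e q = g (prod_coord c q)" if q: "q \<in> ?V" "prod_coord c q \<in> S" for q
  proof -
    have "(coord e \<circ> prod_inv c) (prod_coord c q) = g (prod_coord c q)" using g(3) q by blast
    moreover have "fst q \<in> chart_dom c" using q(1) by auto
    ultimately show ?thesis using prod_inv_coord[OF c(1), of q] by simp
  qed
  have pQ: "coord e p \<in> Q" using pV Q(2) by blast
  have Gp: "prod_coord c p = G (coord e p)" using eqG[OF p] G(1) pQ by blast
  have pT: "coord e p \<in> T" unfolding T_def using G(1) pQ Gp[symmetric] r by (cases p) (simp add: prod_coord_def)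
  let ?DG = "frechet_derivative G (at (coord e p))" and ?Dg = "frechet_derivative g (at (prod_coord c p))"
  have dG: "(G has_derivative ?DG) (at (coord e p))" by (rule smooth_open_has_derivative[OF Gs pT])
  have dg: "(g has_derivative ?Dg) (at (G (coord e p)))" unfolding Gp[symmetric] by (rule smooth_open_has_derivative[OF g(2,1)])
  have oTS: "open (T \<inter> G -` S)" by (rule smooth_open_Int_preimage[OF Gs smooth_openD(1)[OF g(2)]])
  \<comment> \<open>The composition is the identity only on the part of the half-space in the chart
    image, which still determines its derivative. The opposite order then follows from equality of
    dimensions.\<close>
  have "(\<lambda>v. ?Dg (?DG v)) = (\<lambda>v. v)"
  proof (rule derivative_eq_on_half_space[OF tc(4) ef(5)[OF p] oTS _ has_derivative_compose[OF dG dg] has_derivative_ident])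
    show "coord e p \<in> T \<inter> G -` S" using pT g(1) Gp by simp
    show "g (G y) = y" if y: "y \<in> chart_img e" "y \<in> T \<inter> G -` S" for y
    proof -
      note q = ef(4)[OF y(1)]
      have "coord e (chart_inv e y) \<in> T0 \<inter> Q" using q y(2) unfolding T_def by simp
      note E = eqG[OF conjunct1[OF q] this]
      have "prod_coord c (chart_inv e y) = G y" using E q by simp
      then show ?thesis using eqg[OF conjunct1[OF E]] y(2) q by simp
    qed
  qed
  then have inv: "?Dg (?DG v) = v" for v by (rule fun_cong)
  have inv2: "?DG (?Dg w) = w" for w
    by (rule left_inverse_imp_right_inverse[OF has_derivative_linear[OF dG] inv]) simp
  have "tube_rep e p c (coord c (fst p)) r T G S g"
    unfolding tube_rep_def
  proof (intro conjI ballI impI allI)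
    show "fst (G y) \<in> ?B" if "y \<in> T" for y using that unfolding T_def by auto
    show "fst q \<in> chart_dom c" "prod_coord c q = G (coord e q)" if "q \<in> chart_dom e" "coord e q \<in> T" for q
      using eqG[OF that(1)] that(2) unfolding T_def by auto
    show "coord e q = g (prod_coord c q)" if "q \<in> chart_dom e" "fst q \<in> chart_dom c" "prod_coord c q \<in> S" for q
      by (rule eqg) (use that in \<open>cases q, auto\<close>)
  qed (use pT Gs g(1,2) inv inv2 in blast)+
  then show thesis by (rule that)
qed

lemma tube_repD:
  assumes "tube_rep e p c x0 r T G S g"
  shows "coord e p \<in> T" "smooth_open T G" "\<And>y. y \<in> T \<Longrightarrow> fst (G y) \<in> ball x0 r"
     "\<And>q. q \<in> chart_dom e \<Longrightarrow> coord e q \<in> T \<Longrightarrow> fst q \<in> chart_dom c"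
     "\<And>q. q \<in> chart_dom e \<Longrightarrow> coord e q \<in> T \<Longrightarrow> prod_coord c q = G (coord e q)"
     "prod_coord c p \<in> S" "smooth_open S g"
     "\<And>q. q \<in> chart_dom e \<Longrightarrow> fst q \<in> chart_dom c \<Longrightarrow> prod_coord c q \<in> S \<Longrightarrow> coord e q = g (prod_coord c q)"
     "\<And>v. frechet_derivative g (at (prod_coord c p)) (frechet_derivative G (at (coord e p)) v) = v"
     "\<And>w. frechet_derivative G (at (coord e p)) (frechet_derivative g (at (prod_coord c p)) w) = w"
  using assms unfolding tube_rep_def by blast+

lemma prod_coord_eq: "prod_coord c q = (coord c (fst q), snd q)"
  by (cases q) (simp add: prod_coord_def)

text \<open>\<open>tube_form\<close> evaluates \<open>lam\<close> in an unspecified chart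
  \<open>d\<close>. The coordinate change from \<open>c\<close> to \<open>d\<close> is composed with
  \<open>G\<close>, and the transformation law of \<open>lam\<close> removes it again.\<close>

lemma tube_form_rep:
  fixes e :: "('a \<times> (complex ^ ('n::finite)), real \<times> (complex ^ 'n)) chart"
  assumes e: "e \<in> tube_atlas W A H" and c: "c \<in> A" and gb: "good_ball c x0 r l1 l2 h"
    and rep: "tube_rep e p c x0 r T G S g" and q: "q \<in> chart_dom e" "coord e q \<in> T"
  shows "tube_form A lam e q v = tube_plane_form l1 l2 (G (coord e q)) (frechet_derivative G (at (coord e q)) v)"
proof -
  note R = tube_repD[OF rep]
  note rf = rep_facts[OF good_ballD(2)[OF gb]]
  note tc = tube_chart[OF e]
  note ef = topological_chart_facts[OF tc(1)]
  have wc: "fst q \<in> chart_dom c" by (rule R(4)[OF q])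
  have Gq: "G (coord e q) = prod_coord c q" using R(5)[OF q] by simp
  define d where "d = (SOME c. c \<in> A \<and> fst q \<in> chart_dom c)"
  have d: "d \<in> A" "fst q \<in> chart_dom d" unfolding d_def using someI_ex[of "\<lambda>c. c \<in> A \<and> fst q \<in> chart_dom c"] c wc by blast+
  let ?V = "chart_dom e \<inter> (chart_dom d \<times> UNIV)"
  have xB: "coord c (fst q) \<in> ball x0 r" using R(3)[OF q(2)] Gq by (simp add: prod_coord_eq)
  obtain Td k1 k2 hd where drep: "coord d (fst q) \<in> Td" "local_rep d Td k1 k2 hd" by (rule local_rep_exists[OF d])
  obtain Tt Gt where Tt: "coord c (fst q) \<in> Tt" "smooth_open Tt Gt" "Tt \<subseteq> ball x0 r" "Gt ` Tt \<subseteq> Td"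
    and Gt: "\<forall>w\<in>chart_dom c \<inter> chart_dom d. coord c w \<in> Tt \<longrightarrow> coord d w = Gt (coord c w) \<and>
        (\<forall>v. lam c w v = lam d w (frechet_derivative Gt (at (coord c w)) v))"
    by (rule transition_rep[OF good_ballD(2)[OF gb] drep(2) wc d(2) xB drep(1)])
  have "openin (tube W H) (chart_dom e \<inter> {q \<in> topspace (tube W H). fst q \<in> chart_dom d \<and> prod_coord d q \<in> UNIV})"
    by (rule openin_Int[OF ef(1) tube_open_preimage[OF d(1) open_UNIV]])
  moreover have "chart_dom e \<inter> {q \<in> topspace (tube W H). fst q \<in> chart_dom d \<and> prod_coord d q \<in> UNIV} = ?V"
    using openin_subset[OF ef(1)] by auto
  ultimately obtain Q where Q: "open Q" "coord e ` ?V = chart_img e \<inter> Q" using ef(6)[of ?V] by auto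
  have oV: "openin (top_of_set half_space) (coord e ` ?V)"
    unfolding Q(2) using tc(4) Q(1) by (simp add: openin_Int_open)
  have qV: "coord e q \<in> coord e ` ?V" using q(1) d(2) by (cases q) auto
  let ?O = "T \<inter> G -` (Tt \<times> UNIV)"
  have oO: "open ?O" by (intro smooth_open_Int_preimage[OF R(2)] open_Times smooth_openD(1)[OF Tt(2)] open_UNIV)
  have qO: "coord e q \<in> ?O" using q(2) Gq Tt(1) by (simp add: prod_coord_eq)
  let ?DG = "frechet_derivative G (at (coord e q))" and ?Dt = "frechet_derivative Gt (at (coord c (fst q)))"
  have dG: "(G has_derivative ?DG) (at (coord e q))" by (rule smooth_open_has_derivative[OF R(2) q(2)])
  have fG: "fst (G (coord e q)) = coord c (fst q)" using Gq by (simp add: prod_coord_eq)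
  have dt: "(Gt has_derivative ?Dt) (at (fst (G (coord e q))))" unfolding fG by (rule smooth_open_has_derivative[OF Tt(2,1)])
  have "frechet_derivative (prod_coord d \<circ> chart_inv e) (at (coord e q) within coord e ` ?V) = (\<lambda>v. (?Dt (fst (?DG v)), snd (?DG v)))"
  proof (rule frechet_derivative_half_space_ext[OF oV qV oO qO])
    show "((\<lambda>y. (Gt (fst (G y)), snd (G y))) has_derivative (\<lambda>v. (?Dt (fst (?DG v)), snd (?DG v)))) (at (coord e q))"
      by (intro has_derivative_Pair has_derivative_snd dG has_derivative_compose[OF has_derivative_fst[OF dG] dt])
    fix y assume y: "y \<in> coord e ` ?V" "y \<in> ?O"
    obtain q' where q': "q' \<in> chart_dom e" "fst q' \<in> chart_dom d" "y = coord e q'" using y(1) by auto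
    have yT: "coord e q' \<in> T" using y(2) q'(3) by simp
    have w': "fst q' \<in> chart_dom c" by (rule R(4)[OF q'(1) yT])
    have Gy: "G y = prod_coord c q'" using R(5)[OF q'(1) yT] q'(3) by simp
    have "coord d (fst q') = Gt (coord c (fst q'))"
      using bspec[OF Gt, of "fst q'"] w' q'(2) y(2) Gy by (simp add: prod_coord_eq)
    then show "(prod_coord d \<circ> chart_inv e) y = (Gt (fst (G y)), snd (G y))"
      using ef(3)[OF q'(1)] q'(3) Gy by (simp add: prod_coord_eq)
  qed
  then have tf: "tube_form A lam e q v = lam d (fst q) (?Dt (fst (?DG v))) + std_form (snd q) (snd (?DG v))"
    unfolding tube_form_def Let_def d_def[symmetric] by simp
  have "\<forall>v. lam c (fst q) v = lam d (fst q) (?Dt v)"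
    using bspec[OF Gt, of "fst q"] wc d(2) Tt(1) by blast
  then have "lam d (fst q) (?Dt (fst (?DG v))) = lam c (fst q) (fst (?DG v))" by (elim allE) (rule sym)
  also have "lam c (fst q) = plane_form l1 l2 (coord c (fst q))" by (rule rf(6)[OF wc xB])
  finally show ?thesis unfolding tf tube_plane_form_def Gq by (simp add: prod_coord_eq)
qed

text \<open>Near \<open>p\<close> the form on the tube is the pullback under \<open>G\<close> of the
  form in product coordinates, so this is an instance of \<open>pullback_curl\<close>.\<close>

lemma ext_deriv_tube_form:
  fixes e :: "('a \<times> (complex ^ ('n::finite)), real \<times> (complex ^ 'n)) chart"
  assumes e: "e \<in> tube_atlas W A H" and p: "p \<in> chart_dom e" and c: "c \<in> A" and gb: "good_ball c x0 r l1 l2 h"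
    and rep: "tube_rep e p c x0 r T G S g"
  shows "ext_deriv (tube_form A lam) e p u v = curl (tube_plane_form l1 l2) (prod_coord c p)
    (frechet_derivative G (at (coord e p)) u) (frechet_derivative G (at (coord e p)) v)"
proof -
  note R = tube_repD[OF rep]
  note rf = rep_facts[OF good_ballD(2)[OF gb]]
  note tc = tube_chart[OF e]
  note ef = topological_chart_facts[OF tc(1)]
  let ?m = "\<lambda>y v. tube_plane_form l1 l2 (G y) (frechet_derivative G (at y) v)"
  have ms: "smooth_open (ball x0 r \<times> (UNIV :: (complex ^ 'n) set)) (\<lambda>y. tube_plane_form l1 l2 y v)" for v
    by (rule tube_plane_form_smooth[OF rf(2,3)])
  have GT: "G y \<in> ball x0 r \<times> UNIV" if "y \<in> T" for y using R(3)[OF that] by (cases "G y") simp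
  have "frechet_derivative (\<lambda>x. tube_form A lam e (chart_inv e x) v) (at (coord e p) within chart_img e) =
    frechet_derivative (\<lambda>y. ?m y v) (at (coord e p))" for v
  proof (rule frechet_derivative_half_space_ext[OF tc(4) ef(5)[OF p] smooth_openD(1)[OF R(2)] R(1)])
    show "((\<lambda>y. ?m y v) has_derivative frechet_derivative (\<lambda>y. ?m y v) (at (coord e p))) (at (coord e p))"
      by (rule frechet_derivative_works[THEN iffD1, OF differentiableI[OF pullback_derivative[OF R(2) ms tube_plane_form_linear GT R(1)]]])
    show "tube_form A lam e (chart_inv e y) v = ?m y v" if y: "y \<in> chart_img e" "y \<in> T" for y
      using tube_form_rep[OF e c gb rep, of "chart_inv e y" v] ef(4)[OF y(1)] y(2) by simp
  qed
  then have "ext_deriv (tube_form A lam) e p u v = curl ?m (coord e p) u v"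
    unfolding ext_deriv_def curl_def by simp
  also have "\<dots> = curl (tube_plane_form l1 l2) (G (coord e p)) (frechet_derivative G (at (coord e p)) u) (frechet_derivative G (at (coord e p)) v)"
    by (rule pullback_curl[OF R(2) ms tube_plane_form_linear GT R(1)])
  finally show ?thesis using R(5)[OF p R(1)] by simp
qed


section \<open>The boundary of the tube\<close>

abbreviation tube_boundary :: "('a \<times> (complex ^ ('n::finite))) set" where
  "tube_boundary \<equiv> {(w, z). w \<in> topspace W \<and> pi * (norm z)\<^sup>2 = H w}"

lemma tube_chart_subset:
  fixes e :: "('a \<times> (complex ^ ('n::finite)), real \<times> (complex ^ 'n)) chart"
  assumes "e \<in> tube_atlas W A H" "q \<in> chart_dom e"
  shows "fst q \<in> topspace W" "pi * (norm (snd q))\<^sup>2 \<le> H (fst q)"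
proof -
  have "q \<in> topspace (tube W H)"
    using openin_subset[OF topological_chart_facts(1)[OF tube_chart(1)[OF assms(1)]]] assms(2) by blast
  then show "fst q \<in> topspace W" "pi * (norm (snd q))\<^sup>2 \<le> H (fst q)" by (auto simp: topspace_tube)
qed

text \<open>If the defining function were positive at \<open>p\<close>, a full neighbourhood in
  product coordinates would consist of tube points. The first chart coordinate, nonnegative there
  and zero at \<open>p\<close>, would have a minimum and hence zero derivative, although the
  derivative of the coordinate change is onto.\<close>

lemma boundary_imp_defining_eq:
  fixes e :: "('a \<times> (complex ^ ('n::finite)), real \<times> (complex ^ 'n)) chart"
  assumes e: "e \<in> tube_atlas W A H" and p: "p \<in> chart_dom e" and b: "fst (coord e p) = 0"
  shows "pi * (norm (snd p))\<^sup>2 = H (fst p)"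
proof (rule ccontr)
  assume "pi * (norm (snd p))\<^sup>2 \<noteq> H (fst p)"
  then have lt: "pi * (norm (snd p))\<^sup>2 < H (fst p)" using tube_chart_subset(2)[OF e p] by simp
  obtain c where c: "c \<in> A" "fst p \<in> chart_dom c" using tube_chart_subset(1)[OF e p] covers by blast
  obtain r l1 l2 h where gb: "good_ball c (coord c (fst p)) r l1 l2 h" by (rule good_ball_exists[OF c])
  note g' = good_ballD[OF gb]
  note rf = rep_facts[OF g'(2)]
  obtain T G S g where rep: "tube_rep e p c (coord c (fst p)) r T G S g" by (rule tube_rep_exists[OF e p c g'(1)])
  note R = tube_repD[OF rep]
  note tc = tube_chart[OF e]
  note ef = topological_chart_facts[OF tc(1)]
  let ?y0 = "prod_coord c p"
  let ?B = "ball (coord c (fst p)) r"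
  let ?K = "defining h :: (real \<times> real) \<times> (complex ^ 'n) \<Rightarrow> real"
  have pB: "coord c (fst p) \<in> ?B" using g'(1) by simp
  obtain N where N: "open N" "?y0 \<in> N"
    "\<forall>q\<in>topspace (tube W H). fst q \<in> chart_dom c \<longrightarrow> prod_coord c q \<in> N \<longrightarrow> q \<in> chart_dom e"
    by (rule tube_open_chart[OF ef(1) p c])
  have Ks: "smooth_open (?B \<times> UNIV) ?K" by (rule defining_smooth[OF rf(4)])
  let ?O = "N \<inter> S \<inter> ((?B \<times> UNIV) \<inter> ?K -` {0<..})"
  have oO: "open ?O" by (intro open_Int N(1) smooth_openD(1)[OF R(7)] smooth_open_Int_preimage[OF Ks] open_greaterThan)
  have yO: "?y0 \<in> ?O"
  proof -
    have "?K ?y0 > 0" using tube_defining[OF g'(2) c(2) pB] lt by simp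
    then show ?thesis using N(2) R(6) pB by (simp add: prod_coord_eq)
  qed
  have dg: "((\<lambda>y. fst (g y)) has_derivative (\<lambda>v. fst (frechet_derivative g (at ?y0) v))) (at ?y0)"
    by (rule has_derivative_fst[OF smooth_open_has_derivative[OF R(7,6)]])
  have "fst (g ?y0) \<le> fst (g y)" if y: "y \<in> ?O" for y
  proof -
    obtain x z where xz: "y = (x, z)" by (cases y)
    have "x \<in> ?B" "?K (x, z) \<ge> 0" using y xz by auto
    note tp = tube_point[OF gb this]
    let ?q = "(chart_inv c x, z)"
    have "?q \<in> chart_dom e" using N(3) tp y xz by simp
    then have "coord e ?q = g y" using R(8)[of ?q] tp y xz by simp
    moreover have "coord e ?q \<in> chart_img e" by (rule ef(5)) fact
    ultimately have "g y \<in> chart_img e" by simp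
    then have "g y \<in> half_space" using openin_imp_subset[OF tc(4)] by blast
    moreover have "g ?y0 = coord e p" using R(8)[OF p c(2) R(6)] by simp
    ultimately show ?thesis using b by (simp add: half_space_def)
  qed
  then have "(\<lambda>v. fst (frechet_derivative g (at ?y0) v)) = (\<lambda>v. 0)"
    using differential_zero_maxmin[OF yO oO dg] by blast
  from fun_cong[OF this, of "frechet_derivative G (at (coord e p)) (1, 0)"] show False unfolding R(9) by simp
qed

lemma manifold_boundary_tube:
  "manifold_boundary (tube W H) (tube_atlas W A H) = (tube_boundary :: ('a \<times> (complex ^ ('n::finite))) set)"
proof
  show "manifold_boundary (tube W H) (tube_atlas W A H) \<subseteq> (tube_boundary :: ('a \<times> (complex ^ 'n)) set)"
    unfolding manifold_boundary_def using boundary_imp_defining_eq by (auto simp: topspace_tube)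
  show "(tube_boundary :: ('a \<times> (complex ^ 'n)) set) \<subseteq> manifold_boundary (tube W H) (tube_atlas W A H)"
  proof
    fix p :: "'a \<times> (complex ^ 'n)" assume p: "p \<in> tube_boundary"
    then have "\<exists>e\<in>tube_atlas W A H. p \<in> chart_dom e \<and> fst (coord e p) = 0"
      by (intro tube_boundary_chart) auto
    moreover have "p \<in> topspace (tube W H)" using p by (auto simp: topspace_tube)
    ultimately show "p \<in> manifold_boundary (tube W H) (tube_atlas W A H)"
      unfolding manifold_boundary_def by blast
  qed
qed

text \<open>The Reeb field in product coordinates: \<open>X_H / tau\<close> on the base, and
  rotation of the fibre at \<open>1 / tau\<close> turns per unit of time.\<close>

definition reeb_lift where
  "reeb_lift c p = (reeb_field c (fst p), (2 * pi * rho (fst p)) *\<^sub>R imul (snd p :: complex ^ ('n::finite)))"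

context
  fixes e :: "('a \<times> (complex ^ ('n::finite)), real \<times> (complex ^ 'n)) chart" and p c r l1 l2 h T G S g
  assumes e: "e \<in> tube_atlas W A H" and p: "p \<in> chart_dom e" and bd: "pi * (norm (snd p))\<^sup>2 = H (fst p)"
    and c: "c \<in> A" "fst p \<in> chart_dom c" and gb: "good_ball c (coord c (fst p)) r l1 l2 h"
    and rep: "tube_rep e p c (coord c (fst p)) r T G S g"
begin

lemmas gb' = good_ballD[OF gb] and rfc = rep_facts[OF good_ballD(2)[OF gb]] and RR = tube_repD[OF rep]
  and tce = tube_chart[OF e] and efe = topological_chart_facts[OF tube_chart(1)[OF e]]

lemma center_in_ball: "coord c (fst p) \<in> ball (coord c (fst p)) r"
  using gb'(1) by simp

lemma defining_at: "(defining h has_derivative frechet_derivative (defining h) (at (prod_coord c p))) (at (prod_coord c p))"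
  by (rule smooth_open_has_derivative[OF defining_smooth[OF rfc(4)]]) (use center_in_ball in \<open>simp add: prod_coord_eq\<close>)

lemma G_center: "G (coord e p) = prod_coord c p"
  using RR(5)[OF p RR(1)] by simp

lemma defining_chart:
  assumes "q \<in> chart_dom e" "coord e q \<in> T"
  shows "defining h (G (coord e q)) = H (fst q) - pi * (norm (snd q))\<^sup>2"
proof -
  have "coord c (fst q) \<in> ball (coord c (fst p)) r"
    using RR(3)[OF assms(2)] unfolding RR(5)[OF assms, symmetric] by (simp add: prod_coord_eq)
  then show ?thesis using tube_defining[OF gb'(2) RR(4)[OF assms]] unfolding RR(5)[OF assms] by simp
qed

lemma defining_pullback:
  "((\<lambda>y. defining h (G y)) has_derivative (\<lambda>v. frechet_derivative (defining h) (at (prod_coord c p)) (frechet_derivative G (at (coord e p)) v))) (at (coord e p))"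
  by (rule has_derivative_compose[OF smooth_open_has_derivative[OF RR(2,1)]]) (simp add: G_center defining_at)

text \<open>Mirror image of \<open>boundary_imp_defining_eq\<close>: at a positive first coordinate
  the pulled-back defining function would have an interior minimum, against
  \<open>defining_derivative_nonzero\<close>.\<close>

lemma boundary_first_coordinate: "fst (coord e p) = 0"
proof (rule ccontr)
  assume "fst (coord e p) \<noteq> 0"
  moreover have "coord e p \<in> half_space" using efe(5)[OF p] openin_imp_subset[OF tce(4)] by blast
  ultimately have pos: "fst (coord e p) > 0" by (simp add: half_space_def)
  obtain s where s: "s > 0" "half_space \<inter> ball (coord e p) s \<subseteq> chart_img e"
    by (rule half_space_openE[OF tce(4) efe(5)[OF p]])
  let ?O = "T \<inter> ball (coord e p) s \<inter> {y. 0 < fst y}"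
  have oO: "open ?O" by (intro open_Int smooth_openD(1)[OF RR(2)] open_ball open_Collect_less continuous_intros)
  have yO: "coord e p \<in> ?O" using RR(1) s(1) pos by simp
  have "defining h (G (coord e p)) \<le> defining h (G y)" if y: "y \<in> ?O" for y
  proof -
    have "y \<in> chart_img e" using y s(2) by (auto simp: half_space_def)
    note q = efe(4)[OF this]
    have "defining h (G y) = H (fst (chart_inv e y)) - pi * (norm (snd (chart_inv e y)))\<^sup>2"
      using defining_chart[of "chart_inv e y"] q y by simp
    also have "\<dots> \<ge> 0" using tube_chart_subset(2)[OF e conjunct1[OF q]] by simp
    finally show ?thesis using defining_chart[OF p RR(1)] bd by simp
  qed
  then have "(\<lambda>v. frechet_derivative (defining h) (at (prod_coord c p)) (frechet_derivative G (at (coord e p)) v)) = (\<lambda>v. 0)"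
    using differential_zero_maxmin[OF yO oO defining_pullback] by blast
  then have z: "frechet_derivative (defining h) (at (prod_coord c p)) (frechet_derivative G (at (coord e p)) v) = 0" for v
    by (rule fun_cong)
  obtain w where "frechet_derivative (defining h) (at (prod_coord c p)) w \<noteq> 0"
    using defining_derivative_nonzero[OF gb c bd] by (auto simp: prod_coord_eq)
  then show False using z[of "frechet_derivative g (at (prod_coord c p)) w"] unfolding RR(10) by simp
qed

text \<open>A short line through \<open>coord e p\<close> in a direction \<open>v\<close> with
  \<open>fst v = 0\<close> runs in the boundary of the chart image, so by
  \<open>boundary_imp_defining_eq\<close> the defining function is zero along it.\<close>

lemma defining_tangent:
  assumes v: "fst v = 0"
  shows "frechet_derivative (defining h) (at (prod_coord c p)) (frechet_derivative G (at (coord e p)) v) = 0"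
proof -
  obtain s where s: "s > 0" "half_space \<inter> ball (coord e p) s \<subseteq> chart_img e"
    by (rule half_space_openE[OF tce(4) efe(5)[OF p]])
  let ?y = "\<lambda>t. coord e p + t *\<^sub>R v"
  have yd: "(?y has_derivative (\<lambda>t. t *\<^sub>R v)) (at 0)" by (auto intro!: derivative_eq_intros)
  have "((\<lambda>t. defining h (G (?y t))) has_derivative
    (\<lambda>t. frechet_derivative (defining h) (at (prod_coord c p)) (frechet_derivative G (at (coord e p)) (t *\<^sub>R v)))) (at 0)"
    by (rule has_derivative_compose[OF yd]) (use defining_pullback in simp)
  moreover have "((\<lambda>t. defining h (G (?y t))) has_derivative (\<lambda>t. 0)) (at 0)"
  proof -
    have o: "open (ball (coord e p) s \<inter> T)" using smooth_openD(1)[OF RR(2)] by blast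
    have "isCont ?y 0" by (intro continuous_intros)
    then obtain X where X: "open X" "0 \<in> X" "\<forall>t\<in>X. ?y t \<in> ball (coord e p) s \<inter> T"
      using o s(1) RR(1) unfolding continuous_at_open by (metis IntI add.right_neutral centre_in_ball scaleR_zero_left)
    show ?thesis
    proof (rule has_derivative_transform_within_open[OF has_derivative_const X(1,2)])
      fix t assume "t \<in> X"
      then have t: "?y t \<in> ball (coord e p) s" "?y t \<in> T" using X(3) by auto
      have f0: "fst (?y t) = 0" using boundary_first_coordinate v by simp
      then have "?y t \<in> chart_img e" using t(1) s(2) by (auto simp: half_space_def)
      note q = efe(4)[OF this]
      have "pi * (norm (snd (chart_inv e (?y t))))\<^sup>2 = H (fst (chart_inv e (?y t)))"
        by (rule boundary_imp_defining_eq[OF e]) (use q f0 in auto)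
      then show "0 = defining h (G (?y t))" using defining_chart[of "chart_inv e (?y t)"] q t(2) by simp
    qed
  qed
  ultimately have "(\<lambda>t. frechet_derivative (defining h) (at (prod_coord c p)) (frechet_derivative G (at (coord e p)) (t *\<^sub>R v))) = (\<lambda>t. 0)"
    by (rule has_derivative_unique)
  from fun_cong[OF this, of 1] show ?thesis by simp
qed

lemma transversal:
  assumes l: "linear f" and z: "\<And>v. fst v = 0 \<Longrightarrow> f (frechet_derivative G (at (coord e p)) v) = (0::real)"
  shows "f (frechet_derivative G (at (coord e p)) v) = fst v * f (frechet_derivative G (at (coord e p)) (1, 0))"
proof -
  let ?DG = "frechet_derivative G (at (coord e p))"
  have Gl: "linear ?DG" by (rule has_derivative_linear[OF smooth_open_has_derivative[OF RR(2,1)]])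
  have "v = fst v *\<^sub>R (1, 0) + (0, snd v)" by (cases v) simp
  then have "?DG v = ?DG (fst v *\<^sub>R (1, 0) + (0, snd v))" by (rule arg_cong)
  also have "\<dots> = fst v *\<^sub>R ?DG (1, 0) + ?DG (0, snd v)" unfolding linear_add[OF Gl] linear_scale[OF Gl] ..
  finally show ?thesis using z[of "(0, snd v)"] linear_add[OF l] linear_scale[OF l] by simp
qed

text \<open>Lagrange multiplier: the tangent space of the boundary is a hyperplane, and covectors
  vanishing on it are determined by their value on one transversal vector. The differential of the
  defining function is a nonzero such covector.\<close>

lemma annihilator_multiple:
  assumes f: "linear f" and z: "\<And>v. fst v = 0 \<Longrightarrow> f (frechet_derivative G (at (coord e p)) v) = (0::real)"
  shows "\<exists>b. \<forall>w. f w = b * frechet_derivative (defining h) (at (prod_coord c p)) w"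
proof -
  let ?DG = "frechet_derivative G (at (coord e p))" and ?Dg = "frechet_derivative g (at (prod_coord c p))"
  let ?k = "frechet_derivative (defining h) (at (prod_coord c p))"
  have kl: "linear ?k" by (rule has_derivative_linear[OF defining_at])
  have f1: "f w = fst (?Dg w) * f (?DG (1, 0))" for w using transversal[OF f z, of "?Dg w"] unfolding RR(10) .
  have k1: "?k w = fst (?Dg w) * ?k (?DG (1, 0))" for w using transversal[OF kl defining_tangent, of "?Dg w"] unfolding RR(10) .
  obtain w0 where "?k w0 \<noteq> 0" using defining_derivative_nonzero[OF gb c bd] by (auto simp: prod_coord_eq)
  then have "?k (?DG (1, 0)) \<noteq> 0" using k1[of w0] by auto
  then have "f w = (f (?DG (1, 0)) / ?k (?DG (1, 0))) * ?k w" for w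
    unfolding f1[of w] k1[of w] by simp
  then show ?thesis by blast
qed

lemma defining_derivative_at:
  "frechet_derivative (defining h) (at (prod_coord c p)) v = differential H c (fst p) (fst v) - 2 * pi * (snd p \<bullet> snd v)"
proof -
  have x: "fst (prod_coord c p) \<in> ball (coord c (fst p)) r" using center_in_ball by (simp add: prod_coord_eq)
  have hd: "(h has_derivative frechet_derivative h (at (coord c (fst p)))) (at (coord c (fst p)))"
    by (rule smooth_open_has_derivative[OF rfc(4) center_in_ball])
  show ?thesis
    unfolding defining_derivative[OF rfc(4) x] differential_rep[OF gb'(2) c(2) center_in_ball]
    using frechet_derivative_plane[OF hd, of "fst v"] by (simp add: prod_coord_eq)
qed

lemma curl_at:
  "curl (tube_plane_form l1 l2) (prod_coord c p) u v = ext_deriv lam c (fst p) (fst u) (fst v) - snd u \<bullet> imul (snd v)"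
proof -
  have x: "fst (prod_coord c p) \<in> ball (coord c (fst p)) r" using center_in_ball by (simp add: prod_coord_eq)
  show ?thesis
    unfolding curl_tube_plane_form[OF rfc(2,3) x] ext_deriv_rep[OF gb'(2) c(2) center_in_ball]
    by (simp add: prod_coord_eq)
qed

section \<open>The Reeb vector field of the tube\<close>

lemma hamiltonian_at: "ext_deriv lam c (fst p) (hamiltonian_vf lam H c (fst p)) v = differential H c (fst p) v"
  unfolding hamiltonian_vf_rep[OF gb'(2) c(2) center_in_ball] differential_rep[OF gb'(2) c(2) center_in_ball]
  using symplectic_dual[OF gb'(2) c(2) center_in_ball] by blast

lemma rho_pos: "rho (fst p) > 0"
  unfolding rho_eq[OF c] using tau_pos[OF gb'(2) c(2) center_in_ball] by simp

lemma reeb_field_rho: "reeb_field c (fst p) = rho (fst p) *\<^sub>R hamiltonian_vf lam H c (fst p)"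
  unfolding reeb_field_def rho_eq[OF c] by (simp add: inverse_eq_divide)

text \<open>Both parts give \<open>rho\<close> times a differential: the base by the defining
  equation of \<open>X_H\<close>, the fibre because \<open>imul\<close> preserves the inner product.
  On vectors tangent to the boundary the right-hand side vanishes, which is the Reeb
  condition.\<close>

lemma reeb_lift_curl:
  "curl (tube_plane_form l1 l2) (prod_coord c p) (reeb_lift c p) v =
    rho (fst p) * frechet_derivative (defining h) (at (prod_coord c p)) v"
proof -
  have "ext_deriv lam c (fst p) (reeb_field c (fst p)) (fst v) = rho (fst p) * differential H c (fst p) (fst v)"
    unfolding reeb_field_rho hamiltonian_at[symmetric] ext_deriv_rep[OF gb'(2) c(2) center_in_ball]
    by (simp add: algebra_simps)
  then show ?thesis
    unfolding curl_at defining_derivative_at reeb_lift_def by (simp add: inner_imul algebra_simps)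
qed

text \<open>The fibre contributes \<open>rho * pi * |z|^2\<close>, which on the boundary is
  \<open>rho * H\<close>, and the base contributes \<open>rho\<close> times the value of
  \<open>lam\<close> on \<open>X_H\<close>; together this is \<open>rho * tau = 1\<close>.\<close>

lemma reeb_lift_form: "tube_plane_form l1 l2 (prod_coord c p) (reeb_lift c p) = 1"
proof -
  note t = tau_pos[OF gb'(2) c(2) center_in_ball]
  have l: "plane_form l1 l2 (coord c (fst p)) = lam c (fst p)" using rfc(6)[OF c(2) center_in_ball] by simp
  have lin: "linear (lam c (fst p))" unfolding l[symmetric] by (rule plane_form_linear)
  have "std_form (snd p) ((2 * pi * rho (fst p)) *\<^sub>R imul (snd p)) = rho (fst p) * (pi * (norm (snd p))\<^sup>2)"
    unfolding std_form_eq imul_scaleR imul_imul by (simp add: power2_norm_eq_inner)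
  then have "tube_plane_form l1 l2 (prod_coord c p) (reeb_lift c p) =
    rho (fst p) * (lam c (fst p) (hamiltonian_vf lam H c (fst p)) + H (fst p))"
    unfolding tube_plane_form_def reeb_lift_def prod_coord_eq fst_conv snd_conv l reeb_field_rho linear_scale[OF lin] bd
    by (simp add: algebra_simps)
  also have "\<dots> = 1" unfolding rho_eq[OF c] tau_def[symmetric] using t by simp
  finally show ?thesis .
qed

text \<open>\<open>X_H\<close> preserves \<open>H\<close>, and rotation is perpendicular to the
  radius.\<close>

lemma reeb_lift_tangent: "frechet_derivative (defining h) (at (prod_coord c p)) (reeb_lift c p) = 0"
proof -
  have "differential H c (fst p) (reeb_field c (fst p)) = 0"
    unfolding differential_rep[OF gb'(2) c(2) center_in_ball] reeb_field_rep[OF gb'(2) c(2) center_in_ball] by simp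
  then show ?thesis unfolding defining_derivative_at reeb_lift_def by (simp add: inner_imul_self)
qed

lemma curl_nondegenerate:
  assumes "\<And>v. curl (tube_plane_form l1 l2) (prod_coord c p) u v = 0"
  shows "u = 0"
proof -
  have "ext_deriv lam c (fst p) (fst u) v = 0 * fst v + 0 * snd v" for v
    using assms[of "(v, 0)"] unfolding curl_at by (simp add: linear_0[OF bounded_linear.linear[OF imul_linear]])
  then have "\<forall>v. ext_deriv lam c (fst p) (fst u) v = fst v * 0 + snd v * 0" by simp
  then have 1: "fst u = 0" unfolding symplectic_dual[OF gb'(2) c(2) center_in_ball] by (simp add: zero_prod_def)
  have "snd u \<bullet> snd u = 0"
    using assms[of "(0, imul (snd u))"] unfolding curl_at ext_deriv_rep[OF gb'(2) c(2) center_in_ball]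
    by (simp add: imul_imul)
  then show ?thesis using 1 by (simp add: prod_eq_iff)
qed

text \<open>Existence comes from the three properties of \<open>reeb_lift\<close>. For uniqueness,
  the contraction of a competitor \<open>Y\<close> is a multiple of the differential of the defining
  function, hence the contraction of a multiple of \<open>reeb_lift\<close>; nondegeneracy makes
  \<open>Y\<close> that multiple, and the normalisation makes the factor 1.\<close>

lemma reeb_vf_tube: "reeb_vf (tube_form A lam) e p = frechet_derivative g (at (prod_coord c p)) (reeb_lift c p)"
  unfolding reeb_vf_def
proof (rule the_equality)
  let ?DG = "frechet_derivative G (at (coord e p))" and ?Dg = "frechet_derivative g (at (prod_coord c p))"
  let ?k = "frechet_derivative (defining h) (at (prod_coord c p))" and ?X = "reeb_lift c p"
  let ?m = "curl (tube_plane_form l1 l2) (prod_coord c p)"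
  note ed = ext_deriv_tube_form[OF e p c(1) gb rep]
  have tf: "tube_form A lam e p v = tube_plane_form l1 l2 (prod_coord c p) (?DG v)" for v
    using tube_form_rep[OF e c(1) gb rep p RR(1), of v] unfolding G_center .
  have kl: "linear ?k" by (rule has_derivative_linear[OF defining_at])
  show "fst (?Dg ?X) = 0 \<and> tube_form A lam e p (?Dg ?X) = 1 \<and> (\<forall>v. fst v = 0 \<longrightarrow> ext_deriv (tube_form A lam) e p (?Dg ?X) v = 0)"
  proof (intro conjI allI impI)
    note km = transversal[OF kl defining_tangent]
    obtain w0 where "?k w0 \<noteq> 0" using defining_derivative_nonzero[OF gb c bd] by (auto simp: prod_coord_eq)
    then have "?k (?DG (1, 0)) \<noteq> 0" using km[of "?Dg w0"] unfolding RR(10) by auto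
    then show "fst (?Dg ?X) = 0" using km[of "?Dg ?X"] unfolding RR(10) reeb_lift_tangent by simp
    show "tube_form A lam e p (?Dg ?X) = 1" unfolding tf RR(10) by (rule reeb_lift_form)
    show "ext_deriv (tube_form A lam) e p (?Dg ?X) v = 0" if "fst v = 0" for v
      unfolding ed RR(10) reeb_lift_curl defining_tangent[OF that] by simp
  qed
  fix Y assume Y: "fst Y = 0 \<and> tube_form A lam e p Y = 1 \<and> (\<forall>v. fst v = 0 \<longrightarrow> ext_deriv (tube_form A lam) e p Y v = 0)"
  have ml: "linear (?m (?DG Y))"
    unfolding curl_at ext_deriv_rep[OF gb'(2) c(2) center_in_ball]
    by (rule linearI) (simp_all add: imul_add imul_scaleR inner_add_right algebra_simps)
  obtain b where b: "\<forall>w. ?m (?DG Y) w = b * ?k w"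
    using annihilator_multiple[OF ml] Y unfolding ed by blast
  define a where "a = b / rho (fst p)"
  have "?DG Y - a *\<^sub>R ?X = 0"
  proof (rule curl_nondegenerate)
    fix v
    have "?m (?DG Y - a *\<^sub>R ?X) v = ?m (?DG Y) v - a * ?m ?X v"
      unfolding curl_at ext_deriv_rep[OF gb'(2) c(2) center_in_ball] by (simp add: inner_diff_left algebra_simps)
    also have "\<dots> = 0" unfolding reeb_lift_curl b[rule_format, of v] using rho_pos by (simp add: a_def)
    finally show "?m (?DG Y - a *\<^sub>R ?X) v = 0" .
  qed
  then have DY: "?DG Y = a *\<^sub>R ?X" by simp
  have "1 = tube_plane_form l1 l2 (prod_coord c p) (?DG Y)" using Y tf by simp
  also have "\<dots> = a" unfolding DY linear_scale[OF tube_plane_form_linear] reeb_lift_form by simp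
  finally have "?DG Y = ?X" using DY by simp
  then show "Y = ?Dg ?X" using RR(9)[of Y] by simp
qed

end


section \<open>Reeb trajectories in product form\<close>

lemma reeb_trajectory_base:
  fixes \<gamma> :: "real \<Rightarrow> 'a \<times> (complex ^ ('n::finite))"
  assumes tr: "reeb_trajectory (tube W H) (tube_atlas W A H) (tube_form A lam) \<gamma>"
  shows "reeb.trajectory_at (\<lambda>t. fst (\<gamma> t)) t"
    "((\<lambda>t. snd (\<gamma> t)) has_vector_derivative (2 * pi * rho (fst (\<gamma> t))) *\<^sub>R imul (snd (\<gamma> t))) (at t)"
proof -
  note parts = tr[unfolded reeb_trajectory_def manifold_boundary_tube]
  note cont = parts[THEN conjunct1] and bd = parts[THEN conjunct2, THEN conjunct1, rule_format, of t]
    and der = parts[THEN conjunct2, THEN conjunct2, rule_format, of _ t]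
  let ?p = "\<gamma> t"
  have p: "fst ?p \<in> topspace W" "pi * (norm (snd ?p))\<^sup>2 = H (fst ?p)" using bd by auto
  obtain e where e: "e \<in> tube_atlas W A H" "?p \<in> chart_dom e" using tube_boundary_chart[OF p] by blast
  obtain c where c: "c \<in> A" "fst ?p \<in> chart_dom c" using p(1) covers by blast
  obtain r l1 l2 h where gb: "good_ball c (coord c (fst ?p)) r l1 l2 h" by (rule good_ball_exists[OF c])
  obtain T G S g where rep: "tube_rep e ?p c (coord c (fst ?p)) r T G S g"
    by (rule tube_rep_exists[OF e c good_ballD(1)[OF gb]])
  note R = tube_repD[OF rep]
  note ef = topological_chart_facts[OF tube_chart(1)[OF e(1)]]
  have "openin (tube W H) {q \<in> chart_dom e. coord e q \<in> T}" by (rule ef(7)[OF smooth_openD(1)[OF R(2)]])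
  then have ev: "eventually (\<lambda>s. \<gamma> s \<in> {q \<in> chart_dom e. coord e q \<in> T}) (nhds t)"
    by (rule continuous_map_eventually[OF cont]) (use e(2) R(1) in simp)
  have "((\<lambda>s. G ((coord e \<circ> \<gamma>) s)) has_vector_derivative
    frechet_derivative G (at (coord e ?p)) (reeb_vf (tube_form A lam) e ?p)) (at t)"
    by (rule has_vector_derivative_chain[OF der[OF e]]) (use smooth_open_has_derivative[OF R(2,1)] in simp)
  then have "((\<lambda>s. G ((coord e \<circ> \<gamma>) s)) has_vector_derivative reeb_lift c ?p) (at t)"
    unfolding reeb_vf_tube[OF e p(2) c gb rep] R(10) .
  then have P: "((\<lambda>s. prod_coord c (\<gamma> s)) has_vector_derivative reeb_lift c ?p) (at t)"
    by (rule has_vector_derivative_transform_eventually)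
      (rule eventually_mono[OF ev], use R(5) in \<open>simp del: split_paired_All\<close>)
  have evc: "eventually (\<lambda>s. fst (\<gamma> s) \<in> chart_dom c) (nhds t)"
    by (rule eventually_mono[OF ev]) (use R(4) in blast)
  have "((\<lambda>s. fst (prod_coord c (\<gamma> s))) has_vector_derivative fst (reeb_lift c ?p)) (at t)"
    by (rule has_vector_derivative_chain[OF P bounded_linear_imp_has_derivative[OF bounded_linear_fst]])
  then have "((coord c \<circ> (\<lambda>t. fst (\<gamma> t))) has_vector_derivative reeb_field c (fst ?p)) (at t)"
    by (simp add: prod_coord_eq reeb_lift_def o_def)
  then show "reeb.trajectory_at (\<lambda>t. fst (\<gamma> t)) t"
    unfolding reeb.trajectory_at_def using c evc by blast
  have "((\<lambda>s. snd (prod_coord c (\<gamma> s))) has_vector_derivative snd (reeb_lift c ?p)) (at t)"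
    by (rule has_vector_derivative_chain[OF P bounded_linear_imp_has_derivative[OF bounded_linear_snd]])
  then show "((\<lambda>t. snd (\<gamma> t)) has_vector_derivative (2 * pi * rho (fst (\<gamma> t))) *\<^sub>R imul (snd (\<gamma> t))) (at t)"
    by (simp add: prod_coord_eq reeb_lift_def)
qed

text \<open>Converse of \<open>reeb_trajectory_base\<close>. The Reeb equation has to hold in every
  chart of the atlas; the chain rule through the coordinate change \<open>g\<close> gives it in each
  of them.\<close>

lemma reeb_trajectoryI:
  fixes \<gamma> :: "real \<Rightarrow> 'a \<times> (complex ^ ('n::finite))"
  assumes cont: "continuous_map euclideanreal (tube W H) \<gamma>" and bd: "\<And>t. \<gamma> t \<in> tube_boundary"
    and w: "\<And>t. reeb.trajectory_at (\<lambda>t. fst (\<gamma> t)) t"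
    and z: "\<And>t. ((\<lambda>t. snd (\<gamma> t)) has_vector_derivative (2 * pi * rho (fst (\<gamma> t))) *\<^sub>R imul (snd (\<gamma> t))) (at t)"
  shows "reeb_trajectory (tube W H) (tube_atlas W A H) (tube_form A lam) \<gamma>"
  unfolding reeb_trajectory_def manifold_boundary_tube
proof (intro conjI allI ballI impI)
  fix t and e :: "('a \<times> (complex ^ 'n), real \<times> (complex ^ 'n)) chart"
  assume e: "e \<in> tube_atlas W A H" "\<gamma> t \<in> chart_dom e"
  let ?p = "\<gamma> t"
  have p: "fst ?p \<in> topspace W" "pi * (norm (snd ?p))\<^sup>2 = H (fst ?p)" using bd[of t] by auto
  obtain c where c: "c \<in> A" "fst ?p \<in> chart_dom c" using p(1) covers by blast
  obtain r l1 l2 h where gb: "good_ball c (coord c (fst ?p)) r l1 l2 h" by (rule good_ball_exists[OF c])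
  obtain T G S g where rep: "tube_rep e ?p c (coord c (fst ?p)) r T G S g"
    by (rule tube_rep_exists[OF e c good_ballD(1)[OF gb]])
  note R = tube_repD[OF rep]
  note ef = topological_chart_facts[OF tube_chart(1)[OF e(1)]]
  have "((coord c \<circ> (\<lambda>t. fst (\<gamma> t))) has_vector_derivative reeb_field c (fst ?p)) (at t)"
    by (rule reeb.trajectory_derivative[OF w c])
  then have "((\<lambda>s. (coord c (fst (\<gamma> s)), snd (\<gamma> s))) has_vector_derivative reeb_lift c ?p) (at t)"
    using z[of t] unfolding has_vector_derivative_def reeb_lift_def o_def
    by (elim has_derivative_eq_rhs[OF has_derivative_Pair]) simp_all
  then have P: "((\<lambda>s. prod_coord c (\<gamma> s)) has_vector_derivative reeb_lift c ?p) (at t)"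
    by (simp add: prod_coord_eq)
  have gd: "((\<lambda>s. g (prod_coord c (\<gamma> s))) has_vector_derivative reeb_vf (tube_form A lam) e ?p) (at t)"
    unfolding reeb_vf_tube[OF e p(2) c gb rep]
    by (rule has_vector_derivative_chain[OF P smooth_open_has_derivative[OF R(7,6)]])
  have "openin (tube W H) {q \<in> topspace (tube W H). fst q \<in> chart_dom c \<and> prod_coord c q \<in> S}"
    by (rule tube_open_preimage[OF c(1) smooth_openD(1)[OF R(7)]])
  then have "eventually (\<lambda>s. \<gamma> s \<in> {q \<in> topspace (tube W H). fst q \<in> chart_dom c \<and> prod_coord c q \<in> S}) (nhds t)"
    by (rule continuous_map_eventually[OF cont]) (use c(2) R(6) openin_subset[OF ef(1)] e(2) in blast)
  moreover have "eventually (\<lambda>s. \<gamma> s \<in> chart_dom e) (nhds t)"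
    by (rule continuous_map_eventually[OF cont ef(1) e(2)])
  ultimately have "eventually (\<lambda>s. g (prod_coord c (\<gamma> s)) = (coord e \<circ> \<gamma>) s) (nhds t)"
  proof eventually_elim
    case (elim s)
    then show ?case using R(8)[of "\<gamma> s"] by simp
  qed
  with gd show "((coord e \<circ> \<gamma>) has_vector_derivative reeb_vf (tube_form A lam) e ?p) (at t)"
    by (rule has_vector_derivative_transform_eventually)
qed (use cont bd in auto)

lemma rot_derivative:
  fixes z :: "complex ^ ('n::finite)"
  assumes w: "w \<in> topspace W"
  shows "((\<lambda>t. rot (2 * pi * phase t w) z) has_vector_derivative
    (2 * pi * rho (reeb.flow t w)) *\<^sub>R imul (rot (2 * pi * phase t w) z)) (at t)"
proof -
  have "((\<lambda>t. 2 * pi * phase t w) has_vector_derivative 2 * pi * rho (reeb.flow t w)) (at t)"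
    using DERIV_cmult[OF phase(2)[OF w], of "2 * pi"] by (simp add: has_real_derivative_iff_has_vector_derivative)
  moreover have "(cis has_derivative (\<lambda>a. a *\<^sub>R (\<i> * cis x))) (at x)" for x
    by (rule has_derivative_cis[OF has_derivative_ident])
  ultimately have "((\<lambda>t. cis (2 * pi * phase t w)) has_vector_derivative
    (2 * pi * rho (reeb.flow t w)) *\<^sub>R (\<i> * cis (2 * pi * phase t w))) (at t)"
    by (rule has_vector_derivative_chain)
  moreover have "bounded_linear (\<lambda>a. \<chi> i. a * z $ i)"
    by (simp add: linear_conv_bounded_linear[symmetric] linear_iff vec_eq_iff algebra_simps)
  ultimately have "((\<lambda>t. \<chi> i. cis (2 * pi * phase t w) * z $ i) has_vector_derivative
    (\<chi> i. ((2 * pi * rho (reeb.flow t w)) *\<^sub>R (\<i> * cis (2 * pi * phase t w))) * z $ i)) (at t)"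
    by (rule has_vector_derivative_chain[OF _ bounded_linear_imp_has_derivative])
  moreover have "(\<chi> i. ((2 * pi * rho (reeb.flow t w)) *\<^sub>R (\<i> * cis (2 * pi * phase t w))) * z $ i) =
    (2 * pi * rho (reeb.flow t w)) *\<^sub>R imul (rot (2 * pi * phase t w) z)"
    by (simp add: vec_eq_iff imul_def rot_def mult.assoc)
  ultimately show ?thesis by (simp add: rot_def)
qed

lemma norm_imul: "norm (imul z) = norm (z :: complex ^ ('n::finite))"
  using inner_imul[of z z] by (simp add: norm_eq_sqrt_inner)

text \<open>As \<open>reeb_flow\<close> is defined by \<open>THE\<close>, uniqueness of the
  trajectory is part of the claim. The base curve is determined by \<open>flow_unique\<close>; the
  fibre then solves a linear equation with bounded coefficient, and the Gronwall estimate
  applies.\<close>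

lemma reeb_flow_tube:
  fixes z :: "complex ^ ('n::finite)"
  assumes w: "w \<in> topspace W" and z: "pi * (norm z)\<^sup>2 = H w"
  shows "reeb_flow (tube W H) (tube_atlas W A H) (tube_form A lam) t (w, z) =
    (reeb.flow t w, rot (2 * pi * phase t w) z)"
proof -
  let ?\<gamma> = "\<lambda>t. (reeb.flow t w, rot (2 * pi * phase t w) z)"
  have bd: "?\<gamma> t \<in> tube_boundary" for t using reeb.flow_in[OF w] H_flow[OF w] z by simp
  have "continuous_map euclideanreal (prod_topology euclideanreal W) (\<lambda>t. (t, w))"
    using w by (intro continuous_map_pairedI) auto
  from continuous_map_compose[OF this reeb.continuous_map_flow]
  have c1: "continuous_map euclideanreal W (\<lambda>t. reeb.flow t w)" by (simp add: o_def)
  have "continuous_on UNIV (\<lambda>t. rot (2 * pi * phase t w) z)"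
    unfolding continuous_on_eq_continuous_at[OF open_UNIV]
    using has_vector_derivative_continuous[OF rot_derivative[OF w]] by blast
  then have c2: "continuous_map euclideanreal euclidean (\<lambda>t. rot (2 * pi * phase t w) z)" by simp
  have cont: "continuous_map euclideanreal (tube W H) ?\<gamma>"
    unfolding tube_def
    by (intro continuous_map_into_subtopology continuous_map_pairedI c1 c2)
      (use bd in \<open>auto simp: sum_cmod_square\<close>)
  have tr: "reeb_trajectory (tube W H) (tube_atlas W A H) (tube_form A lam) ?\<gamma>"
    by (rule reeb_trajectoryI[OF cont bd])
      (use reeb.flow_trajectory(2)[OF w] rot_derivative[OF w] in simp_all)
  have g0: "?\<gamma> 0 = (w, z)" using reeb.flow_trajectory(1)[OF w] phase(1)[OF w] by simp
  have "\<gamma> = ?\<gamma>" if \<gamma>: "reeb_trajectory (tube W H) (tube_atlas W A H) (tube_form A lam) \<gamma>" "\<gamma> 0 = (w, z)" for \<gamma>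
  proof
    fix t
    note b = reeb_trajectory_base[OF \<gamma>(1)]
    have fl: "fst (\<gamma> s) = reeb.flow s w" for s
      using reeb.flow_unique[of "\<bar>s\<bar> + 1" "\<lambda>t. fst (\<gamma> t)" s] b(1) \<gamma>(2) by simp
    obtain B where B: "B > 0" "\<forall>w\<in>topspace W. \<bar>rho w\<bar> \<le> B" using extension.rho_bounded .
    have "norm (snd (\<gamma> t) - rot (2 * pi * phase t w) z) \<le> exp (2 * pi * B * \<bar>t\<bar>) * norm (snd (\<gamma> 0) - rot (2 * pi * phase 0 w) z)"
    proof (rule gronwall[where h = "\<bar>t\<bar> + 1"])
      show "\<bar>t\<bar> < \<bar>t\<bar> + 1" by simp
      show "((\<lambda>t. snd (\<gamma> t)) has_vector_derivative (2 * pi * rho (reeb.flow s w)) *\<^sub>R imul (snd (\<gamma> s))) (at s)" for s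
        using b(2)[of s] unfolding fl .
      show "((\<lambda>t. rot (2 * pi * phase t w) z) has_vector_derivative
        (2 * pi * rho (reeb.flow s w)) *\<^sub>R imul (rot (2 * pi * phase s w) z)) (at s)" for s by (rule rot_derivative[OF w])
      show "norm ((2 * pi * rho (reeb.flow s w)) *\<^sub>R imul (snd (\<gamma> s)) - (2 * pi * rho (reeb.flow s w)) *\<^sub>R imul (rot (2 * pi * phase s w) z))
        \<le> 2 * pi * B * norm (snd (\<gamma> s) - rot (2 * pi * phase s w) z)" for s
      proof -
        have "norm ((2 * pi * rho (reeb.flow s w)) *\<^sub>R imul (snd (\<gamma> s)) - (2 * pi * rho (reeb.flow s w)) *\<^sub>R imul (rot (2 * pi * phase s w) z))
          = \<bar>2 * pi * rho (reeb.flow s w)\<bar> * norm (snd (\<gamma> s) - rot (2 * pi * phase s w) z)"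
          unfolding scaleR_diff_right[symmetric] bounded_linear.linear[OF imul_linear, THEN linear_diff, symmetric] norm_scaleR norm_imul ..
        also have "\<dots> \<le> 2 * pi * B * norm (snd (\<gamma> s) - rot (2 * pi * phase s w) z)"
          using B(2) reeb.flow_in[OF w] by (intro mult_right_mono) (simp_all add: abs_mult)
        finally show ?thesis .
      qed
    qed
    then have "snd (\<gamma> t) = rot (2 * pi * phase t w) z" using \<gamma>(2) phase(1)[OF w] by simp
    then show "\<gamma> t = ?\<gamma> t" using fl[of t] by (simp add: prod_eq_iff)
  qed
  then have "(THE \<gamma>. reeb_trajectory (tube W H) (tube_atlas W A H) (tube_form A lam) \<gamma> \<and> \<gamma> 0 = (w, z)) = ?\<gamma>"
    using tr g0 by (intro the_equality) blast+
  then show ?thesis unfolding reeb_flow_def by simp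
qed

theorem entropy_zero:
  "topological_entropy
     (subtopology (tube W H :: ('a \<times> (complex ^ ('n::finite))) topology)
        (manifold_boundary (tube W H) (tube_atlas W A H)))
     (reeb_flow (tube W H) (tube_atlas W A H) (tube_form A lam) 1) = 0"
proof -
  have sp: "subtopology (tube W H) (manifold_boundary (tube W H) (tube_atlas W A H)) =
    (extension.space :: ('a \<times> (complex ^ 'n)) topology)"
  proof -
    have "{(w, z :: complex ^ 'n). w \<in> topspace W \<and> pi * (\<Sum>i\<in>UNIV. (cmod (z $ i))\<^sup>2) \<le> H w} \<inter> tube_boundary = tube_boundary"
      by (auto simp: sum_cmod_square)
    then show ?thesis unfolding manifold_boundary_tube unfolding tube_def subtopology_subtopology by simp
  qed
  have "topological_entropy (extension.space :: ('a \<times> (complex ^ 'n)) topology)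
      (reeb_flow (tube W H) (tube_atlas W A H) (tube_form A lam) 1) =
      topological_entropy (extension.space :: ('a \<times> (complex ^ 'n)) topology) extension.skew"
  proof (rule topological_entropy_cong)
    show "extension.skew ` topspace extension.space \<subseteq> topspace (extension.space :: ('a \<times> (complex ^ 'n)) topology)"
      using extension.skew_cont by (rule continuous_map_image_subset_topspace)
    fix x :: "'a \<times> (complex ^ 'n)" assume x: "x \<in> topspace extension.space"
    obtain w z where xx: "x = (w, z)" by (cases x)
    then show "reeb_flow (tube W H) (tube_atlas W A H) (tube_form A lam) 1 x = extension.skew x"
      using reeb_flow_tube[of w z 1] x by (simp add: extension.skew_def)
  qed
  then show ?thesis unfolding sp using extension.topological_entropy_skew by simp
qed

end

theorem corollary1p19:
  fixes W :: "'a topology"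
    and A :: "('a, real) chart set"
    and lam :: "('a, real) one_form"
    and H :: "'a \<Rightarrow> real"
  assumes "liouville_domain W A lam"
    and "H \<in> admissible_hamiltonians W A lam"
  shows "topological_entropy
           (subtopology (tube W H :: ('a \<times> (complex ^ ('n::finite))) topology)
              (manifold_boundary (tube W H) (tube_atlas W A H)))
           (reeb_flow (tube W H) (tube_atlas W A H) (tube_form A lam) 1) = 0"
proof -
  interpret liouville_surface W A lam H by unfold_locales (fact assms)+
  show ?thesis by (rule entropy_zero)
qed

end
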